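(* Let $m,n\ge1$ be integers, let $\sigma\in S^l_{\rho,\delta}(n,m)$ with $0\le\rho,\delta\le1$ and $l<mn(\rho-1)$, and let $\vec b=(b_1,\dots,b_m)\in\mathrm{BMO}^m$. Let $\phi$ be an $N$-function with the sub-multiplicative property, and let $C_1$ be a constant such that $\phi(\lambda t)\le2^{C_1}\lambda^{C_1}\phi(t)$ for all $\lambda\ge2$, $t>0$. For each $1\le r<\infty$, if $r<i_\phi<\infty$, then there exist two constants $\alpha$ and $C(\phi,w,r)$ (the latter depending on the weight $w$) such that for every $1<q<\frac{i_\phi}{r}$, every $w\in A_q$ and all $\vec f=(f_1,\dots,f_m)$ for which $T_{\sigma,\Sigma\mathbf{b}}(\vec f)$ is defined, $$\int_{\mathbb{R}^n}\phi(|T_{\sigma,\Sigma\mathbf{b}}(\vec f)(x)|)w(x)\,dx\le C(\phi,w,r)\,\|\vec b\|_{\mathrm{BMO}}^{1+\alpha C_1}\Big(\prod_{i=1}^m\int_{\mathbb{R}^n}\phi^m(|f_i(x)|)w(x)\,dx\Big)^{\frac1m}.$$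
   Context: **Symbols and operators.** $S^l_{\rho,\delta}(n,m)$ ($l\in\mathbb{R}$, $0\le\rho,\delta\le1$) is the set of smooth functions $\sigma$ on $\mathbb{R}^n\times\mathbb{R}^{mn}$ such that for all multi-indices $\alpha,\beta_1,\dots,\beta_m$ there is a constant $C_{\alpha,\beta}$ with $|\partial_x^\alpha\partial_{\xi_1}^{\beta_1}\cdots\partial_{\xi_m}^{\beta_m}\sigma(x,\vec\xi)|\le C_{\alpha,\beta}(1+|\xi_1|+\cdots+|\xi_m|)^{l-\rho\sum_j|\beta_j|+\delta|\alpha|}$. With $\widehat f(\xi)=\int_{\mathbb{R}^n}f(x)e^{-2\pi i x\cdot\xi}dx$, the $m$-linear pseudo-differential operator is $T_\sigma(\vec f)(x)=\int_{(\mathbb{R}^n)^m}\sigma(x,\vec\xi)e^{2\pi i x\cdot(\xi_1+\cdots+\xi_m)}\widehat f_1(\xi_1)\cdots\widehat f_m(\xi_m)\,d\vec\xi$ (defined e.g. for Schwartz functions). Its $m$-linear commutator is $T_{\sigma,\Sigma\mathbf{b}}(\vec f)=\sum_{j=1}^m[b_j,T_\sigma]_j(\vec f)$, where $[b_j,T_\sigma]_j(\vec f)(x)=b_j(x)T_\sigma(\vec f)(x)-T_\sigma(f_1,\dots,b_jf_j,\dots,f_m)(x)$. $\|\vec b\|_{\mathrm{BMO}}=\sup_{1\le j\le m}\|b_j\|_{\mathrm{BMO}}$. **Young functions.** $\Phi$ is the set of nonnegative increasing functions $\phi:[0,\infty)\to[0,\infty)$ with $\lim_{t\to\infty}\phi(t)=\infty$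 and $\lim_{t\to0}\phi(t)=0$. A Young function is a convex $\phi\in\Phi$; it is an $N$-function if $\lim_{t\to0^+}\phi(t)/t=0$ and $\lim_{t\to\infty}\phi(t)/t=\infty$. Sub-multiplicative: $\phi(st)\le\phi(s)\phi(t)$ for all $s,t\ge0$ (this implies the doubling condition $\Delta_2$, hence a constant $C_1$ as in the claim exists). $\phi^m(t)=\phi(t)^m$. The lower dilation index is $i_\phi=\lim_{t\to0^+}\frac{\log h_\phi(t)}{\log t}$, where $h_\phi(t)=\sup_{s>0}\frac{\phi(st)}{\phi(s)}$. **Weights.** A weight is a nonnegative locally integrable function. For $1<q<\infty$, $w\in A_q$ means $[w]_{A_q}=\sup_Q\big(\frac1{|Q|}\int_Qw\big)\big(\frac1{|Q|}\int_Qw^{1-q'}\big)^{q-1}<\infty$, with $Q$ ranging over cubes. *)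

theory Defs
  imports "HOL-Analysis.Analysis"
begin

text \<open>Throughout, \<open>\<real>\<^sup>n\<close> is \<^typ>\<open>real^'n\<close> and \<open>(\<real>\<^sup>n)\<^sup>m\<close> is \<^typ>\<open>real^'n^'m\<close>, so \<open>n = CARD('n)\<close> and
  \<open>m = CARD('m)\<close> are arbitrary positive integers and the block \<open>\<xi>\<^sub>j\<close> of \<open>\<xi>\<close> is \<open>\<xi> $ j\<close>.\<close>

subsection \<open>Smooth functions and symbols\<close>

primrec iter_deriv ::
  "'a list \<Rightarrow> ('a::real_normed_vector \<Rightarrow> 'b::real_normed_vector) \<Rightarrow> 'a \<Rightarrow> 'b" where
  "iter_deriv [] f = f"
| "iter_deriv (v # vs) f = (\<lambda>z. frechet_derivative (iter_deriv vs f) (at z) v)"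

definition smooth :: "('a::euclidean_space \<Rightarrow> 'b::real_normed_vector) \<Rightarrow> bool" where
  "smooth f \<longleftrightarrow> (\<forall>vs z. set vs \<subseteq> Basis \<longrightarrow> iter_deriv vs f differentiable (at z))"

definition dir_x :: "'n::finite \<Rightarrow> (real^'n) \<times> (real^'n^'m::finite)" where
  "dir_x i = (axis i 1, 0)"

definition dir_xi :: "'m::finite \<times> 'n::finite \<Rightarrow> (real^'n) \<times> (real^'n^'m)" where
  "dir_xi = (\<lambda>(j, i). (0, axis j (axis i 1)))"

text \<open>A multi-index \<open>\<alpha>\<close> is given by a list \<open>is\<close> of coordinates of \<open>x\<close> in which \<open>i\<close> occurs \<open>\<alpha>\<^sub>i\<close> times, and
  \<open>(\<beta>\<^sub>1, \<dots>, \<beta>\<^sub>m)\<close> by a list \<open>ks\<close> of pairs in which \<open>(j, i)\<close> occurs as often as the \<open>i\<close>-th entry of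
  \<open>\<beta>\<^sub>j\<close> says. Hence \<open>length is = |\<alpha>|\<close> and \<open>length ks = |\<beta>\<^sub>1| + \<dots> + |\<beta>\<^sub>m|\<close>; the order in the lists is
  irrelevant because \<open>\<sigma>\<close> is smooth.\<close>

definition symbol_class ::
  "real \<Rightarrow> real \<Rightarrow> real \<Rightarrow> ((real^'n::finite) \<times> (real^'n^'m::finite) \<Rightarrow> complex) set" where
  "symbol_class l \<rho> \<delta> = {\<sigma>. smooth \<sigma> \<and>
     (\<forall>(is :: 'n list) (ks :: ('m \<times> 'n) list). \<exists>C::real. \<forall>x \<xi>.
        cmod (iter_deriv (map dir_x is @ map dir_xi ks) \<sigma> (x, \<xi>))
          \<le> C * (1 + (\<Sum>j\<in>UNIV. norm (\<xi> $ j)))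
                 powr (l - \<rho> * real (length ks) + \<delta> * real (length is)))}"

subsection \<open>Pseudo-differential operators and commutators\<close>

definition fourier :: "(real^'n::finite \<Rightarrow> complex) \<Rightarrow> real^'n \<Rightarrow> complex" where
  "fourier f \<xi> = (LINT x|lebesgue. f x * cis (- 2 * pi * (x \<bullet> \<xi>)))"

definition pdo_integrand ::
  "((real^'n::finite) \<times> (real^'n^'m::finite) \<Rightarrow> complex) \<Rightarrow> ('m \<Rightarrow> real^'n \<Rightarrow> complex)
     \<Rightarrow> real^'n \<Rightarrow> real^'n^'m \<Rightarrow> complex" where
  "pdo_integrand \<sigma> f x \<xi> =
     \<sigma> (x, \<xi>) * cis (2 * pi * (x \<bullet> (\<Sum>j\<in>UNIV. \<xi> $ j))) * (\<Prod>j\<in>UNIV. fourier (f j) (\<xi> $ j))"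

definition pdo ::
  "((real^'n::finite) \<times> (real^'n^'m::finite) \<Rightarrow> complex) \<Rightarrow> ('m \<Rightarrow> real^'n \<Rightarrow> complex)
     \<Rightarrow> real^'n \<Rightarrow> complex" where
  "pdo \<sigma> f x = (LINT \<xi>|lebesgue. pdo_integrand \<sigma> f x \<xi>)"

text \<open>\<open>T\<^sub>\<sigma>(f)\<close> is defined when the integrals in its definition converge: those for the Fourier
  transforms, which means \<open>f\<^sub>j \<in> L\<^sup>1\<close>, and the one over \<open>\<xi>\<close> for almost every \<open>x\<close>.\<close>

definition pdo_defined ::
  "((real^'n::finite) \<times> (real^'n^'m::finite) \<Rightarrow> complex) \<Rightarrow> ('m \<Rightarrow> real^'n \<Rightarrow> complex) \<Rightarrow> bool" where
  "pdo_defined \<sigma> f \<longleftrightarrow> (\<forall>j. integrable lebesgue (f j)) \<and>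
     (AE x in lebesgue. integrable lebesgue (pdo_integrand \<sigma> f x))"

definition mult_at ::
  "('m \<Rightarrow> 'x \<Rightarrow> complex) \<Rightarrow> 'm \<Rightarrow> ('m \<Rightarrow> 'x \<Rightarrow> complex) \<Rightarrow> 'm \<Rightarrow> 'x \<Rightarrow> complex" where
  "mult_at b j f = f(j := (\<lambda>y. b j y * f j y))"

definition pdo_commutator ::
  "((real^'n::finite) \<times> (real^'n^'m::finite) \<Rightarrow> complex) \<Rightarrow> ('m \<Rightarrow> real^'n \<Rightarrow> complex)
     \<Rightarrow> ('m \<Rightarrow> real^'n \<Rightarrow> complex) \<Rightarrow> real^'n \<Rightarrow> complex" where
  "pdo_commutator \<sigma> b f x = (\<Sum>j\<in>UNIV. b j x * pdo \<sigma> f x - pdo \<sigma> (mult_at b j f) x)"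

definition pdo_commutator_defined ::
  "((real^'n::finite) \<times> (real^'n^'m::finite) \<Rightarrow> complex) \<Rightarrow> ('m \<Rightarrow> real^'n \<Rightarrow> complex)
     \<Rightarrow> ('m \<Rightarrow> real^'n \<Rightarrow> complex) \<Rightarrow> bool" where
  "pdo_commutator_defined \<sigma> b f \<longleftrightarrow>
     pdo_defined \<sigma> f \<and> (\<forall>j. pdo_defined \<sigma> (mult_at b j f))"

subsection \<open>BMO\<close>

definition cubes :: "(real^'n::finite) set set" where
  "cubes = {cbox a (a + (\<chi> i. s)) |a s. s > 0}"

definition locally_integrable ::
  "(real^'n::finite \<Rightarrow> 'b::{banach, second_countable_topology}) \<Rightarrow> bool" where
  "locally_integrable f \<longleftrightarrow> (\<forall>K. compact K \<longrightarrow> set_integrable lebesgue K f)"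

definition cube_avg ::
  "(real^'n::finite \<Rightarrow> 'b::{banach, second_countable_topology}) \<Rightarrow> (real^'n) set \<Rightarrow> 'b" where
  "cube_avg f Q = (LINT y:Q|lebesgue. f y) /\<^sub>R measure lebesgue Q"

definition mean_osc :: "(real^'n::finite \<Rightarrow> complex) \<Rightarrow> (real^'n) set \<Rightarrow> real" where
  "mean_osc b Q = cube_avg (\<lambda>y. cmod (b y - cube_avg b Q)) Q"

definition bmo :: "(real^'n::finite \<Rightarrow> complex) set" where
  "bmo = {b. locally_integrable b \<and> bdd_above (mean_osc b ` cubes)}"

definition bmo_norm :: "(real^'n::finite \<Rightarrow> complex) \<Rightarrow> real" where
  "bmo_norm b = (SUP Q\<in>cubes. mean_osc b Q)"

definition bmo_vec_norm :: "('m::finite \<Rightarrow> real^'n::finite \<Rightarrow> complex) \<Rightarrow> real" where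
  "bmo_vec_norm b = (SUP j. bmo_norm (b j))"

subsection \<open>Young functions\<close>

text \<open>A function \<open>[0,\<infinity>) \<rightarrow> [0,\<infinity>)\<close> is represented by a function on \<open>\<real>\<close> whose values at negative
  arguments play no role.\<close>

definition growth_functions :: "(real \<Rightarrow> real) set" where
  "growth_functions = {\<phi>. (\<forall>t\<ge>0. \<phi> t \<ge> 0) \<and> mono_on {0..} \<phi> \<and>
     filterlim \<phi> at_top at_top \<and> (\<phi> \<longlongrightarrow> 0) (at_right 0)}"

definition young_function :: "(real \<Rightarrow> real) \<Rightarrow> bool" where
  "young_function \<phi> \<longleftrightarrow> \<phi> \<in> growth_functions \<and> convex_on {0..} \<phi>"

definition N_function :: "(real \<Rightarrow> real) \<Rightarrow> bool" where
  "N_function \<phi> \<longleftrightarrow> young_function \<phi> \<and>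
     ((\<lambda>t. \<phi> t / t) \<longlongrightarrow> 0) (at_right 0) \<and> filterlim (\<lambda>t. \<phi> t / t) at_top at_top"

definition submultiplicative :: "(real \<Rightarrow> real) \<Rightarrow> bool" where
  "submultiplicative \<phi> \<longleftrightarrow> (\<forall>s\<ge>0. \<forall>t\<ge>0. \<phi> (s * t) \<le> \<phi> s * \<phi> t)"

text \<open>For a submultiplicative Young function the set under the supremum is bounded by \<open>\<phi> t\<close> (and by
  \<open>1\<close> for \<open>t \<le> 1\<close>), so a real supremum suffices.\<close>

definition dilation_fun :: "(real \<Rightarrow> real) \<Rightarrow> real \<Rightarrow> real" where
  "dilation_fun \<phi> t = (SUP s\<in>{0<..}. \<phi> (s * t) / \<phi> s)"

definition lower_index :: "(real \<Rightarrow> real) \<Rightarrow> ereal" where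
  "lower_index \<phi> = Lim (at_right 0) (\<lambda>t. ereal (ln (dilation_fun \<phi> t) / ln t))"

subsection \<open>Weights\<close>

text \<open>Real powers on \<open>[0,\<infinity>]\<close>. Negative powers send \<open>0\<close> to \<open>\<infinity>\<close>, unlike \<^const>\<open>powr\<close>.\<close>

definition ennpowr :: "ennreal \<Rightarrow> real \<Rightarrow> ennreal" where
  "ennpowr x p =
     (if p = 0 then 1
      else if x = 0 then (if p < 0 then \<infinity> else 0)
      else if x = \<infinity> then (if p < 0 then 0 else \<infinity>)
      else ennreal (enn2real x powr p))"

definition weight :: "(real^'n::finite \<Rightarrow> real) \<Rightarrow> bool" where
  "weight w \<longleftrightarrow> (\<forall>x. w x \<ge> 0) \<and> locally_integrable w"

definition cube_nn_avg :: "(real^'n::finite \<Rightarrow> ennreal) \<Rightarrow> (real^'n) set \<Rightarrow> ennreal" where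
  "cube_nn_avg g Q = (\<integral>\<^sup>+y\<in>Q. g y \<partial>lebesgue) / emeasure lebesgue Q"

definition Aq_const :: "real \<Rightarrow> (real^'n::finite \<Rightarrow> real) \<Rightarrow> ennreal" where
  "Aq_const q w = (SUP Q\<in>cubes. cube_nn_avg (\<lambda>x. ennreal (w x)) Q *
     ennpowr (cube_nn_avg (\<lambda>x. ennpowr (ennreal (w x)) (1 - q / (q - 1))) Q) (q - 1))"

definition Aq :: "real \<Rightarrow> (real^'n::finite \<Rightarrow> real) set" where
  "Aq q = {w. weight w \<and> Aq_const q w < \<infinity>}"

end

theory Submission imports Defs begin

text \<open>For fixed \<open>x\<close> the value \<open>T\<^sub>\<sigma>(f)(x)\<close> is the integral of \<open>f\<^sub>1(y\<^sub>1) \<cdots> f\<^sub>m(y\<^sub>m)\<close> against a kernel \<open>K(x, z)\<close> at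
  \<open>z = (x - y\<^sub>1, \<dots>, x - y\<^sub>m)\<close>, the inverse Fourier transform of \<open>\<sigma>(x, \<cdot>)\<close>. Under the hypothesis
  \<open>l < m n (\<rho> - 1)\<close> this kernel is better than a singular one: uniformly in \<open>x\<close> it is \<open>O(|z|\<^sup>-\<^sup>a)\<close> near \<open>0\<close> for some
  \<open>a < m n\<close> and \<open>O(|z|\<^sup>-\<^sup>m\<^sup>n\<^sup>-\<^sup>1)\<close> at infinity (\<open>kernel_decay\<close>, proved with finite differences of the symbol). So it
  is dominated by a series of normalised indicator functions of balls, over all dyadic radii \<open>t\<^sub>k\<close>, with summable
  coefficients (\<open>kernel_majorant\<close>). The kernel of the \<open>j\<close>-th commutator has the additional factor
  \<open>b\<^sub>j(x) - b\<^sub>j(y\<^sub>j)\<close>. Hence the commutator is at most a convergent sum over \<open>k\<close> of products of \<open>m\<close> factors: averages of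
  \<open>|f\<^sub>i|\<close> over a cube of side comparable to \<open>t\<^sub>k\<close> and, in slot \<open>j\<close>, an average of \<open>|b\<^sub>j(x) - b\<^sub>j||f\<^sub>j|\<close>
  (\<open>commutator_term_bound\<close>).

  Averages of a fixed scale live on a grid of cubes with bounded overlap, so no maximal function occurs and it is
  enough to bound the modular of an average, or of such an oscillating average, on one cube with a constant
  independent of the cube. For \<open>\<Psi> = \<phi>\<^sup>m\<close> and \<open>q < i\<^sub>\<phi>\<close> the function \<open>\<Psi>\<close> grows at least like \<open>t\<^sup>q\<close>
  (\<open>lower_index_growth\<close>), and the \<open>A\<^sub>q\<close> condition gives the bound for averages (\<open>cube_average_modular\<close>). For the
  oscillating ones it is combined with moments of \<open>|b\<^sub>j - avg b\<^sub>j|\<close> over the cube, with respect to \<open>w\<close> and to the dual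
  weight. These are bounded since the distribution of \<open>|b\<^sub>j - avg b\<^sub>j|\<close> decays exponentially even with respect to a
  weight in \<open>A\<^sub>q\<close> (\<open>weighted_john_nirenberg\<close>).

  The pieces are assembled in \<open>commutator_modular\<close>: convexity of \<open>\<phi>\<close> takes the series over the scales out of \<open>\<phi>\<close>,
  sub-multiplicativity splits \<open>\<phi>\<close> of the product, and Hoelder's inequality with \<open>m\<close> equal exponents
  produces the product of the integrals of \<open>\<phi>\<^sup>m(|f\<^sub>i|)\<close>. This is done for functions \<open>b\<^sub>j\<close> with mean oscillations at most
  \<open>1\<close>. In general one divides \<open>b\<close> by \<open>\<beta> = \<parallel>b\<parallel>\<close> and pays the factor \<open>\<phi> \<beta>\<close>, which is at most a multiple of \<open>\<beta>\<close> if
  \<open>\<beta> \<le> 2\<close>, by convexity, and of \<open>\<beta> powr C1\<close> otherwise, by the doubling condition. The two cases correspond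
  to \<open>\<alpha> = 0\<close> and \<open>1 + \<alpha> C1 = C1\<close>. If \<open>\<beta> = 0\<close>, the \<open>b\<^sub>j\<close> are constant and the commutator vanishes.\<close>

section \<open>Elementary properties of N-functions\<close>

lemma N_function_zero:
  assumes "N_function \<phi>"
  shows "\<phi> 0 = 0"
proof -
  have gf: "\<phi> \<in> growth_functions" using assms by (simp add: N_function_def young_function_def)
  have nn: "\<phi> 0 \<ge> 0" and lim: "(\<phi> \<longlongrightarrow> 0) (at_right 0)" and mono: "mono_on {0..} \<phi>"
    using gf by (auto simp: growth_functions_def)
  have "eventually (\<lambda>t. \<phi> 0 \<le> \<phi> t) (at_right 0)"
    using mono by (auto simp: eventually_at_right_field mono_on_def intro!: exI[of _ 1])
  then have "\<phi> 0 \<le> 0" using tendsto_lowerbound[OF lim] by simp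
  with nn show ?thesis by simp
qed

lemma N_function_mono: "N_function \<phi> \<Longrightarrow> 0 \<le> s \<Longrightarrow> s \<le> t \<Longrightarrow> \<phi> s \<le> \<phi> t"
  by (auto simp: N_function_def young_function_def growth_functions_def mono_on_def)

lemma N_function_nonneg: "N_function \<phi> \<Longrightarrow> 0 \<le> t \<Longrightarrow> 0 \<le> \<phi> t"
  by (auto simp: N_function_def young_function_def growth_functions_def)

text \<open>A zero of \<open>\<phi>\<close> at some \<open>t > 0\<close> would propagate to all \<open>s\<close> by \<open>\<phi> s \<le> \<phi> t * \<phi> (s / t)\<close>.\<close>

lemma N_function_pos:
  assumes N: "N_function \<phi>" and sub: "submultiplicative \<phi>" and t: "t > 0"
  shows "\<phi> t > 0"
proof (rule ccontr)
  assume "\<not> \<phi> t > 0"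
  then have z: "\<phi> t = 0" using N_function_nonneg[OF N, of t] t by simp
  have "\<phi> s \<le> 0" if "s \<ge> 0" for s
  proof -
    have "\<phi> (t * (s / t)) \<le> \<phi> t * \<phi> (s / t)"
      using sub that t unfolding submultiplicative_def by (meson divide_nonneg_pos less_imp_le)
    then show ?thesis using z t by simp
  qed
  moreover have "filterlim \<phi> at_top at_top" using N by (auto simp: N_function_def young_function_def growth_functions_def)
  then have "eventually (\<lambda>s. \<phi> s \<ge> 1) at_top" by (simp add: filterlim_at_top)
  then obtain s0 where "\<And>s. s \<ge> s0 \<Longrightarrow> \<phi> s \<ge> 1" by (auto simp: eventually_at_top_linorder)
  ultimately show False by (metis max.cobounded1 max.cobounded2 not_one_le_zero order_trans)
qed

lemma N_function_le_linear:
  assumes N: "N_function \<phi>" and c: "0 \<le> c" "c \<le> 1" and t: "0 \<le> t"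
  shows "\<phi> (c * t) \<le> c * \<phi> t"
proof -
  have "convex_on {0..} \<phi>" using N by (auto simp: N_function_def young_function_def)
  then have "\<phi> ((1 - c) *\<^sub>R 0 + c *\<^sub>R t) \<le> (1 - c) * \<phi> 0 + c * \<phi> t"
    using c t by (intro convex_onD) auto
  then show ?thesis using N_function_zero[OF N] by simp
qed

section \<open>The lower dilation index\<close>

text \<open>By sub-multiplicativity \<open>\<phi> t\<close> is an upper bound of the quotients \<open>\<phi> (s * t) / \<phi> s\<close>; so their real supremum is
  a genuine one.\<close>

lemma dilation_fun_props:
  assumes N: "N_function \<phi>" and sub: "submultiplicative \<phi>" and t: "t > 0"
  shows dilation_fun_upper: "s > 0 \<Longrightarrow> \<phi> (s * t) \<le> dilation_fun \<phi> t * \<phi> s"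
    and dilation_fun_pos: "dilation_fun \<phi> t > 0"
    and dilation_fun_le: "(\<And>s. s > 0 \<Longrightarrow> \<phi> (s * t) \<le> c * \<phi> s) \<Longrightarrow> dilation_fun \<phi> t \<le> c"
proof -
  have bdd: "bdd_above ((\<lambda>s. \<phi> (s * t) / \<phi> s) ` {0<..})"
  proof (rule bdd_aboveI2)
    fix s :: real assume "s \<in> {0<..}"
    then show "\<phi> (s * t) / \<phi> s \<le> \<phi> t"
      using N_function_pos[OF N sub, of s] sub t by (simp add: divide_simps submultiplicative_def mult.commute)
  qed
  have up: "\<phi> (s * t) \<le> dilation_fun \<phi> t * \<phi> s" if "s > 0" for s
  proof -
    have "\<phi> (s * t) / \<phi> s \<le> dilation_fun \<phi> t"
      unfolding dilation_fun_def using that by (intro cSUP_upper[OF _ bdd]) auto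
    then show ?thesis using N_function_pos[OF N sub, of s] that by (simp add: divide_simps)
  qed
  then show "s > 0 \<Longrightarrow> \<phi> (s * t) \<le> dilation_fun \<phi> t * \<phi> s" .
  show "dilation_fun \<phi> t > 0"
    using up[of 1] N_function_pos[OF N sub, of 1] N_function_pos[OF N sub, of t] t
    by (smt (verit) mult_nonneg_nonneg mult_minus_left mult_nonpos_nonneg mult_1)
  show "dilation_fun \<phi> t \<le> c" if "\<And>s. s > 0 \<Longrightarrow> \<phi> (s * t) \<le> c * \<phi> s"
    unfolding dilation_fun_def
    by (rule cSUP_least) (use that N_function_pos[OF N sub] in \<open>auto simp: divide_simps\<close>)
qed

lemma dilation_fun_submult:
  assumes N: "N_function \<phi>" and sub: "submultiplicative \<phi>" and "t > 0" "u > 0"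
  shows "dilation_fun \<phi> (t * u) \<le> dilation_fun \<phi> t * dilation_fun \<phi> u"
proof (rule dilation_fun_le[OF N sub])
  fix s :: real assume s: "s > 0"
  have "\<phi> (s * (t * u)) = \<phi> ((s * t) * u)" by (simp add: mult.assoc)
  also have "\<dots> \<le> dilation_fun \<phi> u * \<phi> (s * t)"
    using assms s by (intro dilation_fun_upper) auto
  also have "\<dots> \<le> dilation_fun \<phi> u * (dilation_fun \<phi> t * \<phi> s)"
    using assms s by (intro mult_left_mono dilation_fun_upper less_imp_le[OF dilation_fun_pos]) auto
  finally show "\<phi> (s * (t * u)) \<le> dilation_fun \<phi> t * dilation_fun \<phi> u * \<phi> s" by (simp add: mult_ac)
qed (use assms in auto)

lemma dilation_fun_le_1:
  assumes N: "N_function \<phi>" and sub: "submultiplicative \<phi>" and t: "0 < t" "t \<le> 1"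
  shows "dilation_fun \<phi> t \<le> 1"
  by (rule dilation_fun_le[OF N sub]) (use t in \<open>auto intro!: N_function_mono[OF N] simp: mult_le_cancel_left1\<close>)

lemma dilation_fun_power:
  assumes N: "N_function \<phi>" and sub: "submultiplicative \<phi>" and t: "0 < t" "t \<le> 1"
  shows "dilation_fun \<phi> (t ^ k) \<le> dilation_fun \<phi> t ^ k"
proof (induction k)
  case 0 then show ?case using dilation_fun_le_1[OF N sub, of 1] by simp
next
  case (Suc k)
  have "dilation_fun \<phi> (t * t ^ k) \<le> dilation_fun \<phi> t * dilation_fun \<phi> (t ^ k)"
    using t by (intro dilation_fun_submult[OF N sub]) auto
  also have "\<dots> \<le> dilation_fun \<phi> t * dilation_fun \<phi> t ^ k"
    using t Suc by (intro mult_left_mono less_imp_le[OF dilation_fun_pos[OF N sub]]) auto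
  finally show ?case by simp
qed

text \<open>The function \<open>\<lambda>t. ln (h t)\<close> of \<open>- ln t\<close> is subadditive and monotone, so by Fekete's
  argument the limit that defines the index exists and is a supremum. Consequently an exponent
  below the index is already realised by \<open>h\<close> at a single dilation.\<close>

lemma dilation_fun_less_powr:
  assumes N: "N_function \<phi>" and sub: "submultiplicative \<phi>" and q: "ereal q < lower_index \<phi>"
  obtains t where "0 < t" "t < 1" "dilation_fun \<phi> t \<le> t powr q"
proof -
  define r where "r = (\<lambda>t. ln (dilation_fun \<phi> t) / ln t)"
  define L where "L = (SUP t\<in>{0<..<1}. ereal (r t))"
  have "((\<lambda>t. ereal (r t)) \<longlongrightarrow> L) (at_right 0)"
  proof (rule order_tendstoI)
    fix a assume "L < a"
    have "eventually (\<lambda>t::real. t \<in> {0<..<1}) (at_right 0)"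
      by (rule eventually_at_right_real) simp
    then show "eventually (\<lambda>t. ereal (r t) < a) (at_right 0)"
    proof eventually_elim
      case (elim t)
      have "ereal (r t) \<le> L" unfolding L_def using elim by (intro SUP_upper)
      then show ?case using \<open>L < a\<close> by simp
    qed
  next
    fix a assume "a < L"
    then obtain t0 where t0: "0 < t0" "t0 < 1" "a < ereal (r t0)"
      unfolding L_def by (auto simp: less_SUP_iff)
    have h0: "dilation_fun \<phi> t0 > 0" "dilation_fun \<phi> t0 \<le> 1"
      using dilation_fun_pos[OF N sub] dilation_fun_le_1[OF N sub] t0 by auto
    have r0: "r t0 \<ge> 0" unfolding r_def using h0 t0 by (simp add: divide_nonpos_neg)
    \<comment> \<open>for \<open>t\<close> between consecutive powers of \<open>t0\<close> the ratio loses at most one unit of exponent\<close>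
    have key: "r t \<ge> r t0 * (1 - ln t0 / ln t)" if t: "0 < t" "t < t0" for t
    proof -
      define k where "k = nat \<lfloor>ln t / ln t0\<rfloor>"
      have lt: "ln t < ln t0" "ln t0 < 0" using t t0 by auto
      have q1: "ln t / ln t0 \<ge> 1" using lt by (simp add: divide_simps)
      have k: "real k \<le> ln t / ln t0" "ln t / ln t0 < real k + 1" unfolding k_def using q1 by linarith+
      have kt: "ln t \<le> real k * ln t0" using k(1) lt by (simp add: divide_simps mult.commute)
      have tk: "t \<le> t0 ^ k"
        using kt t t0 by (metis ln_ge_iff exp_ln exp_le_cancel_iff ln_realpow zero_less_power)
      have "dilation_fun \<phi> t = dilation_fun \<phi> (t0 ^ k * (t / t0 ^ k))" using t0 by simp
      also have "\<dots> \<le> dilation_fun \<phi> (t0 ^ k) * dilation_fun \<phi> (t / t0 ^ k)"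
        using t t0 by (intro dilation_fun_submult[OF N sub]) auto
      also have "\<dots> \<le> dilation_fun \<phi> t0 ^ k * 1"
        using t t0 h0 tk by (intro mult_mono dilation_fun_power[OF N sub] dilation_fun_le_1[OF N sub]
            less_imp_le[OF dilation_fun_pos[OF N sub]]) auto
      finally have "ln (dilation_fun \<phi> t) \<le> ln (dilation_fun \<phi> t0 ^ k)"
        using dilation_fun_pos[OF N sub t(1)] h0 by (subst ln_le_cancel_iff) auto
      also have "\<dots> = real k * ln (dilation_fun \<phi> t0)" using h0 by (simp add: ln_realpow)
      finally have "ln (dilation_fun \<phi> t) \<le> real k * ln (dilation_fun \<phi> t0)" .
      also have "\<dots> \<le> (ln t / ln t0 - 1) * ln (dilation_fun \<phi> t0)"
        using k h0 by (intro mult_right_mono_neg) auto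
      finally have "r t \<ge> (ln t / ln t0 - 1) * ln (dilation_fun \<phi> t0) / ln t"
        unfolding r_def using lt by (intro divide_right_mono_neg) auto
      also have "(ln t / ln t0 - 1) * ln (dilation_fun \<phi> t0) / ln t = r t0 * (1 - ln t0 / ln t)"
        unfolding r_def using lt by (simp add: field_simps)
      finally show ?thesis .
    qed
    have lim: "((\<lambda>t. r t0 * (1 - ln t0 / ln t)) \<longlongrightarrow> r t0 * (1 - 0)) (at_right 0)"
      by (intro tendsto_intros tendsto_divide_0[OF tendsto_const]
          filterlim_mono[OF ln_at_0 at_bot_le_at_infinity order_refl])
    then have "((\<lambda>t. ereal (r t0 * (1 - ln t0 / ln t))) \<longlongrightarrow> ereal (r t0)) (at_right 0)" by simp
    then have e1: "eventually (\<lambda>t. a < ereal (r t0 * (1 - ln t0 / ln t))) (at_right 0)"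
      using t0(3) by (rule order_tendstoD)
    have e2: "eventually (\<lambda>t::real. t \<in> {0<..<t0}) (at_right 0)"
      by (rule eventually_at_right_real) (use t0 in simp)
    show "eventually (\<lambda>t. a < ereal (r t)) (at_right 0)"
      using e1 e2 by eventually_elim (use key in \<open>force intro: less_le_trans\<close>)
  qed
  then have "lower_index \<phi> = L"
    unfolding lower_index_def r_def by (rule tendsto_Lim[rotated]) simp
  then have "ereal q < L" using q by simp
  then obtain t where t: "0 < t" "t < 1" "ereal q < ereal (r t)"
    unfolding L_def by (auto simp: less_SUP_iff)
  have "ln (dilation_fun \<phi> t) \<le> q * ln t"
    using t unfolding r_def by (simp add: divide_simps mult.commute split: if_splits)
  then have "dilation_fun \<phi> t \<le> exp (q * ln t)"
    using dilation_fun_pos[OF N sub t(1)] by (metis exp_le_cancel_iff exp_ln)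
  then have "dilation_fun \<phi> t \<le> t powr q" using t by (simp add: powr_def)
  with t that show ?thesis by blast
qed

text \<open>Every ratio \<open>a / g \<le> 1\<close> lies between two consecutive powers of a dilation \<open>t\<close> at which \<open>h t \<le> t powr q\<close>;
  the gap between them accounts for the constant \<open>(1 / t) powr q\<close>.\<close>

lemma lower_index_growth:
  assumes N: "N_function \<phi>" and sub: "submultiplicative \<phi>" and q: "ereal q < lower_index \<phi>" "q \<ge> 0"
  obtains K where "K > 0" "\<And>a g. 0 < a \<Longrightarrow> a \<le> g \<Longrightarrow> \<phi> a \<le> K * (a / g) powr q * \<phi> g"
proof -
  obtain t where t: "0 < t" "t < 1" "dilation_fun \<phi> t \<le> t powr q"
    using dilation_fun_less_powr[OF N sub q(1)] .
  show thesis
  proof (rule that[of "(1/t) powr q"])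
    show "(1/t) powr q > 0" using t by simp
    fix a g :: real assume a: "0 < a" "a \<le> g"
    define u where "u = a / g"
    have u: "0 < u" "u \<le> 1" using a by (auto simp: u_def)
    define k where "k = nat \<lfloor>ln u / ln t\<rfloor>"
    have lt: "ln t < 0" "ln u \<le> 0" using t u by auto
    have "ln u / ln t \<ge> 0" using lt by (simp add: divide_nonpos_neg)
    then have k: "real k \<le> ln u / ln t" "ln u / ln t < real k + 1" unfolding k_def by linarith+
    have kt: "ln u \<le> real k * ln t" "(real k + 1) * ln t \<le> ln u" 
      using k lt by (auto simp: divide_simps mult.commute)
    have tk: "u \<le> t ^ k"
      using kt t u by (metis exp_ln exp_le_cancel_iff ln_realpow zero_less_power)
    have tk1: "t ^ (Suc k) \<le> u"
      using kt t u by (metis exp_ln exp_le_cancel_iff ln_realpow zero_less_power of_nat_Suc add.commute)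
    have g: "0 < g" using a by simp
    have "\<phi> a = \<phi> (g * u)" unfolding u_def using g by simp
    also have "\<dots> \<le> \<phi> (g * t ^ k)" using g u tk by (intro N_function_mono[OF N]) auto
    also have "\<dots> \<le> dilation_fun \<phi> (t ^ k) * \<phi> g" using t g by (intro dilation_fun_upper[OF N sub]) auto
    also have "\<dots> \<le> dilation_fun \<phi> t ^ k * \<phi> g"
      using t g N_function_nonneg[OF N, of g] by (intro mult_right_mono dilation_fun_power[OF N sub]) auto
    also have "\<dots> \<le> (t powr q) ^ k * \<phi> g"
      using t g N_function_nonneg[OF N, of g] dilation_fun_pos[OF N sub, of t]
      by (intro mult_right_mono power_mono) auto
    also have "(t powr q) ^ k = (1/t) powr q * (t ^ Suc k) powr q"
      using t by (simp add: powr_mult powr_divide powr_powr powr_realpow[symmetric] mult.commute)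
    also have "(1/t) powr q * (t ^ Suc k) powr q * \<phi> g \<le> (1/t) powr q * u powr q * \<phi> g"
      using tk1 t g q N_function_nonneg[OF N, of g] by (intro mult_right_mono mult_left_mono powr_mono2) auto
    finally show "\<phi> a \<le> (1/t) powr q * (a / g) powr q * \<phi> g" by (simp add: u_def)
  qed
qed

section \<open>Cubes and their dyadic children\<close>

text \<open>Half-open cubes split exactly into dyadic children; they differ from the closed cubes
  by null sets only.\<close>

abbreviation ccube :: "real^'n \<Rightarrow> real \<Rightarrow> (real^'n::finite) set" where
  "ccube a s \<equiv> cbox a (a + (\<chi> i. s))"

definition hcube :: "real^'n \<Rightarrow> real \<Rightarrow> (real^'n::finite) set" where
  "hcube a s = {x. \<forall>i. a $ i \<le> x $ i \<and> x $ i < a $ i + s}"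

definition child :: "real^'n \<Rightarrow> real \<Rightarrow> 'n set \<Rightarrow> real^'n::finite" where
  "child a s S = (\<chi> i. if i \<in> S then a $ i + s / 2 else a $ i)"

lemma hcube_borel [measurable, simp]: "hcube a s \<in> sets borel"
proof -
  have "hcube a s = {x \<in> space borel. \<forall>i. a $ i \<le> x $ i \<and> x $ i < a $ i + s}" by (auto simp: hcube_def)
  also have "\<dots> \<in> sets borel" by measurable
  finally show ?thesis .
qed

lemma hcube_lebesgue [measurable, simp]: "hcube a s \<in> sets lebesgue" by simp

lemma ccube_lebesgue [measurable, simp]: "ccube a s \<in> sets lebesgue"
  by simp

lemma hcube_subset_ccube: "hcube a s \<subseteq> ccube a s"
  by (auto simp: hcube_def mem_box_cart less_imp_le)

lemma AE_hcube_ccube: "AE x in lebesgue. x \<in> hcube a s \<longleftrightarrow> x \<in> ccube a s"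
proof -
  have "negligible (ccube a s - box a (a + (\<chi> i. s)))" by (rule negligible_frontier_interval)
  then have "ccube a s - box a (a + (\<chi> i. s)) \<in> null_sets lebesgue"
    by (simp add: negligible_iff_null_sets)
  from AE_not_in[OF this] show ?thesis
    by eventually_elim (auto simp: hcube_def mem_box_cart less_imp_le)
qed

lemma measure_ccube:
  assumes "s \<ge> 0"
  shows "measure lborel (ccube (a::real^'n::finite) s) = s ^ CARD('n)"
    and "measure lebesgue (ccube a s) = s ^ CARD('n)"
proof -
  have "ccube a s \<noteq> {}" using assms by (simp add: interval_ne_empty_cart)
  then show "measure lborel (ccube a s) = s ^ CARD('n)" by (simp add: content_cbox_if_cart)
  then show "measure lebesgue (ccube a s) = s ^ CARD('n)" by simp
qed

lemma emeasure_ccube: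
  assumes "s \<ge> 0"
  shows "emeasure lborel (ccube (a::real^'n::finite) s) = ennreal (s ^ CARD('n))"
    and "emeasure lebesgue (ccube a s) = ennreal (s ^ CARD('n))"
proof -
  show "emeasure lborel (ccube a s) = ennreal (s ^ CARD('n))"
    using assms measure_ccube(1)[of s a] emeasure_lborel_cbox_finite[of a "a + (\<chi> i. s)"]
    by (simp add: emeasure_eq_ennreal_measure top.not_eq_extremum)
  then show "emeasure lebesgue (ccube a s) = ennreal (s ^ CARD('n))" by simp
qed

lemma emeasure_hcube:
  assumes "s \<ge> 0"
  shows "emeasure lborel (hcube (a::real^'n::finite) s) = ennreal (s ^ CARD('n))"
    and "emeasure lebesgue (hcube a s) = ennreal (s ^ CARD('n))"
proof -
  have "emeasure lebesgue (hcube a s) = emeasure lebesgue (ccube a s)"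
    by (rule emeasure_eq_AE, rule AE_hcube_ccube) auto
  then show "emeasure lebesgue (hcube a s) = ennreal (s ^ CARD('n))"
    using emeasure_ccube(2)[OF assms] by simp
  then show "emeasure lborel (hcube a s) = ennreal (s ^ CARD('n))" by simp
qed

lemma nn_integral_hcube:
  "(\<integral>\<^sup>+x\<in>hcube a s. f x \<partial>lebesgue) = (\<integral>\<^sup>+x\<in>ccube a s. f x \<partial>lebesgue)"
  by (intro nn_integral_cong_AE eventually_mono[OF AE_hcube_ccube[of a s]]) (auto simp: indicator_def)

lemma hcube_children: "hcube a s = (\<Union>S. hcube (child a s S) (s / 2))"
proof (intro set_eqI iffI)
  fix x assume x: "x \<in> hcube a s"
  have "x \<in> hcube (child a s {i. x $ i \<ge> a $ i + s / 2}) (s / 2)"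
    using x unfolding hcube_def child_def
    by (auto simp: not_le add.assoc)
  then show "x \<in> (\<Union>S. hcube (child a s S) (s / 2))" by blast
next
  fix x assume "x \<in> (\<Union>S. hcube (child a s S) (s / 2))"
  then obtain S where x: "x \<in> hcube (child a s S) (s / 2)" by blast
  have "a $ i \<le> x $ i \<and> x $ i < a $ i + s" for i
  proof -
    have "child a s S $ i \<le> x $ i" "x $ i < child a s S $ i + s / 2" using x by (auto simp: hcube_def)
    then show ?thesis by (auto simp: child_def split: if_splits)
  qed
  then show "x \<in> hcube a s" by (simp add: hcube_def)
qed

lemma child_disjoint: "disjoint_family (\<lambda>S. hcube (child a s S) (s / 2))"
proof (unfold disjoint_family_on_def, intro ballI impI, rule ccontr)
  fix S T :: "'a set" assume "S \<noteq> T" "hcube (child a s S) (s / 2) \<inter> hcube (child a s T) (s / 2) \<noteq> {}"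
  then obtain x i where "x \<in> hcube (child a s S) (s / 2)" "x \<in> hcube (child a s T) (s / 2)"
    and i: "i \<in> S \<longleftrightarrow> i \<notin> T" by blast
  then have "child a s S $ i \<le> x $ i" "x $ i < child a s S $ i + s / 2"
     "child a s T $ i \<le> x $ i" "x $ i < child a s T $ i + s / 2" by (auto simp: hcube_def)
  then show False using i by (auto simp: child_def split: if_splits)
qed

lemma nn_integral_children:
  assumes [measurable]: "f \<in> borel_measurable lebesgue"
  shows "(\<integral>\<^sup>+x\<in>hcube a s. f x \<partial>lebesgue) = (\<Sum>S\<in>UNIV. \<integral>\<^sup>+x\<in>hcube (child a s S) (s / 2). f x \<partial>lebesgue)"
proof -
  have "indicator (hcube a s) x = (\<Sum>S\<in>UNIV. indicator (hcube (child a s S) (s / 2)) x :: ennreal)" for x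
    unfolding hcube_children[of a s] by (rule indicator_UN_disjoint) (use child_disjoint[of a s] in auto)
  then have "(\<integral>\<^sup>+x\<in>hcube a s. f x \<partial>lebesgue) = (\<integral>\<^sup>+x. (\<Sum>S\<in>UNIV. f x * indicator (hcube (child a s S) (s / 2)) x) \<partial>lebesgue)"
    by (simp add: sum_distrib_left)
  also have "\<dots> = (\<Sum>S\<in>UNIV. \<integral>\<^sup>+x\<in>hcube (child a s S) (s / 2). f x \<partial>lebesgue)"
    by (rule nn_integral_sum) measurable
  finally show ?thesis .
qed

lemma borel_measurable_lebesgueI:
  fixes f :: "'a::euclidean_space \<Rightarrow> 'b::topological_space"
  shows "f \<in> borel_measurable borel \<Longrightarrow> f \<in> borel_measurable lebesgue"
  by (intro measurable_completion) simp

lemma locally_integrable_measurable: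
  fixes f :: "real^'n::finite \<Rightarrow> 'b::{banach, second_countable_topology}"
  assumes "locally_integrable f"
  shows "f \<in> borel_measurable lebesgue"
proof (rule borel_measurable_LIMSEQ_metric)
  fix k :: nat
  show "(\<lambda>x. indicator (cball 0 (real k)) x *\<^sub>R f x) \<in> borel_measurable lebesgue"
    using assms unfolding locally_integrable_def set_integrable_def by (meson borel_measurable_integrable compact_cball)
next
  fix x :: "real^'n"
  have "eventually (\<lambda>k. indicator (cball 0 (real k)) x *\<^sub>R f x = f x) sequentially"
    using eventually_ge_at_top[of "nat \<lceil>norm x\<rceil>"] by eventually_elim (simp add: indicator_def ceiling_le_iff nat_le_iff, linarith?)
  then show "(\<lambda>k. indicator (cball 0 (real k)) x *\<^sub>R f x) \<longlonglongrightarrow> f x" by (rule tendsto_eventually)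
qed

lemma locally_integrable_finite:
  assumes "locally_integrable f"
  shows "(\<integral>\<^sup>+x\<in>ccube a s. ennreal (norm (f x)) \<partial>lebesgue) < \<infinity>"
proof -
  have "set_integrable lebesgue (ccube a s) f" using assms by (auto simp: locally_integrable_def)
  then have "(\<integral>\<^sup>+x. ennreal (norm (indicator (ccube a s) x *\<^sub>R f x)) \<partial>lebesgue) < \<infinity>"
    unfolding set_integrable_def by (simp add: integrable_iff_bounded)
  then show ?thesis by (simp add: mult.commute nn_integral_set_ennreal indicator_mult_ennreal) 
qed

section \<open>The weighted John--Nirenberg inequality\<close>

lemma cube_avg_deviation:
  fixes b :: "real^'n::finite \<Rightarrow> complex"
  assumes b: "locally_integrable b" and s: "s > 0"
  shows "ennreal (cmod (cube_avg b (ccube a s) - c) * s ^ CARD('n)) \<le> (\<integral>\<^sup>+x\<in>hcube a s. ennreal (cmod (b x - c)) \<partial>lebesgue)"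
proof -
  have int: "set_integrable lebesgue (ccube a s) b" using b by (auto simp: locally_integrable_def)
  have intc: "set_integrable lebesgue (ccube a s) (\<lambda>_. c)"
    unfolding set_integrable_def by (subst integrable_completion) (auto intro: borel_integrable_compact)
  have "cube_avg (\<lambda>_. c) (ccube a s) = c"
  proof -
    have "integrable lebesgue (indicat_real (ccube a s))"
      using s emeasure_ccube(2)[of s a] by (intro integrable_real_indicator) auto
    then show ?thesis using s by (simp add: cube_avg_def set_lebesgue_integral_def measure_ccube)
  qed
  then have "cube_avg b (ccube a s) - c = (LINT y:ccube a s|lebesgue. b y - c) /\<^sub>R s ^ CARD('n)"
    using s int intc by (simp add: cube_avg_def measure_ccube set_integral_diff scaleR_diff_right)
  then have "cmod (cube_avg b (ccube a s) - c) * s ^ CARD('n) = cmod (LINT y:ccube a s|lebesgue. b y - c)"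
    using s by (simp add: norm_divide norm_power divide_simps)
  also have "ennreal \<dots> \<le> (\<integral>\<^sup>+y. ennreal (cmod (indicator (ccube a s) y *\<^sub>R (b y - c))) \<partial>lebesgue)"
    unfolding set_lebesgue_integral_def
    by (rule integral_norm_bound_ennreal) (use set_integral_diff(1)[OF int intc] in \<open>simp add: set_integrable_def\<close>)
  also have "\<dots> = (\<integral>\<^sup>+x\<in>ccube a s. ennreal (cmod (b x - c)) \<partial>lebesgue)"
    by (intro nn_integral_cong) (auto simp: indicator_def)
  finally show ?thesis by (simp add: nn_integral_hcube)
qed

lemma mean_osc_nn:
  fixes b :: "real^'n::finite \<Rightarrow> complex"
  assumes b: "locally_integrable b" and s: "s > 0"
  shows "(\<integral>\<^sup>+x\<in>hcube a s. ennreal (cmod (b x - cube_avg b (ccube a s))) \<partial>lebesgue)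
          = ennreal (mean_osc b (ccube a s) * s ^ CARD('n))"
proof -
  define c where "c = cube_avg b (ccube a s)"
  have int: "set_integrable lebesgue (ccube a s) b" using b by (auto simp: locally_integrable_def)
  have intc: "set_integrable lebesgue (ccube a s) (\<lambda>_. c)"
    unfolding set_integrable_def by (subst integrable_completion) (auto intro: borel_integrable_compact)
  have i: "integrable lebesgue (\<lambda>y. indicator (ccube a s) y *\<^sub>R (b y - c))"
    using set_integral_diff(1)[OF int intc] by (simp add: set_integrable_def)
  have "(\<integral>\<^sup>+x\<in>ccube a s. ennreal (cmod (b x - c)) \<partial>lebesgue) = (\<integral>\<^sup>+x. ennreal (indicator (ccube a s) x *\<^sub>R cmod (b x - c)) \<partial>lebesgue)"
    by (intro nn_integral_cong) (auto simp: indicator_def)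
  also have "\<dots> = ennreal (LINT x:ccube a s|lebesgue. cmod (b x - c))"
    unfolding set_lebesgue_integral_def
    by (rule nn_integral_eq_integral) (use integrable_norm[OF i] in \<open>auto simp: abs_mult\<close>)
  finally have eq: "(\<integral>\<^sup>+x\<in>ccube a s. ennreal (cmod (b x - c)) \<partial>lebesgue) = ennreal (LINT x:ccube a s|lebesgue. cmod (b x - c))" .
  show ?thesis
  proof -
    have "mean_osc b (ccube a s) * s ^ CARD('n) = (LINT x:ccube a s|lebesgue. cmod (b x - c))"
      unfolding mean_osc_def c_def[symmetric]
      unfolding cube_avg_def using s by (simp add: measure_ccube divide_simps)
    then show ?thesis using eq by (simp add: c_def nn_integral_hcube)
  qed
qed

text \<open>The average of \<open>b\<close> over the cube of generation \<open>N\<close>, inside the cube at \<open>a\<close> of side \<open>s\<close>,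
  that contains \<open>x\<close>.\<close>

primrec dyad_avg :: "(real^'n \<Rightarrow> complex) \<Rightarrow> nat \<Rightarrow> real^'n \<Rightarrow> real \<Rightarrow> real^'n::finite \<Rightarrow> complex" where
  "dyad_avg b 0 a s x = cube_avg b (ccube a s)"
| "dyad_avg b (Suc N) a s x = dyad_avg b N (child a s {i. a $ i + s / 2 \<le> x $ i}) (s / 2) x"

lemma dyad_avg_child:
  assumes "x \<in> hcube (child a s S) (s / 2)"
  shows "dyad_avg b (Suc N) a s x = dyad_avg b N (child a s S) (s / 2) x"
proof -
  have "S = {i. a $ i + s / 2 \<le> x $ i}"
    using assms by (force simp: hcube_def child_def not_le split: if_splits)
  then show ?thesis by simp
qed

lemma dyad_avg_measurable [measurable]: "dyad_avg b N a s \<in> borel_measurable lebesgue"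
proof -
  have "dyad_avg b N a s \<in> borel_measurable borel"
  proof (induction N arbitrary: a s)
    case (Suc N)
    have [measurable]: "(\<lambda>x. dyad_avg b N (child a s S) (s / 2) x) \<in> borel_measurable borel" for S
      using Suc by blast
    have "dyad_avg b (Suc N) a s = (\<lambda>x. \<Sum>S\<in>UNIV. if (\<forall>i. i \<in> S \<longleftrightarrow> a $ i + s / 2 \<le> x $ i)
        then dyad_avg b N (child a s S) (s / 2) x else 0)"
    proof
      fix x
      have "(\<forall>i. i \<in> S \<longleftrightarrow> a $ i + s / 2 \<le> x $ i) \<longleftrightarrow> S = {i. a $ i + s / 2 \<le> x $ i}" for S by auto
      then show "dyad_avg b (Suc N) a s x = (\<Sum>S\<in>UNIV. if (\<forall>i. i \<in> S \<longleftrightarrow> a $ i + s / 2 \<le> x $ i)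
        then dyad_avg b N (child a s S) (s / 2) x else 0)" by simp
    qed
    also have "\<dots> \<in> borel_measurable borel" by measurable
    finally show ?case .
  qed (simp add: measurable_const cong: measurable_cong)
  then have "dyad_avg b N a s \<in> borel_measurable lborel" by simp
  then show ?thesis by (rule measurable_completion)
qed

text \<open>Cubes, met while bisecting, on which \<open>b\<close> deviates from \<open>c\<close> by more than \<open>2\<close> on average.\<close>

definition heavy :: "(real^'n::finite \<Rightarrow> complex) \<Rightarrow> real^'n \<Rightarrow> real \<Rightarrow> complex \<Rightarrow> bool" where
  "heavy b a s c \<longleftrightarrow> ennreal (2 * s ^ CARD('n)) < (\<integral>\<^sup>+x\<in>hcube a s. ennreal (cmod (b x - c)) \<partial>lebesgue)"

text \<open>The union of the maximal heavy cubes among those of generation at most \<open>N\<close>.\<close>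

primrec heavy_union :: "(real^'n \<Rightarrow> complex) \<Rightarrow> nat \<Rightarrow> real^'n \<Rightarrow> real \<Rightarrow> complex \<Rightarrow> (real^'n::finite) set" where
  "heavy_union b 0 a s c = (if heavy b a s c then hcube a s else {})"
| "heavy_union b (Suc N) a s c =
     (if heavy b a s c then hcube a s else (\<Union>S. heavy_union b N (child a s S) (s / 2) c))"

lemma heavy_union_subset: "heavy_union b N a s c \<subseteq> hcube a s"
proof (induction N arbitrary: a s)
  case (Suc N)
  then have "(\<Union>S. heavy_union b N (child a s S) (s / 2) c) \<subseteq> hcube a s"
    unfolding hcube_children[of a s] by blast
  then show ?case by simp
qed simp

lemma heavy_union_borel [measurable, simp]: "heavy_union b N a s c \<in> sets borel"
  by (induction N arbitrary: a s) auto

text \<open>The maximal heavy cubes are disjoint, and the integral of \<open>|b - c|\<close> over each of them exceeds twice its volume.\<close>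

lemma heavy_union_small:
  assumes [measurable]: "b \<in> borel_measurable lebesgue" and s: "s > 0"
  shows "2 * emeasure lebesgue (heavy_union b N (a::real^'n::finite) s c) \<le> (\<integral>\<^sup>+x\<in>hcube a s. ennreal (cmod (b x - c)) \<partial>lebesgue)"
  using s
proof (induction N arbitrary: a s)
  case 0
  then show ?case by (auto simp: heavy_def emeasure_hcube ennreal_mult' dest: less_imp_le simp del: emeasure_lborel_countable)
next
  case (Suc N)
  show ?case
  proof (cases "heavy b a s c")
    case True
    then show ?thesis using Suc.prems by (auto simp: heavy_def emeasure_hcube ennreal_mult' dest: less_imp_le)
  next
    case False
    have "emeasure lebesgue (\<Union>S. heavy_union b N (child a s S) (s / 2) c)
       \<le> (\<Sum>S\<in>UNIV. emeasure lebesgue (heavy_union b N (child a s S) (s / 2) c))"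
      by (rule emeasure_subadditive_finite) auto
    then have "2 * emeasure lebesgue (\<Union>S. heavy_union b N (child a s S) (s / 2) c)
       \<le> (\<Sum>S\<in>UNIV. 2 * emeasure lebesgue (heavy_union b N (child a s S) (s / 2) c))"
      unfolding sum_distrib_left[symmetric] by (rule mult_left_mono) simp
    also have "\<dots> \<le> (\<Sum>S\<in>UNIV. \<integral>\<^sup>+x\<in>hcube (child a s S) (s / 2). ennreal (cmod (b x - c)) \<partial>lebesgue)"
      using Suc by (intro sum_mono) auto
    also have "\<dots> = (\<integral>\<^sup>+x\<in>hcube a s. ennreal (cmod (b x - c)) \<partial>lebesgue)"
      by (rule nn_integral_children[symmetric]) measurable
    finally show ?thesis using False by simp
  qed
qed

locale unit_bmo =
  fixes b :: "real^'n::finite \<Rightarrow> complex"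
  assumes loc_int: "locally_integrable b"
    and osc_le_1: "s > 0 \<Longrightarrow> mean_osc b (ccube a s) \<le> 1"
begin

lemma meas [measurable]: "b \<in> borel_measurable lebesgue"
  using loc_int by (rule locally_integrable_measurable)

lemma osc_nn:
  assumes "s > 0"
  shows "(\<integral>\<^sup>+x\<in>hcube a s. ennreal (cmod (b x - cube_avg b (ccube a s))) \<partial>lebesgue) \<le> ennreal (s ^ CARD('n))"
  using osc_le_1[OF assms, of a] assms
  by (subst mean_osc_nn[OF loc_int assms]) (auto intro!: ennreal_leI simp: mult_le_cancel_right1)

end

text \<open>A weight, given as a measure, that loses a fixed proportion of its mass on every subset of a
  cube with at most half of the volume.\<close>

locale bmo_with_doubling_weight = unit_bmo b
  for b :: "real^'n::finite \<Rightarrow> complex" +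
  fixes \<nu> :: "(real^'n) measure" and \<gamma> :: real
  assumes sets_nu: "sets \<nu> = sets lebesgue"
    and null_nu: "E \<in> null_sets lebesgue \<Longrightarrow> E \<in> null_sets \<nu>"
    and gamma: "0 \<le> \<gamma>" "\<gamma> < 1"
    and half: "s > 0 \<Longrightarrow> E \<in> sets lebesgue \<Longrightarrow> E \<subseteq> hcube a s \<Longrightarrow>
       2 * emeasure lebesgue E \<le> ennreal (s ^ CARD('n)) \<Longrightarrow> emeasure \<nu> E \<le> ennreal \<gamma> * emeasure \<nu> (hcube a s)"
begin

text \<open>The bound \<open>2\<close> for the average of \<open>|b - c|\<close> over a cube that is not heavy, times the factor \<open>2 ^ n\<close> lost
  in passing to a child.\<close>

definition level :: real where "level = 2 ^ (CARD('n) + 1)"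

text \<open>A finite stage of the deviation set of \<open>b\<close>. The averages of generation \<open>N\<close> take finitely many values on the cube, which
  permits induction over the generations; \<open>N\<close> tends to infinity only at the end.\<close>

definition devset :: "nat \<Rightarrow> real^'n \<Rightarrow> real \<Rightarrow> complex \<Rightarrow> real \<Rightarrow> (real^'n) set" where
  "devset N a s c \<theta> = {x \<in> hcube a s. cmod (dyad_avg b N a s x - c) > \<theta>}"

lemma devset_sets [measurable, simp]: "devset N a s c \<theta> \<in> sets \<nu>"
proof -
  have "{x \<in> space lebesgue. x \<in> hcube a s \<and> cmod (dyad_avg b N a s x - c) > \<theta>} \<in> sets lebesgue" by measurable
  then show ?thesis by (simp add: devset_def sets_nu)
qed

lemma devset_Suc: "devset (Suc N) a s c \<theta> = (\<Union>S. devset N (child a s S) (s / 2) c \<theta>)"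
  unfolding devset_def hcube_children[of a s]
  by (auto simp del: dyad_avg.simps simp: dyad_avg_child)

lemma level_le: 
  assumes "\<not> heavy b a s c" "s > 0"
  shows "(\<integral>\<^sup>+x\<in>hcube (child a s S) (s / 2). ennreal (cmod (b x - c)) \<partial>lebesgue) \<le> ennreal (level * (s / 2) ^ CARD('n))"
proof -
  have "(\<integral>\<^sup>+x\<in>hcube (child a s S) (s / 2). ennreal (cmod (b x - c)) \<partial>lebesgue) \<le> (\<integral>\<^sup>+x\<in>hcube a s. ennreal (cmod (b x - c)) \<partial>lebesgue)"
    unfolding hcube_children[of a s] by (intro nn_integral_mono mult_left_mono) (auto simp: indicator_def)
  also have "\<dots> \<le> ennreal (2 * s ^ CARD('n))" using assms by (simp add: heavy_def not_less)
  also have "2 * s ^ CARD('n) = level * (s / 2) ^ CARD('n)" by (simp add: level_def power_divide)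
  finally show ?thesis .
qed

text \<open>One stopping step: on a heavy cube whose parent is not heavy the average of \<open>b\<close> is within
  \<open>level\<close> of \<open>c\<close>, so deviation \<open>(k + 1) * level\<close> from \<open>c\<close> forces deviation \<open>k * level\<close> from that
  average; outside of the heavy cubes all averages are within \<open>2\<close> of \<open>c\<close>.\<close>

lemma devset_step:
  assumes IH: "\<And>N a s. s > 0 \<Longrightarrow> emeasure \<nu> (devset N a s (cube_avg b (ccube a s)) (real k * level)) \<le> M * emeasure \<nu> (hcube a s)"
    and s: "s > 0" and near: "(\<integral>\<^sup>+x\<in>hcube a s. ennreal (cmod (b x - c)) \<partial>lebesgue) \<le> ennreal (level * s ^ CARD('n))"
  shows "emeasure \<nu> (devset N a s c (real (Suc k) * level)) \<le> M * emeasure \<nu> (heavy_union b N a s c)"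
  using s near
proof (induction N arbitrary: a s)
  have heavy_case: "emeasure \<nu> (devset N a s c (real (Suc k) * level)) \<le> M * emeasure \<nu> (hcube a s)"
    if "s > 0" "(\<integral>\<^sup>+x\<in>hcube a s. ennreal (cmod (b x - c)) \<partial>lebesgue) \<le> ennreal (level * s ^ CARD('n))" for N a s
  proof -
    have "ennreal (cmod (cube_avg b (ccube a s) - c) * s ^ CARD('n)) \<le> ennreal (level * s ^ CARD('n))"
      using cube_avg_deviation[OF loc_int that(1)] that(2) by (rule order_trans)
    then have d: "cmod (cube_avg b (ccube a s) - c) \<le> level"
      using that(1) by (simp add: ennreal_le_iff level_def)
    have "devset N a s c (real (Suc k) * level) \<subseteq> devset N a s (cube_avg b (ccube a s)) (real k * level)"
    proof
      fix x assume "x \<in> devset N a s c (real (Suc k) * level)"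
      moreover have "cmod (dyad_avg b N a s x - c) \<le> cmod (dyad_avg b N a s x - cube_avg b (ccube a s)) + cmod (cube_avg b (ccube a s) - c)"
        using norm_triangle_ineq[of "dyad_avg b N a s x - cube_avg b (ccube a s)" "cube_avg b (ccube a s) - c"] by simp
      ultimately show "x \<in> devset N a s (cube_avg b (ccube a s)) (real k * level)"
        using d by (auto simp: devset_def algebra_simps)
    qed
    then have "emeasure \<nu> (devset N a s c (real (Suc k) * level)) \<le> emeasure \<nu> (devset N a s (cube_avg b (ccube a s)) (real k * level))"
      by (intro emeasure_mono) auto
    then show ?thesis using IH[OF that(1), of N a] by (rule order_trans)
  qed
  {
    case 0
    show ?case
    proof (cases "heavy b a s c")
      case True
      then show ?thesis using heavy_case[OF 0, of 0] by simp
    next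
      case False
      have "ennreal (cmod (cube_avg b (ccube a s) - c) * s ^ CARD('n)) \<le> ennreal (2 * s ^ CARD('n))"
        using cube_avg_deviation[OF loc_int 0(1)] False unfolding heavy_def not_less by (rule order_trans)
      then have "cmod (cube_avg b (ccube a s) - c) \<le> 2"
        using 0(1) by (simp add: ennreal_le_iff)
      moreover have "2 \<le> level" by (simp add: level_def)
      then have "2 \<le> real (Suc k) * level" using mult_mono[of 1 "real (Suc k)" 2 level] by simp
      ultimately have "devset 0 a s c (real (Suc k) * level) = {}" by (auto simp: devset_def)
      then show ?thesis by simp
    qed
  next
    case (Suc N)
    show ?case
    proof (cases "heavy b a s c")
      case True
      then show ?thesis using heavy_case[OF Suc.prems, of "Suc N"] by simp
    next
      case False
      have disj: "disjoint_family (\<lambda>S. heavy_union b N (child a s S) (s / 2) c)"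
        using child_disjoint[of a s] heavy_union_subset[of b N _ "s / 2" c]
        unfolding disjoint_family_on_def by blast
      have "emeasure \<nu> (devset (Suc N) a s c (real (Suc k) * level))
        \<le> (\<Sum>S\<in>UNIV. emeasure \<nu> (devset N (child a s S) (s / 2) c (real (Suc k) * level)))"
        unfolding devset_Suc by (rule emeasure_subadditive_finite) auto
      also have "\<dots> \<le> (\<Sum>S\<in>UNIV. M * emeasure \<nu> (heavy_union b N (child a s S) (s / 2) c))"
        using level_le[OF False Suc.prems(1)] Suc.prems(1) by (intro sum_mono Suc.IH) auto
      also have "\<dots> = M * emeasure \<nu> (\<Union>S. heavy_union b N (child a s S) (s / 2) c)"
        by (subst sum_emeasure[symmetric, of _ UNIV]) (use disj in \<open>auto simp: sets_nu sum_distrib_left\<close>)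
      finally show ?thesis using False by simp
    qed
  }
qed

text \<open>The heavy cubes of \<open>c = avg b\<close> occupy at most half of the cube, hence at most the proportion \<open>\<gamma>\<close> of the mass of
  \<open>\<nu>\<close>; the other \<open>k\<close> levels are passed inside of them.\<close>

lemma devset_decay:
  assumes "s > 0"
  shows "emeasure \<nu> (devset N a s (cube_avg b (ccube a s)) (real k * level)) \<le> ennreal \<gamma> ^ k * emeasure \<nu> (hcube a s)"
  using assms
proof (induction k arbitrary: N a s)
  case 0
  show ?case by (auto intro!: emeasure_mono simp: devset_def sets_nu)
next
  case (Suc k)
  define c where "c = cube_avg b (ccube a s)"
  have osc: "(\<integral>\<^sup>+x\<in>hcube a s. ennreal (cmod (b x - c)) \<partial>lebesgue) \<le> ennreal (s ^ CARD('n))"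
    unfolding c_def using Suc.prems by (rule osc_nn)
  also have "\<dots> \<le> ennreal (level * s ^ CARD('n))"
    using Suc.prems one_le_power[of "2::real" "CARD('n) + 1"]
    by (intro ennreal_leI) (simp add: level_def mult_le_cancel_right1)
  finally have step: "emeasure \<nu> (devset N a s c (real (Suc k) * level)) \<le> ennreal \<gamma> ^ k * emeasure \<nu> (heavy_union b N a s c)"
    by (intro devset_step Suc.IH Suc.prems)
  have "emeasure \<nu> (heavy_union b N a s c) \<le> ennreal \<gamma> * emeasure \<nu> (hcube a s)"
    by (rule half[OF Suc.prems _ heavy_union_subset order_trans[OF heavy_union_small[OF meas Suc.prems] osc]]) simp
  then have "emeasure \<nu> (devset N a s c (real (Suc k) * level)) \<le> ennreal \<gamma> ^ k * (ennreal \<gamma> * emeasure \<nu> (hcube a s))"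
    by (intro order_trans[OF step] mult_left_mono) auto
  then show ?case by (simp add: c_def mult_ac)
qed

end

subsection \<open>Convergence of the dyadic averages\<close>

text \<open>Clipping \<open>b\<close> to a large ball changes it little in \<open>L\<^sup>1\<close>. A measurable function is almost everywhere a limit of
  continuous ones; clipped to the same ball these converge dominatedly.\<close>

lemma L1_continuous_approximation:
  fixes b :: "real^'n::finite \<Rightarrow> complex"
  assumes b: "locally_integrable b" and e: "e > 0"
  obtains g where "continuous_on UNIV g" "(\<integral>\<^sup>+x\<in>ccube a s. ennreal (cmod (b x - g x)) \<partial>lebesgue) \<le> ennreal e"
proof -
  have bm [measurable]: "b \<in> borel_measurable lebesgue" using b by (rule locally_integrable_measurable)
  define clip :: "nat \<Rightarrow> complex \<Rightarrow> complex" where "clip M = closest_point (cball 0 (real M))" for M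
  have clip_cont: "continuous_on UNIV (clip M)" for M
    unfolding clip_def by (rule continuous_on_closest_point) auto
  then have [measurable]: "clip M \<in> borel_measurable borel" for M by (rule borel_measurable_continuous_onI)
  have clip_le: "cmod (clip M z) \<le> real M" for M z
    unfolding clip_def using closest_point_in_set[of "cball 0 (real M)" z] by auto
  have clip_self: "clip M z = z" if "cmod z \<le> real M" for M z
    unfolding clip_def using that by (intro closest_point_self) auto
  have clip_dist: "cmod (z - clip M z) \<le> cmod z" for M z
    unfolding clip_def using closest_point_le[of "cball 0 (real M)" 0 z] by (auto simp: dist_norm)
  have "(\<lambda>M. \<integral>\<^sup>+x\<in>ccube a s. ennreal (cmod (b x - clip M (b x))) \<partial>lebesgue) \<longlonglongrightarrow> integral\<^sup>N lebesgue (\<lambda>x::real^'n. 0)"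
  proof (rule nn_integral_dominated_convergence[where w = "\<lambda>x. ennreal (cmod (b x)) * indicator (ccube a s) x"])
    show "(\<integral>\<^sup>+x\<in>ccube a s. ennreal (cmod (b x)) \<partial>lebesgue) < \<infinity>" using locally_integrable_finite[OF b] .
    show "AE x in lebesgue. (\<lambda>M. ennreal (cmod (b x - clip M (b x))) * indicator (ccube a s) x) \<longlonglongrightarrow> 0"
    proof (rule AE_I2)
      fix x
      have "eventually (\<lambda>M. ennreal (cmod (b x - clip M (b x))) * indicator (ccube a s) x = 0) sequentially"
        using eventually_ge_at_top[of "nat \<lceil>cmod (b x)\<rceil>"]
        by eventually_elim (simp add: clip_self nat_le_iff ceiling_le_iff)
      then show "(\<lambda>M. ennreal (cmod (b x - clip M (b x))) * indicator (ccube a s) x) \<longlonglongrightarrow> 0"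
        by (rule tendsto_eventually)
    qed
    show "AE x in lebesgue. ennreal (cmod (b x - clip M (b x))) * indicator (ccube a s) x \<le> ennreal (cmod (b x)) * indicator (ccube a s) x" for M
      by (intro AE_I2 mult_right_mono ennreal_leI clip_dist) simp
  qed measurable
  then have "eventually (\<lambda>M. (\<integral>\<^sup>+x\<in>ccube a s. ennreal (cmod (b x - clip M (b x))) \<partial>lebesgue) < ennreal (e / 2)) sequentially"
    using e by (intro order_tendstoD(2)) auto
  then obtain M where M: "(\<integral>\<^sup>+x\<in>ccube a s. ennreal (cmod (b x - clip M (b x))) \<partial>lebesgue) < ennreal (e / 2)"
    by (auto simp: eventually_sequentially)
  have "b measurable_on UNIV" by (rule lebesgue_measurable_imp_measurable_on) auto
  then obtain N g where N: "negligible N" and g: "\<And>n. continuous_on UNIV (g n)" "\<And>x. x \<notin> N \<Longrightarrow> (\<lambda>n. g n x) \<longlonglongrightarrow> b x"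
    unfolding measurable_on_def by auto
  have gm [measurable]: "g n \<in> borel_measurable lebesgue" for n
    by (intro borel_measurable_lebesgueI borel_measurable_continuous_onI g(1))
  have "(\<lambda>n. \<integral>\<^sup>+x\<in>ccube a s. ennreal (cmod (clip M (b x) - clip M (g n x))) \<partial>lebesgue) \<longlonglongrightarrow> integral\<^sup>N lebesgue (\<lambda>x::real^'n. 0)"
  proof (rule nn_integral_dominated_convergence[where w = "\<lambda>x. ennreal (2 * real M) * indicator (ccube a s) x"])
    show "(\<integral>\<^sup>+x\<in>ccube a s. ennreal (2 * real M) \<partial>lebesgue) < \<infinity>"
      using emeasure_lborel_cbox_finite[of a "a + (\<chi> i. s)"] by (simp add: nn_integral_cmult_indicator ennreal_mult_less_top)
    show "AE x in lebesgue. ennreal (cmod (clip M (b x) - clip M (g n x))) * indicator (ccube a s) x \<le> ennreal (2 * real M) * indicator (ccube a s) x" for n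
      by (intro AE_I2 mult_right_mono ennreal_leI) (use norm_triangle_ineq4 clip_le in \<open>smt (verit)\<close>, simp)
    have "AE x in lebesgue. x \<notin> N" using N by (intro AE_not_in) (simp add: negligible_iff_null_sets)
    then show "AE x in lebesgue. (\<lambda>n. ennreal (cmod (clip M (b x) - clip M (g n x))) * indicator (ccube a s) x) \<longlonglongrightarrow> 0"
    proof eventually_elim
      case (elim x)
      have "(\<lambda>n. clip M (g n x)) \<longlonglongrightarrow> clip M (b x)"
        using clip_cont[of M] g(2)[OF elim] by (auto simp: continuous_on_eq_continuous_at intro: isCont_tendsto_compose)
      then have "(\<lambda>n. cmod (clip M (b x) - clip M (g n x))) \<longlonglongrightarrow> cmod (clip M (b x) - clip M (b x))"
        by (intro tendsto_intros)
      then have "(\<lambda>n. ennreal (cmod (clip M (b x) - clip M (g n x)))) \<longlonglongrightarrow> ennreal 0"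
        by (intro tendsto_ennrealI) simp
      then show ?case by (cases "x \<in> ccube a s") simp_all
    qed
  qed measurable
  then have "eventually (\<lambda>n. (\<integral>\<^sup>+x\<in>ccube a s. ennreal (cmod (clip M (b x) - clip M (g n x))) \<partial>lebesgue) < ennreal (e / 2)) sequentially"
    using e by (intro order_tendstoD(2)) auto
  then obtain n where n: "(\<integral>\<^sup>+x\<in>ccube a s. ennreal (cmod (clip M (b x) - clip M (g n x))) \<partial>lebesgue) < ennreal (e / 2)"
    by (auto simp: eventually_sequentially)
  show thesis
  proof (rule that[of "\<lambda>x. clip M (g n x)"])
    show "continuous_on UNIV (\<lambda>x. clip M (g n x))"
      using continuous_on_compose2[OF clip_cont g(1)] by auto
    have "(\<integral>\<^sup>+x\<in>ccube a s. ennreal (cmod (b x - clip M (g n x))) \<partial>lebesgue)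
      \<le> (\<integral>\<^sup>+x. ennreal (cmod (b x - clip M (b x))) * indicator (ccube a s) x + ennreal (cmod (clip M (b x) - clip M (g n x))) * indicator (ccube a s) x \<partial>lebesgue)"
      unfolding distrib_right[symmetric] ennreal_plus[symmetric, OF norm_ge_zero norm_ge_zero]
      by (intro nn_integral_mono mult_right_mono ennreal_leI) (use norm_triangle_ineq in \<open>smt (verit) diff_add_cancel add_diff_eq\<close>, simp)
    also have "\<dots> = (\<integral>\<^sup>+x\<in>ccube a s. ennreal (cmod (b x - clip M (b x))) \<partial>lebesgue) + (\<integral>\<^sup>+x\<in>ccube a s. ennreal (cmod (clip M (b x) - clip M (g n x))) \<partial>lebesgue)"
      by (rule nn_integral_add) auto
    also have "\<dots> \<le> ennreal (e / 2) + ennreal (e / 2)" using M n by (intro add_mono) auto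
    also have "\<dots> = ennreal e" using e by (simp flip: ennreal_plus)
    finally show "(\<integral>\<^sup>+x\<in>ccube a s. ennreal (cmod (b x - clip M (g n x))) \<partial>lebesgue) \<le> ennreal e" .
  qed
qed

text \<open>On the cubes of generation \<open>N\<close> the comparison function \<open>g\<close> is constant up to \<open>e\<close>. The average of \<open>b\<close> deviates from such a
  constant at most as much as \<open>b\<close> itself does, in the mean; hence the factor \<open>2\<close>.\<close>

lemma dyad_avg_error:
  fixes b g :: "real^'n::finite \<Rightarrow> complex"
  assumes b: "locally_integrable b" and gm [measurable]: "g \<in> borel_measurable lebesgue" and e: "e \<ge> 0" and s: "s > 0"
    and osc: "\<And>x y. x \<in> hcube a s \<Longrightarrow> y \<in> hcube a s \<Longrightarrow> (\<And>i. \<bar>x $ i - y $ i\<bar> \<le> s / 2 ^ N) \<Longrightarrow> cmod (g x - g y) \<le> e"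
  shows "(\<integral>\<^sup>+x\<in>hcube a s. ennreal (cmod (dyad_avg b N a s x - b x)) \<partial>lebesgue)
     \<le> 2 * (\<integral>\<^sup>+x\<in>hcube a s. ennreal (cmod (b x - g x)) \<partial>lebesgue) + ennreal (2 * e * s ^ CARD('n))"
  using s osc
proof (induction N arbitrary: a s)
  case 0
  have [measurable]: "b \<in> borel_measurable lebesgue" using b by (rule locally_integrable_measurable)
  define c where "c = g a"
  define m where "m = cube_avg b (ccube a s)"
  have ah: "a \<in> hcube a s" using 0 by (auto simp: hcube_def)
  define D where "D = (\<integral>\<^sup>+x\<in>hcube a s. ennreal (cmod (b x - c)) \<partial>lebesgue)"
  have "D \<le> (\<integral>\<^sup>+x. ennreal (cmod (b x - g x)) * indicator (hcube a s) x + ennreal e * indicator (hcube a s) x \<partial>lebesgue)"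
    unfolding D_def
  proof (rule nn_integral_mono)
    fix x
    show "ennreal (cmod (b x - c)) * indicator (hcube a s) x \<le> ennreal (cmod (b x - g x)) * indicator (hcube a s) x + ennreal e * indicator (hcube a s) x"
    proof (cases "x \<in> hcube a s")
      case True
      have "\<bar>x $ i - a $ i\<bar> \<le> s / 2 ^ 0" for i
      proof -
        have "a $ i \<le> x $ i \<and> x $ i < a $ i + s" using True by (simp add: hcube_def)
        then show ?thesis by simp
      qed
      then have "cmod (g x - c) \<le> e" unfolding c_def using 0(2)[OF True ah] by blast
      then have "cmod (b x - c) \<le> cmod (b x - g x) + e"
        using norm_triangle_ineq[of "b x - g x" "g x - c"] by simp
      then show ?thesis using True e by (simp add: ennreal_leI flip: ennreal_plus)
    qed simp
  qed
  also have "\<dots> = (\<integral>\<^sup>+x\<in>hcube a s. ennreal (cmod (b x - g x)) \<partial>lebesgue) + ennreal (e * s ^ CARD('n))"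
    using 0(1) e by (subst nn_integral_add) (auto simp: nn_integral_cmult_indicator emeasure_hcube ennreal_mult'')
  finally have D: "D \<le> (\<integral>\<^sup>+x\<in>hcube a s. ennreal (cmod (b x - g x)) \<partial>lebesgue) + ennreal (e * s ^ CARD('n))" .
  have "(\<integral>\<^sup>+x\<in>hcube a s. ennreal (cmod (m - b x)) \<partial>lebesgue)
    \<le> (\<integral>\<^sup>+x. ennreal (cmod (m - c)) * indicator (hcube a s) x + ennreal (cmod (b x - c)) * indicator (hcube a s) x \<partial>lebesgue)"
  proof (rule nn_integral_mono)
    fix x
    have "cmod (m - b x) \<le> cmod (m - c) + cmod (b x - c)"
      using norm_triangle_ineq4[of "m - c" "b x - c"] by simp
    then show "ennreal (cmod (m - b x)) * indicator (hcube a s) x \<le> ennreal (cmod (m - c)) * indicator (hcube a s) x + ennreal (cmod (b x - c)) * indicator (hcube a s) x"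
      unfolding distrib_right[symmetric] ennreal_plus[symmetric, OF norm_ge_zero norm_ge_zero]
      by (intro mult_right_mono ennreal_leI) auto
  qed
  also have "\<dots> = ennreal (cmod (m - c) * s ^ CARD('n)) + D"
    using 0(1) unfolding D_def by (subst nn_integral_add) (auto simp: nn_integral_cmult_indicator emeasure_hcube ennreal_mult'')
  also have "\<dots> \<le> D + D"
    unfolding D_def m_def by (intro add_right_mono cube_avg_deviation[OF b 0(1)])
  also have "\<dots> = 2 * D" by (simp add: mult_2)
  also have "\<dots> \<le> 2 * ((\<integral>\<^sup>+x\<in>hcube a s. ennreal (cmod (b x - g x)) \<partial>lebesgue) + ennreal (e * s ^ CARD('n)))"
    using D by (rule mult_left_mono) simp
  also have "\<dots> = 2 * (\<integral>\<^sup>+x\<in>hcube a s. ennreal (cmod (b x - g x)) \<partial>lebesgue) + ennreal (2 * e * s ^ CARD('n))"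
    using e 0(1) by (simp add: distrib_left ennreal_mult' mult.assoc)
  finally show ?case by (simp add: m_def)
next
  case (Suc N)
  have [measurable]: "b \<in> borel_measurable lebesgue" using b by (rule locally_integrable_measurable)
  have sub: "hcube (child a s S) (s / 2) \<subseteq> hcube a s" for S unfolding hcube_children[of a s] by blast
  have "(\<integral>\<^sup>+x\<in>hcube a s. ennreal (cmod (dyad_avg b (Suc N) a s x - b x)) \<partial>lebesgue)
     = (\<Sum>S\<in>UNIV. \<integral>\<^sup>+x\<in>hcube (child a s S) (s / 2). ennreal (cmod (dyad_avg b (Suc N) a s x - b x)) \<partial>lebesgue)"
    by (rule nn_integral_children) (simp del: dyad_avg.simps)
  also have "\<dots> = (\<Sum>S\<in>UNIV. \<integral>\<^sup>+x\<in>hcube (child a s S) (s / 2). ennreal (cmod (dyad_avg b N (child a s S) (s / 2) x - b x)) \<partial>lebesgue)"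
    by (intro sum.cong refl nn_integral_cong) (auto simp: dyad_avg_child indicator_def simp del: dyad_avg.simps)
  also have "\<dots> \<le> (\<Sum>S\<in>UNIV. 2 * (\<integral>\<^sup>+x\<in>hcube (child a s S) (s / 2). ennreal (cmod (b x - g x)) \<partial>lebesgue) + ennreal (2 * e * (s / 2) ^ CARD('n)))"
    using Suc.prems(1) sub by (intro sum_mono Suc.IH Suc.prems(2)) (auto simp: field_simps)
  also have "\<dots> = 2 * (\<integral>\<^sup>+x\<in>hcube a s. ennreal (cmod (b x - g x)) \<partial>lebesgue) + (\<Sum>S\<in>(UNIV::'n set set). ennreal (2 * e * (s / 2) ^ CARD('n)))"
    by (subst nn_integral_children[of _ a s]) (simp_all add: sum.distrib sum_distrib_left)
  also have "(\<Sum>S\<in>(UNIV::'n set set). ennreal (2 * e * (s / 2) ^ CARD('n))) = ennreal (2 * e * s ^ CARD('n))"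
  proof -
    have "(\<Sum>S\<in>(UNIV::'n set set). ennreal (2 * e * (s / 2) ^ CARD('n))) = ennreal (\<Sum>S\<in>(UNIV::'n set set). 2 * e * (s / 2) ^ CARD('n))"
      using e Suc.prems(1) by (intro sum_ennreal) auto
    also have "(\<Sum>S\<in>(UNIV::'n set set). 2 * e * (s / 2) ^ CARD('n)) = 2 * e * s ^ CARD('n)"
      using card_Pow[of "UNIV::'n set"] by (simp add: power_divide)
    finally show ?thesis .
  qed
  finally show ?case .
qed

text \<open>This takes the place of the Lebesgue differentiation theorem: along a subsequence the averages converge almost
  everywhere.\<close>

lemma dyad_avg_L1_convergence:
  fixes b :: "real^'n::finite \<Rightarrow> complex"
  assumes b: "locally_integrable b" and s: "s > 0"
  shows "(\<lambda>N. \<integral>\<^sup>+x\<in>hcube a s. ennreal (cmod (dyad_avg b N a s x - b x)) \<partial>lebesgue) \<longlonglongrightarrow> 0"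
proof (rule order_tendstoI)
  fix y :: ennreal assume y: "y > 0"
  define t where "t = (if y = top then 1 else enn2real y)"
  have t: "t > 0" "ennreal t \<le> y" using y by (auto simp: t_def enn2real_positive_iff top.not_eq_extremum)
  define P where "P = 1 + s ^ CARD('n)"
  define e where "e = t / (4 * P)"
  have sp: "s ^ CARD('n) > 0" using s by simp
  have P: "P > 0" using sp by (simp add: P_def)
  have "2 * e + 2 * e * s ^ CARD('n) = 2 * e * P" by (simp add: P_def algebra_simps)
  also have "\<dots> = t / 2" using P by (simp add: e_def)
  finally have "2 * e + 2 * e * s ^ CARD('n) < t" using t by simp
  moreover have "e > 0" using t P by (simp add: e_def)
  ultimately have e: "e > 0" "2 * e + 2 * e * s ^ CARD('n) < t" by simp_all
  obtain g where g: "continuous_on UNIV g" "(\<integral>\<^sup>+x\<in>ccube a s. ennreal (cmod (b x - g x)) \<partial>lebesgue) \<le> ennreal e"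
    using L1_continuous_approximation[OF b e(1)] by blast
  have gm: "g \<in> borel_measurable lebesgue"
    by (intro borel_measurable_lebesgueI borel_measurable_continuous_onI g(1))
  have "uniformly_continuous_on (ccube a s) g"
    using g(1) by (intro compact_uniformly_continuous) (auto intro: continuous_on_subset)
  then obtain d where d: "d > 0" "\<And>x y. x \<in> ccube a s \<Longrightarrow> y \<in> ccube a s \<Longrightarrow> dist y x < d \<Longrightarrow> dist (g y) (g x) < e"
    unfolding uniformly_continuous_on_def using e(1) by meson
  have "(\<lambda>N. (real CARD('n) * s) * (1/2) ^ N) \<longlonglongrightarrow> (real CARD('n) * s) * 0"
    by (intro tendsto_intros LIMSEQ_power_zero) auto
  then have "eventually (\<lambda>N. real CARD('n) * s * (1/2) ^ N < d) sequentially"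
    using d(1) by (intro order_tendstoD(2)) auto
  then show "eventually (\<lambda>N. (\<integral>\<^sup>+x\<in>hcube a s. ennreal (cmod (dyad_avg b N a s x - b x)) \<partial>lebesgue) < y) sequentially"
  proof eventually_elim
    case (elim N)
    have "(\<integral>\<^sup>+x\<in>hcube a s. ennreal (cmod (dyad_avg b N a s x - b x)) \<partial>lebesgue)
     \<le> 2 * (\<integral>\<^sup>+x\<in>hcube a s. ennreal (cmod (b x - g x)) \<partial>lebesgue) + ennreal (2 * e * s ^ CARD('n))"
    proof (rule dyad_avg_error[OF b gm less_imp_le[OF e(1)] s])
      fix x y assume xy: "x \<in> hcube a s" "y \<in> hcube a s" "\<And>i. \<bar>x $ i - y $ i\<bar> \<le> s / 2 ^ N"
      have "dist x y \<le> (\<Sum>i\<in>UNIV. \<bar>(x - y) $ i\<bar>)" unfolding dist_norm by (rule norm_le_l1_cart)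
      also have "\<dots> \<le> (\<Sum>i\<in>(UNIV::'n set). s / 2 ^ N)" using xy(3) by (intro sum_mono) simp
      also have "\<dots> < d" using elim by (simp add: power_one_over field_simps)
      finally have "dist (g x) (g y) < e" using d(2)[of y x] xy(1,2) hcube_subset_ccube by blast
      then show "cmod (g x - g y) \<le> e" by (simp add: dist_norm)
    qed
    also have "\<dots> \<le> 2 * ennreal e + ennreal (2 * e * s ^ CARD('n))"
      using g(2) unfolding nn_integral_hcube by (intro add_right_mono mult_left_mono) auto
    also have "\<dots> = ennreal (2 * e + 2 * e * s ^ CARD('n))" using e sp by (simp add: ennreal_mult')
    also have "\<dots> < ennreal t" using e sp t by (intro ennreal_lessI) auto
    finally show ?case using t(2) by simp
  qed
qed simp

context bmo_with_doubling_weight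
begin

text \<open>Almost every point of the set on the left lies in \<open>devset N\<close> for all sufficiently large \<open>N\<close> of a subsequence, so
  Fatou's lemma transfers the decay from the dyadic averages to \<open>b\<close>.\<close>

theorem weighted_john_nirenberg:
  assumes s: "s > 0"
  shows "emeasure \<nu> {x \<in> hcube a s. cmod (b x - cube_avg b (ccube a s)) > real k * level}
    \<le> ennreal \<gamma> ^ k * emeasure \<nu> (hcube a s)" (is "emeasure \<nu> ?B \<le> ?c")
proof -
  define m where "m = cube_avg b (ccube a s)"
  define u where "u N x = indicator (hcube a s) x *\<^sub>R (dyad_avg b N a s x - b x)" for N x
  have um [measurable]: "u N \<in> borel_measurable lebesgue" for N unfolding u_def by measurable
  have nn: "(\<integral>\<^sup>+x. ennreal (cmod (u N x)) \<partial>lebesgue) = (\<integral>\<^sup>+x\<in>hcube a s. ennreal (cmod (dyad_avg b N a s x - b x)) \<partial>lebesgue)" for N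
    unfolding u_def by (intro nn_integral_cong) (auto simp: indicator_def)
  have int: "integrable lebesgue (u N)" for N
  proof (rule integrableI_bounded)
    have "(\<integral>\<^sup>+x. ennreal (cmod (u N x)) \<partial>lebesgue) \<le> 2 * (\<integral>\<^sup>+x\<in>hcube a s. ennreal (cmod (b x - 0)) \<partial>lebesgue) + ennreal (2 * 0 * s ^ CARD('n))"
      unfolding nn by (rule dyad_avg_error[OF loc_int]) (use s in auto)
    also have "\<dots> < \<infinity>" using locally_integrable_finite[OF loc_int, of a s]
      by (simp add: nn_integral_hcube ennreal_mult_less_top)
    finally show "(\<integral>\<^sup>+x. ennreal (cmod (u N x)) \<partial>lebesgue) < \<infinity>" .
  qed measurable
  have "ennreal (LINT x|lebesgue. cmod (u N x)) = (\<integral>\<^sup>+x\<in>hcube a s. ennreal (cmod (dyad_avg b N a s x - b x)) \<partial>lebesgue)" for N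
    unfolding nn[symmetric] by (rule nn_integral_eq_integral[symmetric]) (use int in auto)
  then have "(\<lambda>N. ennreal (LINT x|lebesgue. cmod (u N x))) \<longlonglongrightarrow> ennreal 0"
    using dyad_avg_L1_convergence[OF loc_int s, of a] by simp
  then have "(\<lambda>N. LINT x|lebesgue. cmod (u N x)) \<longlonglongrightarrow> 0"
    by (subst (asm) tendsto_ennreal_iff) auto
  then obtain r where r: "strict_mono r" "AE x in lebesgue. (\<lambda>n. u (r n) x) \<longlonglongrightarrow> 0"
    using tendsto_L1_AE_subseq[of lebesgue u] int by blast
  then obtain E where E: "E \<in> null_sets lebesgue" "\<And>x. x \<notin> E \<Longrightarrow> (\<lambda>n. u (r n) x) \<longlonglongrightarrow> 0"
    by (auto elim!: AE_E3)
  have B: "?B \<in> sets \<nu>"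
  proof -
    have "{x \<in> space lebesgue. x \<in> hcube a s \<and> cmod (b x - cube_avg b (ccube a s)) > real k * level} \<in> sets lebesgue" by measurable
    then show ?thesis by (simp add: sets_nu)
  qed
  have ev: "eventually (\<lambda>n. x \<in> devset (r n) a s m (real k * level)) sequentially" if x: "x \<in> ?B" "x \<notin> E" for x
  proof -
    have "(\<lambda>n. u (r n) x) \<longlonglongrightarrow> 0" using E x by blast
    then have "(\<lambda>n. dyad_avg b (r n) a s x - b x) \<longlonglongrightarrow> 0" using x by (simp add: u_def)
    then have "(\<lambda>n. (dyad_avg b (r n) a s x - b x) + (b x - m)) \<longlonglongrightarrow> 0 + (b x - m)" by (intro tendsto_intros)
    then have "(\<lambda>n. cmod (dyad_avg b (r n) a s x - m)) \<longlonglongrightarrow> cmod (b x - m)" using tendsto_norm by fastforce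
    then have "eventually (\<lambda>n. real k * level < cmod (dyad_avg b (r n) a s x - m)) sequentially"
      using x by (intro order_tendstoD(1)) (auto simp: m_def)
    then show ?thesis by eventually_elim (use x in \<open>auto simp: devset_def\<close>)
  qed
  have "emeasure \<nu> ?B = (\<integral>\<^sup>+x. indicator ?B x \<partial>\<nu>)" using B by simp
  also have "\<dots> \<le> (\<integral>\<^sup>+x. liminf (\<lambda>n. indicator (devset (r n) a s m (real k * level)) x) \<partial>\<nu>)"
  proof (rule nn_integral_mono_AE)
    have claim: "indicator ?B x \<le> liminf (\<lambda>n. indicator (devset (r n) a s m (real k * level)) x :: ennreal)"
      if "x \<notin> E" for x
    proof (cases "x \<in> ?B")
      case True
      have "eventually (\<lambda>n. 1 \<le> (indicator (devset (r n) a s m (real k * level)) x :: ennreal)) sequentially"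
        by (intro eventually_mono[OF ev[OF True that]]) (simp only: indicator_simps(1) order_refl)
      then have "1 \<le> liminf (\<lambda>n. indicator (devset (r n) a s m (real k * level)) x :: ennreal)"
        by (rule Liminf_bounded)
      then show ?thesis using True by (simp only: indicator_simps(1))
    next
      case False
      show ?thesis unfolding indicator_simps(2)[OF False] by (rule zero_le)
    qed
    show "AE x in \<nu>. indicator ?B x \<le> liminf (\<lambda>n. indicator (devset (r n) a s m (real k * level)) x :: ennreal)"
      by (rule AE_I'[OF null_nu[OF E(1)]]) (use claim in blast)
  qed
  also have "\<dots> \<le> liminf (\<lambda>n. \<integral>\<^sup>+x. indicator (devset (r n) a s m (real k * level)) x \<partial>\<nu>)"
    by (rule nn_integral_liminf) auto
  also have "\<dots> \<le> liminf (\<lambda>n::nat. ?c)"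
    using devset_decay[OF s] by (intro Liminf_mono always_eventually allI) (auto simp: m_def)
  also have "\<dots> = ?c" by (simp add: Liminf_const)
  finally show ?thesis .
qed

text \<open>The integral is decomposed according to the interval \<open>(k * level, (k + 1) * level]\<close> that contains the deviation.\<close>

lemma oscillation_moment:
  fixes \<Psi> :: "real \<Rightarrow> real"
  assumes s: "s > 0" and \<Psi>: "\<And>t u. 0 \<le> t \<Longrightarrow> t \<le> u \<Longrightarrow> \<Psi> t \<le> \<Psi> u" "\<Psi> 0 = 0"
  shows "(\<integral>\<^sup>+x\<in>hcube a s. ennreal (\<Psi> (cmod (b x - cube_avg b (ccube a s)))) \<partial>\<nu>)
    \<le> (\<Sum>k. ennreal (\<Psi> (real (Suc k) * level)) * ennreal \<gamma> ^ k) * emeasure \<nu> (hcube a s)"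
proof -
  define D where "D k = {x \<in> hcube a s. cmod (b x - cube_avg b (ccube a s)) > real k * level}" for k :: nat
  have D [measurable]: "D k \<in> sets \<nu>" for k
  proof -
    have "{x \<in> space lebesgue. x \<in> hcube a s \<and> cmod (b x - cube_avg b (ccube a s)) > real k * level} \<in> sets lebesgue" by measurable
    then show ?thesis by (simp add: sets_nu D_def)
  qed
  have lv: "level > 0" by (simp add: level_def)
  have "(\<integral>\<^sup>+x\<in>hcube a s. ennreal (\<Psi> (cmod (b x - cube_avg b (ccube a s)))) \<partial>\<nu>)
     \<le> (\<integral>\<^sup>+x. (\<Sum>k. ennreal (\<Psi> (real (Suc k) * level)) * indicator (D k) x) \<partial>\<nu>)"
  proof (rule nn_integral_mono)
    fix x
    define y where "y = cmod (b x - cube_avg b (ccube a s))"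
    show "ennreal (\<Psi> (cmod (b x - cube_avg b (ccube a s)))) * indicator (hcube a s) x
       \<le> (\<Sum>k. ennreal (\<Psi> (real (Suc k) * level)) * indicator (D k) x)"
    proof (cases "x \<in> hcube a s \<and> y > 0")
      case True
      define k where "k = nat (\<lceil>y / level\<rceil> - 1)"
      have "\<lceil>y / level\<rceil> \<ge> 1" using True lv by simp
      then have "real k < y / level" "y / level \<le> real (Suc k)" unfolding k_def by linarith+
      then have k: "real k * level < y" "y \<le> real (Suc k) * level" using lv by (auto simp: field_simps)
      have "ennreal (\<Psi> y) * indicator (hcube a s) x \<le> ennreal (\<Psi> (real (Suc k) * level)) * indicator (D k) x"
        using True k \<Psi>(1)[of y "real (Suc k) * level"] by (auto simp: D_def y_def indicator_def intro!: ennreal_leI)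
      also have "\<dots> \<le> (\<Sum>k. ennreal (\<Psi> (real (Suc k) * level)) * indicator (D k) x)"
        using sum_le_suminf[of "\<lambda>k. ennreal (\<Psi> (real (Suc k) * level)) * indicator (D k) x" "{k}"]
        by (simp del: of_nat_Suc sum_mult_indicator)
      finally show ?thesis by (simp add: y_def)
    next
      case False
      then have "x \<notin> hcube a s \<or> y = 0" by (auto simp: y_def)
      then show ?thesis using \<Psi>(2) by (auto simp: y_def)
    qed
  qed
  also have "\<dots> = (\<Sum>k. \<integral>\<^sup>+x. ennreal (\<Psi> (real (Suc k) * level)) * indicator (D k) x \<partial>\<nu>)"
    by (rule nn_integral_suminf) measurable
  also have "\<dots> = (\<Sum>k. ennreal (\<Psi> (real (Suc k) * level)) * emeasure \<nu> (D k))"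
    by (simp add: nn_integral_cmult_indicator)
  also have "\<dots> \<le> (\<Sum>k. ennreal (\<Psi> (real (Suc k) * level)) * (ennreal \<gamma> ^ k * emeasure \<nu> (hcube a s)))"
    unfolding D_def by (intro suminf_le mult_left_mono weighted_john_nirenberg s) auto
  also have "\<dots> = (\<Sum>k. ennreal (\<Psi> (real (Suc k) * level)) * ennreal \<gamma> ^ k) * emeasure \<nu> (hcube a s)"
    by (simp add: mult.assoc[symmetric])
  finally show ?thesis .
qed

end

section \<open>Muckenhoupt weights\<close>

text \<open>A weight \<open>w\<close> together with its dual \<open>s = w powr (- 1 / (q - 1))\<close>; \<open>W\<close> and \<open>S\<close> are their masses
  on the cube at \<open>a\<close> of side \<open>t\<close>. The notion is symmetric: the dual weight satisfies it for the
  conjugate exponent.\<close>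

locale Aq_weight =
  fixes w s :: "real^'n::finite \<Rightarrow> real" and q A :: real and W S :: "real^'n \<Rightarrow> real \<Rightarrow> real"
  assumes q: "1 < q" and A: "A > 0"
    and w_meas [measurable]: "w \<in> borel_measurable lebesgue" and s_meas [measurable]: "s \<in> borel_measurable lebesgue"
    and w_s: "AE x in lebesgue. w x > 0 \<and> s x = w x powr (- 1 / (q - 1))"
    and W: "t > 0 \<Longrightarrow> (\<integral>\<^sup>+x\<in>hcube a t. ennreal (w x) \<partial>lebesgue) = ennreal (W a t)" "t > 0 \<Longrightarrow> W a t > 0"
    and S: "t > 0 \<Longrightarrow> (\<integral>\<^sup>+x\<in>hcube a t. ennreal (s x) \<partial>lebesgue) = ennreal (S a t)" "t > 0 \<Longrightarrow> S a t > 0"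
    and WS: "t > 0 \<Longrightarrow> W a t * S a t powr (q - 1) \<le> A * (t ^ CARD('n)) powr q"
begin

lemma dual: "Aq_weight s w (q / (q - 1)) (A powr (1 / (q - 1))) S W"
proof
  show "1 < q / (q - 1)" using q by simp
  show "A powr (1 / (q - 1)) > 0" using A by simp
  have e: "q / (q - 1) - 1 = 1 / (q - 1)" using q by (simp add: field_simps)
  show "AE x in lebesgue. s x > 0 \<and> w x = s x powr (- 1 / (q / (q - 1) - 1))"
    using w_s
  proof eventually_elim
    case (elim x)
    have "- 1 / (q - 1) * (- 1 / (1 / (q - 1))) = 1" using q by (simp add: field_simps)
    then have "s x powr (- 1 / (1 / (q - 1))) = w x" using elim by (simp add: powr_powr del: divide_divide_eq_right)
    then show ?case using elim unfolding e by simp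
  qed
  show "S a t * W a t powr (q / (q - 1) - 1) \<le> A powr (1 / (q - 1)) * (t ^ CARD('n)) powr (q / (q - 1))" if t: "t > 0" for a t
  proof -
    have "(W a t * S a t powr (q - 1)) powr (1 / (q - 1)) \<le> (A * (t ^ CARD('n)) powr q) powr (1 / (q - 1))"
      using q W(2)[OF t] S(2)[OF t] by (intro powr_mono2 WS t) (auto simp: less_imp_le)
    then show ?thesis using q W(2)[OF t, of a] S(2)[OF t, of a] A t unfolding e
      by (simp add: powr_mult powr_powr mult.commute)
  qed
qed (use W S in \<open>auto\<close>)

text \<open>Young's inequality with a free scale \<open>\<mu>\<close>, in place of Hoelder's inequality for the pair.\<close>

lemma young:
  assumes \<mu>: "\<mu> > 0"
  shows "AE x in lebesgue. \<forall>y z. y \<ge> 0 \<longrightarrow> z \<ge> 0 \<longrightarrow>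
    y * z \<le> \<mu> powr q * (y powr q * w x) + \<mu> powr (- (q / (q - 1))) * (z powr (q / (q - 1)) * s x)"
  using w_s
proof eventually_elim
  case (elim x)
  show ?case
  proof (intro allI impI)
    fix y z :: real assume y: "y \<ge> 0" and z: "z \<ge> 0"
    define p where "p = q / (q - 1)"
    have p: "p > 1" using q by (simp add: p_def)
    have wx: "w x > 0" and sx: "s x = w x powr (- 1 / (q - 1))" using elim by auto
    have "y * z = (\<mu> * y * w x powr (1 / q)) * (z * w x powr (- 1 / q) / \<mu>)"
      using \<mu> wx q by (simp add: powr_minus field_simps)
    also have "\<dots> \<le> (\<mu> * y * w x powr (1 / q)) powr q / q + (z * w x powr (- 1 / q) / \<mu>) powr p / p"
      using q p y z \<mu> by (intro Youngs_inequality) (auto simp: p_def field_simps)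
    also have "\<dots> \<le> (\<mu> * y * w x powr (1 / q)) powr q + (z * w x powr (- 1 / q) / \<mu>) powr p"
      using q p by (intro add_mono) (auto simp: divide_le_eq mult_le_cancel_left1)
    also have "(\<mu> * y * w x powr (1 / q)) powr q = \<mu> powr q * (y powr q * w x)"
      using \<mu> y wx q by (simp add: powr_mult powr_powr)
    also have "(z * w x powr (- 1 / q) / \<mu>) powr p = \<mu> powr (- p) * (z powr p * s x)"
    proof -
      have "- 1 / q * p = - 1 / (q - 1)" using q by (simp add: p_def)
      then show ?thesis using \<mu> z wx by (simp add: powr_mult powr_divide powr_powr sx powr_minus field_simps)
    qed
    finally show "y * z \<le> \<mu> powr q * (y powr q * w x) + \<mu> powr (- (q / (q - 1))) * (z powr (q / (q - 1)) * s x)"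
      by (simp add: p_def)
  qed
qed

definition decay :: real where "decay = max 0 (1 - 4 powr (- q) / A)"

lemma decay: "0 \<le> decay" "decay < 1" using A by (auto simp: decay_def)

definition mass :: "(real^'n) measure" where "mass = density lebesgue (\<lambda>x. ennreal (w x))"

lemma emeasure_mass: "E \<in> sets lebesgue \<Longrightarrow> emeasure mass E = (\<integral>\<^sup>+x\<in>E. ennreal (w x) \<partial>lebesgue)"
  unfolding mass_def by (subst emeasure_density) auto

text \<open>The \<open>A\<^sub>q\<close> condition, tested on the indicator function of \<open>F\<close>. In Young's inequality \<open>\<mu>\<close> is chosen such that the term
  with the dual weight is a quarter of the volume of the cube and can be absorbed.\<close>

lemma large_subset_mass:
  assumes t: "t > 0" and F: "F \<in> sets lebesgue" "F \<subseteq> hcube a t" "ennreal (t ^ CARD('n)) \<le> 2 * emeasure lebesgue F"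
  shows "ennreal (4 powr (- q) / A * W a t) \<le> emeasure mass F"
proof -
  define V where "V = t ^ CARD('n)"
  have V: "V > 0" using t by (simp add: V_def)
  note Sp = S(2)[OF t, of a]
  define p where "p = q / (q - 1)"
  have p: "p > 1" using q by (simp add: p_def)
  define \<mu> where "\<mu> = (4 * S a t / V) powr (1 / p)"
  have \<mu>: "\<mu> > 0" using Sp V by (simp add: \<mu>_def)
  have \<mu>p: "\<mu> powr (- p) = V / (4 * S a t)"
    using Sp V p unfolding \<mu>_def powr_powr by (simp add: powr_minus_divide)
  have \<mu>q: "\<mu> powr q = (4 * S a t / V) powr (q - 1)"
  proof -
    have "1 / p * q = q - 1" using q by (simp add: p_def)
    then show ?thesis by (simp add: \<mu>_def powr_powr)
  qed
  have [measurable]: "F \<in> sets lebesgue" by fact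
  have "emeasure lebesgue F = (\<integral>\<^sup>+x. 1 * indicator F x \<partial>lebesgue)" by simp
  also have "\<dots> \<le> (\<integral>\<^sup>+x. ennreal (\<mu> powr q) * (ennreal (w x) * indicator F x) + ennreal (\<mu> powr (- p)) * (ennreal (s x) * indicator (hcube a t) x) \<partial>lebesgue)"
  proof (rule nn_integral_mono_AE)
    show "AE x in lebesgue. 1 * indicator F x \<le> ennreal (\<mu> powr q) * (ennreal (w x) * indicator F x) + ennreal (\<mu> powr (- p)) * (ennreal (s x) * indicator (hcube a t) x)"
      using young[OF \<mu>] w_s
    proof eventually_elim
      case (elim x)
      have "1 \<le> \<mu> powr q * w x + \<mu> powr (- p) * s x"
        using elim(1)[THEN spec, of 1, THEN spec, of 1] by (simp add: p_def)
      then have "ennreal 1 \<le> ennreal (\<mu> powr q * w x + \<mu> powr (- p) * s x)" by (rule ennreal_leI)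
      also have "\<dots> = ennreal (\<mu> powr q) * ennreal (w x) + ennreal (\<mu> powr (- p)) * ennreal (s x)"
        using elim(2) by (subst ennreal_plus) (auto simp: ennreal_mult' less_imp_le simp del: ennreal_plus)
      finally show ?case using F(2) by (auto simp: indicator_def)
    qed
  qed
  also have "\<dots> = ennreal (\<mu> powr q) * emeasure mass F + ennreal (\<mu> powr (- p)) * ennreal (S a t)"
    unfolding emeasure_mass[OF F(1)] S(1)[OF t, symmetric]
    by (subst nn_integral_add) (simp_all add: nn_integral_cmult)
  also have "ennreal (\<mu> powr (- p)) * ennreal (S a t) = ennreal (V / 4)"
    unfolding \<mu>p using Sp V by (simp flip: ennreal_mult')
  finally have le: "emeasure lebesgue F \<le> ennreal (\<mu> powr q) * emeasure mass F + ennreal (V / 4)" .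
  have fin: "emeasure mass F < \<infinity>"
  proof -
    have "emeasure mass F \<le> emeasure mass (hcube a t)"
      using F by (intro emeasure_mono) (auto simp: mass_def)
    then show ?thesis by (simp add: emeasure_mass W(1)[OF t] order_le_less_trans)
  qed
  define m where "m = enn2real (emeasure mass F)"
  have m: "emeasure mass F = ennreal m" "m \<ge> 0" using fin by (auto simp: m_def less_top)
  have "ennreal V \<le> 2 * (ennreal (\<mu> powr q) * emeasure mass F + ennreal (V / 4))"
    using F(3) le unfolding V_def[symmetric] by (meson mult_left_mono order_trans zero_le)
  also have "\<dots> = ennreal (2 * (\<mu> powr q * m + V / 4))"
    unfolding m(1) using m(2) V
    by (subst ennreal_mult, simp, simp, subst ennreal_plus, simp, simp, subst ennreal_mult) auto
  finally have "V \<le> 2 * (\<mu> powr q * m + V / 4)" using m V by (subst (asm) ennreal_le_iff) auto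
  then have "V / 4 \<le> \<mu> powr q * m" by simp
  then have "V / 4 * (V powr (q - 1)) \<le> 4 powr (q - 1) * S a t powr (q - 1) * m"
    unfolding \<mu>q using Sp V by (simp add: powr_divide powr_mult divide_simps mult.commute)
  then have "V powr q \<le> 4 powr q * S a t powr (q - 1) * m"
    using V by (simp add: powr_diff field_simps)
  then have "A * V powr q * 4 powr (- q) \<le> A * (4 powr q * S a t powr (q - 1) * m) * 4 powr (- q)"
    using A by (intro mult_right_mono mult_left_mono) auto
  also have "\<dots> = A * m * S a t powr (q - 1)" by (simp add: powr_minus field_simps)
  finally have up: "A * V powr q * 4 powr (- q) \<le> A * m * S a t powr (q - 1)" .
  have "4 powr (- q) * (W a t * S a t powr (q - 1)) \<le> 4 powr (- q) * (A * V powr q)"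
    using WS[OF t, of a] by (intro mult_left_mono) (auto simp: V_def)
  also have "\<dots> = A * V powr q * 4 powr (- q)" by simp
  also note up
  finally have "4 powr (- q) * (W a t * S a t powr (q - 1)) \<le> A * m * S a t powr (q - 1)" .
  then have "4 powr (- q) * W a t \<le> A * m" using Sp by (simp add: mult.assoc[symmetric])
  then have "4 powr (- q) / A * W a t \<le> m" using A by (simp add: divide_simps mult_ac)
  then show ?thesis unfolding m(1) by (rule ennreal_leI)
qed

text \<open>The complement of \<open>E\<close> is large, so it keeps the proportion \<open>1 - decay\<close> of the mass.\<close>

lemma small_subset_mass:
  assumes t: "t > 0" and E: "E \<in> sets lebesgue" "E \<subseteq> hcube a t" "2 * emeasure lebesgue E \<le> ennreal (t ^ CARD('n))"
  shows "emeasure mass E \<le> ennreal decay * emeasure mass (hcube a t)"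
proof -
  define F where "F = hcube a t - E"
  have F: "F \<in> sets lebesgue" "F \<subseteq> hcube a t" using E by (auto simp: F_def)
  have split: "emeasure M (hcube a t) = emeasure M E + emeasure M F" if "sets M = sets lebesgue" for M
    using E that by (subst plus_emeasure) (auto simp: F_def intro!: arg_cong[of _ _ "emeasure M"])
  define V where "V = t ^ CARD('n)"
  have V: "V > 0" using t by (simp add: V_def)
  have cube: "emeasure lebesgue (hcube a t) = ennreal V" using t by (simp add: emeasure_hcube V_def)
  have fin: "emeasure lebesgue E < \<infinity>" "emeasure lebesgue F < \<infinity>"
    using cube split[of lebesgue] by (metis ennreal_add_eq_top ennreal_neq_top infinity_ennreal_def less_top)+
  obtain x y where xy: "emeasure lebesgue E = ennreal x" "x \<ge> 0" "emeasure lebesgue F = ennreal y" "y \<ge> 0"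
    using fin by (metis enn2real_nonneg ennreal_enn2real infinity_ennreal_def)
  have "ennreal V = ennreal x + ennreal y" using split[OF refl] unfolding cube xy(1) xy(3) .
  then have "ennreal V = ennreal (x + y)" using xy by simp
  then have "V = x + y" using V xy by (subst (asm) ennreal_inj) auto
  moreover have "ennreal (2 * x) \<le> ennreal V"
    using E(3) unfolding xy(1) V_def[symmetric] by (simp add: ennreal_mult')
  then have "2 * x \<le> V" using V by (subst (asm) ennreal_le_iff) auto
  ultimately have "ennreal V \<le> 2 * emeasure lebesgue F"
    using ennreal_leI[of V "2 * y"] unfolding xy(3) by (simp add: ennreal_mult')
  then have low: "ennreal (4 powr (- q) / A * W a t) \<le> emeasure mass F"
    using F by (intro large_subset_mass t) (simp_all add: V_def)
  have sm: "sets mass = sets lebesgue" by (simp add: mass_def)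
  have cm: "emeasure mass (hcube a t) = ennreal (W a t)" by (simp add: emeasure_mass W(1)[OF t])
  have "emeasure mass E + emeasure mass F = ennreal (W a t)" using split[OF sm] cm by simp
  moreover from this obtain x' y' where xy': "emeasure mass E = ennreal x'" "x' \<ge> 0" "emeasure mass F = ennreal y'" "y' \<ge> 0"
    by (metis enn2real_nonneg ennreal_enn2real ennreal_add_eq_top ennreal_neq_top less_top)
  ultimately have sum: "x' + y' = W a t" using W(2)[OF t, of a] by (simp flip: ennreal_plus)
  have "4 powr (- q) / A * W a t \<le> y'" using low xy' by (simp add: ennreal_le_iff)
  then have "x' \<le> (1 - 4 powr (- q) / A) * W a t" using sum by (simp add: algebra_simps)
  also have "\<dots> \<le> decay * W a t" using W(2)[OF t, of a] by (intro mult_right_mono) (auto simp: decay_def)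
  finally show ?thesis unfolding cm xy'(1) using decay W(2)[OF t, of a]
    by (simp add: ennreal_leI flip: ennreal_mult)
qed

lemma bmo_with_doubling_weight:
  assumes "unit_bmo b"
  shows "bmo_with_doubling_weight b mass decay"
proof -
  interpret unit_bmo b by fact
  show ?thesis
  proof
    show "E \<in> null_sets mass" if "E \<in> null_sets lebesgue" for E
      using that unfolding mass_def by (subst null_sets_density_iff) (auto dest: AE_not_in)
  qed (use decay small_subset_mass in \<open>auto simp: mass_def emeasure_hcube\<close>)
qed

end

lemma summable_poly_geometric:
  fixes g L D :: real
  assumes "0 \<le> g" "g < 1" "L \<ge> 0"
  shows "summable (\<lambda>k. D * (1 + real (Suc k) * L) ^ P * g ^ k)"
proof -
  have s: "summable (\<lambda>k. (real (Suc k)) ^ P * g ^ k)"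
  proof (cases "g = 0")
    case True
    then show ?thesis by (intro summable_finite[of "{0}"]) auto
  next
    case False
    define c where "c = (1 + g) / 2"
    have c: "g < c" "c < 1" using assms by (auto simp: c_def)
    have "(\<lambda>k. g * (1 + inverse (real (Suc k))) ^ P) \<longlonglongrightarrow> g * (1 + 0) ^ P"
      by (intro tendsto_intros LIMSEQ_inverse_real_of_nat)
    then have "eventually (\<lambda>k. g * (1 + inverse (real (Suc k))) ^ P < c) sequentially"
      using c by (intro order_tendstoD(2)) auto
    then obtain N where N: "\<And>k. k \<ge> N \<Longrightarrow> g * (1 + inverse (real (Suc k))) ^ P < c"
      by (auto simp: eventually_sequentially)
    show ?thesis
    proof (rule summable_ratio_test[OF c(2), of N])
      fix k assume "k \<ge> N"
      have "(1 + inverse (real (Suc k))) ^ P * real (Suc k) ^ P = real (Suc (Suc k)) ^ P"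
      proof -
        have "(1 + inverse (real (Suc k))) * real (Suc k) = real (Suc (Suc k))" by (simp add: field_simps)
        then show ?thesis by (metis power_mult_distrib)
      qed
      then have "real (Suc (Suc k)) ^ P * g ^ Suc k = g * (1 + inverse (real (Suc k))) ^ P * (real (Suc k) ^ P * g ^ k)"
        by (simp add: mult_ac)
      also have "\<dots> \<le> c * (real (Suc k) ^ P * g ^ k)"
        using N[OF \<open>k \<ge> N\<close>] assms by (intro mult_right_mono) auto
      finally show "norm (real (Suc (Suc k)) ^ P * g ^ Suc k) \<le> c * norm (real (Suc k) ^ P * g ^ k)"
        using assms by (simp add: abs_mult)
    qed
  qed
  show ?thesis
  proof (rule summable_comparison_test'[of "\<lambda>k. \<bar>D\<bar> * (1 + L) ^ P * ((real (Suc k)) ^ P * g ^ k)"])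
    show "summable (\<lambda>k. \<bar>D\<bar> * (1 + L) ^ P * ((real (Suc k)) ^ P * g ^ k))" using s by (rule summable_mult)
    fix k :: nat
    have "(1 + real (Suc k) * L) ^ P \<le> ((1 + L) * real (Suc k)) ^ P"
      using assms by (intro power_mono) (auto simp: algebra_simps)
    then have "\<bar>D\<bar> * (1 + real (Suc k) * L) ^ P * g ^ k \<le> \<bar>D\<bar> * ((1 + L) * real (Suc k)) ^ P * g ^ k"
      using assms by (intro mult_right_mono mult_left_mono) auto
    then show "norm (D * (1 + real (Suc k) * L) ^ P * g ^ k) \<le> \<bar>D\<bar> * (1 + L) ^ P * ((real (Suc k)) ^ P * g ^ k)"
      using assms by (simp add: abs_mult power_mult_distrib mult_ac)
  qed
qed

text \<open>The series in \<open>oscillation_moment\<close> in dimension \<open>n\<close>, whose levels are the multiples of \<open>2 ^ (n + 1)\<close>.\<close>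

definition moment_const :: "nat \<Rightarrow> (real \<Rightarrow> real) \<Rightarrow> real \<Rightarrow> real" where
  "moment_const n \<Psi> g = (\<Sum>k. \<Psi> (real (Suc k) * 2 ^ (n + 1)) * g ^ k)"

lemma moment_const:
  assumes g: "0 \<le> g" "g < 1" and \<Psi>: "\<And>t. t \<ge> 0 \<Longrightarrow> 0 \<le> \<Psi> t" "\<And>t. t \<ge> 0 \<Longrightarrow> \<Psi> t \<le> D * (1 + t) ^ P"
  shows "0 \<le> moment_const n \<Psi> g"
    and "(\<Sum>k. ennreal (\<Psi> (real (Suc k) * 2 ^ (n + 1))) * ennreal g ^ k) = ennreal (moment_const n \<Psi> g)"
proof -
  have sum: "summable (\<lambda>k. \<Psi> (real (Suc k) * 2 ^ (n + 1)) * g ^ k)"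
  proof (rule summable_comparison_test'[OF summable_poly_geometric[OF g, of "2 ^ (n + 1)" D P]])
    fix k :: nat
    show "norm (\<Psi> (real (Suc k) * 2 ^ (n + 1)) * g ^ k) \<le> D * (1 + real (Suc k) * 2 ^ (n + 1)) ^ P * g ^ k"
      using g \<Psi>(1)[of "real (Suc k) * 2 ^ (n + 1)"] \<Psi>(2)[of "real (Suc k) * 2 ^ (n + 1)"]
      by (simp add: abs_mult mult_right_mono del: of_nat_Suc)
  qed simp
  show "0 \<le> moment_const n \<Psi> g" unfolding moment_const_def
    using g \<Psi>(1) by (intro suminf_nonneg sum) auto
  have "(\<Sum>k. ennreal (\<Psi> (real (Suc k) * 2 ^ (n + 1))) * ennreal g ^ k) = (\<Sum>k. ennreal (\<Psi> (real (Suc k) * 2 ^ (n + 1)) * g ^ k))"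
    using g \<Psi>(1) by (simp add: ennreal_mult ennreal_power)
  also have "\<dots> = ennreal (moment_const n \<Psi> g)" unfolding moment_const_def
    using g \<Psi>(1) by (intro suminf_ennreal2 sum) auto
  finally show "(\<Sum>k. ennreal (\<Psi> (real (Suc k) * 2 ^ (n + 1))) * ennreal g ^ k) = ennreal (moment_const n \<Psi> g)" .
qed

lemma (in Aq_weight) weighted_oscillation:
  assumes b: "unit_bmo b" and t: "t > 0"
    and \<Psi>: "\<And>t u. 0 \<le> t \<Longrightarrow> t \<le> u \<Longrightarrow> \<Psi> t \<le> \<Psi> u" "\<Psi> 0 = 0" "\<And>t. t \<ge> 0 \<Longrightarrow> \<Psi> t \<le> D * (1 + t) ^ P"
    and [measurable]: "(\<lambda>x. \<Psi> (cmod (b x - cube_avg b (ccube a t)))) \<in> borel_measurable lebesgue"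
  shows "(\<integral>\<^sup>+x\<in>hcube a t. ennreal (\<Psi> (cmod (b x - cube_avg b (ccube a t)))) * ennreal (w x) \<partial>lebesgue)
     \<le> ennreal (moment_const CARD('n) \<Psi> decay * W a t)"
proof -
  interpret bmo_with_doubling_weight b mass decay by (rule bmo_with_doubling_weight[OF b])
  have \<Psi>0: "0 \<le> \<Psi> t" if "t \<ge> 0" for t using \<Psi>(1)[of 0 t] \<Psi>(2) that by simp
  have "(\<integral>\<^sup>+x\<in>hcube a t. ennreal (\<Psi> (cmod (b x - cube_avg b (ccube a t)))) \<partial>mass)
      = (\<integral>\<^sup>+x. ennreal (w x) * (ennreal (\<Psi> (cmod (b x - cube_avg b (ccube a t)))) * indicator (hcube a t) x) \<partial>lebesgue)"
    unfolding mass_def by (subst nn_integral_density) auto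
  then have "(\<integral>\<^sup>+x\<in>hcube a t. ennreal (\<Psi> (cmod (b x - cube_avg b (ccube a t)))) * ennreal (w x) \<partial>lebesgue)
      = (\<integral>\<^sup>+x\<in>hcube a t. ennreal (\<Psi> (cmod (b x - cube_avg b (ccube a t)))) \<partial>mass)" by (simp add: mult_ac)
  also have "\<dots> \<le> (\<Sum>k. ennreal (\<Psi> (real (Suc k) * 2 ^ (CARD('n) + 1))) * ennreal decay ^ k) * emeasure mass (hcube a t)"
    using oscillation_moment[OF t, of \<Psi> a] \<Psi> unfolding level_def by blast
  also have "\<dots> = ennreal (moment_const CARD('n) \<Psi> decay) * ennreal (W a t)"
    using moment_const(2)[OF decay \<Psi>0 \<Psi>(3)] by (simp add: emeasure_mass W(1)[OF t])
  finally show ?thesis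
    using moment_const(1)[OF decay \<Psi>0 \<Psi>(3)] W(2)[OF t, of a] by (simp add: ennreal_mult')
qed

lemma ennpowr_neg_exponent:
  assumes "p < 0" "x \<ge> 0"
  shows "ennpowr (ennreal x) p = (if x = 0 then \<infinity> else ennreal (x powr p))"
  using assms by (auto simp: ennpowr_def)

text \<open>On a cube of positive mass the dual average cannot be infinite, so there the defining supremum in \<open>[0, \<infinity>]\<close> yields an
  inequality between real numbers.\<close>

lemma Aq_const_bound:
  assumes t: "t > 0" and Wx: "(\<integral>\<^sup>+x\<in>hcube (a::real^'n::finite) t. ennreal (w x) \<partial>lebesgue) = ennreal x" "x > 0"
    and q: "1 < q" and fin: "Aq_const q w < \<infinity>"
  defines "V \<equiv> (\<integral>\<^sup>+x\<in>hcube a t. ennpowr (ennreal (w x)) (- 1 / (q - 1)) \<partial>lebesgue)"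
  shows "V < \<infinity>"
    and "x * enn2real V powr (q - 1) \<le> enn2real (Aq_const q w) * (t ^ CARD('n)) powr q"
proof -
  define T where "T = t ^ CARD('n)"
  have T: "T > 0" using t by (simp add: T_def)
  have e: "1 - q / (q - 1) = - 1 / (q - 1)" using q by (simp add: field_simps)
  have em: "emeasure lebesgue (ccube a t) = ennreal T" using t by (simp add: emeasure_ccube T_def)
  have "ccube a t \<in> cubes" using t by (auto simp: cubes_def)
  then have "cube_nn_avg (\<lambda>x. ennreal (w x)) (ccube a t) *
     ennpowr (cube_nn_avg (\<lambda>x. ennpowr (ennreal (w x)) (1 - q / (q - 1))) (ccube a t)) (q - 1) \<le> Aq_const q w"
    unfolding Aq_const_def by (rule SUP_upper)
  then have le: "(ennreal x / ennreal T) * ennpowr (V / ennreal T) (q - 1) \<le> Aq_const q w"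
    unfolding cube_nn_avg_def e em nn_integral_hcube[symmetric] Wx V_def .
  have pos: "ennreal x / ennreal T > 0" using Wx T by (simp add: divide_ennreal)
  show fV: "V < \<infinity>"
  proof (rule ccontr)
    assume "\<not> V < \<infinity>"
    then have "V = top" by (metis infinity_ennreal_def less_top)
    then have "V / ennreal T = top" by (simp add: ennreal_top_divide)
    then have "ennpowr (V / ennreal T) (q - 1) = top" using q by (simp add: ennpowr_def)
    then show False using le pos fin Wx by (simp add: ennreal_mult_top top_unique ennreal_eq_0_iff)
  qed
  define v where "v = enn2real V"
  have v: "V = ennreal v" "v \<ge> 0" using fV by (auto simp: v_def less_top)
  have "ennpowr (ennreal (v / T)) (q - 1) = ennreal ((v / T) powr (q - 1))"
    using v T q by (auto simp: ennpowr_def enn2real_ennreal)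
  then have "ennreal (x / T * (v / T) powr (q - 1)) \<le> Aq_const q w"
    using le Wx v T by (subst ennreal_mult) (simp_all add: divide_ennreal)
  also have "\<dots> = ennreal (enn2real (Aq_const q w))" using fin by (simp add: less_top)
  finally have "x / T * (v / T) powr (q - 1) \<le> enn2real (Aq_const q w)" by (simp add: ennreal_le_iff)
  then have "x / T * (v / T) powr (q - 1) * T powr q \<le> enn2real (Aq_const q w) * T powr q"
    by (rule mult_right_mono) simp
  moreover have "x / T * (v / T) powr (q - 1) * T powr q = x * v powr (q - 1)"
    using v T by (simp add: powr_divide powr_diff field_simps)
  ultimately show "x * enn2real V powr (q - 1) \<le> enn2real (Aq_const q w) * (t ^ CARD('n)) powr q"
    by (simp add: v_def T_def)
qed

lemma AE_if_AE_on_cubes: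
  assumes "\<And>k::nat. AE x in lebesgue. x \<in> hcube (\<chi> i. - real (Suc k)) (2 * real (Suc k)) \<longrightarrow> P (x::real^'n::finite)"
  shows "AE x in lebesgue. P x"
proof -
  have "AE x in lebesgue. \<forall>k::nat. x \<in> hcube (\<chi> i. - real (Suc k)) (2 * real (Suc k)) \<longrightarrow> P x"
    unfolding AE_all_countable using assms by (intro allI)
  then show ?thesis
  proof eventually_elim
    case (elim x)
    define k where "k = nat \<lceil>norm x\<rceil>"
    have "- real (Suc k) \<le> x $ i \<and> x $ i < real (Suc k)" for i
      using component_le_norm_cart[of x i] unfolding k_def by linarith
    then have "x \<in> hcube (\<chi> i. - real (Suc k)) (2 * real (Suc k))" by (auto simp: hcube_def)
    then show ?case using elim by blast
  qed
qed

text \<open>A weight in \<open>A\<^sub>q\<close> vanishes almost everywhere or almost nowhere: if it vanished on a set of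
  positive measure, the dual average would be infinite on large cubes.\<close>

lemma Aq_cases:
  fixes w :: "real^'n::finite \<Rightarrow> real"
  assumes q: "1 < q" and w: "w \<in> Aq q"
  obtains "AE x in lebesgue. w x = 0"
  | A W S where "Aq_weight w (\<lambda>x. w x powr (- 1 / (q - 1))) q A W S"
proof (cases "AE x in lebesgue. w x = 0")
  case False
  have nn: "w x \<ge> 0" for x using w by (auto simp: Aq_def weight_def)
  have loc: "locally_integrable w" and fin: "Aq_const q w < \<infinity>"
    using w by (auto simp: Aq_def weight_def)
  have [measurable]: "w \<in> borel_measurable lebesgue" using loc by (rule locally_integrable_measurable)
  define p where "p = - 1 / (q - 1)"
  have p: "p < 0" using q by (simp add: p_def)
  define Wn where "Wn a t = (\<integral>\<^sup>+x\<in>hcube a t. ennreal (w x) \<partial>lebesgue)" for a t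
  define Vn where "Vn a t = (\<integral>\<^sup>+x\<in>hcube a t. ennpowr (ennreal (w x)) p \<partial>lebesgue)" for a t
  have Wfin: "Wn a t < \<infinity>" for a t
    using locally_integrable_finite[OF loc, of a t] nn unfolding Wn_def by (simp add: nn_integral_hcube)
  have big: "AE x in lebesgue. x \<in> hcube a t \<longrightarrow> w x > 0" if t: "t > 0" and "Wn a t > 0" for a t
  proof -
    have Wn: "Wn a t = ennreal (enn2real (Wn a t))" "enn2real (Wn a t) > 0"
      using that Wfin[of a t] by (auto simp: less_top enn2real_positive_iff)
    have "Vn a t < \<infinity>"
      using Aq_const_bound(1)[OF t _ Wn(2) q fin, of a] Wn(1) by (simp add: Wn_def Vn_def p_def)
    moreover have "top * emeasure lebesgue {x \<in> hcube a t. w x = 0} \<le> Vn a t"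
    proof -
      have "{x \<in> space lebesgue. x \<in> hcube a t \<and> w x = 0} \<in> sets lebesgue" by measurable
      then have m: "{x \<in> hcube a t. w x = 0} \<in> sets lebesgue" by simp
      then have "top * emeasure lebesgue {x \<in> hcube a t. w x = 0} = (\<integral>\<^sup>+x. top * indicator {x \<in> hcube a t. w x = 0} x \<partial>lebesgue)"
        by (subst nn_integral_cmult_indicator) auto
      also have "\<dots> \<le> Vn a t" unfolding Vn_def using p
        by (intro nn_integral_mono) (auto simp: indicator_def ennpowr_def)
      finally show ?thesis .
    qed
    ultimately have "emeasure lebesgue {x \<in> hcube a t. w x = 0} = 0"
      by (cases "emeasure lebesgue {x \<in> hcube a t. w x = 0} = 0") (auto simp: ennreal_top_mult top_unique)
    moreover have "{x \<in> space lebesgue. x \<in> hcube a t \<and> w x = 0} \<in> sets lebesgue" by measurable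
    ultimately have "{x \<in> hcube a t. w x = 0} \<in> null_sets lebesgue" by auto
    from AE_not_in[OF this] show ?thesis by eventually_elim (use nn in \<open>auto simp: less_le\<close>)
  qed
  have pos: "Wn a t > 0" if t: "t > 0" for a t
  proof (rule ccontr)
    assume "\<not> Wn a t > 0"
    then have "Wn a t = 0" by simp
    then have "AE x in lebesgue. ennreal (w x) * indicator (hcube a t) x = 0"
      unfolding Wn_def by (subst (asm) nn_integral_0_iff_AE) auto
    then have z: "AE x in lebesgue. x \<in> hcube a t \<longrightarrow> w x = 0"
      by eventually_elim (use nn in \<open>auto simp: indicator_def ennreal_eq_0_iff intro: antisym\<close>)
    have "AE x in lebesgue. w x = 0"
    proof (rule AE_if_AE_on_cubes)
      fix k :: nat
      \<comment> \<open>a cube around the origin that contains both cubes: if \<open>w\<close> had positive mass there, it would be positive on all of it\<close>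
      define R where "R = real (Suc k) + (norm a + t)"
      have R: "R > 0" using t by (simp add: R_def add_pos_nonneg)
      have sub1: "hcube a t \<subseteq> hcube (\<chi> i. - R) (2 * R)"
      proof
        fix x assume x: "x \<in> hcube a t"
        have "- R \<le> x $ i \<and> x $ i < R" for i
        proof -
          have "a $ i \<le> x $ i \<and> x $ i < a $ i + t" using x by (simp add: hcube_def)
          then show ?thesis using component_le_norm_cart[of a i] t unfolding R_def by linarith
        qed
        then show "x \<in> hcube (\<chi> i. - R) (2 * R)" by (simp add: hcube_def)
      qed
      have sub2: "hcube (\<chi> i::'n. - real (Suc k)) (2 * real (Suc k)) \<subseteq> hcube (\<chi> i. - R) (2 * R)"
      proof
        fix x assume x: "x \<in> hcube (\<chi> i::'n. - real (Suc k)) (2 * real (Suc k))"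
        have "- R \<le> x $ i \<and> x $ i < R" for i
        proof -
          define M where "M = real (Suc k)"
          have "- M \<le> x $ i" "x $ i < - M + 2 * M"
            using x unfolding hcube_def M_def by simp_all
          moreover have "R > M" using norm_ge_zero[of a] t unfolding R_def M_def by linarith
          ultimately show ?thesis by linarith
        qed
        then show "x \<in> hcube (\<chi> i. - R) (2 * R)" by (simp add: hcube_def)
      qed
      have "Wn (\<chi> i. - R) (2 * R) = 0"
      proof (rule ccontr)
        assume "Wn (\<chi> i. - R) (2 * R) \<noteq> 0"
        then have "AE x in lebesgue. x \<in> hcube (\<chi> i. - R) (2 * R) \<longrightarrow> w x > 0"
          using R by (intro big) (auto simp: zero_less_iff_neq_zero)
        with z have "AE x in lebesgue. x \<notin> hcube a t"
          by eventually_elim (use sub1 in auto)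
        then have "emeasure lebesgue (hcube a t) = 0"
          by (subst (asm) AE_iff_measurable[of "hcube a t"]) auto
        then show False using t by (simp add: emeasure_hcube)
      qed
      then have "AE x in lebesgue. ennreal (w x) * indicator (hcube (\<chi> i. - R) (2 * R)) x = 0"
        unfolding Wn_def by (subst (asm) nn_integral_0_iff_AE) auto
      then show "AE x in lebesgue. x \<in> hcube (\<chi> i. - real (Suc k)) (2 * real (Suc k)) \<longrightarrow> w x = 0"
        by eventually_elim (use nn sub2 in \<open>auto simp: indicator_def ennreal_eq_0_iff intro: antisym split: if_splits\<close>)
    qed
    with False show False by contradiction
  qed
  have wpos: "AE x in lebesgue. w x > 0"
    by (rule AE_if_AE_on_cubes, rule big, simp, rule pos, simp)
  have Wreal: "Wn a t = ennreal (enn2real (Wn a t))" "enn2real (Wn a t) > 0" if "t > 0" for a t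
    using pos[OF that, of a] Wfin[of a t] by (auto simp: less_top enn2real_positive_iff)
  have Vs: "Vn a t = (\<integral>\<^sup>+x\<in>hcube a t. ennreal (w x powr p) \<partial>lebesgue)" for a t
    unfolding Vn_def
    by (rule nn_integral_cong_AE, rule eventually_mono[OF wpos]) (use p in \<open>simp add: ennpowr_neg_exponent\<close>)
  have Vfin: "Vn a t < \<infinity>" if "t > 0" for a t
    using Aq_const_bound(1)[OF that _ Wreal(2)[OF that] q fin, of a] Wreal(1)[OF that] by (simp add: Wn_def Vn_def p_def)
  have Vpos: "Vn a t > 0" if t: "t > 0" for a t
  proof (rule ccontr)
    assume "\<not> Vn a t > 0"
    then have "(\<integral>\<^sup>+x\<in>hcube a t. ennreal (w x powr p) \<partial>lebesgue) = 0" by (simp add: Vs)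
    then have "AE x in lebesgue. ennreal (w x powr p) * indicator (hcube a t) x = 0"
      by (subst (asm) nn_integral_0_iff_AE) auto
    with wpos have "AE x in lebesgue. x \<notin> hcube a t"
      by eventually_elim (auto simp: indicator_def split: if_splits)
    then have "emeasure lebesgue (hcube a t) = 0"
      by (subst (asm) AE_iff_measurable[of "hcube a t"]) auto
    then show False using t by (simp add: emeasure_hcube)
  qed
  have "Aq_weight w (\<lambda>x. w x powr (- 1 / (q - 1))) q (enn2real (Aq_const q w) + 1)
     (\<lambda>a t. enn2real (Wn a t)) (\<lambda>a t. enn2real (Vn a t))"
  proof
    show "0 < enn2real (Aq_const q w) + 1" by (simp add: add_nonneg_pos)
    show "AE x in lebesgue. 0 < w x \<and> w x powr (- 1 / (q - 1)) = w x powr (- 1 / (q - 1))"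
      using wpos by simp
    fix a t assume t: "(t::real) > 0"
    show "(\<integral>\<^sup>+x\<in>hcube a t. ennreal (w x) \<partial>lebesgue) = ennreal (enn2real (Wn a t))" "0 < enn2real (Wn a t)"
      using Wreal[OF t, of a] by (simp_all add: Wn_def)
    show "(\<integral>\<^sup>+x\<in>hcube a t. ennreal (w x powr (- 1 / (q - 1))) \<partial>lebesgue) = ennreal (enn2real (Vn a t))" "0 < enn2real (Vn a t)"
      using Vfin[OF t, of a] Vpos[OF t, of a] Vs[of a t] by (simp_all add: p_def less_top enn2real_positive_iff)
    have "enn2real (Wn a t) * enn2real (Vn a t) powr (q - 1) \<le> enn2real (Aq_const q w) * (t ^ CARD('n)) powr q"
      using Aq_const_bound(2)[OF t _ Wreal(2)[OF t] q fin, of a] Wreal(1)[OF t, of a] by (simp add: Wn_def Vn_def p_def)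
    also have "\<dots> \<le> (enn2real (Aq_const q w) + 1) * (t ^ CARD('n)) powr q" by (intro mult_right_mono) auto
    finally show "enn2real (Wn a t) * enn2real (Vn a t) powr (q - 1) \<le> (enn2real (Aq_const q w) + 1) * (t ^ CARD('n)) powr q" .
  qed (use q in \<open>simp_all\<close>)
  then show thesis by (rule that(2))
qed (rule that(1))

section \<open>Modular inequalities on cubes\<close>

lemma mono_nonneg_measurable:
  fixes \<phi> :: "real \<Rightarrow> real"
  assumes mono: "\<And>s t. 0 \<le> s \<Longrightarrow> s \<le> t \<Longrightarrow> \<phi> s \<le> \<phi> t" and "f \<in> borel_measurable M" and nn: "\<And>x. f x \<ge> 0"
  shows "(\<lambda>x. \<phi> (f x)) \<in> borel_measurable M"
proof -
  have "mono (\<lambda>t. \<phi> (max 0 t))" by (intro monoI mono) auto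
  then have [measurable]: "(\<lambda>t. \<phi> (max 0 t)) \<in> borel_measurable borel" by (rule borel_measurable_mono)
  have [measurable]: "f \<in> borel_measurable M" by fact
  have "(\<lambda>x. \<phi> (max 0 (f x))) \<in> borel_measurable M" by measurable
  then show ?thesis using nn by (simp add: max_def)
qed

text \<open>The properties of \<open>\<Psi> = \<phi> ^ m\<close> used on cubes. By \<open>growth\<close> the function \<open>\<Psi> t / t powr q\<close> is increasing up to
  a constant, with a slack of \<open>2\<close> because functions will be split at half of their average; \<open>poly\<close> makes
  exponential decay win over \<open>\<Psi>\<close>.\<close>

locale admissible_growth =
  fixes \<Psi> :: "real \<Rightarrow> real" and q c D :: real and P :: nat
  assumes mono: "0 \<le> t \<Longrightarrow> t \<le> u \<Longrightarrow> \<Psi> t \<le> \<Psi> u"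
    and zero: "\<Psi> 0 = 0" and pos: "t > 0 \<Longrightarrow> \<Psi> t > 0"
    and submult: "0 \<le> t \<Longrightarrow> 0 \<le> u \<Longrightarrow> \<Psi> (t * u) \<le> \<Psi> t * \<Psi> u"
    and c_pos: "c > 0"
    and growth: "0 < a \<Longrightarrow> a / 2 < g \<Longrightarrow> g powr q * \<Psi> a \<le> c * (a powr q * \<Psi> g)"
    and poly: "t \<ge> 0 \<Longrightarrow> \<Psi> t \<le> D * (1 + t) ^ P"
begin

lemma nonneg: "t \<ge> 0 \<Longrightarrow> \<Psi> t \<ge> 0"
  using mono[of 0 t] zero by simp

lemma measurable_comp: "f \<in> borel_measurable M \<Longrightarrow> (\<And>x. f x \<ge> 0) \<Longrightarrow> (\<lambda>x. \<Psi> (f x)) \<in> borel_measurable M"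
  by (rule mono_nonneg_measurable[OF mono])

lemma add_le: "0 \<le> t \<Longrightarrow> 0 \<le> u \<Longrightarrow> \<Psi> (t + u) \<le> \<Psi> 2 * (\<Psi> t + \<Psi> u)"
proof -
  assume t: "0 \<le> t" "0 \<le> u"
  have "\<Psi> (t + u) \<le> \<Psi> (2 * max t u)" using t by (intro mono) auto
  also have "\<dots> \<le> \<Psi> 2 * \<Psi> (max t u)" using t by (intro submult) auto
  also have "\<dots> \<le> \<Psi> 2 * (\<Psi> t + \<Psi> u)"
    using t nonneg[of t] nonneg[of u] nonneg[of 2] by (intro mult_left_mono) (auto simp: max_def)
  finally show ?thesis .
qed

end

locale Aq_growth = Aq_weight w s q A W S + admissible_growth \<Psi> q c D P
  for w s :: "real^'n::finite \<Rightarrow> real" and q A W S \<Psi> c D P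
begin

text \<open>Write \<open>B\<close> for the average of \<open>u * f\<close>. Where \<open>f \<le> B / 2\<close> the product contributes at most half
  of \<open>B\<close>, since \<open>u\<close> has average at most \<open>1\<close>; elsewhere \<open>f powr q\<close> is dominated by \<open>\<Psi> f\<close>, because
  \<open>\<Psi>\<close> grows at least like the power \<open>q\<close>.\<close>

lemma cube_average_modular:
  assumes t: "t > 0" and [measurable]: "u \<in> borel_measurable lebesgue" "f \<in> borel_measurable lebesgue"
    and nn: "\<And>x. u x \<ge> 0" "\<And>x. f x \<ge> 0"
    and u1: "(\<integral>\<^sup>+x\<in>hcube a t. ennreal (u x) \<partial>lebesgue) \<le> ennreal (t ^ CARD('n))"
    and K: "K > 0" and up: "(\<integral>\<^sup>+x\<in>hcube a t. ennreal (u x powr (q / (q - 1))) * ennreal (s x) \<partial>lebesgue) \<le> ennreal (K * S a t)"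
    and B: "B \<ge> 0" "(\<integral>\<^sup>+x\<in>hcube a t. ennreal (u x * f x) \<partial>lebesgue) = ennreal (B * t ^ CARD('n))"
  shows "ennreal (\<Psi> B * W a t) \<le> ennreal (4 * (4 * K) powr (q - 1) * c * A) * (\<integral>\<^sup>+x\<in>hcube a t. ennreal (\<Psi> (f x)) * ennreal (w x) \<partial>lebesgue)"
    (is "_ \<le> _ * ?X")
proof -
  consider "B = 0" | "?X = \<infinity>" | "B > 0" "?X < \<infinity>" using B(1) by (fastforce simp: less_top)
  then show ?thesis
  proof cases
    case 2
    have "ennreal (4 * (4 * K) powr (q - 1) * c * A) > 0" using K c_pos A by simp
    then show ?thesis using K c_pos A unfolding 2 by (simp add: ennreal_mult_top)
  next
    case 3
    define X where "X = enn2real ?X"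
    have X: "?X = ennreal X" "X \<ge> 0" using 3(2) by (auto simp: X_def less_top)
    define V where "V = t ^ CARD('n)"
    have V: "V > 0" using t by (simp add: V_def)
    note Sp = S(2)[OF t, of a]
    define p where "p = q / (q - 1)"
    have p: "p > 1" using q by (simp add: p_def)
    \<comment> \<open>the term with the dual weight becomes a quarter of \<open>B * V\<close>; another half comes from \<open>f \<le> B / 2\<close>\<close>
    define \<mu> where "\<mu> = (4 * K * S a t / (B * V)) powr (1 / p)"
    have \<mu>: "\<mu> > 0" using Sp V K 3 by (simp add: \<mu>_def)
    have \<mu>p: "\<mu> powr (- p) * (K * S a t) = B * V / 4"
      using Sp V p K 3 unfolding \<mu>_def powr_powr by (simp add: powr_minus_divide)
    have \<mu>q: "\<mu> powr q = (4 * K * S a t / (B * V)) powr (q - 1)"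
    proof -
      have "1 / p * q = q - 1" using q by (simp add: p_def)
      then show ?thesis by (simp add: \<mu>_def powr_powr)
    qed
    have \<Psi>B: "\<Psi> B > 0" using pos 3 by simp
    define \<kappa> where "\<kappa> = \<mu> powr q * (c * B powr q / \<Psi> B)"
    have \<kappa>: "\<kappa> \<ge> 0" using \<Psi>B c_pos by (simp add: \<kappa>_def)
    have [measurable]: "(\<lambda>x. \<Psi> (f x)) \<in> borel_measurable lebesgue" by (rule measurable_comp) (use nn in auto)
    have "ennreal (B * V) = (\<integral>\<^sup>+x\<in>hcube a t. ennreal (u x * f x) \<partial>lebesgue)" using B by (simp add: V_def)
    also have "\<dots> \<le> (\<integral>\<^sup>+x. ennreal (B / 2) * (ennreal (u x) * indicator (hcube a t) x)
        + (ennreal \<kappa> * (ennreal (\<Psi> (f x)) * ennreal (w x) * indicator (hcube a t) x)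
        + ennreal (\<mu> powr (- p)) * (ennreal (u x powr p) * ennreal (s x) * indicator (hcube a t) x)) \<partial>lebesgue)"
    proof (rule nn_integral_mono_AE)
      show "AE x in lebesgue. ennreal (u x * f x) * indicator (hcube a t) x \<le> ennreal (B / 2) * (ennreal (u x) * indicator (hcube a t) x)
        + (ennreal \<kappa> * (ennreal (\<Psi> (f x)) * ennreal (w x) * indicator (hcube a t) x)
        + ennreal (\<mu> powr (- p)) * (ennreal (u x powr p) * ennreal (s x) * indicator (hcube a t) x))"
        using young[OF \<mu>] w_s
      proof eventually_elim
        case (elim x)
        have wx: "w x > 0" "s x \<ge> 0" using elim(2) by auto
        have "u x * f x \<le> B / 2 * u x + (\<kappa> * (\<Psi> (f x) * w x) + \<mu> powr (- p) * (u x powr p * s x))"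
        proof (cases "f x \<le> B / 2")
          case True
          then have "u x * f x \<le> B / 2 * u x" using mult_right_mono[OF True nn(1)[of x]] by (simp add: mult.commute)
          moreover have "\<kappa> * (\<Psi> (f x) * w x) \<ge> 0" "\<mu> powr (- p) * (u x powr p * s x) \<ge> 0"
            using \<kappa> wx nonneg nn by simp_all
          ultimately show ?thesis by linarith
        next
          case False
          then have "f x powr q * \<Psi> B \<le> c * (B powr q * \<Psi> (f x))" using 3 by (intro growth) auto
          then have fq: "f x powr q \<le> c * B powr q / \<Psi> B * \<Psi> (f x)" using \<Psi>B by (simp add: field_simps)
          have "f x * u x \<le> \<mu> powr q * (f x powr q * w x) + \<mu> powr (- p) * (u x powr p * s x)"
            using elim(1) nn unfolding p_def by blast
          also have "\<mu> powr q * (f x powr q * w x) \<le> \<mu> powr q * (c * B powr q / \<Psi> B * \<Psi> (f x) * w x)"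
            using fq wx by (intro mult_left_mono mult_right_mono) auto
          also have "\<dots> = \<kappa> * (\<Psi> (f x) * w x)" by (simp add: \<kappa>_def)
          finally have "u x * f x \<le> \<kappa> * (\<Psi> (f x) * w x) + \<mu> powr (- p) * (u x powr p * s x)" by (simp add: mult.commute)
          moreover have "B / 2 * u x \<ge> 0" using B nn by simp
          ultimately show ?thesis by linarith
        qed
        then have "ennreal (u x * f x) \<le> ennreal (B / 2 * u x + (\<kappa> * (\<Psi> (f x) * w x) + \<mu> powr (- p) * (u x powr p * s x)))"
          by (rule ennreal_leI)
        also have "\<dots> = ennreal (B / 2) * ennreal (u x) + (ennreal \<kappa> * (ennreal (\<Psi> (f x)) * ennreal (w x)) + ennreal (\<mu> powr (- p)) * (ennreal (u x powr p) * ennreal (s x)))"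
        proof -
          have 1: "0 \<le> B / 2 * u x" "0 \<le> \<kappa> * (\<Psi> (f x) * w x)" "0 \<le> \<mu> powr (- p) * (u x powr p * s x)"
            using B nn \<kappa> wx nonneg by simp_all
          have 2: "ennreal (B / 2 * u x) = ennreal (B / 2) * ennreal (u x)" using B(1) by (intro ennreal_mult') auto
          have 3: "ennreal (\<kappa> * (\<Psi> (f x) * w x)) = ennreal \<kappa> * (ennreal (\<Psi> (f x)) * ennreal (w x))"
            using \<kappa> nonneg[OF nn(2)] by (simp add: ennreal_mult')
          have 4: "ennreal (\<mu> powr (- p) * (u x powr p * s x)) = ennreal (\<mu> powr (- p)) * (ennreal (u x powr p) * ennreal (s x))"
            by (simp add: ennreal_mult')
          show ?thesis using 1 by (simp only: ennreal_plus add_nonneg_nonneg 2 3 4)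
        qed
        finally show ?case by (auto simp: indicator_def)
      qed
    qed
    also have "\<dots> = ennreal (B / 2) * (\<integral>\<^sup>+x\<in>hcube a t. ennreal (u x) \<partial>lebesgue) + (ennreal \<kappa> * ?X
        + ennreal (\<mu> powr (- p)) * (\<integral>\<^sup>+x\<in>hcube a t. ennreal (u x powr p) * ennreal (s x) \<partial>lebesgue))"
      by (subst nn_integral_add, measurable, subst nn_integral_add, measurable) (simp add: nn_integral_cmult)
    also have "\<dots> \<le> ennreal (B / 2) * ennreal V + (ennreal \<kappa> * ennreal X + ennreal (\<mu> powr (- p)) * ennreal (K * S a t))"
      using u1 up unfolding X(1) V_def p_def by (intro add_mono mult_left_mono) auto
    also have "\<dots> = ennreal (B / 2 * V + (\<kappa> * X + \<mu> powr (- p) * (K * S a t)))"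
    proof -
      have 1: "0 \<le> B / 2 * V" "0 \<le> \<kappa> * X" "0 \<le> \<mu> powr (- p) * (K * S a t)" using B V \<kappa> X K Sp by simp_all
      have 2: "ennreal (B / 2 * V) = ennreal (B / 2) * ennreal V" "ennreal (\<kappa> * X) = ennreal \<kappa> * ennreal X"
        "ennreal (\<mu> powr (- p) * (K * S a t)) = ennreal (\<mu> powr (- p)) * ennreal (K * S a t)"
        using B \<kappa> by (simp_all only: ennreal_mult' divide_nonneg_pos zero_less_numeral powr_ge_zero)
      show ?thesis using 1 by (simp only: ennreal_plus add_nonneg_nonneg 2)
    qed
    finally have "B * V \<le> B / 2 * V + (\<kappa> * X + \<mu> powr (- p) * (K * S a t))"
      using B V \<kappa> X K Sp by (subst (asm) ennreal_le_iff) auto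
    then have "B * V / 4 \<le> \<kappa> * X" unfolding \<mu>p by (simp add: field_simps)
    then have "\<Psi> B * (B * V / 4) \<le> \<Psi> B * (\<kappa> * X)" using \<Psi>B by (intro mult_left_mono) auto
    also have "\<dots> = \<mu> powr q * c * B powr q * X" using \<Psi>B by (simp add: \<kappa>_def)
    finally have "\<Psi> B * (B * V / 4) * (B * V) powr (q - 1) \<le> \<mu> powr q * c * B powr q * X * (B * V) powr (q - 1)"
      by (intro mult_right_mono) auto
    also have "\<dots> = (4 * K * S a t) powr (q - 1) * c * B powr q * X"
      unfolding \<mu>q using 3(1) V K Sp by (simp add: powr_divide)
    also have "\<Psi> B * (B * V / 4) * (B * V) powr (q - 1) = \<Psi> B * (B powr q * V powr q) / 4"
      using 3(1) V by (simp add: powr_mult powr_diff field_simps)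
    finally have "B powr q * (\<Psi> B * V powr q) \<le> B powr q * (4 * (4 * K * S a t) powr (q - 1) * c * X)"
      by (simp add: mult_ac)
    then have "\<Psi> B * V powr q \<le> 4 * (4 * K * S a t) powr (q - 1) * c * X" using 3(1) by simp
    then have "W a t * (\<Psi> B * V powr q) \<le> W a t * (4 * (4 * K * S a t) powr (q - 1) * c * X)"
      using W(2)[OF t, of a] by (intro mult_left_mono) auto
    also have "\<dots> = 4 * (4 * K) powr (q - 1) * c * X * (W a t * S a t powr (q - 1))"
      using K Sp by (simp add: powr_mult)
    also have "\<dots> \<le> 4 * (4 * K) powr (q - 1) * c * X * (A * V powr q)"
      using WS[OF t, of a] K c_pos X by (intro mult_left_mono) (auto simp: V_def)
    finally have "V powr q * (\<Psi> B * W a t) \<le> V powr q * (4 * (4 * K) powr (q - 1) * c * A * X)" by (simp add: mult_ac)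
    then have "\<Psi> B * W a t \<le> 4 * (4 * K) powr (q - 1) * c * A * X" using V by simp
    then have "ennreal (\<Psi> B * W a t) \<le> ennreal (4 * (4 * K) powr (q - 1) * c * A * X)" by (rule ennreal_leI)
    also have "\<dots> = ennreal (4 * (4 * K) powr (q - 1) * c * A) * ?X"
      unfolding X(1) using K c_pos A by (intro ennreal_mult') auto
    finally show ?thesis .
  qed (simp add: zero)
qed

lemma hcube_avg_modular:
  assumes t: "t > 0" and [measurable]: "f \<in> borel_measurable lebesgue" and nn: "\<And>x. f x \<ge> 0"
    and F: "F \<ge> 0" "(\<integral>\<^sup>+x\<in>hcube a t. ennreal (f x) \<partial>lebesgue) = ennreal (F * t ^ CARD('n))"
  shows "ennreal (\<Psi> F * W a t) \<le> ennreal (4 * 4 powr (q - 1) * c * A) * (\<integral>\<^sup>+x\<in>hcube a t. ennreal (\<Psi> (f x)) * ennreal (w x) \<partial>lebesgue)"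
  using cube_average_modular[OF t, of "\<lambda>_. 1" f a 1 F] F t nn S(1)[OF t, of a] q by (simp add: emeasure_hcube)

text \<open>A bound for the moment of order \<open>q / (q - 1)\<close> of an oscillation with respect to the dual weight, increased by \<open>1\<close> to be positive.\<close>

definition dual_moment :: real where
  "dual_moment = 1 + moment_const CARD('n) (\<lambda>x. x powr (q / (q - 1))) (Aq_weight.decay (q / (q - 1)) (A powr (1 / (q - 1))))"

lemma powr_le_poly: "t \<ge> 0 \<Longrightarrow> t powr p \<le> 1 * (1 + t) ^ nat \<lceil>p\<rceil>" if "p > 0" for t p :: real
proof -
  assume t: "t \<ge> 0"
  have "t powr p \<le> (1 + t) powr p" using t that by (intro powr_mono2) auto
  also have "\<dots> \<le> (1 + t) powr real (nat \<lceil>p\<rceil>)" using t that by (intro powr_mono) linarith+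
  finally show ?thesis using t by (simp add: powr_realpow)
qed

lemma dual_moment:
  assumes b: "unit_bmo b" and t: "t > 0"
  shows "dual_moment > 0"
    and "(\<integral>\<^sup>+x\<in>hcube a t. ennreal (cmod (b x - cube_avg b (ccube a t)) powr (q / (q - 1))) * ennreal (s x) \<partial>lebesgue)
     \<le> ennreal (dual_moment * S a t)"
proof -
  interpret d: Aq_weight s w "q / (q - 1)" "A powr (1 / (q - 1))" S W by (rule dual)
  interpret unit_bmo b by fact
  have p: "q / (q - 1) > 0" using q by simp
  have "0 \<le> moment_const CARD('n) (\<lambda>x. x powr (q / (q - 1))) d.decay"
    by (rule moment_const(1)[OF d.decay _ powr_le_poly[OF p]]) auto
  then show "dual_moment > 0" by (simp add: dual_moment_def)
  have "(\<integral>\<^sup>+x\<in>hcube a t. ennreal (cmod (b x - cube_avg b (ccube a t)) powr (q / (q - 1))) * ennreal (s x) \<partial>lebesgue)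
      \<le> ennreal (moment_const CARD('n) (\<lambda>x. x powr (q / (q - 1))) d.decay * S a t)"
    using p by (intro d.weighted_oscillation[OF b t _ _ powr_le_poly[OF p]]) (auto intro: powr_mono2)
  also have "\<dots> \<le> ennreal (dual_moment * S a t)"
    using S(2)[OF t, of a] by (intro ennreal_leI mult_right_mono) (auto simp: dual_moment_def)
  finally show "(\<integral>\<^sup>+x\<in>hcube a t. ennreal (cmod (b x - cube_avg b (ccube a t)) powr (q / (q - 1))) * ennreal (s x) \<partial>lebesgue)
     \<le> ennreal (dual_moment * S a t)" .
qed

definition osc_const :: real where
  "osc_const = \<Psi> 2 * (moment_const CARD('n) \<Psi> decay * (4 * 4 powr (q - 1) * c * A) + 4 * (4 * dual_moment) powr (q - 1) * c * A)"

text \<open>With \<open>u = |b - avg b|\<close>, sub-multiplicativity separates \<open>\<Psi> (u * F)\<close> into \<open>\<Psi> F\<close>, which the average bound controls, and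
  \<open>\<Psi> u\<close>, whose weighted integral is a moment of the oscillation. The term \<open>H\<close> is an average of \<open>u * f\<close> and is
  controlled through the moment of \<open>u\<close> with respect to the dual weight.\<close>

lemma hcube_osc_modular:
  assumes b: "unit_bmo b" and t: "t > 0" and [measurable]: "f \<in> borel_measurable lebesgue" and nn: "\<And>x. f x \<ge> 0"
    and F: "F \<ge> 0" "(\<integral>\<^sup>+x\<in>hcube a t. ennreal (f x) \<partial>lebesgue) = ennreal (F * t ^ CARD('n))"
    and H: "H \<ge> 0" "(\<integral>\<^sup>+x\<in>hcube a t. ennreal (cmod (b x - cube_avg b (ccube a t)) * f x) \<partial>lebesgue) = ennreal (H * t ^ CARD('n))"
  shows "(\<integral>\<^sup>+x\<in>hcube a t. ennreal (\<Psi> (cmod (b x - cube_avg b (ccube a t)) * F + H)) * ennreal (w x) \<partial>lebesgue)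
    \<le> ennreal osc_const * (\<integral>\<^sup>+x\<in>hcube a t. ennreal (\<Psi> (f x)) * ennreal (w x) \<partial>lebesgue)" (is "_ \<le> _ * ?X")
proof -
  interpret unit_bmo b by fact
  define u where "u x = cmod (b x - cube_avg b (ccube a t))" for x
  have [measurable]: "u \<in> borel_measurable lebesgue" unfolding u_def by measurable
  have u0: "u x \<ge> 0" for x by (simp add: u_def)
  have um [measurable]: "(\<lambda>x. \<Psi> (u x)) \<in> borel_measurable lebesgue" and [measurable]: "(\<lambda>x. \<Psi> (f x)) \<in> borel_measurable lebesgue"
    using u0 nn by (auto intro: measurable_comp)
  define M where "M = moment_const CARD('n) \<Psi> decay"
  have M0: "M \<ge> 0" unfolding M_def by (rule moment_const(1)[OF decay nonneg poly])
  have M: "(\<integral>\<^sup>+x\<in>hcube a t. ennreal (\<Psi> (u x)) * ennreal (w x) \<partial>lebesgue) \<le> ennreal (M * W a t)"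
    unfolding M_def u_def by (rule weighted_oscillation[OF b t mono zero poly]) (rule um[unfolded u_def] | assumption)+
  have Hb: "ennreal (\<Psi> H * W a t) \<le> ennreal (4 * (4 * dual_moment) powr (q - 1) * c * A) * ?X"
    using H nn u0 osc_nn[OF t, of a] dual_moment(1)[OF b t] dual_moment(2)[OF b t, of a] unfolding u_def[symmetric]
    by (intro cube_average_modular[OF t]) auto
  have Fb: "ennreal (\<Psi> F * W a t) \<le> ennreal (4 * 4 powr (q - 1) * c * A) * ?X"
    by (rule hcube_avg_modular[OF t]) (use F nn in auto)
  have "(\<integral>\<^sup>+x\<in>hcube a t. ennreal (\<Psi> (u x * F + H)) * ennreal (w x) \<partial>lebesgue)
    \<le> (\<integral>\<^sup>+x. ennreal (\<Psi> 2) * (ennreal (\<Psi> F) * (ennreal (\<Psi> (u x)) * ennreal (w x) * indicator (hcube a t) x)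
          + ennreal (\<Psi> H) * (ennreal (w x) * indicator (hcube a t) x)) \<partial>lebesgue)"
  proof (rule nn_integral_mono)
    fix x
    have "\<Psi> (u x * F + H) \<le> \<Psi> 2 * (\<Psi> (u x * F) + \<Psi> H)" using u0 F H by (intro add_le) auto
    also have "\<dots> \<le> \<Psi> 2 * (\<Psi> F * \<Psi> (u x) + \<Psi> H)"
      using submult[of "u x" F] u0 F nonneg[of 2] by (intro mult_left_mono add_right_mono) (auto simp: mult.commute)
    finally have "ennreal (\<Psi> (u x * F + H)) \<le> ennreal (\<Psi> 2 * (\<Psi> F * \<Psi> (u x) + \<Psi> H))" by (rule ennreal_leI)
    also have "\<dots> = ennreal (\<Psi> 2) * (ennreal (\<Psi> F) * ennreal (\<Psi> (u x)) + ennreal (\<Psi> H))"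
      using nonneg[OF u0, of x] nonneg[OF F(1)] nonneg[OF H(1)] nonneg[of 2] by (simp add: ennreal_mult')
    finally have "ennreal (\<Psi> (u x * F + H)) * ennreal (w x) \<le> ennreal (\<Psi> 2) * (ennreal (\<Psi> F) * ennreal (\<Psi> (u x)) + ennreal (\<Psi> H)) * ennreal (w x)"
      by (rule mult_right_mono) simp
    then show "ennreal (\<Psi> (u x * F + H)) * ennreal (w x) * indicator (hcube a t) x
      \<le> ennreal (\<Psi> 2) * (ennreal (\<Psi> F) * (ennreal (\<Psi> (u x)) * ennreal (w x) * indicator (hcube a t) x)
          + ennreal (\<Psi> H) * (ennreal (w x) * indicator (hcube a t) x))"
      by (auto simp: indicator_def distrib_left distrib_right mult_ac)
  qed
  also have "\<dots> = ennreal (\<Psi> 2) * (ennreal (\<Psi> F) * (\<integral>\<^sup>+x\<in>hcube a t. ennreal (\<Psi> (u x)) * ennreal (w x) \<partial>lebesgue)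
      + ennreal (\<Psi> H) * ennreal (W a t))"
    by (subst nn_integral_cmult, measurable, subst nn_integral_add, measurable) (simp add: nn_integral_cmult W(1)[OF t])
  also have "\<dots> \<le> ennreal (\<Psi> 2) * (ennreal (\<Psi> F) * ennreal (M * W a t) + ennreal (\<Psi> H) * ennreal (W a t))"
    using M by (intro mult_left_mono add_right_mono) auto
  also have "\<dots> = ennreal (\<Psi> 2) * (ennreal M * ennreal (\<Psi> F * W a t) + ennreal (\<Psi> H * W a t))"
    using nonneg[OF F(1)] nonneg[OF H(1)] M0 W(2)[OF t, of a] by (simp add: ennreal_mult' mult_ac)
  also have "\<dots> \<le> ennreal (\<Psi> 2) * (ennreal M * (ennreal (4 * 4 powr (q - 1) * c * A) * ?X) + ennreal (4 * (4 * dual_moment) powr (q - 1) * c * A) * ?X)"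
    using Fb Hb by (intro mult_left_mono add_mono) auto
  also have "\<dots> = (ennreal (\<Psi> 2) * (ennreal M * ennreal (4 * 4 powr (q - 1) * c * A) + ennreal (4 * (4 * dual_moment) powr (q - 1) * c * A))) * ?X"
    by (simp add: distrib_left distrib_right mult_ac)
  also have "ennreal (\<Psi> 2) * (ennreal M * ennreal (4 * 4 powr (q - 1) * c * A) + ennreal (4 * (4 * dual_moment) powr (q - 1) * c * A)) = ennreal osc_const"
  proof -
    have 1: "0 \<le> M * (4 * 4 powr (q - 1) * c * A)" "0 \<le> 4 * (4 * dual_moment) powr (q - 1) * c * A"
      using M0 c_pos A by simp_all
    have 2: "ennreal (M * (4 * 4 powr (q - 1) * c * A)) = ennreal M * ennreal (4 * 4 powr (q - 1) * c * A)"
      using M0 by (rule ennreal_mult')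
    have "ennreal (\<Psi> 2) * (ennreal M * ennreal (4 * 4 powr (q - 1) * c * A) + ennreal (4 * (4 * dual_moment) powr (q - 1) * c * A))
        = ennreal (\<Psi> 2) * ennreal (M * (4 * 4 powr (q - 1) * c * A) + 4 * (4 * dual_moment) powr (q - 1) * c * A)"
      using 1 by (simp only: ennreal_plus 2)
    also have "\<dots> = ennreal osc_const"
      unfolding osc_const_def M_def[symmetric] using nonneg[of 2] by (subst ennreal_mult'[symmetric]) auto
    finally show ?thesis .
  qed
  finally show ?thesis by (simp add: u_def)
qed

end

section \<open>Averages and oscillations at a fixed scale\<close>

definition grid_index :: "real \<Rightarrow> real^'n::finite \<Rightarrow> int^'n" where
  "grid_index t x = (\<chi> i. \<lfloor>x $ i / t\<rfloor>)"

text \<open>The corner is moved by \<open>- t\<close> in every coordinate, so that the cube of side \<open>3 * t\<close> at it contains the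
  \<open>t\<close>-neighbourhood of the grid cube with index \<open>k\<close>.\<close>

definition grid_corner :: "real \<Rightarrow> int^'n \<Rightarrow> real^'n::finite" where
  "grid_corner t k = (\<chi> i. t * (of_int (k $ i) - 1))"

lemma mem_grid_cube:
  assumes "t > 0"
  shows "y \<in> hcube (grid_corner t k) (3 * t) \<longleftrightarrow> (\<forall>i. \<lfloor>y $ i / t\<rfloor> \<in> {k $ i - 1..k $ i + 1})"
proof -
  have "(t * (of_int (k $ i) - 1) \<le> y $ i \<and> y $ i < t * (of_int (k $ i) - 1) + 3 * t) \<longleftrightarrow> \<lfloor>y $ i / t\<rfloor> \<in> {k $ i - 1..k $ i + 1}" for i
  proof -
    have "\<lfloor>y $ i / t\<rfloor> \<in> {k $ i - 1..k $ i + 1} \<longleftrightarrow> of_int (k $ i - 1) \<le> y $ i / t \<and> y $ i / t < of_int (k $ i + 1) + 1"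
      by (auto simp: le_floor_iff floor_le_iff)
    then show ?thesis using assms by (simp add: field_simps)
  qed
  then show ?thesis by (simp add: hcube_def grid_corner_def)
qed

lemma near_subset_grid_cube:
  assumes t: "t > 0" and y: "\<And>i. \<bar>x $ i - y $ i\<bar> \<le> t"
  shows "y \<in> hcube (grid_corner t (grid_index t x)) (3 * t)"
  unfolding mem_grid_cube[OF t]
proof
  fix i
  have "x $ i / t - 1 \<le> y $ i / t" "y $ i / t \<le> x $ i / t + 1" 
    using divide_right_mono[of "x $ i - t" "y $ i" t] divide_right_mono[of "y $ i" "x $ i + t" t] t y[of i]
    by (simp_all add: diff_divide_distrib add_divide_distrib abs_le_iff)
  then show "\<lfloor>y $ i / t\<rfloor> \<in> {grid_index t x $ i - 1..grid_index t x $ i + 1}"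
    unfolding grid_index_def by simp linarith
qed

lemma grid_overlap:
  assumes t: "t > 0"
  shows "(\<integral>\<^sup>+k. indicator (hcube (grid_corner t k) (3 * t)) (y::real^'n::finite) \<partial>count_space UNIV) \<le> 3 ^ CARD('n)"
proof -
  define T where "T = vec_lambda ` (PiE UNIV (\<lambda>i::'n. {\<lfloor>y $ i / t\<rfloor> - 1..\<lfloor>y $ i / t\<rfloor> + 1}))"
  have fin: "finite T" unfolding T_def by (intro finite_imageI finite_PiE) auto
  have "card T \<le> card (PiE UNIV (\<lambda>i::'n. {\<lfloor>y $ i / t\<rfloor> - 1..\<lfloor>y $ i / t\<rfloor> + 1}))"
    unfolding T_def by (intro card_image_le finite_PiE) auto
  also have "\<dots> = 3 ^ CARD('n)" by (simp add: card_PiE)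
  finally have card: "card T \<le> 3 ^ CARD('n)" .
  have sub: "k \<in> T" if "y \<in> hcube (grid_corner t k) (3 * t)" for k
  proof -
    have "(\<lambda>i. k $ i) \<in> PiE UNIV (\<lambda>i. {\<lfloor>y $ i / t\<rfloor> - 1..\<lfloor>y $ i / t\<rfloor> + 1})"
      using that unfolding mem_grid_cube[OF t] by (auto simp: PiE_iff) (smt (verit))+
    then have "vec_lambda (\<lambda>i. k $ i) \<in> T" unfolding T_def by (rule imageI)
    then show ?thesis by simp
  qed
  have "(\<integral>\<^sup>+k. indicator (hcube (grid_corner t k) (3 * t)) y \<partial>count_space UNIV) \<le> (\<integral>\<^sup>+k. indicator T k \<partial>count_space UNIV)"
    using sub by (intro nn_integral_mono) (auto simp: indicator_def)
  also have "\<dots> = ennreal (real (card T))" using fin by (simp add: ennreal_of_nat_eq_real_of_nat)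
  also have "\<dots> \<le> 3 ^ CARD('n)"
    using card by (metis ennreal_leI ennreal_numeral ennreal_power of_nat_le_iff of_nat_numeral of_nat_power zero_le_numeral)
  finally show ?thesis .
qed

text \<open>Bounds on the tripled grid cubes add up, as every point lies in at most \<open>3 ^ n\<close> of them.\<close>

lemma grid_sum_bound:
  fixes g :: "int^'n::finite \<Rightarrow> real^'n \<Rightarrow> ennreal"
  assumes t: "t > 0" and g: "\<And>k. g k \<in> borel_measurable lebesgue" and [measurable]: "h \<in> borel_measurable lebesgue"
    and le: "\<And>k. (\<integral>\<^sup>+x\<in>hcube (grid_corner t k) (3 * t). g k x \<partial>lebesgue) \<le> C * (\<integral>\<^sup>+x\<in>hcube (grid_corner t k) (3 * t). h x \<partial>lebesgue)"
  shows "(\<integral>\<^sup>+x. g (grid_index t x) x \<partial>lebesgue) \<le> C * 3 ^ CARD('n) * (\<integral>\<^sup>+x. h x \<partial>lebesgue)"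
proof -
  note g[measurable]
  let ?Q = "\<lambda>k. hcube (grid_corner t k) (3 * t)"
  have "(\<integral>\<^sup>+x. g (grid_index t x) x \<partial>lebesgue) \<le> (\<integral>\<^sup>+x. (\<integral>\<^sup>+k. g k x * indicator (?Q k) x \<partial>count_space UNIV) \<partial>lebesgue)"
  proof (rule nn_integral_mono)
    fix x :: "real^'n"
    have "x \<in> ?Q (grid_index t x)" using t by (intro near_subset_grid_cube) auto
    then have "g (grid_index t x) x = g (grid_index t x) x * indicator (?Q (grid_index t x)) x" by simp
    also have "\<dots> \<le> (\<integral>\<^sup>+k. g k x * indicator (?Q k) x \<partial>count_space UNIV)"
      by (rule nn_integral_ge_point) simp
    finally show "g (grid_index t x) x \<le> (\<integral>\<^sup>+k. g k x * indicator (?Q k) x \<partial>count_space UNIV)" .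
  qed
  also have "\<dots> = (\<integral>\<^sup>+k. (\<integral>\<^sup>+x\<in>?Q k. g k x \<partial>lebesgue) \<partial>count_space UNIV)"
    by (rule nn_integral_count_space_nn_integral) auto
  also have "\<dots> \<le> (\<integral>\<^sup>+k. C * (\<integral>\<^sup>+x\<in>?Q k. h x \<partial>lebesgue) \<partial>count_space UNIV)"
    using le by (intro nn_integral_mono) auto
  also have "\<dots> = C * (\<integral>\<^sup>+k. (\<integral>\<^sup>+x\<in>?Q k. h x \<partial>lebesgue) \<partial>count_space UNIV)"
    by (rule nn_integral_cmult) simp
  finally have 1: "(\<integral>\<^sup>+x. g (grid_index t x) x \<partial>lebesgue) \<le> C * (\<integral>\<^sup>+k. (\<integral>\<^sup>+x\<in>?Q k. h x \<partial>lebesgue) \<partial>count_space UNIV)" .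
  have "(\<integral>\<^sup>+k. (\<integral>\<^sup>+x\<in>?Q k. h x \<partial>lebesgue) \<partial>count_space UNIV) = (\<integral>\<^sup>+x. (\<integral>\<^sup>+k. h x * indicator (?Q k) x \<partial>count_space UNIV) \<partial>lebesgue)"
    by (rule nn_integral_count_space_nn_integral[symmetric]) auto
  also have "\<dots> = (\<integral>\<^sup>+x. h x * (\<integral>\<^sup>+k. indicator (?Q k) x \<partial>count_space UNIV) \<partial>lebesgue)"
    by (intro nn_integral_cong nn_integral_cmult) simp
  also have "\<dots> \<le> (\<integral>\<^sup>+x. h x * 3 ^ CARD('n) \<partial>lebesgue)"
    using grid_overlap[OF t] by (intro nn_integral_mono mult_left_mono) auto
  also have "\<dots> = (\<integral>\<^sup>+x. h x \<partial>lebesgue) * 3 ^ CARD('n)" by (rule nn_integral_multc) simp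
  finally have "C * (\<integral>\<^sup>+k. (\<integral>\<^sup>+x\<in>?Q k. h x \<partial>lebesgue) \<partial>count_space UNIV) \<le> C * ((\<integral>\<^sup>+x. h x \<partial>lebesgue) * 3 ^ CARD('n))"
    by (rule mult_left_mono) simp
  then show ?thesis using 1 by (simp add: mult_ac)
qed

definition loc_avg :: "real \<Rightarrow> (real^'n::finite \<Rightarrow> real) \<Rightarrow> real^'n \<Rightarrow> real" where
  "loc_avg t f x = enn2real (\<integral>\<^sup>+y\<in>hcube (grid_corner t (grid_index t x)) (3 * t). ennreal (f y) \<partial>lebesgue) / (3 * t) ^ CARD('n)"

text \<open>A majorant of the average of \<open>|b x - b y| * f y\<close> over the tripled grid cube around \<open>x\<close>, by comparison of both values of
  \<open>b\<close> with the mean \<open>m\<close>.\<close>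

definition loc_osc :: "real \<Rightarrow> (real^'n::finite \<Rightarrow> complex) \<Rightarrow> (real^'n \<Rightarrow> real) \<Rightarrow> real^'n \<Rightarrow> real" where
  "loc_osc t b f x = (let a = grid_corner t (grid_index t x); m = cube_avg b (ccube a (3 * t)) in
     cmod (b x - m) * loc_avg t f x
     + enn2real (\<integral>\<^sup>+y\<in>hcube a (3 * t). ennreal (cmod (b y - m) * f y) \<partial>lebesgue) / (3 * t) ^ CARD('n))"

lemma grid_index_measurable [measurable]: "(grid_index t :: real^'n::finite \<Rightarrow> int^'n) \<in> lebesgue \<rightarrow>\<^sub>M count_space UNIV"
proof -
  have "(grid_index t :: real^'n \<Rightarrow> int^'n) \<in> borel \<rightarrow>\<^sub>M count_space UNIV"
  proof (subst measurable_count_space_eq_countable, simp, intro conjI ballI)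
    fix k :: "int^'n"
    have "grid_index t -` {k} \<inter> space borel = {x \<in> space (borel :: (real^'n) measure). \<forall>i. \<lfloor>x $ i / t\<rfloor> = k $ i}"
      by (auto simp: grid_index_def vec_eq_iff)
    also have "\<dots> \<in> sets borel" by measurable
    finally show "grid_index t -` {k} \<inter> space borel \<in> sets borel" .
  qed auto
  then show ?thesis by (intro measurable_completion) simp
qed

lemma loc_avg_measurable [measurable]: "loc_avg t f \<in> borel_measurable lebesgue"
  unfolding loc_avg_def by (rule measurable_compose[OF grid_index_measurable]) simp

lemma loc_osc_measurable [measurable]:
  assumes [measurable]: "b \<in> borel_measurable lebesgue"
  shows "loc_osc t b f \<in> borel_measurable lebesgue"
proof -
  have "(\<lambda>x. (\<lambda>k x. cmod (b x - cube_avg b (ccube (grid_corner t k) (3 * t))) * loc_avg t f x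
     + enn2real (\<integral>\<^sup>+y\<in>hcube (grid_corner t k) (3 * t). ennreal (cmod (b y - cube_avg b (ccube (grid_corner t k) (3 * t))) * f y) \<partial>lebesgue) / (3 * t) ^ CARD('a)) (grid_index t x) x) \<in> borel_measurable lebesgue"
    by (rule measurable_compose_countable[OF _ grid_index_measurable]) measurable
  then show ?thesis by (simp add: loc_osc_def[abs_def] Let_def)
qed

lemma loc_avg_nonneg: "t > 0 \<Longrightarrow> loc_avg t f x \<ge> 0"
  by (simp add: loc_avg_def)

lemma loc_osc_nonneg: "t > 0 \<Longrightarrow> loc_osc t b f x \<ge> 0"
  by (simp add: loc_osc_def Let_def loc_avg_nonneg)

lemma nn_integral_restrict_le: "(\<integral>\<^sup>+x\<in>E. f x \<partial>M) \<le> (\<integral>\<^sup>+x. f x \<partial>M)"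
  by (intro nn_integral_mono) (auto simp: indicator_def)

lemma loc_avg_eq:
  fixes f :: "real^'n::finite \<Rightarrow> real"
  assumes t: "t > 0" and fin: "(\<integral>\<^sup>+x. ennreal (f x) \<partial>lebesgue) < \<infinity>"
  shows "(\<integral>\<^sup>+y\<in>hcube (grid_corner t (grid_index t x)) (3 * t). ennreal (f y) \<partial>lebesgue) = ennreal (loc_avg t f x * (3 * t) ^ CARD('n))"
proof -
  have "(\<integral>\<^sup>+y\<in>hcube (grid_corner t (grid_index t x)) (3 * t). ennreal (f y) \<partial>lebesgue) < \<infinity>"
    using nn_integral_restrict_le fin by (rule order_le_less_trans)
  then show ?thesis using t by (simp add: loc_avg_def less_top)
qed

lemma product_integrable_finite:
  fixes f :: "real^'n::finite \<Rightarrow> real" and b :: "real^'n \<Rightarrow> complex"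
  assumes [measurable]: "b \<in> borel_measurable lebesgue" "f \<in> borel_measurable lebesgue" and nn: "\<And>x. f x \<ge> 0"
    and fin: "(\<integral>\<^sup>+x. ennreal (f x) \<partial>lebesgue) < \<infinity>" "(\<integral>\<^sup>+x. ennreal (cmod (b x) * f x) \<partial>lebesgue) < \<infinity>"
  shows "(\<integral>\<^sup>+x. ennreal (cmod (b x - m) * f x) \<partial>lebesgue) < \<infinity>"
proof -
  have "(\<integral>\<^sup>+x. ennreal (cmod (b x - m) * f x) \<partial>lebesgue) \<le> (\<integral>\<^sup>+x. ennreal (cmod (b x) * f x) + ennreal (cmod m) * ennreal (f x) \<partial>lebesgue)"
  proof (rule nn_integral_mono)
    fix x
    have "cmod (b x - m) * f x \<le> cmod (b x) * f x + cmod m * f x"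
      using nn[of x] norm_triangle_ineq4[of "b x" m] by (simp add: mult_right_mono flip: distrib_right)
    then have "ennreal (cmod (b x - m) * f x) \<le> ennreal (cmod (b x) * f x + cmod m * f x)" by (rule ennreal_leI)
    also have "\<dots> = ennreal (cmod (b x) * f x) + ennreal (cmod m) * ennreal (f x)"
      using nn[of x] by (simp add: ennreal_mult')
    finally show "ennreal (cmod (b x - m) * f x) \<le> ennreal (cmod (b x) * f x) + ennreal (cmod m) * ennreal (f x)" .
  qed
  also have "\<dots> = (\<integral>\<^sup>+x. ennreal (cmod (b x) * f x) \<partial>lebesgue) + ennreal (cmod m) * (\<integral>\<^sup>+x. ennreal (f x) \<partial>lebesgue)"
    by (subst nn_integral_add) (simp_all add: nn_integral_cmult)
  also have "\<dots> < \<infinity>" using fin by (simp add: ennreal_mult_less_top)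
  finally show ?thesis .
qed

text \<open>The integrals over the ball of radius \<open>t\<close> for the maximum norm around \<open>x\<close> are dominated by data of the tripled grid
  cube of side \<open>t\<close> around \<open>x\<close>.\<close>

lemma near_integral_le_loc_avg:
  fixes f :: "real^'n::finite \<Rightarrow> real"
  assumes t: "t > 0" and fin: "(\<integral>\<^sup>+x. ennreal (f x) \<partial>lebesgue) < \<infinity>"
  shows "(\<integral>\<^sup>+y\<in>{y. \<forall>i. \<bar>x $ i - y $ i\<bar> \<le> t}. ennreal (f y) \<partial>lebesgue) \<le> ennreal ((3 * t) ^ CARD('n) * loc_avg t f x)"
proof -
  have "(\<integral>\<^sup>+y\<in>{y. \<forall>i. \<bar>x $ i - y $ i\<bar> \<le> t}. ennreal (f y) \<partial>lebesgue)
     \<le> (\<integral>\<^sup>+y\<in>hcube (grid_corner t (grid_index t x)) (3 * t). ennreal (f y) \<partial>lebesgue)"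
    using near_subset_grid_cube[OF t] by (intro nn_integral_mono mult_left_mono) (auto simp: indicator_def)
  then show ?thesis unfolding loc_avg_eq[OF assms] by (simp add: mult.commute)
qed

lemma near_integral_le_loc_osc:
  fixes f :: "real^'n::finite \<Rightarrow> real" and b :: "real^'n \<Rightarrow> complex"
  assumes t: "t > 0" and [measurable]: "b \<in> borel_measurable lebesgue" "f \<in> borel_measurable lebesgue" and nn: "\<And>x. f x \<ge> 0"
    and fin: "(\<integral>\<^sup>+x. ennreal (f x) \<partial>lebesgue) < \<infinity>" "(\<integral>\<^sup>+x. ennreal (cmod (b x) * f x) \<partial>lebesgue) < \<infinity>"
  shows "(\<integral>\<^sup>+y\<in>{y. \<forall>i. \<bar>x $ i - y $ i\<bar> \<le> t}. ennreal (cmod (b x - b y) * f y) \<partial>lebesgue) \<le> ennreal ((3 * t) ^ CARD('n) * loc_osc t b f x)"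
proof -
  define a where "a = grid_corner t (grid_index t x)"
  define m where "m = cube_avg b (ccube a (3 * t))"
  let ?Q = "hcube a (3 * t)"
  have H: "(\<integral>\<^sup>+y\<in>?Q. ennreal (cmod (b y - m) * f y) \<partial>lebesgue) < \<infinity>"
    using nn_integral_restrict_le product_integrable_finite[OF assms(2-)] by (rule order_le_less_trans)
  have "(\<integral>\<^sup>+y\<in>{y. \<forall>i. \<bar>x $ i - y $ i\<bar> \<le> t}. ennreal (cmod (b x - b y) * f y) \<partial>lebesgue)
     \<le> (\<integral>\<^sup>+y. ennreal (cmod (b x - m)) * (ennreal (f y) * indicator ?Q y) + ennreal (cmod (b y - m) * f y) * indicator ?Q y \<partial>lebesgue)"
  proof (rule nn_integral_mono)
    fix y
    show "ennreal (cmod (b x - b y) * f y) * indicator {y. \<forall>i. \<bar>x $ i - y $ i\<bar> \<le> t} y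
      \<le> ennreal (cmod (b x - m)) * (ennreal (f y) * indicator ?Q y) + ennreal (cmod (b y - m) * f y) * indicator ?Q y"
    proof (cases "\<forall>i. \<bar>x $ i - y $ i\<bar> \<le> t")
      case True
      then have y: "y \<in> ?Q" unfolding a_def by (intro near_subset_grid_cube[OF t]) auto
      have "cmod (b x - b y) * f y \<le> cmod (b x - m) * f y + cmod (b y - m) * f y"
        using nn[of y] norm_triangle_ineq4[of "b x - m" "b y - m"] by (simp add: mult_right_mono flip: distrib_right)
      then have "ennreal (cmod (b x - b y) * f y) \<le> ennreal (cmod (b x - m) * f y + cmod (b y - m) * f y)" by (rule ennreal_leI)
      also have "\<dots> = ennreal (cmod (b x - m)) * ennreal (f y) + ennreal (cmod (b y - m) * f y)"
        using nn[of y] by (simp add: ennreal_mult')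
      finally show ?thesis using y True by simp
    qed simp
  qed
  also have "\<dots> = ennreal (cmod (b x - m)) * (\<integral>\<^sup>+y\<in>?Q. ennreal (f y) \<partial>lebesgue) + (\<integral>\<^sup>+y\<in>?Q. ennreal (cmod (b y - m) * f y) \<partial>lebesgue)"
    by (subst nn_integral_add) (simp_all add: nn_integral_cmult)
  also have "\<dots> = ennreal (cmod (b x - m) * (loc_avg t f x * (3 * t) ^ CARD('n)) + enn2real (\<integral>\<^sup>+y\<in>?Q. ennreal (cmod (b y - m) * f y) \<partial>lebesgue))"
    using loc_avg_eq[OF t fin(1), of x] H t loc_avg_nonneg[OF t, of f x] unfolding a_def[symmetric]
    by (simp add: ennreal_mult' less_top)
  also have "cmod (b x - m) * (loc_avg t f x * (3 * t) ^ CARD('n)) + enn2real (\<integral>\<^sup>+y\<in>?Q. ennreal (cmod (b y - m) * f y) \<partial>lebesgue)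
     = (3 * t) ^ CARD('n) * loc_osc t b f x"
    using t by (simp add: loc_osc_def Let_def a_def[symmetric] m_def[symmetric] distrib_left)
  finally show ?thesis .
qed

context Aq_growth
begin

lemma loc_avg_modular:
  assumes t: "t > 0" and [measurable]: "f \<in> borel_measurable lebesgue" and nn: "\<And>x. f x \<ge> 0"
    and fin: "(\<integral>\<^sup>+x. ennreal (f x) \<partial>lebesgue) < \<infinity>"
  shows "(\<integral>\<^sup>+x. ennreal (\<Psi> (loc_avg t f x)) * ennreal (w x) \<partial>lebesgue)
    \<le> ennreal (4 * 4 powr (q - 1) * c * A) * 3 ^ CARD('n) * (\<integral>\<^sup>+x. ennreal (\<Psi> (f x)) * ennreal (w x) \<partial>lebesgue)"
proof -
  have [measurable]: "(\<lambda>x. \<Psi> (f x)) \<in> borel_measurable lebesgue" by (rule measurable_comp) (use nn in auto)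
  define F where "F k = enn2real (\<integral>\<^sup>+y\<in>hcube (grid_corner t k) (3 * t). ennreal (f y) \<partial>lebesgue) / (3 * t) ^ CARD('n)" for k
  have "(\<integral>\<^sup>+x. ennreal (\<Psi> (F (grid_index t x))) * ennreal (w x) \<partial>lebesgue)
    \<le> ennreal (4 * 4 powr (q - 1) * c * A) * 3 ^ CARD('n) * (\<integral>\<^sup>+x. ennreal (\<Psi> (f x)) * ennreal (w x) \<partial>lebesgue)"
  proof (rule grid_sum_bound[OF t, where g = "\<lambda>k x. ennreal (\<Psi> (F k)) * ennreal (w x)"])
    fix k :: "int^'n"
    let ?Q = "hcube (grid_corner t k) (3 * t)"
    have t3: "3 * t > 0" using t by simp
    have "(\<integral>\<^sup>+y\<in>?Q. ennreal (f y) \<partial>lebesgue) < \<infinity>"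
      using nn_integral_restrict_le fin by (rule order_le_less_trans)
    then have F: "(\<integral>\<^sup>+y\<in>?Q. ennreal (f y) \<partial>lebesgue) = ennreal (F k * (3 * t) ^ CARD('n))" "F k \<ge> 0"
      using t by (simp_all add: F_def less_top)
    have "(\<integral>\<^sup>+x\<in>?Q. ennreal (\<Psi> (F k)) * ennreal (w x) \<partial>lebesgue) = ennreal (\<Psi> (F k)) * ennreal (W (grid_corner t k) (3 * t))"
      unfolding W(1)[OF t3, symmetric] by (subst nn_integral_cmult[symmetric]) (simp_all add: mult.assoc)
    also have "\<dots> = ennreal (\<Psi> (F k) * W (grid_corner t k) (3 * t))" using nonneg[OF F(2)] by (simp add: ennreal_mult')
    also have "\<dots> \<le> ennreal (4 * 4 powr (q - 1) * c * A) * (\<integral>\<^sup>+x\<in>?Q. ennreal (\<Psi> (f x)) * ennreal (w x) \<partial>lebesgue)"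
      by (rule hcube_avg_modular[OF t3]) (use F nn in auto)
    finally show "(\<integral>\<^sup>+x\<in>?Q. ennreal (\<Psi> (F k)) * ennreal (w x) \<partial>lebesgue)
      \<le> ennreal (4 * 4 powr (q - 1) * c * A) * (\<integral>\<^sup>+x\<in>?Q. ennreal (\<Psi> (f x)) * ennreal (w x) \<partial>lebesgue)" .
  qed measurable
  then show ?thesis by (simp add: loc_avg_def F_def)
qed

lemma loc_osc_modular:
  assumes b: "unit_bmo b" and t: "t > 0" and [measurable]: "f \<in> borel_measurable lebesgue" and nn: "\<And>x. f x \<ge> 0"
    and fin: "(\<integral>\<^sup>+x. ennreal (f x) \<partial>lebesgue) < \<infinity>" "(\<integral>\<^sup>+x. ennreal (cmod (b x) * f x) \<partial>lebesgue) < \<infinity>"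
  shows "(\<integral>\<^sup>+x. ennreal (\<Psi> (loc_osc t b f x)) * ennreal (w x) \<partial>lebesgue)
    \<le> ennreal osc_const * 3 ^ CARD('n) * (\<integral>\<^sup>+x. ennreal (\<Psi> (f x)) * ennreal (w x) \<partial>lebesgue)"
proof -
  interpret unit_bmo b by fact
  have [measurable]: "(\<lambda>x. \<Psi> (f x)) \<in> borel_measurable lebesgue" by (rule measurable_comp) (use nn in auto)
  let ?Q = "\<lambda>k. hcube (grid_corner t k) (3 * t)"
  define m where "m k = cube_avg b (ccube (grid_corner t k) (3 * t))" for k
  define F where "F k = enn2real (\<integral>\<^sup>+y\<in>?Q k. ennreal (f y) \<partial>lebesgue) / (3 * t) ^ CARD('n)" for k
  define H where "H k = enn2real (\<integral>\<^sup>+y\<in>?Q k. ennreal (cmod (b y - m k) * f y) \<partial>lebesgue) / (3 * t) ^ CARD('n)" for k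
  have t3: "3 * t > 0" using t by simp
  have F: "(\<integral>\<^sup>+y\<in>?Q k. ennreal (f y) \<partial>lebesgue) = ennreal (F k * (3 * t) ^ CARD('n))" "F k \<ge> 0" for k
  proof -
    have "(\<integral>\<^sup>+y\<in>?Q k. ennreal (f y) \<partial>lebesgue) < \<infinity>" using nn_integral_restrict_le fin(1) by (rule order_le_less_trans)
    then show "(\<integral>\<^sup>+y\<in>?Q k. ennreal (f y) \<partial>lebesgue) = ennreal (F k * (3 * t) ^ CARD('n))" "F k \<ge> 0"
      using t by (simp_all add: F_def less_top)
  qed
  have H: "(\<integral>\<^sup>+y\<in>?Q k. ennreal (cmod (b y - m k) * f y) \<partial>lebesgue) = ennreal (H k * (3 * t) ^ CARD('n))" "H k \<ge> 0" for k
  proof -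
    have "(\<integral>\<^sup>+y\<in>?Q k. ennreal (cmod (b y - m k) * f y) \<partial>lebesgue) < \<infinity>"
      using nn_integral_restrict_le product_integrable_finite[OF meas assms(3) nn fin] by (rule order_le_less_trans)
    then show "(\<integral>\<^sup>+y\<in>?Q k. ennreal (cmod (b y - m k) * f y) \<partial>lebesgue) = ennreal (H k * (3 * t) ^ CARD('n))" "H k \<ge> 0"
      using t by (simp_all add: H_def less_top)
  qed
  have "(\<integral>\<^sup>+x. ennreal (\<Psi> (cmod (b x - m (grid_index t x)) * F (grid_index t x) + H (grid_index t x))) * ennreal (w x) \<partial>lebesgue)
    \<le> ennreal osc_const * 3 ^ CARD('n) * (\<integral>\<^sup>+x. ennreal (\<Psi> (f x)) * ennreal (w x) \<partial>lebesgue)"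
  proof (rule grid_sum_bound[OF t, where g = "\<lambda>k x. ennreal (\<Psi> (cmod (b x - m k) * F k + H k)) * ennreal (w x)"])
    fix k
    have [measurable]: "(\<lambda>x. \<Psi> (cmod (b x - m k) * F k + H k)) \<in> borel_measurable lebesgue"
      by (rule measurable_comp) (use F H in auto)
    show "(\<lambda>x. ennreal (\<Psi> (cmod (b x - m k) * F k + H k)) * ennreal (w x)) \<in> borel_measurable lebesgue" by measurable
    show "(\<integral>\<^sup>+x\<in>?Q k. ennreal (\<Psi> (cmod (b x - m k) * F k + H k)) * ennreal (w x) \<partial>lebesgue)
      \<le> ennreal osc_const * (\<integral>\<^sup>+x\<in>?Q k. ennreal (\<Psi> (f x)) * ennreal (w x) \<partial>lebesgue)"
      unfolding m_def by (rule hcube_osc_modular[OF b t3]) (use F H nn in \<open>auto simp: m_def\<close>)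
  qed measurable
  then show ?thesis by (simp add: loc_osc_def loc_avg_def F_def H_def m_def Let_def)
qed

end

section \<open>Hoelder's inequality for a product and convex series\<close>

lemma power_powr_inverse:
  assumes "(y::real) \<ge> 0" "n > 0"
  shows "(y ^ n) powr (1 / real n) = y"
proof (cases "y = 0")
  case False
  then show ?thesis using assms by (simp add: powr_powr flip: powr_realpow)
qed (use assms in simp)

text \<open>After division of each factor by its norm this is the inequality between arithmetic and geometric mean,
  integrated.\<close>

lemma nn_integral_prod_Hoelder:
  fixes F :: "'i::finite \<Rightarrow> 'a \<Rightarrow> real"
  assumes F [measurable]: "\<And>i. F i \<in> borel_measurable M" and nn: "\<And>i x. F i x \<ge> 0" and [measurable]: "v \<in> borel_measurable M"
  shows "(\<integral>\<^sup>+x. ennreal (\<Prod>i\<in>UNIV. F i x) * v x \<partial>M)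
     \<le> ennpowr (\<Prod>i\<in>UNIV. \<integral>\<^sup>+x. ennreal (F i x ^ CARD('i)) * v x \<partial>M) (1 / real CARD('i))"
proof -
  define n where "n = CARD('i)"
  have n: "n > 0" by (simp add: n_def)
  define J where "J i = (\<integral>\<^sup>+x. ennreal (F i x ^ n) * v x \<partial>M)" for i
  consider i where "J i = 0" | i where "J i = \<infinity>" "\<And>i. J i \<noteq> 0" | "\<And>i. J i \<noteq> 0" "\<And>i. J i \<noteq> \<infinity>" by blast
  then have "(\<integral>\<^sup>+x. ennreal (\<Prod>i\<in>UNIV. F i x) * v x \<partial>M) \<le> ennpowr (\<Prod>i\<in>UNIV. J i) (1 / real n)"
  proof cases
    case 1
    have "AE x in M. ennreal (F i x ^ n) * v x = 0"
      using 1 unfolding J_def by (subst (asm) nn_integral_0_iff_AE) auto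
    then have "AE x in M. ennreal (\<Prod>i\<in>UNIV. F i x) * v x = 0"
    proof eventually_elim
      case (elim x)
      then have "F i x = 0 \<or> v x = 0" using nn[of i x] by (auto simp: ennreal_eq_0_iff zero_less_power) (metis less_eq_real_def zero_less_power not_le)
      then have "ennreal (\<Prod>i\<in>UNIV. F i x) = 0 \<or> v x = 0"
        by (metis UNIV_I ennreal_0 finite_code prod_zero)
      then show ?case by (elim disjE) (simp_all only: mult_zero_left mult_zero_right)
    qed
    then have "(\<integral>\<^sup>+x. ennreal (\<Prod>i\<in>UNIV. F i x) * v x \<partial>M) = 0" by (subst nn_integral_0_iff_AE) auto
    then show ?thesis by simp
  next
    case 2
    have "(\<Prod>i\<in>UNIV. J i) = \<infinity>" using 2 by (auto simp: ennreal_prod_eq_top)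
    then show ?thesis using n by (simp add: ennpowr_def)
  next
    case 3
    define j where "j i = enn2real (J i)" for i
    have j: "J i = ennreal (j i)" "j i > 0" for i
      using 3(1)[of i] 3(2)[of i] by (auto simp: j_def enn2real_positive_iff less_top zero_less_iff_neq_zero)
    define a where "a i = j i powr (1 / real n)" for i
    have a: "a i > 0" "a i ^ n = j i" for i
      using j(2)[of i] n by (auto simp: a_def powr_powr simp flip: powr_realpow)
    have am: "(\<Prod>i\<in>UNIV. F i x) \<le> (\<Prod>i\<in>UNIV. a i) * (\<Sum>i\<in>UNIV. F i x ^ n / (j i * real n))" for x
    proof -
      have "(\<Prod>i\<in>UNIV. (F i x / a i) ^ n) powr (1 / real n) \<le> (\<Sum>i\<in>UNIV. (F i x / a i) ^ n / real n)"
        using nn a(1) unfolding n_def by (intro arith_geom_mean) (auto simp: less_imp_le)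
      moreover have "(\<Prod>i\<in>UNIV. (F i x / a i) ^ n) powr (1 / real n) = (\<Prod>i\<in>UNIV. F i x / a i)"
      proof -
        have "(\<Prod>i\<in>UNIV. F i x / a i) \<ge> 0" using nn a(1) by (intro prod_nonneg) (auto simp: less_imp_le)
        then show ?thesis unfolding prod_power_distrib[symmetric] using n by (rule power_powr_inverse)
      qed
      ultimately have "(\<Prod>i\<in>UNIV. F i x / a i) \<le> (\<Sum>i\<in>UNIV. F i x ^ n / (j i * real n))"
        using a(2) by (simp add: power_divide)
      then have "(\<Prod>i\<in>UNIV. a i) * (\<Prod>i\<in>UNIV. F i x / a i) \<le> (\<Prod>i\<in>UNIV. a i) * (\<Sum>i\<in>UNIV. F i x ^ n / (j i * real n))"
        using a(1) by (intro mult_left_mono prod_nonneg) (auto simp: less_imp_le)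
      moreover have "(\<Prod>i\<in>UNIV. a i) * (\<Prod>i\<in>UNIV. F i x / a i) = (\<Prod>i\<in>UNIV. F i x)"
        using a(1) by (simp add: prod.distrib[symmetric]) (intro prod.cong refl, metis less_irrefl nonzero_mult_div_cancel_left times_divide_eq_right)
      ultimately show ?thesis by simp
    qed
    have pa: "(\<Prod>i\<in>UNIV. a i) > 0" using a(1) by (intro prod_pos) auto
    have "(\<integral>\<^sup>+x. ennreal (\<Prod>i\<in>UNIV. F i x) * v x \<partial>M)
       \<le> (\<integral>\<^sup>+x. ennreal (\<Prod>i\<in>UNIV. a i) * (\<Sum>i\<in>UNIV. ennreal (1 / (j i * real n)) * (ennreal (F i x ^ n) * v x)) \<partial>M)"
    proof (rule nn_integral_mono)
      fix x
      have "ennreal (\<Prod>i\<in>UNIV. F i x) \<le> ennreal ((\<Prod>i\<in>UNIV. a i) * (\<Sum>i\<in>UNIV. F i x ^ n / (j i * real n)))"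
        using am by (rule ennreal_leI)
      also have "\<dots> = ennreal (\<Prod>i\<in>UNIV. a i) * (\<Sum>i\<in>UNIV. ennreal (1 / (j i * real n)) * ennreal (F i x ^ n))"
        using pa nn j(2) n by (simp add: ennreal_mult' ennreal_mult[symmetric] less_imp_le sum_ennreal)
      finally have "ennreal (\<Prod>i\<in>UNIV. F i x) * v x \<le> ennreal (\<Prod>i\<in>UNIV. a i) * (\<Sum>i\<in>UNIV. ennreal (1 / (j i * real n)) * ennreal (F i x ^ n)) * v x"
        by (rule mult_right_mono) simp
      then show "ennreal (\<Prod>i\<in>UNIV. F i x) * v x \<le> ennreal (\<Prod>i\<in>UNIV. a i) * (\<Sum>i\<in>UNIV. ennreal (1 / (j i * real n)) * (ennreal (F i x ^ n) * v x))"
        by (simp add: mult.assoc sum_distrib_right)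
    qed
    also have "\<dots> = ennreal (\<Prod>i\<in>UNIV. a i) * (\<Sum>i\<in>UNIV. ennreal (1 / (j i * real n)) * J i)"
      by (simp add: nn_integral_cmult nn_integral_sum J_def)
    also have "(\<Sum>i\<in>UNIV. ennreal (1 / (j i * real n)) * J i) = (\<Sum>i\<in>(UNIV::'i set). ennreal (1 / real n))"
    proof (intro sum.cong refl)
      fix i
      show "ennreal (1 / (j i * real n)) * J i = ennreal (1 / real n)"
        using j(2)[of i] n unfolding j(1) by (simp flip: ennreal_mult')
    qed
    also have "\<dots> = 1" by (subst sum_ennreal) (use n in \<open>simp_all add: n_def\<close>)
    also have "ennreal (\<Prod>i\<in>UNIV. a i) * 1 = ennpowr (\<Prod>i\<in>UNIV. J i) (1 / real n)"
    proof -
      define P where "P = (\<Prod>i\<in>UNIV. j i)"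
      have "(\<Prod>i\<in>UNIV. J i) = ennreal P" using j by (simp add: P_def prod_ennreal less_imp_le)
      moreover have "P > 0" unfolding P_def using j by (intro prod_pos) auto
      moreover have "P powr (1 / real n) = (\<Prod>i\<in>UNIV. a i)"
        unfolding a_def P_def by (rule prod_powr_distrib)
      ultimately show ?thesis using n by (auto simp: ennpowr_def)
    qed
    finally show ?thesis .
  qed
  then show ?thesis by (simp add: J_def n_def)
qed

text \<open>Some partial sum already exceeds \<open>v / 2\<close>, and to it Jensen's inequality applies, with the missing weight placed at
  \<open>0\<close>; the halving of \<open>v\<close> costs the factor \<open>\<phi> 2\<close>.\<close>

lemma convex_series_bound:
  assumes N: "N_function \<phi>" and sub: "submultiplicative \<phi>" and v: "v \<ge> 0"
    and a: "\<And>k::nat. a k \<ge> 0" and l: "\<And>k. l k \<ge> 0" "\<And>n. (\<Sum>k<n. l k) \<le> 1"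
    and le: "ennreal v \<le> (\<Sum>k. ennreal (l k * a k))"
  shows "ennreal (\<phi> v) \<le> ennreal (\<phi> 2) * (\<Sum>k. ennreal (l k) * ennreal (\<phi> (a k)))"
proof (cases "v = 0")
  case True
  then show ?thesis using N_function_zero[OF N] by simp
next
  case False
  then have v: "v > 0" using v by simp
  have "ennreal (v / 2) < ennreal v" using v by (intro ennreal_lessI) auto
  also have "\<dots> \<le> (SUP n. \<Sum>k<n. ennreal (l k * a k))" using le by (simp add: suminf_eq_SUP)
  finally obtain n where n: "ennreal (v / 2) < (\<Sum>k<n. ennreal (l k * a k))" by (auto simp: less_SUP_iff)
  also have "\<dots> = ennreal (\<Sum>k<n. l k * a k)" using l a by (intro sum_ennreal) auto
  finally have h: "v / 2 \<le> (\<Sum>k<n. l k * a k)" using v by (simp add: ennreal_less_iff)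
  define l' where "l' k = (if k < n then l k else 1 - (\<Sum>k<n. l k))" for k
  define a' where "a' k = (if k < n then a k else 0)" for k
  have conv: "convex_on {0..} \<phi>" using N by (auto simp: N_function_def young_function_def)
  have "\<phi> (\<Sum>k\<in>{..n}. l' k *\<^sub>R a' k) \<le> (\<Sum>k\<in>{..n}. l' k * \<phi> (a' k))"
    using l a by (intro convex_on_sum[OF _ _ conv]) (auto simp: l'_def a'_def lessThan_Suc_atMost[symmetric])
  then have J: "\<phi> (\<Sum>k<n. l k * a k) \<le> (\<Sum>k<n. l k * \<phi> (a k))"
    using N_function_zero[OF N] by (simp add: l'_def a'_def lessThan_Suc_atMost[symmetric])
  have "\<phi> v \<le> \<phi> 2 * \<phi> (v / 2)" using sub v unfolding submultiplicative_def by (metis divide_nonneg_pos less_imp_le nonzero_mult_div_cancel_left times_divide_eq_right zero_less_numeral zero_neq_numeral)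
  also have "\<dots> \<le> \<phi> 2 * \<phi> (\<Sum>k<n. l k * a k)"
    using h v N_function_nonneg[OF N, of 2] by (intro mult_left_mono N_function_mono[OF N]) auto
  also have "\<dots> \<le> \<phi> 2 * (\<Sum>k<n. l k * \<phi> (a k))"
    using J N_function_nonneg[OF N, of 2] by (intro mult_left_mono) auto
  finally have "ennreal (\<phi> v) \<le> ennreal (\<phi> 2 * (\<Sum>k<n. l k * \<phi> (a k)))" by (rule ennreal_leI)
  also have "\<dots> = ennreal (\<phi> 2) * (\<Sum>k<n. ennreal (l k) * ennreal (\<phi> (a k)))"
    using l a N_function_nonneg[OF N] by (simp add: ennreal_mult' sum_nonneg sum_ennreal[symmetric])
  also have "\<dots> \<le> ennreal (\<phi> 2) * (\<Sum>k. ennreal (l k) * ennreal (\<phi> (a k)))"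
    by (intro mult_left_mono sum_le_suminf) auto
  finally show ?thesis .
qed

section \<open>Integrability of powers at infinity\<close>

text \<open>On the shell \<open>2 ^ k \<le> 1 + norm x < 2 ^ (k + 1)\<close> the integrand is at most \<open>(2 ^ k) powr p\<close>, and the volumes grow like
  \<open>2 ^ (k d)\<close>.\<close>

lemma nn_integral_japanese_bracket_finite:
  fixes p :: real
  assumes p: "p < - real DIM('a::euclidean_space)"
  shows "(\<integral>\<^sup>+x. ennreal ((1 + norm x) powr p) \<partial>(lborel :: 'a measure)) < \<infinity>"
proof -
  let ?d = "DIM('a)"
  define v where "v = unit_ball_vol (real ?d)"
  have v: "v \<ge> 0" by (simp add: v_def)
  define g where "g = 2 powr (p + real ?d)"
  have g: "0 < g" "g < 1" using p by (auto simp: g_def powr_less_one)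
  have p0: "p \<le> 0" using p of_nat_0_le_iff[of "DIM('a)", where 'a = real] by linarith
  have "(\<integral>\<^sup>+x. ennreal ((1 + norm x) powr p) \<partial>(lborel :: 'a measure))
    \<le> (\<integral>\<^sup>+x. (\<Sum>k. ennreal ((2 ^ k) powr p) * indicator (cball (0::'a) (2 ^ Suc k)) x) \<partial>lborel)"
  proof (rule nn_integral_mono)
    fix x :: 'a
    define k where "k = nat \<lfloor>log 2 (1 + norm x)\<rfloor>"
    have l: "log 2 (1 + norm x) \<ge> 0"
      using zero_le_log_cancel_iff[of 2 "1 + norm x"] by (simp add: add_pos_nonneg)
    then have "real k \<le> log 2 (1 + norm x)" "log 2 (1 + norm x) < real (Suc k)" unfolding k_def by linarith+
    then have "2 powr real k \<le> 1 + norm x" "1 + norm x < 2 powr real (Suc k)"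
      using le_log_iff[of 2 "1 + norm x" "real k"] log_less_iff[of 2 "1 + norm x" "real (Suc k)"]
      by (simp_all add: add_pos_nonneg)
    then have k: "2 ^ k \<le> 1 + norm x" "1 + norm x < 2 ^ Suc k"
      unfolding powr_realpow[OF zero_less_numeral, of _ k] powr_realpow[OF zero_less_numeral, of _ "Suc k"] .
    have "ennreal ((1 + norm x) powr p) \<le> ennreal ((2 ^ k) powr p) * indicator (cball (0::'a) (2 ^ Suc k)) x"
    proof -
      have "x \<in> cball 0 (2 ^ Suc k)" using k(2) by simp
      moreover have "(1 + norm x) powr p \<le> (2 ^ k) powr p" by (rule powr_mono2'[OF p0 _ k(1)]) simp
      ultimately show ?thesis by (simp add: ennreal_leI del: power_Suc)
    qed
    also have "\<dots> \<le> (\<Sum>k. ennreal ((2 ^ k) powr p) * indicator (cball (0::'a) (2 ^ Suc k)) x)"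
    proof -
      have "f k \<le> (\<Sum>k. f k)" for f :: "nat \<Rightarrow> ennreal" using sum_le_suminf[of f "{k}"] by simp
      from this[of "\<lambda>k. ennreal ((2 ^ k) powr p) * indicator (cball (0::'a) (2 ^ Suc k)) x"] show ?thesis by (simp only:)
    qed
    finally show "ennreal ((1 + norm x) powr p) \<le> (\<Sum>k. ennreal ((2 ^ k) powr p) * indicator (cball (0::'a) (2 ^ Suc k)) x)" .
  qed
  also have "\<dots> = (\<Sum>k. \<integral>\<^sup>+x. ennreal ((2 ^ k) powr p) * indicator (cball (0::'a) (2 ^ Suc k)) x \<partial>lborel)"
    by (rule nn_integral_suminf, rule borel_measurable_times_ennreal, simp, rule borel_measurable_indicator) simp
  also have "\<dots> = (\<Sum>k. ennreal (v * 2 ^ ?d * g ^ k))"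
  proof (intro arg_cong[of _ _ suminf] ext)
    fix k :: nat
    have "(\<integral>\<^sup>+x. ennreal ((2 ^ k) powr p) * indicator (cball (0::'a) (2 ^ Suc k)) x \<partial>lborel)
       = ennreal ((2 ^ k) powr p) * ennreal (v * (2 ^ Suc k) ^ ?d)"
      using emeasure_cball[of "2 ^ Suc k" "0::'a"] by (simp add: nn_integral_cmult_indicator v_def)
    also have "\<dots> = ennreal ((2 ^ k) powr p * (v * (2 ^ Suc k) ^ ?d))" by (rule ennreal_mult'[symmetric]) simp
    also have "(2 ^ k) powr p * (v * (2 ^ Suc k) ^ ?d) = v * 2 ^ ?d * g ^ k"
    proof -
      have "g ^ k = g powr real k" using g by (simp add: powr_realpow)
      also have "\<dots> = (2 powr real k) powr p * (2 powr real k) powr real ?d"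
        by (simp add: g_def powr_powr powr_add[symmetric] algebra_simps)
      also have "\<dots> = (2 ^ k) powr p * (2 ^ k) ^ ?d" by (simp add: powr_realpow)
      finally show ?thesis by (simp add: power_mult_distrib mult_ac)
    qed
    finally show "(\<integral>\<^sup>+x. ennreal ((2 ^ k) powr p) * indicator (cball (0::'a) (2 ^ Suc k)) x \<partial>lborel) = ennreal (v * 2 ^ ?d * g ^ k)" .
  qed
  also have "\<dots> < \<infinity>"
  proof -
    have "summable (\<lambda>k. v * 2 ^ ?d * g ^ k)" using g by (intro summable_mult summable_geometric) auto
    then have "(\<Sum>k. ennreal (v * 2 ^ ?d * g ^ k)) = ennreal (\<Sum>k. v * 2 ^ ?d * g ^ k)"
      using v g by (intro suminf_ennreal2) auto
    then show ?thesis by simp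
  qed
  finally show ?thesis .
qed

section \<open>Oscillatory integrals and repeated differences\<close>

definition diff_op :: "'a::real_vector \<Rightarrow> ('a \<Rightarrow> complex) \<Rightarrow> 'a \<Rightarrow> complex" where
  "diff_op v f x = f (x + v) - f x"

lemma diff_op_Suc: "(diff_op v ^^ Suc i) f x = (diff_op v ^^ i) f (x + v) - (diff_op v ^^ i) f x"
  by (simp add: diff_op_def)

text \<open>If \<open>D (Suc k)\<close> is the derivative of \<open>D k\<close> in direction \<open>v\<close>, then \<open>j\<close> differences of \<open>D k\<close> with
  step \<open>v\<close> are controlled by \<open>D (k + j)\<close>.\<close>

lemma diff_op_funpow_bound:
  fixes D :: "nat \<Rightarrow> 'a::real_normed_vector \<Rightarrow> complex"
  assumes deriv: "\<And>k x u. k < n \<Longrightarrow> ((\<lambda>u. D k (x + u *\<^sub>R v)) has_vector_derivative D (Suc k) (x + u *\<^sub>R v)) (at u)"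
    and kj: "k + j \<le> n" and bound: "\<And>u. 0 \<le> u \<Longrightarrow> u \<le> real j \<Longrightarrow> cmod (D (k + j) (x + u *\<^sub>R v)) \<le> B"
  shows "cmod ((diff_op v ^^ j) (D k) x) \<le> B"
  using kj bound
proof (induction j arbitrary: k x)
  case 0
  from 0(2)[of 0] show ?case by simp
next
  case (Suc j)
  have d: "((\<lambda>u. (diff_op v ^^ i) (D k) (x + u *\<^sub>R v)) has_vector_derivative (diff_op v ^^ i) (D (Suc k)) (x + u *\<^sub>R v)) (at u)"
    if "k < n" for i x u
  proof (induction i arbitrary: x)
    case 0
    show ?case using deriv[OF that] by simp
  next
    case (Suc i)
    have "((\<lambda>u. (diff_op v ^^ i) (D k) (x + v + u *\<^sub>R v) - (diff_op v ^^ i) (D k) (x + u *\<^sub>R v)) has_vector_derivative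
       (diff_op v ^^ i) (D (Suc k)) (x + v + u *\<^sub>R v) - (diff_op v ^^ i) (D (Suc k)) (x + u *\<^sub>R v)) (at u)"
      by (intro has_vector_derivative_diff Suc.IH)
    then show ?case unfolding diff_op_Suc by (simp add: add_ac)
  qed
  define F where "F u = (diff_op v ^^ j) (D k) (x + u *\<^sub>R v)" for u
  have F: "(F has_vector_derivative (diff_op v ^^ j) (D (Suc k)) (x + u *\<^sub>R v)) (at u)" for u
    unfolding F_def using Suc.prems(1) by (intro d) auto
  have b: "cmod ((diff_op v ^^ j) (D (Suc k)) (x + u *\<^sub>R v)) \<le> B" if u: "0 \<le> u" "u \<le> 1" for u
  proof (rule Suc.IH)
    show "Suc k + j \<le> n" using Suc.prems(1) by simp
    fix r :: real assume r: "0 \<le> r" "r \<le> real j"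
    have "cmod (D (k + Suc j) (x + (u + r) *\<^sub>R v)) \<le> B" using r u by (intro Suc.prems(2)) auto
    then show "cmod (D (Suc k + j) (x + u *\<^sub>R v + r *\<^sub>R v)) \<le> B" by (simp add: scaleR_add_left add_ac)
  qed
  have "cmod (F 1 - F 0) \<le> B * 1 - B * 0"
  proof (rule differentiable_bound_general[where f' = "\<lambda>u. (diff_op v ^^ j) (D (Suc k)) (x + u *\<^sub>R v)" and \<phi>' = "\<lambda>_. B"])
    show "continuous_on {0..1} F"
      using F by (intro continuous_at_imp_continuous_on ballI has_vector_derivative_continuous) blast
    show "((\<lambda>u. B * u) has_vector_derivative B) (at u)" for u :: real
      by (auto intro!: derivative_eq_intros simp: has_real_derivative_iff_has_vector_derivative[symmetric])
  qed (use F b in \<open>auto intro!: continuous_intros\<close>)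
  then show ?case unfolding diff_op_Suc by (simp add: F_def)
qed

lemma diff_op_funpow_triangle:
  "cmod ((diff_op v ^^ j) f x) \<le> 2 ^ j * (\<Sum>i\<le>j. cmod (f (x + real i *\<^sub>R v)))"
proof (induction j arbitrary: x)
  case (Suc j)
  have "cmod ((diff_op v ^^ Suc j) f x) \<le> cmod ((diff_op v ^^ j) f (x + v)) + cmod ((diff_op v ^^ j) f x)"
    unfolding diff_op_Suc by (rule norm_triangle_ineq4)
  also have "\<dots> \<le> 2 ^ j * (\<Sum>i\<le>j. cmod (f (x + v + real i *\<^sub>R v))) + 2 ^ j * (\<Sum>i\<le>j. cmod (f (x + real i *\<^sub>R v)))"
    by (intro add_mono Suc.IH)
  also have "(\<Sum>i\<le>j. cmod (f (x + v + real i *\<^sub>R v))) = (\<Sum>i\<in>Suc ` {..j}. cmod (f (x + real i *\<^sub>R v)))"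
    by (subst sum.reindex) (simp_all add: scaleR_add_left add_ac)
  also have "\<dots> \<le> (\<Sum>i\<le>Suc j. cmod (f (x + real i *\<^sub>R v)))" by (intro sum_mono2) auto
  also have "(\<Sum>i\<le>j. cmod (f (x + real i *\<^sub>R v))) \<le> (\<Sum>i\<le>Suc j. cmod (f (x + real i *\<^sub>R v)))"
    by (intro sum_mono2) auto
  finally show ?case by simp
qed simp

lemma lborel_integral_translate:
  fixes f :: "'a::euclidean_space \<Rightarrow> 'b::{banach, second_countable_topology}"
  assumes [measurable]: "f \<in> borel_measurable borel"
  shows "(LINT x|lborel. f (x + c)) = (LINT x|lborel. f x)"
proof -
  have "(LINT x|lborel. f x) = (LINT x|distr lborel borel ((+) c). f x)" by (simp add: lborel_distr_plus)
  also have "\<dots> = (LINT x|lborel. f (c + x))" by (subst integral_distr) auto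
  finally show ?thesis by (simp add: add.commute)
qed

lemma lborel_nn_integral_translate:
  fixes f :: "'a::euclidean_space \<Rightarrow> ennreal"
  assumes [measurable]: "f \<in> borel_measurable borel"
  shows "(\<integral>\<^sup>+x. f (x + c) \<partial>lborel) = (\<integral>\<^sup>+x. f x \<partial>lborel)"
proof -
  have "(\<integral>\<^sup>+x. f x \<partial>lborel) = (\<integral>\<^sup>+x. f x \<partial>distr lborel borel ((+) c))" by (simp add: lborel_distr_plus)
  also have "\<dots> = (\<integral>\<^sup>+x. f (c + x) \<partial>lborel)" by (subst nn_integral_distr) auto
  finally show ?thesis by (simp add: add.commute)
qed

lemma lborel_integrable_translate:
  fixes f :: "'a::euclidean_space \<Rightarrow> 'b::{banach, second_countable_topology}"
  assumes "integrable lborel f"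
  shows "integrable lborel (\<lambda>x. f (x + c))"
proof -
  have [measurable]: "f \<in> borel_measurable borel" using borel_measurable_integrable[OF assms] by simp
  have "integrable (distr lborel borel ((+) c)) f" using assms by (simp add: lborel_distr_plus)
  then show ?thesis by (subst (asm) integrable_distr_eq) (auto simp: add.commute)
qed

lemma cis_inner_measurable [measurable]:
  "(\<lambda>x::'a::euclidean_space. cis (r * (z \<bullet> x))) \<in> borel_measurable borel"
  by (intro borel_measurable_continuous_onI continuous_intros)

text \<open>A translation by \<open>v\<close> with \<open>z \<bullet> v = 1 / 2\<close> changes the sign of the exponential; hence every
  difference in the amplitude doubles the integral up to sign.\<close>

lemma oscillatory_integral_diff:
  fixes g :: "'a::euclidean_space \<Rightarrow> complex"
  assumes g: "integrable lborel g" and zv: "z \<bullet> v = 1 / 2"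
  shows "integrable lborel ((diff_op v ^^ j) g)"
    and "(LINT x|lborel. (diff_op v ^^ j) g x * cis (2 * pi * (z \<bullet> x))) = (- 2) ^ j * (LINT x|lborel. g x * cis (2 * pi * (z \<bullet> x)))"
proof (induction j)
  case 0
  { case 1 show ?case using g by simp }
  { case 2 show ?case by simp }
next
  case (Suc j)
  define f where "f = (diff_op v ^^ j) g"
  have f: "integrable lborel f" using Suc.IH(1) by (simp add: f_def)
  then have [measurable]: "f \<in> borel_measurable borel" using borel_measurable_integrable by fastforce
  have step: "(diff_op v ^^ Suc j) g = (\<lambda>x. f (x + v) - f x)" by (simp add: f_def diff_op_def fun_eq_iff)
  have ic: "integrable lborel (\<lambda>x. h x * cis (2 * pi * (z \<bullet> x)))" if "integrable lborel h" for h :: "'a \<Rightarrow> complex"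
    by (rule Bochner_Integration.integrable_bound[OF that]) (use that in \<open>auto simp: norm_mult intro!: borel_measurable_times\<close>)
  have "(LINT x|lborel. f (x + v) * cis (2 * pi * (z \<bullet> x))) = (LINT x|lborel. f (x + v) * (- cis (2 * pi * (z \<bullet> (x + v)))))"
  proof (intro arg_cong[of _ _ "integral\<^sup>L lborel"] ext)
    fix x
    have "cis (2 * pi * (z \<bullet> (x + v))) = cis (2 * pi * (z \<bullet> x) + pi)"
    proof -
      have "2 * pi * (z \<bullet> (x + v)) = 2 * pi * (z \<bullet> x) + pi"
        unfolding inner_add_right zv by (simp add: distrib_left)
      then show ?thesis by (rule arg_cong)
    qed
    then show "f (x + v) * cis (2 * pi * (z \<bullet> x)) = f (x + v) * (- cis (2 * pi * (z \<bullet> (x + v))))"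
      by (simp add: cis_mult[symmetric])
  qed
  also have "\<dots> = - (LINT x|lborel. f x * cis (2 * pi * (z \<bullet> x)))"
    using lborel_integral_translate[of "\<lambda>x. f x * (- cis (2 * pi * (z \<bullet> x)))" v] by simp
  finally have tr: "(LINT x|lborel. f (x + v) * cis (2 * pi * (z \<bullet> x))) = - (LINT x|lborel. f x * cis (2 * pi * (z \<bullet> x)))" .
  { case 1
    show ?case unfolding step by (intro Bochner_Integration.integrable_diff lborel_integrable_translate f) }
  { case 2
    have "(LINT x|lborel. (diff_op v ^^ Suc j) g x * cis (2 * pi * (z \<bullet> x)))
       = (LINT x|lborel. f (x + v) * cis (2 * pi * (z \<bullet> x)) - f x * cis (2 * pi * (z \<bullet> x)))"
      unfolding step by (simp add: algebra_simps)
    also have "\<dots> = (LINT x|lborel. f (x + v) * cis (2 * pi * (z \<bullet> x))) - (LINT x|lborel. f x * cis (2 * pi * (z \<bullet> x)))"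
      by (intro Bochner_Integration.integral_diff ic lborel_integrable_translate f)
    also have "\<dots> = (- 2) * (LINT x|lborel. f x * cis (2 * pi * (z \<bullet> x)))" by (simp add: tr)
    finally show ?case using Suc.IH(2) by (simp add: f_def) }
qed

lemma oscillatory_integral_le:
  fixes g :: "'a::euclidean_space \<Rightarrow> complex"
  assumes g: "integrable lborel g" and zv: "z \<bullet> v = 1 / 2"
  shows "ennreal (cmod (LINT x|lborel. g x * cis (2 * pi * (z \<bullet> x)))) \<le> (\<integral>\<^sup>+x. ennreal (cmod ((diff_op v ^^ j) g x)) \<partial>lborel)"
proof -
  define K where "K = (LINT x|lborel. g x * cis (2 * pi * (z \<bullet> x)))"
  have int: "integrable lborel ((diff_op v ^^ j) g)" by (rule oscillatory_integral_diff(1)[OF assms])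
  have int': "integrable lborel (\<lambda>x. (diff_op v ^^ j) g x * cis (2 * pi * (z \<bullet> x)))"
    by (rule Bochner_Integration.integrable_bound[OF int]) (use int in \<open>auto simp: norm_mult intro!: borel_measurable_times\<close>)
  have "cmod K \<le> 2 ^ j * cmod K" by (simp add: mult_le_cancel_right1)
  also have "\<dots> = cmod ((- 2) ^ j * K)" by (simp add: norm_mult norm_power)
  also have "\<dots> = cmod (LINT x|lborel. (diff_op v ^^ j) g x * cis (2 * pi * (z \<bullet> x)))"
    unfolding K_def oscillatory_integral_diff(2)[OF assms] ..
  finally have "ennreal (cmod K) \<le> ennreal (cmod (LINT x|lborel. (diff_op v ^^ j) g x * cis (2 * pi * (z \<bullet> x))))"
    by (rule ennreal_leI)
  also have "\<dots> \<le> (\<integral>\<^sup>+x. ennreal (cmod ((diff_op v ^^ j) g x * cis (2 * pi * (z \<bullet> x)))) \<partial>lborel)"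
    by (rule integral_norm_bound_ennreal[OF int'])
  finally show ?thesis by (simp add: K_def norm_mult)
qed

section \<open>Size of the kernel\<close>

text \<open>For an amplitude of order \<open>l\<close> and type \<open>\<rho>\<close>, \<open>N\<close> differences with step \<open>h\<close> gain the factor
  \<open>min 1 (h ^ N * (1 + norm x) powr (- \<rho> * N))\<close>. For \<open>h \<le> 1\<close> the second term is used. For \<open>h \<ge> 1\<close> the minimum is
  at most the weighted geometric mean \<open>h powr a * (1 + norm x) powr (- \<rho> * a)\<close> away from a ball of radius comparable
  to \<open>h\<close>, and on that ball the same bound holds for every translate, as \<open>\<rho> \<le> 1\<close>.\<close>

locale symbol_amplitude =
  fixes l \<rho> B :: real and D :: "nat \<Rightarrow> 'a::euclidean_space \<Rightarrow> complex" and e :: 'a and N :: nat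
  assumes rho: "0 \<le> \<rho>" "\<rho> \<le> 1" and l: "l \<le> 0" and B: "B \<ge> 0" and N: "N > 0"
    and deriv: "\<And>k x u. k < N \<Longrightarrow> ((\<lambda>u. D k (x + u *\<^sub>R e)) has_vector_derivative D (Suc k) (x + u *\<^sub>R e)) (at u)"
    and bound0: "\<And>x. cmod (D 0 x) \<le> B * (1 + norm x) powr l"
    and boundN: "\<And>x. cmod (D N x) \<le> B * (1 + norm x) powr (l - \<rho> * real N)"
    and int: "integrable lborel (D 0)" and e: "norm e = 1"
begin

lemma diff_bound:
  assumes "\<And>u. 0 \<le> u \<Longrightarrow> u \<le> real N \<Longrightarrow> cmod (D N (x + (u * r) *\<^sub>R e)) \<le> M"
  shows "cmod ((diff_op (r *\<^sub>R e) ^^ N) (D 0) x) \<le> \<bar>r\<bar> ^ N * M"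
proof -
  define E where "E k x = r ^ k *\<^sub>R D k x" for k x
  have "cmod ((diff_op (r *\<^sub>R e) ^^ N) (E 0) x) \<le> \<bar>r\<bar> ^ N * M"
  proof (rule diff_op_funpow_bound[where D = E and k = 0 and j = N and n = N])
    fix k x u assume "k < N"
    have "((\<lambda>u. D k (x + (u * r) *\<^sub>R e)) has_vector_derivative r *\<^sub>R D (Suc k) (x + (u * r) *\<^sub>R e)) (at u)"
    proof -
      have "((\<lambda>u. u * r) has_vector_derivative r) (at u)"
        by (auto simp: has_real_derivative_iff_has_vector_derivative[symmetric] intro!: derivative_eq_intros)
      from vector_diff_chain_at[OF this deriv[OF \<open>k < N\<close>, of x "u * r"]] show ?thesis by (simp add: o_def)
    qed
    then have "((\<lambda>u. r ^ k *\<^sub>R D k (x + (u * r) *\<^sub>R e)) has_vector_derivative r ^ k *\<^sub>R (r *\<^sub>R D (Suc k) (x + (u * r) *\<^sub>R e))) (at u)"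
      by (rule bounded_linear.has_vector_derivative[OF bounded_linear_scaleR_right])
    then show "((\<lambda>u. E k (x + u *\<^sub>R (r *\<^sub>R e))) has_vector_derivative E (Suc k) (x + u *\<^sub>R (r *\<^sub>R e))) (at u)"
      by (simp add: E_def mult.commute)
  next
    fix u :: real assume "0 \<le> u" "u \<le> real N"
    then have "\<bar>r\<bar> ^ N * cmod (D N (x + (u * r) *\<^sub>R e)) \<le> \<bar>r\<bar> ^ N * M" by (intro mult_left_mono assms) auto
    then show "cmod (E (0 + N) (x + u *\<^sub>R (r *\<^sub>R e))) \<le> \<bar>r\<bar> ^ N * M" by (simp add: E_def power_abs)
  qed simp
  then show ?thesis by (simp add: E_def[abs_def])
qed

lemma bracket_shift:
  assumes "0 \<le> u" "u \<le> real N"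
  shows "norm (x + (u * r) *\<^sub>R e) \<ge> norm x - real N * \<bar>r\<bar>"
proof -
  have "norm x - norm ((u * r) *\<^sub>R e) \<le> norm (x + (u * r) *\<^sub>R e)" by (metis add.commute norm_diff_ineq)
  moreover have "norm ((u * r) *\<^sub>R e) \<le> real N * \<bar>r\<bar>" using assms e by (simp add: abs_mult mult_right_mono)
  ultimately show ?thesis by linarith
qed

lemma diff_bound_small:
  assumes r: "\<bar>r\<bar> \<le> 1"
  shows "cmod ((diff_op (r *\<^sub>R e) ^^ N) (D 0) x)
    \<le> \<bar>r\<bar> ^ N * (B * (real N + 1) powr (\<rho> * real N - l) * (1 + norm x) powr (l - \<rho> * real N))"
proof (rule diff_bound)
  fix u :: real assume u: "0 \<le> u" "u \<le> real N"
  define y where "y = norm (x + (u * r) *\<^sub>R e)"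
  have "real N * \<bar>r\<bar> \<le> real N" using r by (simp add: mult_left_le)
  then have "norm x \<le> y + real N" using bracket_shift[OF u, of x r] unfolding y_def by linarith
  moreover have "real N * y \<ge> 0" by (simp add: y_def)
  ultimately have "1 + norm x \<le> (real N + 1) * (1 + y)" by (simp add: algebra_simps)
  then have le: "(1 + norm x) / (real N + 1) \<le> 1 + y" by (simp add: divide_le_eq mult.commute)
  have "(1 + y) powr (l - \<rho> * real N) \<le> ((1 + norm x) / (real N + 1)) powr (l - \<rho> * real N)"
  proof (rule powr_mono2')
    have "\<rho> * real N \<ge> 0" using rho by simp
    then show "l - \<rho> * real N \<le> 0" using l by linarith
    show "0 < (1 + norm x) / (real N + 1)" by (intro divide_pos_pos add_pos_nonneg add_nonneg_pos) auto
  qed (rule le)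
  also have "\<dots> = (real N + 1) powr (\<rho> * real N - l) * (1 + norm x) powr (l - \<rho> * real N)"
  proof -
    have "(real N + 1) powr (\<rho> * real N - l) = inverse ((real N + 1) powr (l - \<rho> * real N))"
      by (metis minus_diff_eq powr_minus)
    moreover have "((1 + norm x) / (real N + 1)) powr (l - \<rho> * real N) = (1 + norm x) powr (l - \<rho> * real N) / (real N + 1) powr (l - \<rho> * real N)"
      by (rule powr_divide)
    ultimately show ?thesis by (simp only: divide_inverse mult.commute)
  qed
  finally have "B * (1 + y) powr (l - \<rho> * real N) \<le> B * ((real N + 1) powr (\<rho> * real N - l) * (1 + norm x) powr (l - \<rho> * real N))"
    using B by (rule mult_left_mono)
  with boundN[of "x + (u * r) *\<^sub>R e"]
  show "cmod (D N (x + (u * r) *\<^sub>R e)) \<le> B * (real N + 1) powr (\<rho> * real N - l) * (1 + norm x) powr (l - \<rho> * real N)"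
    by (simp add: y_def mult.assoc)
qed

text \<open>For \<open>norm x < 2 * N * h\<close>, with \<open>h = |r|\<close>, the \<open>N + 1\<close> translates are estimated one by one, which leads to the sum. Otherwise all of them
  are comparable to \<open>x\<close>, and the bounds with and without gain in \<open>h\<close> are interpolated.\<close>

lemma diff_bound_large:
  assumes r: "\<bar>r\<bar> \<ge> 1" and a: "0 \<le> a" "a \<le> real N"
  shows "cmod ((diff_op (r *\<^sub>R e) ^^ N) (D 0) x)
    \<le> \<bar>r\<bar> powr a * (B * (4 ^ N * (real N + 1) * 2 powr (- l) * (1 + norm x) powr (l - \<rho> * a)
        + 2 ^ N * (4 * real N) powr a * (\<Sum>i\<le>N. (1 + norm (x + real i *\<^sub>R (r *\<^sub>R e))) powr (l - \<rho> * a))))"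
    (is "?L \<le> \<bar>r\<bar> powr a * (B * (?X + ?Y))")
proof -
  define h where "h = \<bar>r\<bar>"
  have h: "h \<ge> 1" using r by (simp add: h_def)
  have X0: "?X \<ge> 0" by simp
  have Y0: "?Y \<ge> 0" by (intro mult_nonneg_nonneg sum_nonneg) auto
  have ha: "h powr a > 0" using h by simp
  have N1: "real N \<ge> 1" using N by simp
  have shift: "(u * r) *\<^sub>R e = u *\<^sub>R (r *\<^sub>R e)" for u by simp
  show ?thesis
  proof (cases "norm x < 2 * real N * h")
    case True
    have t: "cmod (D 0 (x + real i *\<^sub>R (r *\<^sub>R e))) \<le> B * ((4 * real N) powr a * h powr a * (1 + norm (x + real i *\<^sub>R (r *\<^sub>R e))) powr (l - \<rho> * a))"
      if i: "i \<le> N" for i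
    proof -
      define y where "y = norm (x + real i *\<^sub>R (r *\<^sub>R e))"
      have "y \<le> norm x + real i * h" unfolding y_def h_def using norm_triangle_ineq[of x "real i *\<^sub>R (r *\<^sub>R e)"] e by (simp add: abs_mult)
      also have "real i * h \<le> real N * h" using i h by (intro mult_right_mono) auto
      finally have "1 + y \<le> 1 + 3 * (real N * h)" using True by simp
      moreover have "1 \<le> real N * h" using mult_mono[of 1 "real N" 1 h] N1 h by simp
      ultimately have y4: "1 + y \<le> 4 * real N * h" by simp
      have y0: "y \<ge> 0" by (simp add: y_def)
      have "(1 + y) powr l = (1 + y) powr (\<rho> * a) * (1 + y) powr (l - \<rho> * a)" using y0 by (simp flip: powr_add)
      also have "(1 + y) powr (\<rho> * a) \<le> (1 + y) powr a"
        using y0 rho a by (intro powr_mono) (auto simp: mult_left_le_one_le)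
      also have "\<dots> \<le> (4 * real N * h) powr a" using y4 y0 a by (intro powr_mono2) auto
      also have "\<dots> = (4 * real N) powr a * h powr a" using h by (simp add: powr_mult)
      finally have "(1 + y) powr l \<le> (4 * real N) powr a * h powr a * (1 + y) powr (l - \<rho> * a)" by (simp add: mult_right_mono)
      then have "B * (1 + y) powr l \<le> B * ((4 * real N) powr a * h powr a * (1 + y) powr (l - \<rho> * a))" using B by (rule mult_left_mono)
      then show ?thesis using bound0[of "x + real i *\<^sub>R (r *\<^sub>R e)"] by (simp add: y_def)
    qed
    have "?L \<le> 2 ^ N * (\<Sum>i\<le>N. cmod (D 0 (x + real i *\<^sub>R (r *\<^sub>R e))))" by (rule diff_op_funpow_triangle)
    also have "\<dots> \<le> 2 ^ N * (\<Sum>i\<le>N. B * ((4 * real N) powr a * h powr a * (1 + norm (x + real i *\<^sub>R (r *\<^sub>R e))) powr (l - \<rho> * a)))"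
      using t by (intro mult_left_mono sum_mono) auto
    also have "\<dots> = h powr a * (B * ?Y)" by (simp add: sum_distrib_left mult_ac)
    also have "\<dots> \<le> h powr a * (B * (?X + ?Y))" using ha B X0 by (intro mult_left_mono) auto
    finally show ?thesis by (simp add: h_def)
  next
    case False
    define z where "z = 1 + norm x"
    have z: "z \<ge> 1" by (simp add: z_def)
    have half: "z / 2 \<le> 1 + norm (x + (u * r) *\<^sub>R e)" if "0 \<le> u" "u \<le> real N" for u
      using bracket_shift[OF that, of x r] False unfolding z_def h_def by simp
    have pw: "(1 + norm (x + (u * r) *\<^sub>R e)) powr s \<le> 2 powr (- s) * z powr s" if "0 \<le> u" "u \<le> real N" "s \<le> 0" for u s
    proof -
      have "(1 + norm (x + (u * r) *\<^sub>R e)) powr s \<le> (z / 2) powr s"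
        using half[OF that(1,2)] z that(3) by (intro powr_mono2') auto
      also have "\<dots> = 2 powr (- s) * z powr s" 
        by (simp only: powr_divide powr_minus divide_inverse[of "z powr s"] mult.commute)
      finally show ?thesis .
    qed
    define c where "c = 4 ^ N * (real N + 1) * 2 powr (- l)"
    have b1: "?L \<le> B * (c * z powr l)"
    proof -
      have "?L \<le> 2 ^ N * (\<Sum>i\<le>N. cmod (D 0 (x + real i *\<^sub>R (r *\<^sub>R e))))" by (rule diff_op_funpow_triangle)
      also have "\<dots> \<le> 2 ^ N * (\<Sum>i\<le>N. B * (2 powr (- l) * z powr l))"
      proof (intro mult_left_mono sum_mono)
        fix i assume "i \<in> {..N}"
        then have "(1 + norm (x + (real i * r) *\<^sub>R e)) powr l \<le> 2 powr (- l) * z powr l" using l by (intro pw) auto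
        then have "B * (1 + norm (x + (real i * r) *\<^sub>R e)) powr l \<le> B * (2 powr (- l) * z powr l)" using B by (rule mult_left_mono)
        with bound0[of "x + (real i * r) *\<^sub>R e"] show "cmod (D 0 (x + real i *\<^sub>R (r *\<^sub>R e))) \<le> B * (2 powr (- l) * z powr l)" by simp
      qed simp
      also have "\<dots> = 2 ^ N * (real N + 1) * (B * (2 powr (- l) * z powr l))" by simp
      also have "\<dots> \<le> 4 ^ N * (real N + 1) * (B * (2 powr (- l) * z powr l))"
        using B by (intro mult_right_mono power_mono) auto
      finally show ?thesis by (simp add: c_def mult_ac)
    qed
    have b2: "?L \<le> h ^ N * (B * (c * z powr (l - \<rho> * real N)))"
      unfolding h_def
    proof (rule diff_bound)
      fix u :: real assume u: "0 \<le> u" "u \<le> real N"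
      have "\<rho> * real N \<ge> 0" using rho by simp
      then have "l - \<rho> * real N \<le> 0" using l by linarith
      then have "(1 + norm (x + (u * r) *\<^sub>R e)) powr (l - \<rho> * real N) \<le> 2 powr (- (l - \<rho> * real N)) * z powr (l - \<rho> * real N)"
        using u by (intro pw)
      also have "2 powr (- (l - \<rho> * real N)) \<le> c"
      proof -
        have "2 powr (- (l - \<rho> * real N)) = 2 powr (\<rho> * real N) * 2 powr (- l)" by (simp flip: powr_add)
        also have "2 powr (\<rho> * real N) \<le> 2 powr (real N)" using rho by (intro powr_mono) (auto simp: mult_left_le_one_le)
        also have "\<dots> = 2 ^ N" by (simp add: powr_realpow)
        also have "\<dots> \<le> 4 ^ N * (real N + 1)" 
          using mult_mono[of "2 ^ N" "4 ^ N" 1 "real N + 1"] power_mono[of "2::real" 4 N] by simp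
        finally show ?thesis by (simp add: c_def mult_right_mono)
      qed
      finally have "(1 + norm (x + (u * r) *\<^sub>R e)) powr (l - \<rho> * real N) \<le> c * z powr (l - \<rho> * real N)" by (simp add: mult_right_mono)
      then have "B * (1 + norm (x + (u * r) *\<^sub>R e)) powr (l - \<rho> * real N) \<le> B * (c * z powr (l - \<rho> * real N))" using B by (rule mult_left_mono)
      with boundN[of "x + (u * r) *\<^sub>R e"] show "cmod (D N (x + (u * r) *\<^sub>R e)) \<le> B * (c * z powr (l - \<rho> * real N))" by simp
    qed
    have c0: "c \<ge> 0" by (simp add: c_def)
    \<comment> \<open>the two bounds \<open>b1\<close> and \<open>b2\<close> balance at \<open>h = T\<close>\<close>
    define T where "T = z powr \<rho>"
    have T: "T > 0" using z by (simp add: T_def)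
    have zT: "z powr (l - \<rho> * s) = z powr l / T powr s" for s
      using z by (simp add: T_def powr_powr powr_diff)
    have "?L \<le> B * (c * (h powr a * z powr (l - \<rho> * a)))"
    proof (cases "h \<le> T")
      case True
      then have "(h / T) powr real N \<le> (h / T) powr a" using h T a by (intro powr_mono') auto
      then have "h ^ N * z powr (l - \<rho> * real N) \<le> h powr a * z powr (l - \<rho> * a)"
        unfolding zT using h T z by (simp add: powr_divide powr_realpow divide_simps mult_ac)
      then have "B * (c * (h ^ N * z powr (l - \<rho> * real N))) \<le> B * (c * (h powr a * z powr (l - \<rho> * a)))"
        using B c0 by (intro mult_left_mono)
      then show ?thesis using b2 by (simp add: mult_ac)
    next
      case False
      then have "1 \<le> (h / T) powr a" using T a by (intro ge_one_powr_ge_zero) auto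
      then have "z powr l \<le> h powr a * z powr (l - \<rho> * a)"
        unfolding zT using h T z by (simp add: powr_divide divide_simps mult_ac)
      then have "B * (c * z powr l) \<le> B * (c * (h powr a * z powr (l - \<rho> * a)))"
        using B c0 by (intro mult_left_mono)
      then show ?thesis using b1 by simp
    qed
    also have "\<dots> = h powr a * (B * ?X)" by (simp add: c_def z_def mult_ac)
    also have "\<dots> \<le> h powr a * (B * (?X + ?Y))" using ha B Y0 by (intro mult_left_mono) auto
    finally show ?thesis by (simp add: h_def)
  qed
qed

end

text \<open>The step \<open>r\<close> of the differences in direction \<open>e\<close> has to satisfy \<open>z \<bullet> (r e) = 1 / 2\<close>. Large \<open>|z \<bullet> e|\<close> allow a small step and
  the full gain \<open>|r| ^ N\<close>. Small \<open>|z \<bullet> e|\<close> force a large step, which loses \<open>|r| powr a\<close> for any \<open>a\<close> with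
  \<open>l - \<rho> * a\<close> below minus the dimension.\<close>

lemma kernel_decay:
  fixes l \<rho> a :: real
  assumes rho: "0 \<le> \<rho>" "\<rho> \<le> 1" and l: "l \<le> 0" and N: "N > 0" and a: "0 \<le> a" "a \<le> real N"
    and lN: "l - \<rho> * real N < - real DIM('a::euclidean_space)" and la: "l - \<rho> * a < - real DIM('a)"
  obtains C where "C \<ge> 0" "\<And>B D (e::'a) z. symbol_amplitude l \<rho> B D e N \<Longrightarrow> z \<bullet> e \<noteq> 0 \<Longrightarrow>
     cmod (LINT x|lborel. D 0 x * cis (2 * pi * (z \<bullet> x)))
       \<le> C * B * (if \<bar>z \<bullet> e\<bar> \<ge> 1 / 2 then (1 / (2 * \<bar>z \<bullet> e\<bar>)) ^ N else (1 / (2 * \<bar>z \<bullet> e\<bar>)) powr a)"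
proof -
  define I where "I p = enn2real (\<integral>\<^sup>+x. ennreal ((1 + norm x) powr p) \<partial>(lborel :: 'a measure))" for p
  have I0: "I p \<ge> 0" for p by (simp add: I_def)
  have I: "(\<integral>\<^sup>+x. ennreal ((1 + norm x) powr p) \<partial>(lborel :: 'a measure)) = ennreal (I p)" if "p < - real DIM('a)" for p
    unfolding I_def using nn_integral_japanese_bracket_finite[OF that] by (simp add: less_top)
  define C1 where "C1 = (real N + 1) powr (\<rho> * real N - l) * I (l - \<rho> * real N)"
  define c2 where "c2 = 4 ^ N * (real N + 1) * 2 powr (- l)"
  define c3 where "c3 = 2 ^ N * (4 * real N) powr a"
  define C2 where "C2 = (c2 + c3 * real (Suc N)) * I (l - \<rho> * a)"
  have c: "C1 \<ge> 0" "c2 \<ge> 0" "c3 \<ge> 0" "C2 \<ge> 0"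
    using I0 by (auto simp: C1_def c2_def c3_def C2_def intro!: mult_nonneg_nonneg add_nonneg_nonneg)
  show thesis
  proof (rule that[of "C1 + C2"])
    show "C1 + C2 \<ge> 0" using c by simp
    fix B D and e z :: 'a assume sa: "symbol_amplitude l \<rho> B D e N" and ze: "z \<bullet> e \<noteq> 0"
    interpret symbol_amplitude l \<rho> B D e N by fact
    define r where "r = 1 / (2 * (z \<bullet> e))"
    have r: "\<bar>r\<bar> = 1 / (2 * \<bar>z \<bullet> e\<bar>)" by (simp add: r_def abs_mult)
    have zv: "z \<bullet> (r *\<^sub>R e) = 1 / 2" using ze by (simp add: r_def)
    define K where "K = cmod (LINT x|lborel. D 0 x * cis (2 * pi * (z \<bullet> x)))"
    have le: "ennreal K \<le> (\<integral>\<^sup>+x. ennreal (cmod ((diff_op (r *\<^sub>R e) ^^ N) (D 0) x)) \<partial>lborel)"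
      unfolding K_def by (rule oscillatory_integral_le[OF int zv])
    show "K \<le> (C1 + C2) * B * (if \<bar>z \<bullet> e\<bar> \<ge> 1 / 2 then (1 / (2 * \<bar>z \<bullet> e\<bar>)) ^ N else (1 / (2 * \<bar>z \<bullet> e\<bar>)) powr a)"
    proof (cases "\<bar>z \<bullet> e\<bar> \<ge> 1 / 2")
      case True
      then have r1: "\<bar>r\<bar> \<le> 1" unfolding r by (simp add: divide_le_eq)
      note le
      also have "(\<integral>\<^sup>+x. ennreal (cmod ((diff_op (r *\<^sub>R e) ^^ N) (D 0) x)) \<partial>lborel)
        \<le> (\<integral>\<^sup>+x. ennreal (\<bar>r\<bar> ^ N * (B * (real N + 1) powr (\<rho> * real N - l))) * ennreal ((1 + norm x) powr (l - \<rho> * real N)) \<partial>(lborel :: 'a measure))"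
      proof (rule nn_integral_mono)
        fix x
        have "ennreal (cmod ((diff_op (r *\<^sub>R e) ^^ N) (D 0) x)) \<le> ennreal (\<bar>r\<bar> ^ N * (B * (real N + 1) powr (\<rho> * real N - l)) * (1 + norm x) powr (l - \<rho> * real N))"
          using diff_bound_small[OF r1, of x] by (intro ennreal_leI) (simp add: mult.assoc)
        also have "\<dots> = ennreal (\<bar>r\<bar> ^ N * (B * (real N + 1) powr (\<rho> * real N - l))) * ennreal ((1 + norm x) powr (l - \<rho> * real N))"
          using B by (intro ennreal_mult) auto
        finally show "ennreal (cmod ((diff_op (r *\<^sub>R e) ^^ N) (D 0) x)) \<le> \<dots>" .
      qed
      also have "\<dots> = ennreal (\<bar>r\<bar> ^ N * (B * (real N + 1) powr (\<rho> * real N - l))) * ennreal (I (l - \<rho> * real N))"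
        by (subst nn_integral_cmult) (simp_all add: I[OF lN])
      also have "\<dots> = ennreal (C1 * B * \<bar>r\<bar> ^ N)"
        using B I0 by (subst ennreal_mult[symmetric]) (auto simp: C1_def mult_ac)
      finally have "K \<le> C1 * B * \<bar>r\<bar> ^ N" using c B by (subst (asm) ennreal_le_iff) auto
      also have "\<dots> \<le> (C1 + C2) * B * \<bar>r\<bar> ^ N" using c B by (intro mult_right_mono) auto
      finally show ?thesis using True by (simp add: r)
    next
      case False
      then have r1: "\<bar>r\<bar> \<ge> 1" unfolding r using ze by (simp add: le_divide_eq)
      define g where "g x = ennreal ((1 + norm x) powr (l - \<rho> * a))" for x :: 'a
      have [measurable]: "g \<in> borel_measurable borel" unfolding g_def by measurable
      have gI: "(\<integral>\<^sup>+x. g (x + y) \<partial>lborel) = ennreal (I (l - \<rho> * a))" for y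
        using lborel_nn_integral_translate[of g y] I[OF la] by (simp add: g_def)
      have gI0: "(\<integral>\<^sup>+x. g x \<partial>lborel) = ennreal (I (l - \<rho> * a))" using I[OF la] by (simp add: g_def)
      note le
      also have "(\<integral>\<^sup>+x. ennreal (cmod ((diff_op (r *\<^sub>R e) ^^ N) (D 0) x)) \<partial>lborel)
        \<le> (\<integral>\<^sup>+x. ennreal (\<bar>r\<bar> powr a * B) * (ennreal c2 * g x + ennreal c3 * (\<Sum>i\<le>N. g (x + real i *\<^sub>R (r *\<^sub>R e)))) \<partial>lborel)"
      proof (rule nn_integral_mono)
        fix x
        let ?S = "\<Sum>i\<le>N. (1 + norm (x + real i *\<^sub>R (r *\<^sub>R e))) powr (l - \<rho> * a)"
        have S0: "?S \<ge> 0" by (intro sum_nonneg) auto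
        have "ennreal (cmod ((diff_op (r *\<^sub>R e) ^^ N) (D 0) x)) \<le> ennreal (\<bar>r\<bar> powr a * B * (c2 * (1 + norm x) powr (l - \<rho> * a) + c3 * ?S))"
          using diff_bound_large[OF r1 a, of x] by (intro ennreal_leI) (simp add: mult.assoc c2_def c3_def)
        also have "\<dots> = ennreal (\<bar>r\<bar> powr a * B) * ennreal (c2 * (1 + norm x) powr (l - \<rho> * a) + c3 * ?S)"
          using B by (intro ennreal_mult') auto
        also have "ennreal (c2 * (1 + norm x) powr (l - \<rho> * a) + c3 * ?S) = ennreal (c2 * (1 + norm x) powr (l - \<rho> * a)) + ennreal (c3 * ?S)"
          using c S0 by (intro ennreal_plus) auto
        also have "ennreal (c2 * (1 + norm x) powr (l - \<rho> * a)) = ennreal c2 * g x" using c by (simp add: g_def ennreal_mult')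
        also have "ennreal (c3 * ?S) = ennreal c3 * ennreal ?S" using c by (intro ennreal_mult') auto
        also have "ennreal ?S = (\<Sum>i\<le>N. g (x + real i *\<^sub>R (r *\<^sub>R e)))" unfolding g_def by (rule sum_ennreal[symmetric]) simp
        finally show "ennreal (cmod ((diff_op (r *\<^sub>R e) ^^ N) (D 0) x)) \<le> ennreal (\<bar>r\<bar> powr a * B) * (ennreal c2 * g x + ennreal c3 * (\<Sum>i\<le>N. g (x + real i *\<^sub>R (r *\<^sub>R e))))" .
      qed
      also have "\<dots> = ennreal (\<bar>r\<bar> powr a * B) * (ennreal c2 * ennreal (I (l - \<rho> * a)) + ennreal c3 * (\<Sum>i\<le>N. ennreal (I (l - \<rho> * a))))"
        by (subst nn_integral_cmult, measurable, subst nn_integral_add, measurable, subst nn_integral_cmult, measurable,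
            subst nn_integral_cmult, measurable, subst nn_integral_sum, measurable) (simp only: gI gI0)
      also have "\<dots> = ennreal (C2 * B * \<bar>r\<bar> powr a)"
      proof -
        have "(\<Sum>i\<le>N. ennreal (I (l - \<rho> * a))) = ennreal (real (Suc N) * I (l - \<rho> * a))"
          using I0 by (subst sum_ennreal) auto
        moreover have "ennreal c2 * ennreal (I (l - \<rho> * a)) + ennreal c3 * ennreal (real (Suc N) * I (l - \<rho> * a)) = ennreal C2"
          using c I0[of "l - \<rho> * a"] by (subst (1 2) ennreal_mult[symmetric]) (auto simp: C2_def algebra_simps simp flip: ennreal_plus)
        ultimately show ?thesis using B c by (simp add: ennreal_mult[symmetric] mult_ac)
      qed
      finally have "K \<le> C2 * B * \<bar>r\<bar> powr a" using c B by (subst (asm) ennreal_le_iff) auto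
      also have "\<dots> \<le> (C1 + C2) * B * \<bar>r\<bar> powr a" using c B by (intro mult_right_mono) auto
      finally show ?thesis using False by (simp add: r)
    qed
  qed
qed

section \<open>A cutoff with derivatives of symbol type\<close>

text \<open>The product over the coordinates of \<open>(1 + \<i> x\<^sub>b / R) ^ (- M)\<close>. It decays of order \<open>M\<close>, tends to \<open>1\<close> as \<open>R\<close> grows, and has explicit
  derivatives in the coordinate directions, whose bounds are uniform in \<open>R\<close>.\<close>

definition cut_factor :: "real \<Rightarrow> 'a::euclidean_space \<Rightarrow> 'a \<Rightarrow> complex" where
  "cut_factor R b x = 1 + \<i> * of_real ((x \<bullet> b) / R)"

definition cutoff :: "nat \<Rightarrow> real \<Rightarrow> 'a::euclidean_space \<Rightarrow> complex" where
  "cutoff M R x = (\<Prod>b\<in>Basis. inverse (cut_factor R b x ^ M))"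

text \<open>The \<open>k\<close>-th derivative of the cutoff in the coordinate direction \<open>e\<close>.\<close>

definition cutoff_deriv :: "nat \<Rightarrow> real \<Rightarrow> 'a::euclidean_space \<Rightarrow> nat \<Rightarrow> 'a \<Rightarrow> complex" where
  "cutoff_deriv M R e k x = (-1) ^ k * pochhammer (of_nat M) k * (\<i> / of_real R) ^ k * inverse (cut_factor R e x ^ k) * cutoff M R x"

lemma cmod_cut_factor: "cmod (cut_factor R b x) ^ 2 = 1 + ((x \<bullet> b) / R) ^ 2"
  by (simp add: cut_factor_def cmod_power2)

lemma cmod_cut_factor_ge_1: "cmod (cut_factor R b x) \<ge> 1"
  using cmod_cut_factor[of R b x] by (metis le_add_same_cancel1 norm_ge_zero one_power2 power2_le_imp_le zero_le_power2)

lemma cut_factor_nonzero: "cut_factor R b x \<noteq> 0"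
  using cmod_cut_factor_ge_1[of R b x] by auto

lemma cutoff_deriv_0: "cutoff_deriv M R e 0 x = cutoff M R x"
  by (simp add: cutoff_deriv_def)

lemma cutoff_deriv_has_derivative:
  fixes e :: "'a::euclidean_space"
  assumes e: "e \<in> Basis" and R: "R \<noteq> 0"
  shows "((\<lambda>u. cutoff_deriv M R e k (x + u *\<^sub>R e)) has_vector_derivative cutoff_deriv M R e (Suc k) (x + u *\<^sub>R e)) (at u)"
proof -
  define rest where "rest = (\<Prod>b\<in>Basis - {e}. inverse (cut_factor R b x ^ M))"
  define c where "c = (-1) ^ k * pochhammer (of_nat M) k * (\<i> / of_real R) ^ k"
  define f where "f s = 1 + \<i> * (of_real (x \<bullet> e) + s) / of_real R" for s :: complex
  have fe: "cut_factor R e (x + u *\<^sub>R e) = f (of_real u)" for u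
    using e by (simp add: cut_factor_def f_def inner_add_left)
  have rest: "cutoff M R (x + u *\<^sub>R e) = inverse (f (of_real u) ^ M) * rest" for u
  proof -
    have "cutoff M R (x + u *\<^sub>R e) = inverse (cut_factor R e (x + u *\<^sub>R e) ^ M) * (\<Prod>b\<in>Basis - {e}. inverse (cut_factor R b (x + u *\<^sub>R e) ^ M))"
      unfolding cutoff_def using e by (intro prod.remove) auto
    also have "(\<Prod>b\<in>Basis - {e}. inverse (cut_factor R b (x + u *\<^sub>R e) ^ M)) = rest"
      unfolding rest_def using e by (intro prod.cong refl) (auto simp: cut_factor_def inner_add_left inner_Basis)
    finally show ?thesis by (simp add: fe)
  qed
  have f0: "f (of_real u) \<noteq> 0" for u unfolding fe[symmetric] by (rule cut_factor_nonzero)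
  have eq: "cutoff_deriv M R e k (x + u *\<^sub>R e) = c * inverse (f (of_real u) ^ (M + k)) * rest" for u
    by (simp add: cutoff_deriv_def fe rest c_def power_add)
  have eq2: "cutoff_deriv M R e (Suc k) (x + u *\<^sub>R e) = c * (- of_nat (M + k) * (\<i> / of_real R) * inverse (f (of_real u) ^ (M + Suc k))) * rest"
    by (simp add: cutoff_deriv_def fe rest c_def power_add pochhammer_Suc divide_inverse algebra_simps)
  have fd: "(f has_field_derivative \<i> / of_real R) (at s)" for s
    unfolding f_def using R by (auto intro!: derivative_eq_intros)
  have "((\<lambda>s. c * inverse (f s ^ (M + k)) * rest) has_field_derivative
     c * (- of_nat (M + k) * (\<i> / of_real R) * inverse (f (of_real u) ^ (M + Suc k))) * rest) (at (of_real u))"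
  proof (cases "M + k")
    case 0
    then show ?thesis by simp
  next
    case (Suc m)
    show ?thesis
    proof -
      have "((\<lambda>s. f s ^ Suc m) has_field_derivative of_nat (Suc m) * (\<i> / of_real R) * f (of_real u) ^ m) (at (of_real u))"
        using DERIV_power[OF fd, where n = "Suc m"] by (simp add: mult_ac)
      then have "((\<lambda>s. inverse (f s ^ Suc m)) has_field_derivative
          - (inverse (f (of_real u) ^ Suc m) * (of_nat (Suc m) * (\<i> / of_real R) * f (of_real u) ^ m) * inverse (f (of_real u) ^ Suc m))) (at (of_real u))"
        by (rule DERIV_inverse') (use f0 in simp)
      also have "- (inverse (f (of_real u) ^ Suc m) * (of_nat (Suc m) * (\<i> / of_real R) * f (of_real u) ^ m) * inverse (f (of_real u) ^ Suc m))
         = - of_nat (Suc m) * (\<i> / of_real R) * inverse (f (of_real u) ^ Suc (Suc m))"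
      proof -
        have "- (I * (n * c * y) * I) = - n * c * (I * (y * I))" for I n c y :: complex by simp
        moreover have "f (of_real u) ^ m * inverse (f (of_real u) ^ Suc m) = inverse (f (of_real u))" using f0[of u] by simp
        moreover have "inverse (f (of_real u) ^ Suc (Suc m)) = inverse (f (of_real u) ^ Suc m) * inverse (f (of_real u))" by simp
        ultimately show ?thesis by (simp only:)
      qed
      finally show ?thesis unfolding add_Suc_right Suc by (intro DERIV_cmult DERIV_cmult_right)
    qed
  qed
  from has_vector_derivative_real_field[OF this] show ?thesis unfolding eq eq2 .
qed

lemma prod_one_plus_ge:
  fixes f :: "'b \<Rightarrow> real"
  assumes "finite I" "\<And>i. i \<in> I \<Longrightarrow> f i \<ge> 0"
  shows "1 + (\<Sum>i\<in>I. f i) \<le> (\<Prod>i\<in>I. 1 + f i)"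
  using assms
proof (induction I)
  case (insert i I)
  have "1 + (\<Sum>i\<in>insert i I. f i) \<le> (1 + f i) * (1 + (\<Sum>i\<in>I. f i))"
    using insert by (simp add: algebra_simps sum_nonneg)
  also have "\<dots> \<le> (1 + f i) * (\<Prod>i\<in>I. 1 + f i)" using insert by (intro mult_left_mono) auto
  finally show ?case using insert by simp
qed simp

lemma cutoff_bound:
  fixes x :: "'a::euclidean_space"
  assumes R: "R \<ge> 1" and k: "k \<le> M"
  shows "cmod (cutoff M R x) \<le> (2 * R / (1 + norm x)) ^ k"
proof -
  define Y where "Y = (\<Prod>b\<in>Basis. cmod (cut_factor R b x))"
  have Y1: "Y \<ge> 1" unfolding Y_def by (intro prod_ge_1 cmod_cut_factor_ge_1)
  have "(norm x) ^ 2 = (\<Sum>b\<in>Basis. (x \<bullet> b) ^ 2)"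
    unfolding power2_norm_eq_inner by (subst euclidean_inner) (simp add: power2_eq_square)
  then have "1 + (norm x / R) ^ 2 = 1 + (\<Sum>b\<in>Basis. ((x \<bullet> b) / R) ^ 2)"
    by (simp add: power_divide sum_divide_distrib)
  also have "\<dots> \<le> (\<Prod>b\<in>Basis. 1 + ((x \<bullet> b) / R) ^ 2)" by (rule prod_one_plus_ge) auto
  also have "\<dots> = Y ^ 2" by (simp only: Y_def prod_power_distrib cmod_cut_factor)
  finally have Y2: "1 + (norm x / R) ^ 2 \<le> Y ^ 2" .
  then have "(norm x / R) ^ 2 \<le> Y ^ 2" by linarith
  then have "norm x / R \<le> Y" by (rule power2_le_imp_le) (use Y1 in linarith)
  then have "norm x \<le> R * Y" using R by (simp add: divide_le_eq mult.commute)
  moreover have "1 \<le> R * Y" using mult_mono[of 1 R 1 Y] R Y1 by simp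
  ultimately have Y3: "1 + norm x \<le> 2 * R * Y" by simp
  have "(\<Prod>b\<in>Basis. inverse (cmod (cut_factor R b x))) = inverse Y"
    unfolding Y_def by (simp add: prod_inversef[symmetric] o_def)
  moreover have "cmod (cutoff M R x) = (\<Prod>b\<in>Basis. inverse (cmod (cut_factor R b x))) ^ M"
    unfolding cutoff_def prod_norm[symmetric] norm_inverse norm_power power_inverse[symmetric] prod_power_distrib[symmetric] ..
  ultimately have "cmod (cutoff M R x) = inverse Y ^ M" by simp
  also have "\<dots> \<le> inverse Y ^ k" using Y1 k by (intro power_decreasing) (auto simp: inverse_le_1_iff)
  also have "\<dots> \<le> (2 * R / (1 + norm x)) ^ k"
    using Y3 Y1 by (intro power_mono) (auto simp: field_simps add_pos_nonneg)
  finally show ?thesis .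
qed

text \<open>The power \<open>R ^ (- k)\<close> produced by differentiation cancels the power of \<open>R\<close> in \<open>cutoff_bound\<close>.\<close>

lemma cutoff_deriv_bound:
  fixes x :: "'a::euclidean_space"
  assumes R: "R \<ge> 1" and k: "k \<le> M"
  shows "cmod (cutoff_deriv M R e k x) \<le> 2 ^ k * pochhammer (real M) k * (1 + norm x) powr (- real k)"
proof -
  have p: "cmod (pochhammer (of_nat M) k) = pochhammer (real M) k"
    by (metis norm_of_nat pochhammer_of_nat)
  have p0: "pochhammer (real M) k \<ge> 0" by (metis of_nat_0_le_iff pochhammer_of_nat)
  have "inverse (cmod (cut_factor R e x) ^ k) \<le> 1"
    using one_le_power[OF cmod_cut_factor_ge_1[of R e x], of k] by (simp add: inverse_le_1_iff)
  then have "cmod (cutoff_deriv M R e k x) \<le> pochhammer (real M) k * (1 / R) ^ k * 1 * (2 * R / (1 + norm x)) ^ k"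
    unfolding cutoff_deriv_def norm_mult norm_inverse norm_power p using R cutoff_bound[OF R k, of x]
    by (intro mult_mono) (auto simp: norm_divide p0 power_divide)
  also have "\<dots> = 2 ^ k * pochhammer (real M) k * (1 / (1 + norm x)) ^ k"
    using R by (simp add: power_divide power_mult_distrib)
  also have "(1 / (1 + norm x)) ^ k = (1 + norm x) powr (- real k)"
    by (simp add: powr_minus powr_realpow add_pos_nonneg power_one_over inverse_eq_divide)
  finally show ?thesis .
qed

lemma cutoff_norm_le_1: "cmod (cutoff M R x) \<le> 1"
  unfolding cutoff_def prod_norm[symmetric]
  by (intro prod_le_1) (auto simp: norm_inverse norm_power inverse_le_1_iff one_le_power cmod_cut_factor_ge_1)

lemma cutoff_continuous: "continuous_on S (cutoff M R :: 'a::euclidean_space \<Rightarrow> complex)"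
proof -
  have "continuous_on S (cut_factor R b)" for b :: 'a
    unfolding cut_factor_def divide_inverse by (intro continuous_intros)
  then show ?thesis unfolding cutoff_def[abs_def] by (intro continuous_intros) (auto simp: cut_factor_nonzero)
qed

lemma cutoff_tendsto_1: "(\<lambda>j. cutoff M (real (Suc j)) x) \<longlonglongrightarrow> 1"
proof -
  have "(\<lambda>j. \<Prod>b\<in>Basis. inverse ((1 + \<i> * of_real ((x \<bullet> b) * inverse (real (Suc j)))) ^ M)) \<longlonglongrightarrow> (\<Prod>b\<in>Basis. inverse ((1 + \<i> * of_real ((x \<bullet> b) * 0)) ^ M))"
    by (intro tendsto_intros LIMSEQ_inverse_real_of_nat) simp
  then show ?thesis by (simp add: cutoff_def cut_factor_def divide_inverse)
qed

section \<open>Leibniz rule\<close>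

text \<open>The \<open>k\<close>-th derivative of a product, in terms of the sequences of derivatives of the factors.\<close>

primrec leibniz :: "nat \<Rightarrow> (nat \<Rightarrow> 'a \<Rightarrow> complex) \<Rightarrow> (nat \<Rightarrow> 'a \<Rightarrow> complex) \<Rightarrow> 'a \<Rightarrow> complex" where
  "leibniz 0 D E x = D 0 x * E 0 x"
| "leibniz (Suc k) D E x = leibniz k (\<lambda>j. D (Suc j)) E x + leibniz k D (\<lambda>j. E (Suc j)) x"

lemma leibniz_has_derivative:
  fixes e :: "'a::real_normed_vector"
  assumes "\<And>k x u. ((\<lambda>u. D k (x + u *\<^sub>R e)) has_vector_derivative D (Suc k) (x + u *\<^sub>R e)) (at u)"
    and "\<And>k x u. ((\<lambda>u. E k (x + u *\<^sub>R e)) has_vector_derivative E (Suc k) (x + u *\<^sub>R e)) (at u)"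
  shows "((\<lambda>u. leibniz k D E (x + u *\<^sub>R e)) has_vector_derivative leibniz (Suc k) D E (x + u *\<^sub>R e)) (at u)"
  using assms
proof (induction k arbitrary: D E)
  case 0
  show ?case using has_vector_derivative_mult[OF 0(1)[of 0] 0(2)[of 0]] by (simp add: add.commute)
next
  case (Suc k)
  have "((\<lambda>u. leibniz k (\<lambda>j. D (Suc j)) E (x + u *\<^sub>R e)) has_vector_derivative leibniz (Suc k) (\<lambda>j. D (Suc j)) E (x + u *\<^sub>R e)) (at u)"
    by (rule Suc.IH) (rule Suc.prems)+
  moreover have "((\<lambda>u. leibniz k D (\<lambda>j. E (Suc j)) (x + u *\<^sub>R e)) has_vector_derivative leibniz (Suc k) D (\<lambda>j. E (Suc j)) (x + u *\<^sub>R e)) (at u)"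
    by (rule Suc.IH) (rule Suc.prems)+
  ultimately have "((\<lambda>u. leibniz k (\<lambda>j. D (Suc j)) E (x + u *\<^sub>R e) + leibniz k D (\<lambda>j. E (Suc j)) (x + u *\<^sub>R e)) has_vector_derivative
      leibniz (Suc k) (\<lambda>j. D (Suc j)) E (x + u *\<^sub>R e) + leibniz (Suc k) D (\<lambda>j. E (Suc j)) (x + u *\<^sub>R e)) (at u)"
    by (rule has_vector_derivative_add)
  then show ?case by simp
qed

lemma leibniz_bound:
  fixes z :: real
  assumes "z > 0" "A \<ge> 0" "B \<ge> 0"
    and "\<And>j. j \<le> k \<Longrightarrow> cmod (D j x) \<le> A * z powr (\<alpha> - \<rho> * real j)"
    and "\<And>j. j \<le> k \<Longrightarrow> cmod (E j x) \<le> B * z powr (\<beta> - \<rho> * real j)"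
  shows "cmod (leibniz k D E x) \<le> 2 ^ k * (A * B) * z powr (\<alpha> + \<beta> - \<rho> * real k)"
  using assms(4,5)
proof (induction k arbitrary: D E \<alpha> \<beta>)
  case 0
  have "cmod (D 0 x) * cmod (E 0 x) \<le> (A * z powr \<alpha>) * (B * z powr \<beta>)"
    using 0(1)[of 0] 0(2)[of 0] assms(2,3) by (intro mult_mono) auto
  then show ?case by (simp add: norm_mult powr_add mult_ac)
next
  case (Suc k)
  have 1: "cmod (leibniz k (\<lambda>j. D (Suc j)) E x) \<le> 2 ^ k * (A * B) * z powr ((\<alpha> - \<rho>) + \<beta> - \<rho> * real k)"
  proof (rule Suc.IH)
    fix j assume "j \<le> k"
    then show "cmod (D (Suc j) x) \<le> A * z powr (\<alpha> - \<rho> - \<rho> * real j)"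
      using Suc.prems(1)[of "Suc j"] by (simp add: algebra_simps)
    show "cmod (E j x) \<le> B * z powr (\<beta> - \<rho> * real j)" using Suc.prems(2)[of j] \<open>j \<le> k\<close> by simp
  qed
  have 2: "cmod (leibniz k D (\<lambda>j. E (Suc j)) x) \<le> 2 ^ k * (A * B) * z powr (\<alpha> + (\<beta> - \<rho>) - \<rho> * real k)"
  proof (rule Suc.IH)
    fix j assume "j \<le> k"
    then show "cmod (E (Suc j) x) \<le> B * z powr (\<beta> - \<rho> - \<rho> * real j)"
      using Suc.prems(2)[of "Suc j"] by (simp add: algebra_simps)
    show "cmod (D j x) \<le> A * z powr (\<alpha> - \<rho> * real j)" using Suc.prems(1)[of j] \<open>j \<le> k\<close> by simp
  qed
  have "cmod (leibniz (Suc k) D E x) \<le> cmod (leibniz k (\<lambda>j. D (Suc j)) E x) + cmod (leibniz k D (\<lambda>j. E (Suc j)) x)"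
    by (simp add: norm_triangle_ineq)
  also have "\<dots> \<le> 2 ^ Suc k * (A * B) * z powr (\<alpha> + \<beta> - \<rho> * real (Suc k))"
    using 1 2 by (simp add: algebra_simps)
  finally show ?case .
qed

section \<open>The truncated kernel of a symbol\<close>

definition coord :: "'m::finite \<times> 'n::finite \<Rightarrow> real^'n^'m" where
  "coord = (\<lambda>(j, i). axis j (axis i 1))"

lemma dir_xi_coord: "dir_xi c = (0, coord c)"
  by (cases c) (simp add: dir_xi_def coord_def)

lemma coord_Basis: "coord c \<in> Basis"
  by (cases c) (auto simp: coord_def axis_in_Basis_iff)

lemma inner_coord: "z \<bullet> coord (j, i) = z $ j $ i"
  by (simp add: coord_def inner_axis)

lemma iter_deriv_has_vector_derivative:
  fixes \<sigma> :: "'a::euclidean_space \<times> 'b::euclidean_space \<Rightarrow> complex"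
  assumes sm: "smooth \<sigma>" and v: "set vs \<subseteq> Basis" and e: "(0, e) \<in> Basis"
  shows "((\<lambda>u. iter_deriv vs \<sigma> (x, \<xi> + u *\<^sub>R e)) has_vector_derivative iter_deriv ((0, e) # vs) \<sigma> (x, \<xi> + u *\<^sub>R e)) (at u)"
proof -
  let ?F = "iter_deriv vs \<sigma>" and ?p = "(x, \<xi> + u *\<^sub>R e)"
  have "?F differentiable (at ?p)" using sm v by (auto simp: smooth_def)
  then have F: "(?F has_derivative frechet_derivative ?F (at ?p)) (at ?p)" by (simp add: frechet_derivative_works)
  have g: "((\<lambda>u. (x, \<xi> + u *\<^sub>R e)) has_derivative (\<lambda>h. h *\<^sub>R (0, e))) (at u)"
    by (auto intro!: derivative_eq_intros)
  have "((\<lambda>u. ?F (x, \<xi> + u *\<^sub>R e)) has_derivative (\<lambda>h. frechet_derivative ?F (at ?p) (h *\<^sub>R (0, e)))) (at u)"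
    by (rule has_derivative_compose[OF g F])
  moreover have "frechet_derivative ?F (at ?p) (h *\<^sub>R (0, e)) = h *\<^sub>R frechet_derivative ?F (at ?p) (0, e)" for h
    using F by (intro linear_scale has_derivative_linear)
  ultimately show ?thesis by (simp add: has_vector_derivative_def)
qed

lemma norm_le_sum_components: "norm (\<xi> :: real^'n::finite^'m::finite) \<le> (\<Sum>j\<in>UNIV. norm (\<xi> $ j))"
  unfolding norm_vec_def by (rule L2_set_le_sum) simp

lemma symbol_directional_bound:
  fixes \<sigma> :: "(real^'n::finite) \<times> (real^'n^'m::finite) \<Rightarrow> complex"
  assumes \<sigma>: "\<sigma> \<in> symbol_class l \<rho> \<delta>" and rho: "0 \<le> \<rho>" and l: "l \<le> 0"
  obtains A where "A \<ge> 0" "\<And>k c x \<xi>. k \<le> N \<Longrightarrow>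
    cmod (iter_deriv (replicate k (dir_xi c)) \<sigma> (x, \<xi>)) \<le> A * (1 + norm \<xi>) powr (l - \<rho> * real k)"
proof -
  have "\<exists>C::real. \<forall>x \<xi>. cmod (iter_deriv (replicate k (dir_xi c)) \<sigma> (x, \<xi>))
          \<le> C * (1 + (\<Sum>j\<in>UNIV. norm (\<xi> $ j))) powr (l - \<rho> * real k)" for k and c :: "'m \<times> 'n"
  proof -
    have "\<forall>(is :: 'n list) (ks :: ('m \<times> 'n) list). \<exists>C::real. \<forall>x \<xi>.
        cmod (iter_deriv (map dir_x is @ map dir_xi ks) \<sigma> (x, \<xi>))
          \<le> C * (1 + (\<Sum>j\<in>UNIV. norm (\<xi> $ j))) powr (l - \<rho> * real (length ks) + \<delta> * real (length is))"
      using \<sigma> by (simp add: symbol_class_def)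
    from this[rule_format, of "[]" "replicate k c"] show ?thesis by simp
  qed
  then obtain C where C: "\<And>k c x \<xi>. cmod (iter_deriv (replicate k (dir_xi (c :: 'm \<times> 'n))) \<sigma> (x, \<xi>))
          \<le> C k c * (1 + (\<Sum>j\<in>UNIV. norm (\<xi> $ j))) powr (l - \<rho> * real k)" by metis
  define A where "A = (\<Sum>k\<le>N. \<Sum>c\<in>UNIV. \<bar>C k c\<bar>)"
  show thesis
  proof (rule that[of A])
    show "A \<ge> 0" unfolding A_def by (intro sum_nonneg) auto
    fix k and c :: "'m \<times> 'n" and x \<xi> assume k: "k \<le> N"
    have "\<bar>C k c\<bar> \<le> (\<Sum>c\<in>UNIV. \<bar>C k c\<bar>)" by (rule member_le_sum) auto
    also have "\<dots> \<le> A" unfolding A_def using k by (intro member_le_sum) (auto intro!: sum_nonneg)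
    finally have CA: "C k c \<le> A" by simp
    have "cmod (iter_deriv (replicate k (dir_xi c)) \<sigma> (x, \<xi>)) \<le> C k c * (1 + (\<Sum>j\<in>UNIV. norm (\<xi> $ j))) powr (l - \<rho> * real k)" by (rule C)
    also have "\<dots> \<le> A * (1 + (\<Sum>j\<in>UNIV. norm (\<xi> $ j))) powr (l - \<rho> * real k)" using CA by (intro mult_right_mono) auto
    also have "\<dots> \<le> A * (1 + norm \<xi>) powr (l - \<rho> * real k)"
    proof -
      have "\<rho> * real k \<ge> 0" using rho by simp
      then have "l - \<rho> * real k \<le> 0" using l by linarith
      then have "(1 + (\<Sum>j\<in>UNIV. norm (\<xi> $ j))) powr (l - \<rho> * real k) \<le> (1 + norm \<xi>) powr (l - \<rho> * real k)"
        using norm_le_sum_components[of \<xi>] by (intro powr_mono2') (auto simp: add_pos_nonneg)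
      then show ?thesis using \<open>A \<ge> 0\<close> by (rule mult_left_mono)
    qed
    finally show "cmod (iter_deriv (replicate k (dir_xi c)) \<sigma> (x, \<xi>)) \<le> A * (1 + norm \<xi>) powr (l - \<rho> * real k)" .
  qed
qed

lemma smooth_continuous:
  assumes "smooth \<sigma>"
  shows "continuous_on S \<sigma>"
proof -
  have "iter_deriv [] \<sigma> differentiable (at z)" for z using assms unfolding smooth_def by (metis empty_set empty_subsetI)
  then show ?thesis by (simp add: differentiable_imp_continuous_within continuous_at_imp_continuous_on)
qed

lemma truncated_symbol_continuous:
  fixes \<sigma> :: "'a::euclidean_space \<times> 'b::euclidean_space \<Rightarrow> complex"
  assumes "smooth \<sigma>"
  shows "continuous_on UNIV (\<lambda>\<xi>. \<sigma> (x, \<xi>) * cutoff N R \<xi>)"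
proof -
  have "continuous_on UNIV (\<lambda>\<xi>. \<sigma> (x, \<xi>))"
    by (rule continuous_on_compose2[OF smooth_continuous[OF assms, of UNIV]]) (auto intro!: continuous_intros)
  then show ?thesis by (intro continuous_on_mult cutoff_continuous)
qed

lemma truncated_symbol_integrable:
  fixes \<sigma> :: "'a::euclidean_space \<times> 'b::euclidean_space \<Rightarrow> complex"
  assumes sm: "smooth \<sigma>" and bd: "\<And>\<xi>. cmod (\<sigma> (x, \<xi>)) \<le> A * (1 + norm \<xi>) powr l" and l: "l \<le> 0" and A: "A \<ge> 0"
    and N: "DIM('b) < N" and R: "R \<ge> 1"
  shows "integrable lborel (\<lambda>\<xi>. \<sigma> (x, \<xi>) * cutoff N R \<xi>)"
proof (rule integrableI_bounded)
  have "(\<lambda>\<xi>. \<sigma> (x, \<xi>) * cutoff N R \<xi>) \<in> borel_measurable borel"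
    by (intro borel_measurable_continuous_onI truncated_symbol_continuous sm)
  then show "(\<lambda>\<xi>. \<sigma> (x, \<xi>) * cutoff N R \<xi>) \<in> borel_measurable lborel" by simp
  have "(\<integral>\<^sup>+\<xi>. ennreal (cmod (\<sigma> (x, \<xi>) * cutoff N R \<xi>)) \<partial>lborel)
     \<le> (\<integral>\<^sup>+\<xi>. ennreal (A * (2 * R) ^ N) * ennreal ((1 + norm \<xi>) powr (- real N)) \<partial>(lborel :: 'b measure))"
  proof (rule nn_integral_mono)
    fix \<xi> :: 'b
    have "cmod (\<sigma> (x, \<xi>)) \<le> A * (1 + norm \<xi>) powr l" by (rule bd)
    also have "\<dots> \<le> A * (1 + norm \<xi>) powr 0" using A l by (intro mult_left_mono powr_mono) auto
    moreover have "1 + norm \<xi> > 0" by (simp add: add_pos_nonneg)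
    ultimately have s: "cmod (\<sigma> (x, \<xi>)) \<le> A" by simp
    have "cmod (cutoff N R \<xi>) \<le> (2 * R / (1 + norm \<xi>)) ^ N" by (rule cutoff_bound[OF R]) simp
    also have "\<dots> = (2 * R) ^ N * (1 + norm \<xi>) powr (- real N)"
      by (simp add: powr_minus powr_realpow add_pos_nonneg power_divide divide_inverse power_mult_distrib power_inverse)
    finally have "cmod (\<sigma> (x, \<xi>) * cutoff N R \<xi>) \<le> A * ((2 * R) ^ N * (1 + norm \<xi>) powr (- real N))"
      unfolding norm_mult using s A by (intro mult_mono) auto
    then have "ennreal (cmod (\<sigma> (x, \<xi>) * cutoff N R \<xi>)) \<le> ennreal (A * (2 * R) ^ N * (1 + norm \<xi>) powr (- real N))"
      by (intro ennreal_leI) (simp add: mult.assoc)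
    also have "\<dots> = ennreal (A * (2 * R) ^ N) * ennreal ((1 + norm \<xi>) powr (- real N))"
      using A R by (intro ennreal_mult) auto
    finally show "ennreal (cmod (\<sigma> (x, \<xi>) * cutoff N R \<xi>)) \<le> \<dots>" .
  qed
  also have "\<dots> < \<infinity>"
    using nn_integral_japanese_bracket_finite[where 'a = 'b, of "- real N"] N
    by (subst nn_integral_cmult) (auto simp: ennreal_mult_less_top)
  finally show "(\<integral>\<^sup>+\<xi>. ennreal (cmod (\<sigma> (x, \<xi>) * cutoff N R \<xi>)) \<partial>lborel) < \<infinity>" .
qed

text \<open>The cutoff behaves like a symbol of order \<open>0\<close> uniformly in \<open>R\<close>; so the product with \<open>\<sigma>\<close> satisfies the symbol estimates
  of \<open>\<sigma>\<close> with a constant independent of \<open>R\<close> and \<open>x\<close>.\<close>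

lemma truncated_symbol_amplitude:
  fixes \<sigma> :: "(real^'n::finite) \<times> (real^'n^'m::finite) \<Rightarrow> complex"
  assumes sm: "smooth \<sigma>" and rho: "0 \<le> \<rho>" "\<rho> \<le> 1" and l: "l \<le> 0" and A: "A \<ge> 0"
    and bd: "\<And>k \<xi>. k \<le> N \<Longrightarrow> cmod (iter_deriv (replicate k (dir_xi c)) \<sigma> (x, \<xi>)) \<le> A * (1 + norm \<xi>) powr (l - \<rho> * real k)"
    and N: "DIM(real^'n^'m) < N" and R: "R \<ge> 1"
  shows "symbol_amplitude l \<rho> (2 ^ N * (A * (\<Sum>k\<le>N. 2 ^ k * pochhammer (real N) k)))
     (\<lambda>k. leibniz k (\<lambda>k \<xi>. iter_deriv (replicate k (dir_xi c)) \<sigma> (x, \<xi>)) (cutoff_deriv N R (coord c))) (coord c) N"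
    (is "symbol_amplitude l \<rho> ?B (\<lambda>k. leibniz k ?D ?E) ?e N")
proof -
  define P where "P = (\<Sum>k\<le>N. 2 ^ k * pochhammer (real N) k)"
  have p0: "pochhammer (real N) k \<ge> 0" for k by (metis of_nat_0_le_iff pochhammer_of_nat)
  have P0: "P \<ge> 0" unfolding P_def using p0 by (intro sum_nonneg) auto
  have Eb: "cmod (?E k \<xi>) \<le> P * (1 + norm \<xi>) powr (0 - \<rho> * real k)" if k: "k \<le> N" for k and \<xi> :: "real^'n^'m"
  proof -
    have "cmod (?E k \<xi>) \<le> 2 ^ k * pochhammer (real N) k * (1 + norm \<xi>) powr (- real k)" by (rule cutoff_deriv_bound[OF R k])
    also have "\<dots> \<le> P * (1 + norm \<xi>) powr (- real k)"
      unfolding P_def using k p0 by (intro mult_right_mono member_le_sum) auto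
    also have "\<dots> \<le> P * (1 + norm \<xi>) powr (0 - \<rho> * real k)"
      using P0 rho by (intro mult_left_mono powr_mono) (auto simp: mult_left_le_one_le)
    finally show ?thesis .
  qed
  have L: "cmod (leibniz k ?D ?E \<xi>) \<le> 2 ^ N * (A * P) * (1 + norm \<xi>) powr (l - \<rho> * real k)" if k: "k \<le> N" for k \<xi>
  proof -
    have "cmod (leibniz k ?D ?E \<xi>) \<le> 2 ^ k * (A * P) * (1 + norm \<xi>) powr (l + 0 - \<rho> * real k)"
    proof (rule leibniz_bound)
      show "0 < 1 + norm \<xi>" by (simp add: add_pos_nonneg)
    qed (use k A P0 in \<open>auto intro: bd Eb[simplified]\<close>)
    also have "\<dots> \<le> 2 ^ N * (A * P) * (1 + norm \<xi>) powr (l + 0 - \<rho> * real k)"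
      using k A P0 by (intro mult_right_mono power_increasing) auto
    finally show ?thesis by simp
  qed
  have R0: "R \<noteq> 0" using R by simp
  have Dd: "((\<lambda>u. ?D k (\<xi> + u *\<^sub>R ?e)) has_vector_derivative ?D (Suc k) (\<xi> + u *\<^sub>R ?e)) (at u)" for k \<xi> u
  proof -
    have b: "dir_xi c \<in> Basis" by (auto simp: dir_xi_coord Basis_prod_def coord_Basis)
    then have "set (replicate k (dir_xi c)) \<subseteq> Basis" by (simp add: set_replicate_conv_if)
    from iter_deriv_has_vector_derivative[OF sm this b[unfolded dir_xi_coord], of x \<xi> u]
    show ?thesis by (simp add: dir_xi_coord)
  qed
  show ?thesis
  proof
    show "((\<lambda>u. leibniz k ?D ?E (\<xi> + u *\<^sub>R ?e)) has_vector_derivative leibniz (Suc k) ?D ?E (\<xi> + u *\<^sub>R ?e)) (at u)" for k \<xi> u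
      by (intro leibniz_has_derivative Dd cutoff_deriv_has_derivative coord_Basis R0)
    show "cmod (leibniz 0 ?D ?E \<xi>) \<le> ?B * (1 + norm \<xi>) powr l" for \<xi> using L[of 0 \<xi>] by (simp add: P_def)
    show "cmod (leibniz N ?D ?E \<xi>) \<le> ?B * (1 + norm \<xi>) powr (l - \<rho> * real N)" for \<xi> using L[of N \<xi>] by (simp add: P_def)
    have "integrable lborel (\<lambda>\<xi>. \<sigma> (x, \<xi>) * cutoff N R \<xi>)"
      using bd[of 0] by (intro truncated_symbol_integrable[OF sm _ l A N R]) simp
    moreover have "leibniz 0 ?D ?E = (\<lambda>\<xi>. \<sigma> (x, \<xi>) * cutoff N R \<xi>)" by (rule ext) (simp add: cutoff_deriv_0)
    ultimately show "integrable lborel (leibniz 0 ?D ?E)" by simp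
    show "?B \<ge> 0" using A P0 by (simp add: P_def)
    show "N > 0" using N by simp
    show "norm ?e = 1" using coord_Basis by (rule norm_Basis)
  qed fact+
qed

text \<open>The scales: \<open>2, 4, 8, \<dots>\<close> at the even indices and \<open>1, 1 / 2, 1 / 4, \<dots>\<close> at the odd ones.\<close>

definition scale_side :: "nat \<Rightarrow> real" where
  "scale_side k = (if even k then 2 ^ (k div 2 + 1) else (1 / 2) ^ (k div 2))"

text \<open>The size of a kernel at distance comparable to the scale \<open>t\<close>, times \<open>t ^ d\<close>: of order \<open>t powr (-1)\<close> for the large
  scales and \<open>t powr (d - a)\<close> for the small ones.\<close>

definition scale_weight :: "nat \<Rightarrow> real \<Rightarrow> real \<Rightarrow> nat \<Rightarrow> real" where
  "scale_weight d a C k = C * (if even k then 2 ^ d * (1 / 2) ^ (k div 2) else 2 powr a * (2 powr (a - real d)) ^ (k div 2))"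

text \<open>A scale above \<open>s\<close> and comparable to it contributes a term that dominates \<open>v\<close>. For \<open>s = 0\<close> all small scales contribute
  and the series diverges.\<close>

lemma scale_majorant:
  fixes a C :: real and d :: nat
  assumes a: "0 < a" "a < real d" and C: "C > 0"
  defines "t \<equiv> scale_side" and "wt \<equiv> scale_weight d a C"
  shows "t k > 0" and "wt k \<ge> 0" and "summable wt"
    and "s \<ge> 0 \<Longrightarrow> (s \<ge> 1 / 2 \<Longrightarrow> v \<le> C * (1 / (2 * s)) ^ (d + 1)) \<Longrightarrow> (0 < s \<Longrightarrow> s < 1 / 2 \<Longrightarrow> v \<le> C * (1 / (2 * s)) powr a)
      \<Longrightarrow> ennreal v \<le> (\<Sum>k. ennreal (wt k / t k ^ d) * of_bool (s \<le> t k))"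
proof -
  show t0: "t k > 0" for k by (simp add: t_def scale_side_def)
  show l0: "wt k \<ge> 0" for k using C by (simp add: wt_def scale_weight_def)
  define g where "g = max (1 / 2) (2 powr (a - real d))"
  have g: "0 < g" "g < 1" using a by (auto simp: g_def powr_less_one)
  have gk: "g ^ (k div 2) \<le> 1 / g * sqrt g ^ k" for k
  proof -
    have "g * g ^ (k div 2) = sqrt g ^ (2 * (k div 2) + 2)" using g by (simp add: power_mult power_add)
    also have "\<dots> \<le> sqrt g ^ k" using g by (intro power_decreasing) auto
    finally show ?thesis using g by (simp add: field_simps)
  qed
  show "summable wt"
  proof (rule summable_comparison_test'[of "\<lambda>k. C * (2 ^ d + 2 powr a) * (1 / g) * sqrt g ^ k"])
    show "summable (\<lambda>k. C * (2 ^ d + 2 powr a) * (1 / g) * sqrt g ^ k)"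
      using g by (intro summable_mult summable_geometric) auto
    fix k :: nat
    have 1: "(1 / 2) ^ (k div 2) \<le> g ^ (k div 2)" "(2 powr (a - real d)) ^ (k div 2) \<le> g ^ (k div 2)"
      by (intro power_mono, simp_all add: g_def)+
    have "(if even k then 2 ^ d * (1 / 2) ^ (k div 2) else 2 powr a * (2 powr (a - real d)) ^ (k div 2)) \<le> (2 ^ d + 2 powr a) * g ^ (k div 2)"
      using 1 g by (auto intro!: mult_mono)
    also have "\<dots> \<le> (2 ^ d + 2 powr a) * (1 / g * sqrt g ^ k)" using gk by (intro mult_left_mono) auto
    finally have "wt k \<le> C * ((2 ^ d + 2 powr a) * (1 / g * sqrt g ^ k))" unfolding wt_def scale_weight_def using C by (intro mult_left_mono) auto
    then show "norm (wt k) \<le> C * (2 ^ d + 2 powr a) * (1 / g) * sqrt g ^ k" using l0[of k] by (simp add: mult.assoc)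
  qed
  assume s: "s \<ge> 0" and v1: "s \<ge> 1 / 2 \<Longrightarrow> v \<le> C * (1 / (2 * s)) ^ (d + 1)" and v2: "0 < s \<Longrightarrow> s < 1 / 2 \<Longrightarrow> v \<le> C * (1 / (2 * s)) powr a"
  define f where "f k = ennreal (wt k / t k ^ d) * of_bool (s \<le> t k)" for k
  have point: "f k \<le> (\<Sum>k. f k)" for k using sum_le_suminf[of f "{k}"] by simp
  have odd_val: "wt (2 * j + 1) / t (2 * j + 1) ^ d = C * (2 powr a * (2 powr a) ^ j)" for j
  proof -
    have "((1 / 2) ^ j :: real) ^ d = inverse ((2 ^ d) ^ j)" by (simp add: power_one_over inverse_eq_divide power_mult[symmetric] mult.commute)
    moreover have "(2 powr (a - real d)) ^ j = (2 powr a) ^ j / (2 ^ d) ^ j" by (simp add: powr_diff powr_realpow power_divide)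
    ultimately show ?thesis by (simp add: wt_def scale_weight_def t_def scale_side_def field_simps)
  qed
  have even_val: "wt (2 * j) / t (2 * j) ^ d = C * (1 / 2 ^ j) ^ (d + 1)" for j
    by (simp add: wt_def scale_weight_def t_def scale_side_def power_mult_distrib power_divide power_add mult.commute[of d] flip: power_mult)
  show "ennreal v \<le> (\<Sum>k. ennreal (wt k / t k ^ d) * of_bool (s \<le> t k))"
  proof -
    \<comment> \<open>large \<open>s\<close>: even indices; small \<open>s\<close>: odd indices\<close>
    consider "s \<ge> 1 / 2" | "0 < s" "s < 1 / 2" | "s = 0" using s by linarith
    then have "ennreal v \<le> (\<Sum>k. f k)"
    proof cases
      case 1
      define j where "j = nat \<lfloor>log 2 (2 * s)\<rfloor>"
      have "log 2 (2 * s) \<ge> 0" using 1 zero_le_log_cancel_iff[of 2 "2 * s"] by simp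
      then have j: "real j \<le> log 2 (2 * s)" "log 2 (2 * s) < real (Suc j)" unfolding j_def by linarith+
      then have "2 powr real j \<le> 2 * s" "2 * s < 2 powr real (Suc j)"
        using le_log_iff[of 2 "2 * s" "real j"] log_less_iff[of 2 "2 * s" "real (Suc j)"] 1 by simp_all
      then have j: "2 ^ j \<le> 2 * s" "2 * s < 2 ^ Suc j"
        unfolding powr_realpow[OF zero_less_numeral, of _ j] powr_realpow[OF zero_less_numeral, of _ "Suc j"] .
      have "v \<le> C * (1 / (2 * s)) ^ (d + 1)" using v1[OF 1] .
      also have "\<dots> \<le> C * (1 / 2 ^ j) ^ (d + 1)"
        using j(1) 1 C by (intro mult_left_mono power_mono divide_left_mono) auto
      finally have "ennreal v \<le> ennreal (wt (2 * j) / t (2 * j) ^ d)" unfolding even_val by (rule ennreal_leI)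
      also have "\<dots> = f (2 * j)" using j(2) 1 by (simp add: f_def t_def scale_side_def)
      also note point
      finally show ?thesis .
    next
      case 2
      define r where "r = 1 / (2 * s)"
      have r: "r > 1" using 2 by (simp add: r_def)
      define j where "j = nat \<lfloor>log 2 r\<rfloor>"
      have "log 2 r \<ge> 0" using r zero_le_log_cancel_iff[of 2 r] by simp
      then have j: "real j \<le> log 2 r" "log 2 r < real (Suc j)" unfolding j_def by linarith+
      then have "2 powr real j \<le> r" "r < 2 powr real (Suc j)"
        using le_log_iff[of 2 r "real j"] log_less_iff[of 2 r "real (Suc j)"] r by simp_all
      then have j: "2 ^ j \<le> r" "r < 2 ^ Suc j"
        unfolding powr_realpow[OF zero_less_numeral, of _ j] powr_realpow[OF zero_less_numeral, of _ "Suc j"] .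
      have "v \<le> C * r powr a" using v2[OF 2] by (simp add: r_def)
      also have "\<dots> \<le> C * (2 ^ Suc j) powr a" using j(2) r C a by (intro mult_left_mono powr_mono2) auto
      also have "(2 ^ Suc j :: real) powr a = 2 powr a * (2 powr a) ^ j"
        by (simp add: powr_mult powr_powr mult.commute flip: powr_realpow)
      finally have "ennreal v \<le> ennreal (wt (2 * j + 1) / t (2 * j + 1) ^ d)" unfolding odd_val by (rule ennreal_leI)
      also have "\<dots> = f (2 * j + 1)"
      proof -
        have "2 ^ j * (2 * s) \<le> 1" using j(1) 2 by (simp add: r_def field_simps)
        then have "2 ^ j * s \<le> 1" using 2 mult_left_mono[of s "2 * s" "2 ^ j"] by simp
        then have "s \<le> (1 / 2) ^ j" by (simp add: power_one_over field_simps)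
        then show ?thesis by (simp add: f_def t_def scale_side_def)
      qed
      also note point
      finally show ?thesis .
    next
      case 3
      obtain n :: nat where n: "v / C \<le> real n" using real_arch_simple by blast
      have "ennreal v \<le> ennreal (\<Sum>j<n. C)" using n C by (intro ennreal_leI) (simp add: field_simps)
      also have "\<dots> = (\<Sum>j<n. ennreal C)" using C by (intro sum_ennreal[symmetric]) auto
      also have "\<dots> \<le> (\<Sum>j<n. f (2 * j + 1))"
      proof (rule sum_mono)
        fix j
        have "1 \<le> 2 powr a" using a by (simp add: ge_one_powr_ge_zero)
        then have "1 * 1 \<le> 2 powr a * (2 powr a) ^ j" by (intro mult_mono one_le_power) auto
        then have "C \<le> wt (2 * j + 1) / t (2 * j + 1) ^ d" unfolding odd_val using C by simp
        then show "ennreal C \<le> f (2 * j + 1)" using 3 t0[of "2 * j + 1"] by (simp add: f_def ennreal_leI less_imp_le)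
      qed
      also have "\<dots> = (\<Sum>k\<in>(\<lambda>j. 2 * j + 1) ` {..<n}. f k)" by (subst sum.reindex) (auto intro: inj_onI)
      also have "\<dots> \<le> (\<Sum>k. f k)" by (intro sum_le_suminf) auto
      finally show ?thesis .
    qed
    then show ?thesis by (simp add: f_def)
  qed
qed

definition trunc_kernel :: "((real^'n::finite) \<times> (real^'n^'m::finite) \<Rightarrow> complex) \<Rightarrow> nat \<Rightarrow> real \<Rightarrow> real^'n \<Rightarrow> real^'n^'m \<Rightarrow> complex" where
  "trunc_kernel \<sigma> N R x z = (LINT \<xi>|lebesgue. \<sigma> (x, \<xi>) * cutoff N R \<xi> * cis (2 * pi * (z \<bullet> \<xi>)))"

lemma trunc_kernel_lborel:
  assumes "smooth \<sigma>"
  shows "trunc_kernel \<sigma> N R x z = (LINT \<xi>|lborel. \<sigma> (x, \<xi>) * cutoff N R \<xi> * cis (2 * pi * (z \<bullet> \<xi>)))"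
  unfolding trunc_kernel_def
proof (rule integral_completion)
  have [measurable]: "(\<lambda>\<xi>. \<sigma> (x, \<xi>) * cutoff N R \<xi>) \<in> borel_measurable borel"
    by (intro borel_measurable_continuous_onI truncated_symbol_continuous assms)
  show "(\<lambda>\<xi>. \<sigma> (x, \<xi>) * cutoff N R \<xi> * cis (2 * pi * (z \<bullet> \<xi>))) \<in> borel_measurable lborel" by measurable
qed

text \<open>Choosing the coordinate of \<open>z\<close> of largest size in the decay estimate turns it into a bound by a
  convergent series of normalised indicator functions of balls, at all dyadic scales. It holds uniformly in
  the cutoff.\<close>

lemma kernel_majorant:
  fixes \<sigma> :: "(real^'n::finite) \<times> (real^'n^'m::finite) \<Rightarrow> complex"
  assumes rho: "0 \<le> \<rho>" "\<rho> \<le> 1" and \<sigma>: "\<sigma> \<in> symbol_class l \<rho> \<delta>"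
    and l: "l < real CARD('m) * real CARD('n) * (\<rho> - 1)"
  obtains wt t :: "nat \<Rightarrow> real" and N where "\<And>k. wt k \<ge> 0" "\<And>k. t k > 0" "summable wt"
    "\<And>x R z. R \<ge> 1 \<Longrightarrow> ennreal (cmod (trunc_kernel \<sigma> N R x z))
        \<le> (\<Sum>k. ennreal (wt k / t k ^ (CARD('m) * CARD('n))) * of_bool (\<forall>j i. \<bar>z $ j $ i\<bar> \<le> t k))"
    "\<And>x R. R \<ge> 1 \<Longrightarrow> integrable lebesgue (\<lambda>\<xi>. \<sigma> (x, \<xi>) * cutoff N R \<xi>)"
proof -
  define d where "d = CARD('m) * CARD('n)"
  have d: "d > 0" by (simp add: d_def)
  have dim: "DIM(real^'n^'m) = d" by (simp add: d_def)
  define N where "N = d + 1"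
  have sm: "smooth \<sigma>" using \<sigma> by (simp add: symbol_class_def)
  have l': "l < real d * \<rho> - real d" using l by (simp add: d_def algebra_simps)
  have "real d * \<rho> \<le> real d" using rho by (simp add: mult_left_le)
  then have l0: "l \<le> 0" using l' by linarith
  \<comment> \<open>\<open>\<eta>\<close> is the gain in \<open>l < d * \<rho> - d\<close>; half of it is spent to have \<open>a < d\<close>.\<close>
  define \<eta> where "\<eta> = min 1 (real d * \<rho> - real d - l)"
  have \<eta>: "0 < \<eta>" "\<eta> \<le> 1" "\<eta> \<le> real d * \<rho> - real d - l" using l' by (auto simp: \<eta>_def)
  define a where "a = real d - \<eta> / 2"
  have a: "0 < a" "a < real d" using \<eta> d by (auto simp: a_def)
  have "\<rho> * \<eta> \<le> 1 * \<eta>" using rho \<eta> by (intro mult_right_mono) auto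
  moreover have "\<rho> * a = real d * \<rho> - \<rho> * \<eta> / 2" by (simp add: a_def algebra_simps)
  ultimately have la: "l - \<rho> * a < - real d" using \<eta> by linarith
  have "\<rho> * real N \<ge> \<rho> * real d" using rho by (intro mult_left_mono) (auto simp: N_def)
  then have lN: "l - \<rho> * real N < - real d" using l' by (simp add: mult.commute)
  obtain A where A: "A \<ge> 0" "\<And>k c x \<xi>. k \<le> N \<Longrightarrow>
    cmod (iter_deriv (replicate k (dir_xi c)) \<sigma> (x, \<xi>)) \<le> A * (1 + norm \<xi>) powr (l - \<rho> * real k)"
    using symbol_directional_bound[OF \<sigma> rho(1) l0, of N] by blast
  have N0: "0 < N" "0 \<le> a" "a \<le> real N" "DIM(real^'n^'m) < N" using a by (auto simp: N_def d_def)
  obtain C0 where C0: "C0 \<ge> 0" "\<And>B D (e::real^'n^'m) z. symbol_amplitude l \<rho> B D e N \<Longrightarrow> z \<bullet> e \<noteq> 0 \<Longrightarrow>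
     cmod (LINT x|lborel. D 0 x * cis (2 * pi * (z \<bullet> x)))
       \<le> C0 * B * (if \<bar>z \<bullet> e\<bar> \<ge> 1 / 2 then (1 / (2 * \<bar>z \<bullet> e\<bar>)) ^ N else (1 / (2 * \<bar>z \<bullet> e\<bar>)) powr a)"
    using kernel_decay[where 'a = "real^'n^'m", OF rho l0 N0(1-3), unfolded dim, OF lN la] by blast
  define B where "B = 2 ^ N * (A * (\<Sum>k\<le>N. 2 ^ k * pochhammer (real N) k))"
  have p0: "pochhammer (real N) k \<ge> 0" for k by (metis of_nat_0_le_iff pochhammer_of_nat)
  have B0: "B \<ge> 0" unfolding B_def using A(1) p0 by (intro mult_nonneg_nonneg sum_nonneg) auto
  define C where "C = C0 * B + 1"
  have C: "C > 0" using C0 B0 by (simp add: C_def add_nonneg_pos)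
  have amp: "symbol_amplitude l \<rho> B (\<lambda>k. leibniz k (\<lambda>k \<xi>. iter_deriv (replicate k (dir_xi c)) \<sigma> (x, \<xi>)) (cutoff_deriv N R (coord c))) (coord c) N"
    if "R \<ge> 1" for R x c
    unfolding B_def by (rule truncated_symbol_amplitude[OF sm rho l0 A N0(4) that])
  have K: "cmod (trunc_kernel \<sigma> N R x z) \<le> C * (if \<bar>z $ j $ i\<bar> \<ge> 1 / 2 then (1 / (2 * \<bar>z $ j $ i\<bar>)) ^ (d + 1) else (1 / (2 * \<bar>z $ j $ i\<bar>)) powr a)"
    if R: "R \<ge> 1" and z: "z $ j $ i \<noteq> 0" for R x z j i
  proof -
    have "cmod (trunc_kernel \<sigma> N R x z) \<le> C0 * B * (if \<bar>z $ j $ i\<bar> \<ge> 1 / 2 then (1 / (2 * \<bar>z $ j $ i\<bar>)) ^ N else (1 / (2 * \<bar>z $ j $ i\<bar>)) powr a)"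
      using C0(2)[OF amp[OF R, where c = "(j, i)" and x = x], of z, unfolded inner_coord, OF z] unfolding trunc_kernel_lborel[OF sm]
      by (simp only: leibniz.simps replicate_0 iter_deriv.simps cutoff_deriv_0)
    also have "\<dots> \<le> C * (if \<bar>z $ j $ i\<bar> \<ge> 1 / 2 then (1 / (2 * \<bar>z $ j $ i\<bar>)) ^ N else (1 / (2 * \<bar>z $ j $ i\<bar>)) powr a)"
      by (rule mult_right_mono) (auto simp: C_def)
    finally show ?thesis unfolding N_def .
  qed
  define t where "t = scale_side"
  define wt where "wt = scale_weight d a C"
  note sc = scale_majorant[OF a C, folded t_def wt_def]
  show thesis
  proof (rule that[of wt t N])
    show "wt k \<ge> 0" "t k > 0" for k using sc(1,2) by blast+
    show "summable wt" by (rule sc(3))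
    fix x and R :: real assume R: "R \<ge> 1"
    have "integrable lborel (\<lambda>\<xi>. \<sigma> (x, \<xi>) * cutoff N R \<xi>)"
      using A(2)[of 0] by (intro truncated_symbol_integrable[OF sm _ l0 A(1) N0(4) R]) simp
    moreover have "(\<lambda>\<xi>. \<sigma> (x, \<xi>) * cutoff N R \<xi>) \<in> borel_measurable lborel"
      using borel_measurable_continuous_onI[OF truncated_symbol_continuous[OF sm]] by simp
    ultimately show "integrable lebesgue (\<lambda>\<xi>. \<sigma> (x, \<xi>) * cutoff N R \<xi>)" by (simp add: integrable_completion)
    fix z :: "real^'n^'m"
    define s where "s = Max (range (\<lambda>(j, i). \<bar>z $ j $ i\<bar>))"
    have "s \<in> range (\<lambda>(j, i). \<bar>z $ j $ i\<bar>)" unfolding s_def by (rule Max_in) auto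
    then obtain j i where ji: "s = \<bar>z $ j $ i\<bar>" by auto
    have le: "\<bar>z $ j' $ i'\<bar> \<le> s" for j' i'
      unfolding s_def by (rule Max_ge) (auto intro: rev_image_eqI[of "(j', i')"])
    have iff: "(\<forall>j i. \<bar>z $ j $ i\<bar> \<le> u) \<longleftrightarrow> s \<le> u" for u using le ji by (meson order_trans order_refl)
    have "ennreal (cmod (trunc_kernel \<sigma> N R x z)) \<le> (\<Sum>k. ennreal (wt k / t k ^ d) * of_bool (s \<le> t k))"
    proof (rule sc(4))
      show "s \<ge> 0" using ji by simp
      show "cmod (trunc_kernel \<sigma> N R x z) \<le> C * (1 / (2 * s)) ^ (d + 1)" if "1 / 2 \<le> s"
        using K[OF R, of z j i x] that ji by (auto split: if_splits)
      show "cmod (trunc_kernel \<sigma> N R x z) \<le> C * (1 / (2 * s)) powr a" if "0 < s" "s < 1 / 2"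
        using K[OF R, of z j i x] that ji by (auto split: if_splits)
    qed
    then show "ennreal (cmod (trunc_kernel \<sigma> N R x z))
        \<le> (\<Sum>k. ennreal (wt k / t k ^ (CARD('m) * CARD('n))) * of_bool (\<forall>j i. \<bar>z $ j $ i\<bar> \<le> t k))"
      unfolding iff d_def .
  qed
qed

section \<open>Representation of the truncated operator\<close>

lemma sigma_finite_lebesgue: "sigma_finite_measure (lebesgue :: 'a::euclidean_space measure)"
proof
  show "\<exists>A. countable A \<and> A \<subseteq> sets lebesgue \<and> \<Union>A = space (lebesgue :: 'a measure) \<and> (\<forall>a\<in>A. emeasure lebesgue a \<noteq> \<infinity>)"
  proof (intro exI[of _ "range (\<lambda>k::nat. cball (0::'a) (real k))"] conjI ballI)
    show "\<Union> (range (\<lambda>k::nat. cball (0::'a) (real k))) = space lebesgue"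
      using real_arch_simple by (auto simp: mem_cball)
    fix a assume "a \<in> range (\<lambda>k::nat. cball (0::'a) (real k))"
    then show "emeasure lebesgue a \<noteq> \<infinity>" using emeasure_lborel_cball_finite by (auto simp: top.not_eq_extremum)
  qed auto
qed

abbreviation prod_leb :: "('m::finite \<Rightarrow> 'a::euclidean_space) measure" where
  "prod_leb \<equiv> Pi\<^sub>M UNIV (\<lambda>_. lebesgue)"

lemma product_sigma_finite_lebesgue: "product_sigma_finite (\<lambda>_::'m. lebesgue :: 'a::euclidean_space measure)"
  by (simp add: product_sigma_finite_def sigma_finite_lebesgue)

lemma pair_sigma_finite_lebesgue:
  "pair_sigma_finite (lebesgue :: 'b::euclidean_space measure) (prod_leb :: ('m::finite \<Rightarrow> 'a::euclidean_space) measure)"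
proof -
  interpret product_sigma_finite "\<lambda>_::'m. lebesgue :: 'a measure" by (rule product_sigma_finite_lebesgue)
  interpret finite_product_sigma_finite "\<lambda>_::'m. lebesgue :: 'a measure" UNIV by standard auto
  show ?thesis by (simp add: pair_sigma_finite_def sigma_finite_lebesgue sigma_finite_measure_axioms)
qed

lemma ident_lebesgue_measurable [measurable]: "(\<lambda>x. x) \<in> lebesgue \<rightarrow>\<^sub>M (borel :: 'a::euclidean_space measure)"
  by (rule borel_measurable_lebesgueI) simp

lemma integrable_pair_bounded_phase:
  fixes g :: "'b::euclidean_space \<Rightarrow> complex" and F :: "('m::finite \<Rightarrow> 'a::euclidean_space) \<Rightarrow> complex"
  assumes g: "integrable lebesgue g" and F: "integrable prod_leb F"
    and \<theta> [measurable]: "(\<lambda>(\<xi>, y). \<theta> \<xi> y) \<in> borel_measurable (lebesgue \<Otimes>\<^sub>M prod_leb)"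
  shows "integrable (lebesgue \<Otimes>\<^sub>M prod_leb) (\<lambda>(\<xi>, y). g \<xi> * F y * cis (\<theta> \<xi> y))"
proof -
  interpret pair_sigma_finite "lebesgue :: 'b measure" "prod_leb :: ('m \<Rightarrow> 'a) measure" by (rule pair_sigma_finite_lebesgue)
  have [measurable]: "g \<in> borel_measurable lebesgue" "F \<in> borel_measurable prod_leb" using g F by auto
  have cis [measurable]: "cis \<in> borel_measurable borel" by (intro borel_measurable_continuous_onI continuous_intros)
  have gF: "integrable (lebesgue \<Otimes>\<^sub>M prod_leb) (\<lambda>(\<xi>, y). g \<xi> * F y)"
  proof (rule Fubini_integrable)
    show "integrable lebesgue (\<lambda>\<xi>. LINT y|prod_leb. cmod (case (\<xi>, y) of (\<xi>, y) \<Rightarrow> g \<xi> * F y))"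
      using g by (simp add: norm_mult)
    show "AE \<xi> in lebesgue. integrable prod_leb (\<lambda>y. case (\<xi>, y) of (\<xi>, y) \<Rightarrow> g \<xi> * F y)"
      using F by simp
  qed measurable
  show ?thesis
    by (rule Bochner_Integration.integrable_bound[OF gF]) (auto simp: norm_mult split_beta')
qed

lemma kernel_phase_split:
  fixes \<xi> :: "real^'n::finite^'m::finite"
  shows "2 * pi * ((\<chi> j. x - y j) \<bullet> \<xi>) = 2 * pi * (x \<bullet> (\<Sum>j\<in>UNIV. \<xi> $ j)) + (\<Sum>j\<in>UNIV. - 2 * pi * (y j \<bullet> \<xi> $ j))"
  by (simp add: inner_vec_def[of "\<chi> j. x - y j"] inner_diff_left sum_subtractf inner_sum_right sum_negf algebra_simps flip: sum_distrib_left)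

lemma cis_sum: "finite I \<Longrightarrow> cis (\<Sum>i\<in>I. f i) = (\<Prod>i\<in>I. cis (f i))"
  by (induction I rule: finite_induct) (auto simp flip: cis_mult)

lemma prod_fourier:
  fixes f :: "'m::finite \<Rightarrow> real^'n::finite \<Rightarrow> complex" and \<xi> :: "real^'n^'m"
  assumes f: "\<And>j. integrable lebesgue (f j)"
  shows "(\<Prod>j\<in>UNIV. fourier (f j) (\<xi> $ j)) = (LINT y|prod_leb. (\<Prod>j\<in>UNIV. f j (y j)) * cis (\<Sum>j\<in>UNIV. - 2 * pi * (y j \<bullet> \<xi> $ j)))"
proof -
  interpret product_sigma_finite "\<lambda>_::'m. lebesgue :: (real^'n) measure" by (rule product_sigma_finite_lebesgue)
  have cis [measurable]: "cis \<in> borel_measurable borel" by (intro borel_measurable_continuous_onI continuous_intros)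
  have int: "integrable lebesgue (\<lambda>x. f j x * cis (- 2 * pi * (x \<bullet> \<xi> $ j)))" for j
    by (rule Bochner_Integration.integrable_bound[OF f[of j]]) (use f[of j] in \<open>auto simp: norm_mult intro!: borel_measurable_times\<close>)
  have "(\<Prod>j\<in>UNIV. fourier (f j) (\<xi> $ j)) = (LINT y|prod_leb. (\<Prod>j\<in>UNIV. f j (y j) * cis (- 2 * pi * (y j \<bullet> \<xi> $ j))))"
    unfolding fourier_def by (rule product_integral_prod[symmetric]) (use int in auto)
  then show ?thesis by (simp only: prod.distrib cis_sum[OF finite])
qed

text \<open>Truncation makes the amplitude integrable in \<open>\<xi>\<close>, so that Fubini's theorem applies to the Fourier integrals.\<close>

lemma truncated_operator_representation:
  fixes f :: "'m::finite \<Rightarrow> real^'n::finite \<Rightarrow> complex" and \<sigma> :: "(real^'n) \<times> (real^'n^'m) \<Rightarrow> complex"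
  assumes f: "\<And>j. integrable lebesgue (f j)" and g: "integrable lebesgue (\<lambda>\<xi>. \<sigma> (x, \<xi>) * cutoff N R \<xi>)"
  shows "integrable prod_leb (\<lambda>y. (\<Prod>j\<in>UNIV. f j (y j)) * trunc_kernel \<sigma> N R x (\<chi> j. x - y j))"
    and "(LINT \<xi>|lebesgue. pdo_integrand \<sigma> f x \<xi> * cutoff N R \<xi>) = (LINT y|prod_leb. (\<Prod>j\<in>UNIV. f j (y j)) * trunc_kernel \<sigma> N R x (\<chi> j. x - y j))"
proof -
  interpret p: product_sigma_finite "\<lambda>_::'m. lebesgue :: (real^'n) measure" by (rule product_sigma_finite_lebesgue)
  interpret pair_sigma_finite "lebesgue :: (real^'n^'m) measure" "prod_leb :: ('m \<Rightarrow> real^'n) measure" by (rule pair_sigma_finite_lebesgue)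
  define F where "F y = (\<Prod>j\<in>UNIV. f j (y j))" for y
  define G where "G \<xi> = \<sigma> (x, \<xi>) * cutoff N R \<xi>" for \<xi>
  have F: "integrable prod_leb F" unfolding F_def by (rule p.product_integrable_prod) (use f in auto)
  have phase: "cis (2 * pi * ((\<chi> j. x - y j) \<bullet> \<xi>)) = cis (2 * pi * (x \<bullet> (\<Sum>j\<in>UNIV. \<xi> $ j))) * cis (\<Sum>j\<in>UNIV. - 2 * pi * (y j \<bullet> \<xi> $ j))"
    for \<xi> :: "real^'n^'m" and y by (simp only: kernel_phase_split cis_mult)
  have [measurable]: "(\<lambda>\<xi>::real^'n^'m. \<xi> $ j) \<in> borel_measurable borel" for j
    by (intro borel_measurable_continuous_onI continuous_intros)
  have \<theta>: "(\<lambda>(\<xi>, y). 2 * pi * (x \<bullet> (\<Sum>j\<in>UNIV. \<xi> $ j)) + (\<Sum>j\<in>UNIV. - 2 * pi * (y j \<bullet> \<xi> $ j))) \<in> borel_measurable ((lebesgue :: (real^'n^'m) measure) \<Otimes>\<^sub>M prod_leb)"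
    by measurable
  have int: "integrable (lebesgue \<Otimes>\<^sub>M prod_leb) (\<lambda>(\<xi>, y). G \<xi> * F y * cis (2 * pi * ((\<chi> j. x - y j) \<bullet> \<xi>)))"
    unfolding kernel_phase_split using g F \<theta> by (intro integrable_pair_bounded_phase) (simp_all add: G_def[abs_def])
  have inner: "(LINT \<xi>|lebesgue. G \<xi> * F y * cis (2 * pi * ((\<chi> j. x - y j) \<bullet> \<xi>))) = F y * trunc_kernel \<sigma> N R x (\<chi> j. x - y j)" for y
  proof -
    have "(LINT \<xi>|lebesgue. G \<xi> * F y * cis (2 * pi * ((\<chi> j. x - y j) \<bullet> \<xi>))) = (LINT \<xi>|lebesgue. F y * (G \<xi> * cis (2 * pi * ((\<chi> j. x - y j) \<bullet> \<xi>))))"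
      by (simp only: mult_ac)
    then show ?thesis unfolding trunc_kernel_def G_def by (simp only: integral_mult_right_zero)
  qed
  show "integrable prod_leb (\<lambda>y. (\<Prod>j\<in>UNIV. f j (y j)) * trunc_kernel \<sigma> N R x (\<chi> j. x - y j))"
    using integrable_snd[OF int] unfolding inner by (simp add: F_def)
  have "(LINT \<xi>|lebesgue. pdo_integrand \<sigma> f x \<xi> * cutoff N R \<xi>) = (LINT \<xi>|lebesgue. LINT y|prod_leb. G \<xi> * F y * cis (2 * pi * ((\<chi> j. x - y j) \<bullet> \<xi>)))"
  proof (intro arg_cong[of _ _ "integral\<^sup>L lebesgue"] ext)
    fix \<xi> :: "real^'n^'m"
    have "pdo_integrand \<sigma> f x \<xi> * cutoff N R \<xi> = G \<xi> * cis (2 * pi * (x \<bullet> (\<Sum>j\<in>UNIV. \<xi> $ j))) * (LINT y|prod_leb. F y * cis (\<Sum>j\<in>UNIV. - 2 * pi * (y j \<bullet> \<xi> $ j)))"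
      unfolding pdo_integrand_def prod_fourier[OF f] F_def G_def by (simp only: mult_ac)
    also have "\<dots> = (LINT y|prod_leb. G \<xi> * cis (2 * pi * (x \<bullet> (\<Sum>j\<in>UNIV. \<xi> $ j))) * (F y * cis (\<Sum>j\<in>UNIV. - 2 * pi * (y j \<bullet> \<xi> $ j))))"
      by (simp only: integral_mult_right_zero)
    also have "\<dots> = (LINT y|prod_leb. G \<xi> * F y * cis (2 * pi * ((\<chi> j. x - y j) \<bullet> \<xi>)))"
      unfolding phase by (simp only: mult_ac)
    finally show "pdo_integrand \<sigma> f x \<xi> * cutoff N R \<xi> = (LINT y|prod_leb. G \<xi> * F y * cis (2 * pi * ((\<chi> j. x - y j) \<bullet> \<xi>)))" .
  qed
  also have "\<dots> = (LINT y|prod_leb. LINT \<xi>|lebesgue. G \<xi> * F y * cis (2 * pi * ((\<chi> j. x - y j) \<bullet> \<xi>)))"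
    by (rule Fubini_integral[symmetric, OF int])
  finally show "(LINT \<xi>|lebesgue. pdo_integrand \<sigma> f x \<xi> * cutoff N R \<xi>) = (LINT y|prod_leb. (\<Prod>j\<in>UNIV. f j (y j)) * trunc_kernel \<sigma> N R x (\<chi> j. x - y j))"
    unfolding inner by (simp add: F_def)
qed

lemma truncated_operator_tendsto:
  assumes int: "integrable lebesgue (pdo_integrand \<sigma> f x)"
  shows "(\<lambda>k. LINT \<xi>|lebesgue. pdo_integrand \<sigma> f x \<xi> * cutoff N (real (Suc k)) \<xi>) \<longlonglongrightarrow> pdo \<sigma> f x"
  unfolding pdo_def
proof (rule integral_dominated_convergence[where w = "\<lambda>\<xi>. cmod (pdo_integrand \<sigma> f x \<xi>)"])
  show m: "pdo_integrand \<sigma> f x \<in> borel_measurable lebesgue" using int by auto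
  have "cutoff N R \<in> borel_measurable lebesgue" for R
    by (intro borel_measurable_lebesgueI borel_measurable_continuous_onI cutoff_continuous)
  then show "(\<lambda>\<xi>. pdo_integrand \<sigma> f x \<xi> * cutoff N (real (Suc k)) \<xi>) \<in> borel_measurable lebesgue" for k
    using m by (intro borel_measurable_times)
  show "integrable lebesgue (\<lambda>\<xi>. cmod (pdo_integrand \<sigma> f x \<xi>))" using int by (rule integrable_norm)
  show "AE \<xi> in lebesgue. (\<lambda>k. pdo_integrand \<sigma> f x \<xi> * cutoff N (real (Suc k)) \<xi>) \<longlonglongrightarrow> pdo_integrand \<sigma> f x \<xi>"
    using tendsto_mult[OF tendsto_const cutoff_tendsto_1] by (intro AE_I2) fastforce
  show "AE \<xi> in lebesgue. cmod (pdo_integrand \<sigma> f x \<xi> * cutoff N (real (Suc k)) \<xi>) \<le> cmod (pdo_integrand \<sigma> f x \<xi>)" for k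
    by (intro AE_I2) (simp add: norm_mult mult_left_le cutoff_norm_le_1)
qed

section \<open>Pointwise domination of the commutator\<close>

text \<open>The factors of the dominating product at scale \<open>t\<close>: an oscillation in the slot of the commutator and averages in the others.\<close>

definition scale_factor :: "real \<Rightarrow> (real^'n::finite \<Rightarrow> complex) \<Rightarrow> 'm \<Rightarrow> ('m \<Rightarrow> real^'n \<Rightarrow> complex) \<Rightarrow> 'm \<Rightarrow> real^'n \<Rightarrow> real" where
  "scale_factor t b j f i x = (if i = j then loc_osc t b (\<lambda>y. cmod (f i y)) x else loc_avg t (\<lambda>y. cmod (f i y)) x)"

lemma scale_factor_nonneg: "t > 0 \<Longrightarrow> scale_factor t b j f i x \<ge> 0"
  by (simp add: scale_factor_def loc_osc_nonneg loc_avg_nonneg)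

lemma ennreal_prod_mono:
  fixes f g :: "'b \<Rightarrow> ennreal"
  assumes "\<And>i. i \<in> I \<Longrightarrow> f i \<le> g i"
  shows "(\<Prod>i\<in>I. f i) \<le> (\<Prod>i\<in>I. g i)"
  using assms by (induction I rule: infinite_finite_induct) (auto intro!: mult_mono)

lemma near_measurable [measurable]: "{y::real^'n::finite. \<forall>i. \<bar>x $ i - y $ i\<bar> \<le> t} \<in> sets lebesgue"
proof -
  have "{y \<in> space borel. \<forall>i. \<bar>x $ i - y $ i\<bar> \<le> t} \<in> sets (borel :: (real^'n) measure)" by measurable
  then show ?thesis by simp
qed

text \<open>In the truncated integrals the difference carries the factor \<open>b j x - b j (y j)\<close>. The kernel majorant, which does not depend on
  the truncation, splits the integral over \<open>y\<close> into a product at every scale, and the bound survives the limit.\<close>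

lemma commutator_term_bound:
  fixes f :: "'m::finite \<Rightarrow> real^'n::finite \<Rightarrow> complex" and \<sigma> :: "(real^'n) \<times> (real^'n^'m) \<Rightarrow> complex" and b :: "'m \<Rightarrow> real^'n \<Rightarrow> complex"
  assumes wt: "\<And>k. wt k \<ge> 0" and t: "\<And>k. t k > 0"
    and maj: "\<And>x R z. R \<ge> 1 \<Longrightarrow> ennreal (cmod (trunc_kernel \<sigma> N R x z))
        \<le> (\<Sum>k. ennreal (wt k / t k ^ (CARD('m) * CARD('n))) * of_bool (\<forall>j i. \<bar>z $ j $ i\<bar> \<le> t k))"
    and int: "\<And>x R. R \<ge> 1 \<Longrightarrow> integrable lebesgue (\<lambda>\<xi>. \<sigma> (x, \<xi>) * cutoff N R \<xi>)"
    and f: "\<And>i. integrable lebesgue (f i)" and bf: "integrable lebesgue (\<lambda>y. b j y * f j y)"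
    and bm [measurable]: "b j \<in> borel_measurable lebesgue"
    and x: "integrable lebesgue (pdo_integrand \<sigma> f x)" "integrable lebesgue (pdo_integrand \<sigma> (mult_at b j f) x)"
  shows "ennreal (cmod (b j x * pdo \<sigma> f x - pdo \<sigma> (mult_at b j f) x))
    \<le> (\<Sum>k. ennreal (wt k * (3 ^ (CARD('m) * CARD('n)) * (\<Prod>i\<in>UNIV. scale_factor (t k) (b j) j f i x))))"
proof -
  define d where "d = CARD('m) * CARD('n)"
  interpret p: product_sigma_finite "\<lambda>_::'m. lebesgue :: (real^'n) measure" by (rule product_sigma_finite_lebesgue)
  have [measurable]: "f i \<in> borel_measurable lebesgue" for i using f[of i] by auto
  have bf': "integrable lebesgue (mult_at b j f i)" for i using f[of i] bf by (simp add: mult_at_def)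
  define H where "H y = (b j x - b j (y j)) * (\<Prod>i\<in>UNIV. f i (y i))" for y
  define u where "u i y = (if i = j then cmod (b j x - b j y) * cmod (f j y) else cmod (f i y))" for i y
  have u0: "u i y \<ge> 0" for i y by (simp add: u_def)
  have um [measurable]: "u i \<in> borel_measurable lebesgue" for i unfolding u_def by (cases "i = j") simp_all
  have cH: "cmod (H y) = (\<Prod>i\<in>UNIV. u i (y i))" for y
  proof -
    have "(\<Prod>i\<in>UNIV. u i (y i)) = u j (y j) * (\<Prod>i\<in>UNIV - {j}. u i (y i))" by (rule prod.remove) auto
    also have "(\<Prod>i\<in>UNIV - {j}. u i (y i)) = (\<Prod>i\<in>UNIV - {j}. cmod (f i (y i)))" by (intro prod.cong) (auto simp: u_def)
    also have "u j (y j) * \<dots> = cmod (b j x - b j (y j)) * (cmod (f j (y j)) * (\<Prod>i\<in>UNIV - {j}. cmod (f i (y i))))" by (simp add: u_def)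
    also have "cmod (f j (y j)) * (\<Prod>i\<in>UNIV - {j}. cmod (f i (y i))) = (\<Prod>i\<in>UNIV. cmod (f i (y i)))" by (rule prod.remove[symmetric]) auto
    finally show ?thesis by (simp add: H_def norm_mult prod_norm)
  qed
  have mult: "(\<Prod>i\<in>UNIV. mult_at b j f i (y i)) = b j (y j) * (\<Prod>i\<in>UNIV. f i (y i))" for y
  proof -
    have "(\<Prod>i\<in>UNIV. mult_at b j f i (y i)) = mult_at b j f j (y j) * (\<Prod>i\<in>UNIV - {j}. mult_at b j f i (y i))" by (rule prod.remove) auto
    also have "(\<Prod>i\<in>UNIV - {j}. mult_at b j f i (y i)) = (\<Prod>i\<in>UNIV - {j}. f i (y i))" by (intro prod.cong) (auto simp: mult_at_def)
    also have "mult_at b j f j (y j) * \<dots> = b j (y j) * (f j (y j) * (\<Prod>i\<in>UNIV - {j}. f i (y i)))" by (simp add: mult_at_def)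
    also have "f j (y j) * (\<Prod>i\<in>UNIV - {j}. f i (y i)) = (\<Prod>i\<in>UNIV. f i (y i))" by (rule prod.remove[symmetric]) auto
    finally show ?thesis .
  qed
  define M where "M = (\<integral>\<^sup>+y. (\<Sum>k. ennreal (wt k / t k ^ d) * of_bool (\<forall>i l. \<bar>x $ l - y i $ l\<bar> \<le> t k)) * ennreal (cmod (H y)) \<partial>prod_leb)"
  define T where "T k = b j x * (LINT \<xi>|lebesgue. pdo_integrand \<sigma> f x \<xi> * cutoff N (real (Suc k)) \<xi>)
     - (LINT \<xi>|lebesgue. pdo_integrand \<sigma> (mult_at b j f) x \<xi> * cutoff N (real (Suc k)) \<xi>)" for k
  have "ennreal (cmod (T k)) \<le> M" for k
  proof -
    define R where "R = real (Suc k)"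
    have R: "R \<ge> 1" by (simp add: R_def)
    let ?K = "\<lambda>y. trunc_kernel \<sigma> N R x (\<chi> j. x - y j)"
    note r1 = truncated_operator_representation[OF f int[OF R]] and r2 = truncated_operator_representation[where f = "mult_at b j f", OF bf' int[OF R]]
    have i1: "integrable prod_leb (\<lambda>y. b j x * ((\<Prod>i\<in>UNIV. f i (y i)) * ?K y))" by (intro integrable_mult_right r1(1))
    have i2: "integrable prod_leb (\<lambda>y. b j (y j) * (\<Prod>i\<in>UNIV. f i (y i)) * ?K y)" using r2(1)[of x] by (simp only: mult)
    have "T k = (LINT y|prod_leb. b j x * ((\<Prod>i\<in>UNIV. f i (y i)) * ?K y)) - (LINT y|prod_leb. b j (y j) * (\<Prod>i\<in>UNIV. f i (y i)) * ?K y)"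
      unfolding T_def R_def[symmetric] r1(2) r2(2) mult by simp
    also have "\<dots> = (LINT y|prod_leb. b j x * ((\<Prod>i\<in>UNIV. f i (y i)) * ?K y) - b j (y j) * (\<Prod>i\<in>UNIV. f i (y i)) * ?K y)"
      by (rule Bochner_Integration.integral_diff[symmetric, OF i1 i2])
    also have "\<dots> = (LINT y|prod_leb. H y * ?K y)" by (simp add: H_def algebra_simps)
    finally have T: "T k = (LINT y|prod_leb. H y * ?K y)" .
    have "integrable prod_leb (\<lambda>y. H y * ?K y)"
      using Bochner_Integration.integrable_diff[OF i1 i2] by (simp add: H_def algebra_simps)
    then have "ennreal (cmod (T k)) \<le> (\<integral>\<^sup>+y. ennreal (cmod (H y * ?K y)) \<partial>prod_leb)"
      unfolding T by (rule integral_norm_bound_ennreal)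
    also have "\<dots> \<le> M" unfolding M_def
    proof (rule nn_integral_mono)
      fix y
      have "ennreal (cmod (H y * ?K y)) = ennreal (cmod (?K y)) * ennreal (cmod (H y))" by (simp add: norm_mult ennreal_mult' mult.commute)
      also have "\<dots> \<le> (\<Sum>k. ennreal (wt k / t k ^ d) * of_bool (\<forall>i l. \<bar>x $ l - y i $ l\<bar> \<le> t k)) * ennreal (cmod (H y))"
        using maj[OF R, of x "\<chi> j. x - y j"] by (intro mult_right_mono) (simp_all add: d_def)
      finally show "ennreal (cmod (H y * ?K y)) \<le> \<dots>" .
    qed
    finally show ?thesis .
  qed
  moreover have L: "(\<lambda>k. ennreal (cmod (T k))) \<longlonglongrightarrow> ennreal (cmod (b j x * pdo \<sigma> f x - pdo \<sigma> (mult_at b j f) x))"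
    unfolding T_def by (intro tendsto_ennrealI tendsto_intros truncated_operator_tendsto x)
  ultimately have "ennreal (cmod (b j x * pdo \<sigma> f x - pdo \<sigma> (mult_at b j f) x)) \<le> M"
    using LIMSEQ_le_const2[OF L] by blast
  also have "M = (\<integral>\<^sup>+y. (\<Sum>k. ennreal (wt k / t k ^ d) * (\<Prod>i\<in>UNIV. ennreal (u i (y i)) * indicator {z. \<forall>l. \<bar>x $ l - z $ l\<bar> \<le> t k} (y i))) \<partial>prod_leb)"
    unfolding M_def
  proof (intro nn_integral_cong)
    fix y :: "'m \<Rightarrow> real^'n"
    have "of_bool (\<forall>i l. \<bar>x $ l - y i $ l\<bar> \<le> t k) = (\<Prod>i\<in>UNIV. indicator {z. \<forall>l. \<bar>x $ l - z $ l\<bar> \<le> t k} (y i) :: ennreal)" for k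
      by (cases "\<forall>i l. \<bar>x $ l - y i $ l\<bar> \<le> t k") (auto simp: indicator_def intro!: prod_zero[symmetric])
    then show "(\<Sum>k. ennreal (wt k / t k ^ d) * of_bool (\<forall>i l. \<bar>x $ l - y i $ l\<bar> \<le> t k)) * ennreal (cmod (H y))
      = (\<Sum>k. ennreal (wt k / t k ^ d) * (\<Prod>i\<in>UNIV. ennreal (u i (y i)) * indicator {z. \<forall>l. \<bar>x $ l - z $ l\<bar> \<le> t k} (y i)))"
      unfolding cH by (simp add: prod.distrib prod_ennreal u0 mult_ac flip: ennreal_suminf_multc)
  qed
  also have "\<dots> = (\<Sum>k. \<integral>\<^sup>+y. ennreal (wt k / t k ^ d) * (\<Prod>i\<in>UNIV. ennreal (u i (y i)) * indicator {z. \<forall>l. \<bar>x $ l - z $ l\<bar> \<le> t k} (y i)) \<partial>prod_leb)"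
    by (rule nn_integral_suminf) measurable
  also have "\<dots> \<le> (\<Sum>k. ennreal (wt k * (3 ^ d * (\<Prod>i\<in>UNIV. scale_factor (t k) (b j) j f i x))))"
  proof (intro suminf_le allI)
    fix k
    have "(\<integral>\<^sup>+y. ennreal (wt k / t k ^ d) * (\<Prod>i\<in>UNIV. ennreal (u i (y i)) * indicator {z. \<forall>l. \<bar>x $ l - z $ l\<bar> \<le> t k} (y i)) \<partial>prod_leb)
      = ennreal (wt k / t k ^ d) * (\<integral>\<^sup>+y. (\<Prod>i\<in>UNIV. ennreal (u i (y i)) * indicator {z. \<forall>l. \<bar>x $ l - z $ l\<bar> \<le> t k} (y i)) \<partial>prod_leb)"
      by (rule nn_integral_cmult) measurable
    also have "(\<integral>\<^sup>+y. (\<Prod>i\<in>UNIV. ennreal (u i (y i)) * indicator {z. \<forall>l. \<bar>x $ l - z $ l\<bar> \<le> t k} (y i)) \<partial>prod_leb)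
      = (\<Prod>i\<in>UNIV. \<integral>\<^sup>+y\<in>{z. \<forall>l. \<bar>x $ l - z $ l\<bar> \<le> t k}. ennreal (u i y) \<partial>lebesgue)"
      by (rule p.product_nn_integral_prod) auto
    also have "\<dots> \<le> (\<Prod>i\<in>UNIV. ennreal ((3 * t k) ^ CARD('n) * scale_factor (t k) (b j) j f i x))"
    proof (rule ennreal_prod_mono)
      fix i
      have fin: "(\<integral>\<^sup>+y. ennreal (cmod (f i y)) \<partial>lebesgue) < \<infinity>" for i using f[of i] by (simp add: integrable_iff_bounded)
      have fin2: "(\<integral>\<^sup>+y. ennreal (cmod (b j y) * cmod (f j y)) \<partial>lebesgue) < \<infinity>" using bf by (simp add: integrable_iff_bounded norm_mult)
      show "(\<integral>\<^sup>+y\<in>{z. \<forall>l. \<bar>x $ l - z $ l\<bar> \<le> t k}. ennreal (u i y) \<partial>lebesgue) \<le> ennreal ((3 * t k) ^ CARD('n) * scale_factor (t k) (b j) j f i x)"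
      proof (cases "i = j")
        case True
        then show ?thesis using near_integral_le_loc_osc[OF t, of "b j" "\<lambda>y. cmod (f j y)" x k] fin fin2 by (simp add: u_def scale_factor_def)
      next
        case False
        then show ?thesis using near_integral_le_loc_avg[OF t, of "\<lambda>y. cmod (f i y)" x k] fin by (simp add: u_def scale_factor_def)
      qed
    qed
    also have "\<dots> = ennreal ((3 * t k) ^ d * (\<Prod>i\<in>UNIV. scale_factor (t k) (b j) j f i x))"
    proof -
      have "(\<Prod>i\<in>UNIV. ennreal ((3 * t k) ^ CARD('n) * scale_factor (t k) (b j) j f i x)) = ennreal (\<Prod>i\<in>UNIV. (3 * t k) ^ CARD('n) * scale_factor (t k) (b j) j f i x)"
        using t[of k] scale_factor_nonneg[OF t[of k]] by (intro prod_ennreal mult_nonneg_nonneg) auto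
      also have "(\<Prod>i\<in>UNIV. (3 * t k) ^ CARD('n) * scale_factor (t k) (b j) j f i x) = (3 * t k) ^ d * (\<Prod>i\<in>UNIV. scale_factor (t k) (b j) j f i x)"
        unfolding prod.distrib prod_constant d_def power_mult[symmetric] mult.commute[of "CARD('m)"] by simp
      finally show ?thesis .
    qed
    finally have "(\<integral>\<^sup>+y. ennreal (wt k / t k ^ d) * (\<Prod>i\<in>UNIV. ennreal (u i (y i)) * indicator {z. \<forall>l. \<bar>x $ l - z $ l\<bar> \<le> t k} (y i)) \<partial>prod_leb)
      \<le> ennreal (wt k / t k ^ d) * ennreal ((3 * t k) ^ d * (\<Prod>i\<in>UNIV. scale_factor (t k) (b j) j f i x))" by (simp add: mult_left_mono)
    also have "\<dots> = ennreal (wt k / t k ^ d * ((3 * t k) ^ d * (\<Prod>i\<in>UNIV. scale_factor (t k) (b j) j f i x)))"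
      using wt[of k] t[of k] by (intro ennreal_mult'[symmetric]) auto
    also have "wt k / t k ^ d * ((3 * t k) ^ d * (\<Prod>i\<in>UNIV. scale_factor (t k) (b j) j f i x)) = wt k * (3 ^ d * (\<Prod>i\<in>UNIV. scale_factor (t k) (b j) j f i x))"
      using t[of k] by (simp add: power_mult_distrib)
    finally show "(\<integral>\<^sup>+y. ennreal (wt k / t k ^ d) * (\<Prod>i\<in>UNIV. ennreal (u i (y i)) * indicator {z. \<forall>l. \<bar>x $ l - z $ l\<bar> \<le> t k} (y i)) \<partial>prod_leb)
      \<le> ennreal (wt k * (3 ^ d * (\<Prod>i\<in>UNIV. scale_factor (t k) (b j) j f i x)))" .
  qed auto
  finally show ?thesis by (simp add: d_def)
qed

section \<open>Modular estimate for normalised symbols\<close>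

lemma submultiplicative_prod:
  assumes N: "N_function \<phi>" and sub: "submultiplicative \<phi>" and "finite I" "c \<ge> 0" "\<And>i. i \<in> I \<Longrightarrow> g i \<ge> 0"
  shows "\<phi> (c * (\<Prod>i\<in>I. g i)) \<le> \<phi> c * (\<Prod>i\<in>I. \<phi> (g i))"
  using assms(3,5)
proof (induction I)
  case (insert i I)
  have p: "(\<Prod>i\<in>I. g i) \<ge> 0" using insert by (intro prod_nonneg) auto
  have "\<phi> (c * (\<Prod>i\<in>insert i I. g i)) = \<phi> ((c * (\<Prod>i\<in>I. g i)) * g i)" using insert by (simp add: mult_ac)
  also have "\<dots> \<le> \<phi> (c * (\<Prod>i\<in>I. g i)) * \<phi> (g i)"
    using sub p insert(4)[of i] \<open>c \<ge> 0\<close> by (auto simp: submultiplicative_def)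
  also have "\<dots> \<le> \<phi> c * (\<Prod>i\<in>I. \<phi> (g i)) * \<phi> (g i)"
    using insert by (intro mult_right_mono N_function_nonneg[OF N]) auto
  finally show ?case using insert by (simp add: mult_ac)
qed simp

lemma N_function_sum_le:
  fixes v :: "'m::finite \<Rightarrow> real"
  assumes N: "N_function \<phi>" and sub: "submultiplicative \<phi>" and v: "\<And>j. v j \<ge> 0"
  shows "\<phi> (\<Sum>j\<in>UNIV. v j) \<le> \<phi> (real CARD('m)) * (\<Sum>j\<in>UNIV. \<phi> (v j))"
proof -
  define M where "M = Max (range v)"
  have "M \<in> range v" unfolding M_def by (rule Max_in) auto
  then obtain j where j: "M = v j" by auto
  have "(\<Sum>j\<in>UNIV. v j) \<le> (\<Sum>j\<in>(UNIV::'m set). M)" unfolding M_def by (intro sum_mono Max_ge) auto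
  then have "\<phi> (\<Sum>j\<in>UNIV. v j) \<le> \<phi> (real CARD('m) * M)" using v by (intro N_function_mono[OF N] sum_nonneg) auto
  also have "\<dots> \<le> \<phi> (real CARD('m)) * \<phi> (v j)" using sub v[of j] unfolding j submultiplicative_def by simp
  also have "\<dots> \<le> \<phi> (real CARD('m)) * (\<Sum>j\<in>UNIV. \<phi> (v j))"
    using N_function_nonneg[OF N] v by (intro mult_left_mono member_le_sum) auto
  finally show ?thesis .
qed

lemma ennpowr_mono: "x \<le> y \<Longrightarrow> p > 0 \<Longrightarrow> ennpowr x p \<le> ennpowr y p"
proof -
  assume xy: "x \<le> y" and p: "p > 0"
  consider "x = 0" | "y = \<infinity>" | a c where "x = ennreal a" "y = ennreal c" "a > 0" "c > 0" "a \<le> c"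
  proof (cases "x = 0 \<or> y = \<infinity>")
    case False
    then have "y < \<infinity>" "x < \<infinity>" using xy by (auto simp: less_top top_unique)
    then have "x = ennreal (enn2real x)" "y = ennreal (enn2real y)" "enn2real x > 0" "enn2real x \<le> enn2real y"
      using False xy by (auto simp: less_top enn2real_positive_iff zero_less_iff_neq_zero enn2real_mono)
    then show ?thesis using that(3)[of "enn2real x" "enn2real y"] by simp
  qed (use that in auto)
  then show ?thesis using p by cases (auto simp: ennpowr_def powr_mono2 ennreal_leI)
qed

lemma ennpowr_scale:
  assumes g: "g > 0" and n: "n > (0::nat)"
  shows "ennpowr (ennreal g ^ n * Y) (1 / real n) = ennreal g * ennpowr Y (1 / real n)"
proof -
  consider "Y = 0" | "Y = \<infinity>" | y where "Y = ennreal y" "y > 0"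
    by (cases Y) (auto simp: less_le)
  then show ?thesis
  proof cases
    case 1 then show ?thesis using n by (simp add: ennpowr_def)
  next
    case 2 then show ?thesis using g n by (simp add: ennpowr_def ennreal_power ennreal_mult_top)
  next
    case 3
    have pw: "ennpowr (ennreal z) (1 / real n) = ennreal (z powr (1 / real n))" if "z > 0" for z
      using that n by (auto simp: ennpowr_def)
    have "ennreal g ^ n * Y = ennreal (g ^ n * y)" using g 3 by (simp add: ennreal_power ennreal_mult')
    then have "ennpowr (ennreal g ^ n * Y) (1 / real n) = ennreal ((g ^ n * y) powr (1 / real n))"
      using pw[of "g ^ n * y"] g 3 by simp
    also have "(g ^ n * y) powr (1 / real n) = g * y powr (1 / real n)"
      using g n 3 by (simp add: powr_mult power_powr_inverse)
    also have "ennreal (g * y powr (1 / real n)) = ennreal g * ennpowr Y (1 / real n)"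
      using g pw[OF 3(2)] 3 by (simp add: ennreal_mult')
    finally show ?thesis .
  qed
qed

lemma (in Aq_growth) scale_factor_modular:
  fixes f :: "'m::finite \<Rightarrow> real^'n \<Rightarrow> complex"
  assumes t: "t > 0" and b: "unit_bmo b" and f: "\<And>i. integrable lebesgue (f i)" and bf: "integrable lebesgue (\<lambda>y. b y * f j y)"
  shows "(\<integral>\<^sup>+x. ennreal (\<Psi> (scale_factor t b j f i x)) * ennreal (w x) \<partial>lebesgue)
     \<le> ennreal ((4 * 4 powr (q - 1) * c * A + \<bar>osc_const\<bar>) * 3 ^ CARD('n)) * (\<integral>\<^sup>+x. ennreal (\<Psi> (cmod (f i x))) * ennreal (w x) \<partial>lebesgue)"
proof -
  have [measurable]: "f i \<in> borel_measurable lebesgue" for i using f[of i] by auto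
  have fin: "(\<integral>\<^sup>+y. ennreal (cmod (f i y)) \<partial>lebesgue) < \<infinity>" for i using f[of i] by (simp add: integrable_iff_bounded)
  have fin2: "(\<integral>\<^sup>+y. ennreal (cmod (b y) * cmod (f j y)) \<partial>lebesgue) < \<infinity>" using bf by (simp add: integrable_iff_bounded norm_mult)
  define Y where "Y = (\<integral>\<^sup>+x. ennreal (\<Psi> (cmod (f i x))) * ennreal (w x) \<partial>lebesgue)"
  have c1: "4 * 4 powr (q - 1) * c * A \<ge> 0" using c_pos A by simp
  have three: "ennreal r * 3 ^ CARD('n) = ennreal (r * 3 ^ CARD('n))" for r
    by (simp add: ennreal_mult'' flip: ennreal_power ennreal_numeral)
  show ?thesis
  proof (cases "i = j")
    case True
    have "(\<integral>\<^sup>+x. ennreal (\<Psi> (scale_factor t b j f i x)) * ennreal (w x) \<partial>lebesgue) \<le> ennreal osc_const * 3 ^ CARD('n) * Y"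
      using loc_osc_modular[OF b t, of "\<lambda>y. cmod (f j y)"] fin fin2 True by (simp add: scale_factor_def Y_def)
    also have "\<dots> \<le> ennreal ((4 * 4 powr (q - 1) * c * A + \<bar>osc_const\<bar>) * 3 ^ CARD('n)) * Y"
    proof -
      have "osc_const \<le> 4 * 4 powr (q - 1) * c * A + \<bar>osc_const\<bar>" using c1 by linarith
      then show ?thesis unfolding three by (intro mult_right_mono ennreal_leI) (assumption | simp)+
    qed
    finally show ?thesis by (simp add: Y_def)
  next
    case False
    have "(\<integral>\<^sup>+x. ennreal (\<Psi> (scale_factor t b j f i x)) * ennreal (w x) \<partial>lebesgue) \<le> ennreal (4 * 4 powr (q - 1) * c * A) * 3 ^ CARD('n) * Y"
      using loc_avg_modular[OF t, of "\<lambda>y. cmod (f i y)"] fin False by (simp add: scale_factor_def Y_def)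
    also have "\<dots> \<le> ennreal ((4 * 4 powr (q - 1) * c * A + \<bar>osc_const\<bar>) * 3 ^ CARD('n)) * Y"
      unfolding three by (intro mult_right_mono ennreal_leI) auto
    finally show ?thesis by (simp add: Y_def)
  qed
qed

text \<open>The sum over the scales is a convex combination up to the total weight \<open>\<Lambda>\<close>. At every scale sub-multiplicativity and
  Hoelder's inequality reduce the claim to the factors, whose modulars are bounded uniformly in the scale.\<close>

lemma commutator_modular:
  fixes \<sigma> :: "(real^'n::finite) \<times> (real^'n^'m::finite) \<Rightarrow> complex"
  assumes N: "N_function \<phi>" and sub: "submultiplicative \<phi>"
    and wt: "\<And>k. wt k \<ge> 0" and t: "\<And>k. t k > 0" and sum: "summable wt"
    and maj: "\<And>x R z. R \<ge> 1 \<Longrightarrow> ennreal (cmod (trunc_kernel \<sigma> M R x z))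
        \<le> (\<Sum>k. ennreal (wt k / t k ^ (CARD('m) * CARD('n))) * of_bool (\<forall>j i. \<bar>z $ j $ i\<bar> \<le> t k))"
    and int: "\<And>x R. R \<ge> 1 \<Longrightarrow> integrable lebesgue (\<lambda>\<xi>. \<sigma> (x, \<xi>) * cutoff M R \<xi>)"
    and Aq: "Aq_growth w s q A W S (\<lambda>t. \<phi> t ^ CARD('m)) c D P"
  obtains C where "C \<ge> 0" "\<And>b f. (\<And>j. unit_bmo (b j)) \<Longrightarrow> pdo_commutator_defined \<sigma> b f \<Longrightarrow>
     (\<integral>\<^sup>+x. ennreal (\<phi> (cmod (pdo_commutator \<sigma> b f x))) * ennreal (w x) \<partial>lebesgue)
       \<le> ennreal C * ennpowr (\<Prod>i\<in>UNIV. \<integral>\<^sup>+x. ennreal (\<phi> (cmod (f i x)) ^ CARD('m)) * ennreal (w x) \<partial>lebesgue) (1 / real CARD('m))"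
proof -
  interpret Aq_growth w s q A W S "\<lambda>t. \<phi> t ^ CARD('m)" c D P by fact
  define m where "m = CARD('m)"
  have m: "m > 0" by (simp add: m_def)
  define d where "d = CARD('m) * CARD('n)"
  \<comment> \<open>the summand \<open>1\<close> only ensures \<open>\<Lambda> > 0\<close>\<close>
  define \<Lambda> where "\<Lambda> = suminf wt + 1"
  have \<Lambda>: "\<Lambda> > 0" "(\<Sum>k<n. wt k) \<le> \<Lambda>" for n
    using suminf_nonneg[OF sum wt] sum_le_suminf[OF sum, of "{..<n}"] wt by (auto simp: \<Lambda>_def)
  define g where "g = (4 * 4 powr (q - 1) * c * A + \<bar>osc_const\<bar>) * 3 ^ CARD('n)"
  have g: "g > 0" using c_pos A unfolding g_def by (intro mult_pos_pos add_pos_nonneg) auto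
  define c0 where "c0 = \<phi> (real m)"
  define c1 where "c1 = \<phi> 2"
  define c2 where "c2 = \<phi> (\<Lambda> * 3 ^ d)"
  have c0: "c0 \<ge> 0" "c1 \<ge> 0" "c2 \<ge> 0" using \<Lambda>(1) by (auto simp: c0_def c1_def c2_def intro!: N_function_nonneg[OF N])
  have main: "(\<integral>\<^sup>+x. ennreal (\<phi> (cmod (pdo_commutator \<sigma> b f x))) * ennreal (w x) \<partial>lebesgue)
       \<le> ennreal (c0 * (real m * (c1 * (c2 * g)))) * ennpowr (\<Prod>i\<in>UNIV. \<integral>\<^sup>+x. ennreal (\<phi> (cmod (f i x)) ^ m) * ennreal (w x) \<partial>lebesgue) (1 / real m)"
    if b: "\<And>j. unit_bmo (b j)" and def: "pdo_commutator_defined \<sigma> b f" for b f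
  proof -
    define X where "X = ennpowr (\<Prod>i\<in>UNIV. \<integral>\<^sup>+x. ennreal (\<phi> (cmod (f i x)) ^ m) * ennreal (w x) \<partial>lebesgue) (1 / real m)"
    have bm [measurable]: "b j \<in> borel_measurable lebesgue" for j using unit_bmo.meas[OF b] .
    have fi: "integrable lebesgue (f i)" for i using def by (simp add: pdo_commutator_defined_def pdo_defined_def)
    then have [measurable]: "f i \<in> borel_measurable lebesgue" for i by auto
    have bf: "integrable lebesgue (\<lambda>y. b j y * f j y)" for j
    proof -
      have "integrable lebesgue (mult_at b j f j)" using def by (simp add: pdo_commutator_defined_def pdo_defined_def)
      then show ?thesis by (simp add: mult_at_def)
    qed
    have ae: "AE x in lebesgue. integrable lebesgue (pdo_integrand \<sigma> f x) \<and> (\<forall>j. integrable lebesgue (pdo_integrand \<sigma> (mult_at b j f) x))"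
      using def unfolding pdo_commutator_defined_def pdo_defined_def by (intro AE_conjI) (auto simp: eventually_all_finite)
    define G where "G k j i x = scale_factor (t k) (b j) j f i x" for k j i x
    have G0: "G k j i x \<ge> 0" for k j i x unfolding G_def by (rule scale_factor_nonneg[OF t])
    have Gm [measurable]: "G k j i \<in> borel_measurable lebesgue" for k j i
      unfolding G_def scale_factor_def[abs_def] by (cases "i = j") simp_all
    have \<phi>G [measurable]: "(\<lambda>x. \<phi> (G k j i x)) \<in> borel_measurable lebesgue" for k j i
      by (rule mono_nonneg_measurable[OF N_function_mono[OF N] Gm G0])
    have "(\<integral>\<^sup>+x. ennreal (\<phi> (cmod (pdo_commutator \<sigma> b f x))) * ennreal (w x) \<partial>lebesgue)
      \<le> (\<integral>\<^sup>+x. ennreal c0 * (\<Sum>j\<in>UNIV. ennreal c1 * (\<Sum>k. ennreal (wt k / \<Lambda>) * (ennreal c2 * (ennreal (\<Prod>i\<in>UNIV. \<phi> (G k j i x)) * ennreal (w x))))) \<partial>lebesgue)"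
    proof (rule nn_integral_mono_AE)
      show "AE x in lebesgue. ennreal (\<phi> (cmod (pdo_commutator \<sigma> b f x))) * ennreal (w x)
        \<le> ennreal c0 * (\<Sum>j\<in>UNIV. ennreal c1 * (\<Sum>k. ennreal (wt k / \<Lambda>) * (ennreal c2 * (ennreal (\<Prod>i\<in>UNIV. \<phi> (G k j i x)) * ennreal (w x)))))"
        using ae
      proof eventually_elim
        case (elim x)
        define v where "v j = cmod (b j x * pdo \<sigma> f x - pdo \<sigma> (mult_at b j f) x)" for j
        have v0: "v j \<ge> 0" for j by (simp add: v_def)
        have one: "ennreal (\<phi> (v j)) \<le> ennreal c1 * (\<Sum>k. ennreal (wt k / \<Lambda>) * (ennreal c2 * ennreal (\<Prod>i\<in>UNIV. \<phi> (G k j i x))))" for j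
        proof -
          have "ennreal (v j) \<le> (\<Sum>k. ennreal (wt k * (3 ^ d * (\<Prod>i\<in>UNIV. G k j i x))))"
            unfolding v_def G_def d_def
            by (rule commutator_term_bound[OF wt t maj int fi bf bm]) (use elim in auto)
          also have "\<dots> = (\<Sum>k. ennreal (wt k / \<Lambda> * (\<Lambda> * 3 ^ d * (\<Prod>i\<in>UNIV. G k j i x))))"
            using \<Lambda>(1) by (simp add: mult_ac)
          finally have "ennreal (\<phi> (v j)) \<le> ennreal (\<phi> 2) * (\<Sum>k. ennreal (wt k / \<Lambda>) * ennreal (\<phi> (\<Lambda> * 3 ^ d * (\<Prod>i\<in>UNIV. G k j i x))))"
            using v0 \<Lambda> wt G0
            by (intro convex_series_bound[OF N sub]) (auto intro!: mult_nonneg_nonneg prod_nonneg simp: divide_le_eq simp flip: sum_divide_distrib)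
          also have "\<dots> \<le> ennreal c1 * (\<Sum>k. ennreal (wt k / \<Lambda>) * (ennreal c2 * ennreal (\<Prod>i\<in>UNIV. \<phi> (G k j i x))))"
          proof -
            have "ennreal (\<phi> (\<Lambda> * 3 ^ d * (\<Prod>i\<in>UNIV. G k j i x))) \<le> ennreal c2 * ennreal (\<Prod>i\<in>UNIV. \<phi> (G k j i x))" for k
            proof -
              have "ennreal (\<phi> (\<Lambda> * 3 ^ d * (\<Prod>i\<in>UNIV. G k j i x))) \<le> ennreal (c2 * (\<Prod>i\<in>UNIV. \<phi> (G k j i x)))"
                unfolding c2_def using \<Lambda>(1) G0 by (intro ennreal_leI submultiplicative_prod[OF N sub]) auto
              then show ?thesis using c0 by (simp add: ennreal_mult')
            qed
            then show ?thesis unfolding c1_def by (intro mult_left_mono suminf_le) auto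
          qed
          finally show ?thesis .
        qed
        have "cmod (pdo_commutator \<sigma> b f x) \<le> (\<Sum>j\<in>UNIV. v j)" unfolding pdo_commutator_def v_def by (rule norm_sum)
        then have "\<phi> (cmod (pdo_commutator \<sigma> b f x)) \<le> \<phi> (\<Sum>j\<in>UNIV. v j)" by (intro N_function_mono[OF N]) auto
        also have "\<dots> \<le> c0 * (\<Sum>j\<in>UNIV. \<phi> (v j))" unfolding c0_def m_def using v0 by (intro N_function_sum_le[OF N sub])
        finally have "ennreal (\<phi> (cmod (pdo_commutator \<sigma> b f x))) \<le> ennreal (c0 * (\<Sum>j\<in>UNIV. \<phi> (v j)))" by (rule ennreal_leI)
        also have "\<dots> = ennreal c0 * (\<Sum>j\<in>UNIV. ennreal (\<phi> (v j)))"
          using c0 N_function_nonneg[OF N v0] by (simp add: ennreal_mult' sum_ennreal)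
        also have "\<dots> \<le> ennreal c0 * (\<Sum>j\<in>UNIV. ennreal c1 * (\<Sum>k. ennreal (wt k / \<Lambda>) * (ennreal c2 * ennreal (\<Prod>i\<in>UNIV. \<phi> (G k j i x)))))"
          using one by (intro mult_left_mono sum_mono) auto
        finally have "ennreal (\<phi> (cmod (pdo_commutator \<sigma> b f x))) * ennreal (w x)
          \<le> ennreal c0 * (\<Sum>j\<in>UNIV. ennreal c1 * (\<Sum>k. ennreal (wt k / \<Lambda>) * (ennreal c2 * ennreal (\<Prod>i\<in>UNIV. \<phi> (G k j i x))))) * ennreal (w x)"
          by (rule mult_right_mono) simp
        also have "\<dots> = ennreal c0 * (\<Sum>j\<in>UNIV. ennreal c1 * (\<Sum>k. ennreal (wt k / \<Lambda>) * (ennreal c2 * (ennreal (\<Prod>i\<in>UNIV. \<phi> (G k j i x)) * ennreal (w x)))))"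
          by (simp only: mult.assoc sum_distrib_right ennreal_suminf_multc[symmetric])
        finally show ?case .
      qed
    qed
    also have "\<dots> = ennreal c0 * (\<Sum>j\<in>UNIV. ennreal c1 * (\<Sum>k. ennreal (wt k / \<Lambda>) * (ennreal c2 * (\<integral>\<^sup>+x. ennreal (\<Prod>i\<in>UNIV. \<phi> (G k j i x)) * ennreal (w x) \<partial>lebesgue))))"
      by (subst nn_integral_cmult, measurable) (simp add: nn_integral_sum nn_integral_cmult nn_integral_suminf)
    also have "\<dots> \<le> ennreal c0 * (\<Sum>j\<in>(UNIV::'m set). ennreal c1 * (\<Sum>k. ennreal (wt k / \<Lambda>) * (ennreal c2 * (ennreal g * X))))"
    proof -
      have "(\<integral>\<^sup>+x. ennreal (\<Prod>i\<in>UNIV. \<phi> (G k j i x)) * ennreal (w x) \<partial>lebesgue) \<le> ennreal g * X" for k j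
      proof -
        have "(\<integral>\<^sup>+x. ennreal (\<Prod>i\<in>UNIV. \<phi> (G k j i x)) * ennreal (w x) \<partial>lebesgue)
          \<le> ennpowr (\<Prod>i\<in>UNIV. \<integral>\<^sup>+x. ennreal (\<phi> (G k j i x) ^ m) * ennreal (w x) \<partial>lebesgue) (1 / real m)"
          unfolding m_def by (rule nn_integral_prod_Hoelder) (use N_function_nonneg[OF N G0] in simp_all)
        also have "\<dots> \<le> ennpowr (\<Prod>i\<in>UNIV. ennreal g * (\<integral>\<^sup>+x. ennreal (\<phi> (cmod (f i x)) ^ m) * ennreal (w x) \<partial>lebesgue)) (1 / real m)"
        proof (intro ennpowr_mono ennreal_prod_mono)
          fix i
          show "(\<integral>\<^sup>+x. ennreal (\<phi> (G k j i x) ^ m) * ennreal (w x) \<partial>lebesgue) \<le> ennreal g * (\<integral>\<^sup>+x. ennreal (\<phi> (cmod (f i x)) ^ m) * ennreal (w x) \<partial>lebesgue)"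
            using scale_factor_modular[where t = "t k" and b = "b j" and f = f and j = j and i = i, OF t b fi bf] unfolding G_def g_def m_def .
        qed (use m in simp_all)
        also have "(\<Prod>i\<in>UNIV. ennreal g * (\<integral>\<^sup>+x. ennreal (\<phi> (cmod (f i x)) ^ m) * ennreal (w x) \<partial>lebesgue))
          = ennreal g ^ m * (\<Prod>i\<in>UNIV. \<integral>\<^sup>+x. ennreal (\<phi> (cmod (f i x)) ^ m) * ennreal (w x) \<partial>lebesgue)"
          by (simp add: prod.distrib m_def)
        finally show ?thesis unfolding ennpowr_scale[OF g m] X_def .
      qed
      then show ?thesis by (intro mult_left_mono sum_mono suminf_le) auto
    qed
    also have "\<dots> \<le> ennreal c0 * (\<Sum>j\<in>(UNIV::'m set). ennreal c1 * (ennreal c2 * (ennreal g * X)))"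
    proof -
      have "(\<Sum>k. ennreal (wt k / \<Lambda>)) \<le> 1"
      proof (rule suminf_le_const)
        fix n
        have "(\<Sum>k<n. ennreal (wt k / \<Lambda>)) = ennreal ((\<Sum>k<n. wt k) / \<Lambda>)"
          using wt \<Lambda>(1) by (subst sum_ennreal) (auto simp: sum_divide_distrib)
        also have "\<dots> \<le> ennreal 1" using \<Lambda> by (intro ennreal_leI) (simp add: divide_le_eq)
        finally show "(\<Sum>k<n. ennreal (wt k / \<Lambda>)) \<le> 1" by simp
      qed simp
      then have "(\<Sum>k. ennreal (wt k / \<Lambda>)) * (ennreal c2 * (ennreal g * X)) \<le> 1 * (ennreal c2 * (ennreal g * X))"
        by (rule mult_right_mono) simp
      then show ?thesis by (intro mult_left_mono sum_mono) (auto simp: ennreal_suminf_multc)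
    qed
    also have "\<dots> = ennreal (c0 * (real m * (c1 * (c2 * g)))) * X"
      using c0 g by (simp add: ennreal_mult' m_def mult.assoc ennreal_of_nat_eq_real_of_nat)
    finally show ?thesis by (simp add: X_def)
  qed
  show thesis
    by (rule that[of "c0 * (real m * (c1 * (c2 * g)))"]) (use c0 g main in \<open>auto simp: m_def\<close>)
qed

section \<open>Scaling and degenerate cases\<close>

lemma mean_osc_le_bmo_norm:
  fixes b :: "real^'n::finite \<Rightarrow> complex"
  assumes "b \<in> bmo" "s > 0"
  shows "mean_osc b (ccube a s) \<le> bmo_norm b"
proof -
  have "ccube a s \<in> cubes" using assms(2) by (auto simp: cubes_def)
  then show ?thesis using assms(1) unfolding bmo_norm_def bmo_def by (intro cSUP_upper) auto
qed

lemma mean_osc_scale: "mean_osc (\<lambda>x. c * b x) Q = cmod c * mean_osc b Q"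
proof -
  have 1: "cube_avg (\<lambda>x. c * b x) Q = c * cube_avg b Q"
    by (simp add: cube_avg_def scaleR_conv_of_real)
  have "cmod (c * b y - c * cube_avg b Q) = cmod c * cmod (b y - cube_avg b Q)" for y
    by (simp add: right_diff_distrib[symmetric] norm_mult)
  then show ?thesis by (simp add: mean_osc_def 1 cube_avg_def[of "\<lambda>y. cmod c * _ y"] cube_avg_def[of "\<lambda>y. cmod (_ y)"])
qed

lemma locally_integrable_scale:
  fixes c :: complex
  shows "locally_integrable b \<Longrightarrow> locally_integrable (\<lambda>x. c * b x)"
  by (simp add: locally_integrable_def)

lemma unit_bmo_scaled:
  fixes b :: "real^'n::finite \<Rightarrow> complex"
  assumes b: "b \<in> bmo" and le: "bmo_norm b \<le> \<beta>" and \<beta>: "\<beta> > 0"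
  shows "unit_bmo (\<lambda>x. of_real (1 / \<beta>) * b x)"
proof
  show "locally_integrable (\<lambda>x. of_real (1 / \<beta>) * b x)"
    using b by (intro locally_integrable_scale) (simp add: bmo_def)
  fix s a assume "(s::real) > 0"
  then have "mean_osc b (ccube a s) \<le> \<beta>" using mean_osc_le_bmo_norm[OF b, of s a] le by simp
  then show "mean_osc (\<lambda>x. of_real (1 / \<beta>) * b x) (ccube a s) \<le> 1"
    unfolding mean_osc_scale norm_of_real using \<beta> by simp
qed

lemma mean_osc_nonneg: "mean_osc b Q \<ge> 0"
  unfolding mean_osc_def cube_avg_def set_lebesgue_integral_def by (intro scaleR_nonneg_nonneg integral_nonneg) auto

lemma bmo_norm_le_vec: "bmo_norm (b j) \<le> bmo_vec_norm (b :: 'm::finite \<Rightarrow> _)"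
  unfolding bmo_vec_norm_def by (rule cSUP_upper) auto

lemma bmo_norm_nonneg:
  fixes b :: "real^'n::finite \<Rightarrow> complex"
  assumes "b \<in> bmo"
  shows "bmo_norm b \<ge> 0"
  using mean_osc_le_bmo_norm[OF assms, of 1 0] mean_osc_nonneg[of b "ccube 0 1"] by linarith

lemma fourier_scale: "fourier (\<lambda>y. c * f y) \<xi> = c * fourier f \<xi>"
  unfolding fourier_def by (simp add: mult.assoc)

lemma mult_at_scale: "mult_at (\<lambda>j x. c * b j x) j f i = (\<lambda>y. (if i = j then c else 1) * mult_at b j f i y)"
  by (auto simp: mult_at_def mult.assoc)

lemma pdo_integrand_scale:
  fixes f :: "'m::finite \<Rightarrow> real^'n::finite \<Rightarrow> complex"
  shows "pdo_integrand \<sigma> (mult_at (\<lambda>j x. c * b j x) j f) x \<xi> = c * pdo_integrand \<sigma> (mult_at b j f) x \<xi>"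
proof -
  have "(\<Prod>i\<in>UNIV. fourier (mult_at (\<lambda>j x. c * b j x) j f i) (\<xi> $ i))
      = (\<Prod>i\<in>UNIV. (if i = j then c else 1)) * (\<Prod>i\<in>UNIV. fourier (mult_at b j f i) (\<xi> $ i))"
    by (simp only: mult_at_scale fourier_scale prod.distrib)
  also have "(\<Prod>i\<in>UNIV. (if i = j then c else 1)) = c" by (simp add: prod.delta)
  finally show ?thesis by (simp add: pdo_integrand_def)
qed

lemma pdo_commutator_scale:
  fixes f :: "'m::finite \<Rightarrow> real^'n::finite \<Rightarrow> complex"
  shows "pdo_commutator \<sigma> (\<lambda>j x. c * b j x) f x = c * pdo_commutator \<sigma> b f x"
proof -
  have "pdo \<sigma> (mult_at (\<lambda>j x. c * b j x) j f) x = c * pdo \<sigma> (mult_at b j f) x" for j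
    unfolding pdo_def pdo_integrand_scale by simp
  then show ?thesis by (simp add: pdo_commutator_def sum_distrib_left right_diff_distrib mult.assoc)
qed

lemma pdo_commutator_defined_scale:
  fixes f :: "'m::finite \<Rightarrow> real^'n::finite \<Rightarrow> complex"
  assumes "pdo_commutator_defined \<sigma> b f"
  shows "pdo_commutator_defined \<sigma> (\<lambda>j x. c * b j x) f"
proof -
  have "pdo_defined \<sigma> (mult_at (\<lambda>j x. c * b j x) j f)" for j
  proof -
    have d: "\<And>i. integrable lebesgue (mult_at b j f i)" "AE x in lebesgue. integrable lebesgue (pdo_integrand \<sigma> (mult_at b j f) x)"
      using assms by (auto simp: pdo_commutator_defined_def pdo_defined_def)
    have "AE x in lebesgue. integrable lebesgue (\<lambda>\<xi>. c * pdo_integrand \<sigma> (mult_at b j f) x \<xi>)"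
      using d(2) by eventually_elim (rule integrable_mult_right, simp)
    moreover have "pdo_integrand \<sigma> (mult_at (\<lambda>j x. c * b j x) j f) x = (\<lambda>\<xi>. c * pdo_integrand \<sigma> (mult_at b j f) x \<xi>)" for x
      by (rule ext) (rule pdo_integrand_scale)
    ultimately show ?thesis unfolding pdo_defined_def mult_at_scale using d(1) by (simp add: integrable_mult_right)
  qed
  then show ?thesis using assms by (simp add: pdo_commutator_defined_def)
qed

text \<open>If all mean oscillations vanish, then \<open>b\<close> is constant almost everywhere: it is constant on each of an increasing
  sequence of cubes, and the constants agree.\<close>

lemma bmo_norm_zero_imp_constant:
  fixes b :: "real^'n::finite \<Rightarrow> complex"
  assumes b: "b \<in> bmo" and z: "bmo_norm b \<le> 0"
  obtains c where "AE x in lebesgue. b x = c"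
proof -
  have loc: "locally_integrable b" using b by (simp add: bmo_def)
  have [measurable]: "b \<in> borel_measurable lebesgue" using loc by (rule locally_integrable_measurable)
  define a where "a k = (\<chi> i::'n. - real (Suc k))" for k
  define s where "s k = 2 * real (Suc k)" for k
  define m where "m k = cube_avg b (ccube (a k) (s k))" for k
  have ae: "AE x in lebesgue. x \<in> hcube (a k) (s k) \<longrightarrow> b x = m k" for k
  proof -
    have s: "s k > 0" by (simp add: s_def)
    have "mean_osc b (ccube (a k) (s k)) = 0"
      using mean_osc_le_bmo_norm[OF b s, of "a k"] z mean_osc_nonneg[of b "ccube (a k) (s k)"] by linarith
    then have "(\<integral>\<^sup>+x\<in>hcube (a k) (s k). ennreal (cmod (b x - m k)) \<partial>lebesgue) = 0"
      using mean_osc_nn[OF loc s, of "a k"] by (simp add: m_def)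
    then have "AE x in lebesgue. ennreal (cmod (b x - m k)) * indicator (hcube (a k) (s k)) x = 0"
      by (subst (asm) nn_integral_0_iff_AE) auto
    then show ?thesis by eventually_elim (auto simp: indicator_def ennreal_eq_0_iff split: if_splits)
  qed
  have sub: "hcube (a 0) (s 0) \<subseteq> hcube (a k) (s k)" for k
  proof
    fix x assume "x \<in> hcube (a 0) (s 0)"
    then have "- 1 \<le> x $ i \<and> x $ i < 1" for i by (auto simp: hcube_def a_def s_def dest: spec[of _ i])
    then have "- real (Suc k) \<le> x $ i \<and> x $ i < real (Suc k)" for i by (smt (verit) of_nat_0_le_iff of_nat_Suc)
    then show "x \<in> hcube (a k) (s k)" by (auto simp: hcube_def a_def s_def)
  qed
  have eq: "m k = m 0" for k
  proof (rule ccontr)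
    assume ne: "m k \<noteq> m 0"
    have "AE x in lebesgue. x \<notin> hcube (a 0) (s 0)"
      using ae[of k] ae[of 0] by eventually_elim (use sub[of k] ne in auto)
    then have "emeasure lebesgue (hcube (a 0) (s 0)) = 0"
      by (subst (asm) AE_iff_measurable[of "hcube (a 0) (s 0)"]) auto
    then show False by (simp add: emeasure_hcube s_def)
  qed
  have "AE x in lebesgue. b x = m 0"
  proof (rule AE_if_AE_on_cubes)
    fix k show "AE x in lebesgue. x \<in> hcube (\<chi> i. - real (Suc k)) (2 * real (Suc k)) \<longrightarrow> b x = m 0"
      using ae[of k] unfolding eq[of k] a_def s_def .
  qed
  then show thesis by (rule that)
qed

text \<open>Multiplication by a constant commutes with the operator, and changing \<open>b\<close> on a null set does not affect the Fourier
  integrals.\<close>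

lemma commutator_vanishes:
  fixes f :: "'m::finite \<Rightarrow> real^'n::finite \<Rightarrow> complex"
  assumes c: "\<And>j. AE x in lebesgue. b j x = c j" and m: "\<And>j. b j \<in> borel_measurable lebesgue" "\<And>i. f i \<in> borel_measurable lebesgue"
  shows "AE x in lebesgue. pdo_commutator \<sigma> b f x = 0"
proof -
  have four: "fourier (mult_at b j f i) \<zeta> = (if i = j then c j else 1) * fourier (f i) \<zeta>" for i j \<zeta>
  proof (cases "i = j")
    case True
    have "fourier (\<lambda>y. b j y * f j y) \<zeta> = fourier (\<lambda>y. c j * f j y) \<zeta>"
      unfolding fourier_def
    proof (rule integral_cong_AE)
      have cis: "(\<lambda>x. cis (- 2 * pi * (x \<bullet> \<zeta>))) \<in> borel_measurable lebesgue"
        by (intro borel_measurable_lebesgueI borel_measurable_continuous_onI continuous_intros)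
      show "(\<lambda>x. b j x * f j x * cis (- 2 * pi * (x \<bullet> \<zeta>))) \<in> borel_measurable lebesgue"
        "(\<lambda>x. c j * f j x * cis (- 2 * pi * (x \<bullet> \<zeta>))) \<in> borel_measurable lebesgue"
        by (intro borel_measurable_times m cis borel_measurable_const)+
      show "AE x in lebesgue. b j x * f j x * cis (- 2 * pi * (x \<bullet> \<zeta>)) = c j * f j x * cis (- 2 * pi * (x \<bullet> \<zeta>))"
        using c[of j] by eventually_elim simp
    qed
    then show ?thesis using True by (simp add: mult_at_def fourier_scale)
  qed (simp add: mult_at_def)
  have p: "pdo \<sigma> (mult_at b j f) x = c j * pdo \<sigma> f x" for j x
  proof -
    have "pdo_integrand \<sigma> (mult_at b j f) x \<xi> = c j * pdo_integrand \<sigma> f x \<xi>" for \<xi> :: "real^'n^'m"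
      unfolding pdo_integrand_def four prod.distrib by (simp add: prod.delta)
    then show ?thesis by (simp add: pdo_def)
  qed
  have "AE x in lebesgue. \<forall>j. b j x = c j" using c by (simp add: eventually_all_finite)
  then show ?thesis by eventually_elim (simp add: pdo_commutator_def p)
qed

section \<open>The modular inequality\<close>

lemma N_function_poly_growth:
  assumes N: "N_function \<phi>" and C1: "\<And>s t. s \<ge> 2 \<Longrightarrow> t > 0 \<Longrightarrow> \<phi> (s * t) \<le> 2 powr C1 * s powr C1 * \<phi> t"
  shows "t \<ge> 0 \<Longrightarrow> \<phi> t \<le> (\<phi> 2 + 2 powr C1 * \<phi> 1) * (1 + t) ^ nat \<lceil>C1\<rceil>"
proof -
  assume t: "t \<ge> 0"
  have nn: "\<phi> 2 \<ge> 0" "\<phi> 1 \<ge> 0" using N_function_nonneg[OF N] by auto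
  have one: "1 \<le> (1 + t) ^ nat \<lceil>C1\<rceil>" using t by (intro one_le_power) auto
  show ?thesis
  proof (cases "t \<ge> 2")
    case True
    have "\<phi> t \<le> 2 powr C1 * t powr C1 * \<phi> 1" using C1[OF True, of 1] by simp
    also have "\<dots> \<le> 2 powr C1 * (1 + t) ^ nat \<lceil>C1\<rceil> * \<phi> 1"
    proof -
      have "t powr C1 \<le> t powr real (nat \<lceil>C1\<rceil>)" using True by (intro powr_mono) linarith+
      also have "\<dots> = t ^ nat \<lceil>C1\<rceil>" using True by (simp add: powr_realpow)
      also have "\<dots> \<le> (1 + t) ^ nat \<lceil>C1\<rceil>" using True by (intro power_mono) auto
      finally show ?thesis using nn by (intro mult_right_mono mult_left_mono) auto
    qed
    also have "\<dots> \<le> (\<phi> 2 + 2 powr C1 * \<phi> 1) * (1 + t) ^ nat \<lceil>C1\<rceil>" using nn t by (simp add: algebra_simps)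
    finally show ?thesis .
  next
    case False
    then have "\<phi> t \<le> \<phi> 2" using t by (intro N_function_mono[OF N]) auto
    also have "\<dots> \<le> \<phi> 2 + 2 powr C1 * \<phi> 1" using nn by simp
    also have "\<dots> \<le> (\<phi> 2 + 2 powr C1 * \<phi> 1) * (1 + t) ^ nat \<lceil>C1\<rceil>" using mult_left_mono[OF one, of "\<phi> 2 + 2 powr C1 * \<phi> 1"] nn by simp
    finally show ?thesis .
  qed
qed

text \<open>For \<open>a \<le> g\<close> the growth condition is \<open>lower_index_growth\<close>, since the \<open>m\<close>-th power of a number in \<open>[0, 1]\<close> is not larger than the number. For
  \<open>g < a < 2 * g\<close> it is the doubling property.\<close>

lemma admissible_growth_power:
  assumes N: "N_function \<phi>" and sub: "submultiplicative \<phi>" and q: "ereal q < lower_index \<phi>" "q \<ge> 0" and m: "m > (0::nat)"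
    and poly: "\<And>t. t \<ge> 0 \<Longrightarrow> \<phi> t \<le> D * (1 + t) ^ P"
  obtains c where "admissible_growth (\<lambda>t. \<phi> t ^ m) q c (D ^ m) (P * m)"
proof -
  obtain K where K: "K > 0" "\<And>a g. 0 < a \<Longrightarrow> a \<le> g \<Longrightarrow> \<phi> a \<le> K * (a / g) powr q * \<phi> g"
    using lower_index_growth[OF N sub q] by blast
  note nn = N_function_nonneg[OF N]
  have p2: "\<phi> 2 ^ m \<ge> 0" using nn by simp
  show thesis
  proof (rule that[of "K ^ m + \<phi> 2 ^ m"], unfold_locales)
    show "\<phi> t ^ m \<le> \<phi> u ^ m" if "0 \<le> t" "t \<le> u" for t u using that nn N_function_mono[OF N that] by (intro power_mono) auto
    show "\<phi> 0 ^ m = 0" using m N_function_zero[OF N] by simp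
    show "\<phi> t ^ m > 0" if "t > 0" for t using N_function_pos[OF N sub that] by simp
    show "\<phi> (t * u) ^ m \<le> \<phi> t ^ m * \<phi> u ^ m" if "0 \<le> t" "0 \<le> u" for t u
      unfolding power_mult_distrib[symmetric] using that sub nn by (intro power_mono) (auto simp: submultiplicative_def)
    show "K ^ m + \<phi> 2 ^ m > 0" using K p2 by (intro add_pos_nonneg) auto
    show "\<phi> t ^ m \<le> D ^ m * (1 + t) ^ (P * m)" if "t \<ge> 0" for t
      unfolding power_mult power_mult_distrib[symmetric] using that poly nn by (intro power_mono) auto
    fix a g :: real assume a: "0 < a" "a / 2 < g"
    have g: "g > 0" using a by simp
    show "g powr q * \<phi> a ^ m \<le> (K ^ m + \<phi> 2 ^ m) * (a powr q * \<phi> g ^ m)"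
    proof (cases "a \<le> g")
      case True
      define r where "r = (a / g) powr q"
      have r: "0 \<le> r" "r \<le> 1" using a g True q by (auto simp: r_def intro: powr_le1)
      have "\<phi> a ^ m \<le> (K * r * \<phi> g) ^ m" unfolding r_def using K(2)[OF a(1) True] nn a by (intro power_mono) auto
      also have "\<dots> = K ^ m * r ^ m * \<phi> g ^ m" by (simp add: power_mult_distrib)
      also have "\<dots> \<le> K ^ m * r * \<phi> g ^ m"
        using K(1) r nn g power_decreasing[of 1 m r] m by (intro mult_right_mono mult_left_mono) auto
      finally have "g powr q * \<phi> a ^ m \<le> g powr q * (K ^ m * r * \<phi> g ^ m)" by (rule mult_left_mono) simp
      also have "\<dots> = K ^ m * (a powr q * \<phi> g ^ m)" using a g by (simp add: r_def powr_divide)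
      also have "\<dots> \<le> (K ^ m + \<phi> 2 ^ m) * (a powr q * \<phi> g ^ m)" using p2 nn g by (intro mult_right_mono) auto
      finally show ?thesis .
    next
      case False
      have "\<phi> a \<le> \<phi> (2 * g)" using a by (intro N_function_mono[OF N]) auto
      also have "\<dots> \<le> \<phi> 2 * \<phi> g" using sub g by (simp add: submultiplicative_def)
      finally have "\<phi> a ^ m \<le> \<phi> 2 ^ m * \<phi> g ^ m" unfolding power_mult_distrib[symmetric] using nn a by (intro power_mono) auto
      then have "g powr q * \<phi> a ^ m \<le> a powr q * (\<phi> 2 ^ m * \<phi> g ^ m)"
        using False g q nn a by (intro mult_mono powr_mono2) auto
      also have "\<dots> = \<phi> 2 ^ m * (a powr q * \<phi> g ^ m)" by simp
      also have "\<dots> \<le> (K ^ m + \<phi> 2 ^ m) * (a powr q * \<phi> g ^ m)" using K(1) nn g by (intro mult_right_mono) auto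
      finally show ?thesis .
    qed
  qed
qed

text \<open>Simple functions below \<open>c * g\<close> are \<open>c\<close> times simple functions below \<open>g\<close>; this is one half of
  \<open>nn_integral_cmult\<close> for arbitrary \<open>g\<close>.\<close>

lemma nn_integral_cmult_le:
  assumes c: "c > 0"
  shows "(\<integral>\<^sup>+x. ennreal c * g x \<partial>M) \<le> ennreal c * (\<integral>\<^sup>+x. g x \<partial>M)"
  unfolding nn_integral_def[of M "\<lambda>x. ennreal c * g x"]
proof (rule SUP_least)
  fix s assume s: "s \<in> {s. simple_function M s \<and> s \<le> (\<lambda>x. ennreal c * g x)}"
  then have sf: "simple_function M s" and le: "\<And>x. s x \<le> ennreal c * g x" by (auto simp: le_fun_def)
  have inv: "ennreal (1 / c) * (ennreal c * y) = y" "ennreal c * (ennreal (1 / c) * y) = y" for y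
    using c by (simp_all add: mult.assoc[symmetric] ennreal_mult[symmetric])
  have "integral\<^sup>S M s = (\<integral>\<^sup>+x. ennreal c * (ennreal (1 / c) * s x) \<partial>M)"
    unfolding inv by (rule nn_integral_eq_simple_integral[symmetric]) fact
  also have "\<dots> = ennreal c * (\<integral>\<^sup>+x. ennreal (1 / c) * s x \<partial>M)"
    by (rule nn_integral_cmult) (use borel_measurable_simple_function[OF sf] in simp)
  also have "\<dots> \<le> ennreal c * (\<integral>\<^sup>+x. g x \<partial>M)"
  proof (intro mult_left_mono nn_integral_mono)
    fix x
    have "ennreal (1 / c) * s x \<le> ennreal (1 / c) * (ennreal c * g x)" by (intro mult_left_mono le) simp
    then show "ennreal (1 / c) * s x \<le> g x" unfolding inv .
  qed simp
  finally show "integral\<^sup>S M s \<le> ennreal c * (\<integral>\<^sup>+x. g x \<partial>M)" .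
qed

text \<open>An exponent \<open>0\<close> would make \<open>\<phi>\<close> bounded. This permits the exponent \<open>\<alpha> = (C1 - 1) / C1\<close>.\<close>

lemma doubling_exponent_nonzero:
  assumes N: "N_function \<phi>" and C1: "\<And>s t. s \<ge> 2 \<Longrightarrow> t > 0 \<Longrightarrow> \<phi> (s * t) \<le> 2 powr C1 * s powr C1 * \<phi> t"
  shows "C1 \<noteq> 0"
proof
  assume z: "C1 = 0"
  have "filterlim \<phi> at_top at_top" using N by (auto simp: N_function_def young_function_def growth_functions_def)
  then have "eventually (\<lambda>t. \<phi> t \<ge> \<phi> 1 + 1) at_top" by (simp add: filterlim_at_top)
  then obtain s0 where s0: "\<And>s. s \<ge> s0 \<Longrightarrow> \<phi> s \<ge> \<phi> 1 + 1" by (auto simp: eventually_at_top_linorder)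
  have "\<phi> (max s0 2) \<le> \<phi> 1" using C1[of "max s0 2" 1] z by (simp split: if_splits)
  then show False using s0[of "max s0 2"] by simp
qed

text \<open>The size of \<open>\<phi> \<beta>\<close> in terms of a power of \<open>\<beta>\<close>: linear for small \<open>\<beta>\<close> by convexity, and of order \<open>C1\<close> for
  large \<open>\<beta>\<close>.\<close>

lemma N_function_le_power:
  assumes N: "N_function \<phi>" and C1: "\<And>s t. s \<ge> 2 \<Longrightarrow> t > 0 \<Longrightarrow> \<phi> (s * t) \<le> 2 powr C1 * s powr C1 * \<phi> t"
    and \<beta>: "\<beta> > 0"
  defines "\<alpha> \<equiv> if \<beta> \<le> 2 then 0 else (C1 - 1) / C1"
  shows "\<phi> \<beta> \<le> (\<phi> 2 + 2 powr C1 * \<phi> 1) * \<beta> powr (1 + \<alpha> * C1)"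
proof -
  have nn: "\<phi> 2 \<ge> 0" "\<phi> 1 \<ge> 0" using N_function_nonneg[OF N] by auto
  show ?thesis
  proof (cases "\<beta> \<le> 2")
    case True
    have "\<phi> (\<beta> / 2 * 2) \<le> \<beta> / 2 * \<phi> 2" using True \<beta> by (intro N_function_le_linear[OF N]) auto
    then have "\<phi> \<beta> \<le> \<beta> / 2 * \<phi> 2" by simp
    also have "\<dots> \<le> \<phi> 2 * \<beta>" using nn \<beta> by simp
    also have "\<dots> \<le> (\<phi> 2 + 2 powr C1 * \<phi> 1) * \<beta>" using nn \<beta> by (intro mult_right_mono) auto
    finally show ?thesis using True \<beta> by (simp add: \<alpha>_def)
  next
    case False
    have "1 + \<alpha> * C1 = C1" using False doubling_exponent_nonzero[OF N C1] by (simp add: \<alpha>_def)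
    moreover have "\<phi> \<beta> \<le> 2 powr C1 * \<phi> 1 * \<beta> powr C1" using C1[of \<beta> 1] False by (simp add: mult_ac)
    moreover have "2 powr C1 * \<phi> 1 * \<beta> powr C1 \<le> (\<phi> 2 + 2 powr C1 * \<phi> 1) * \<beta> powr C1" using nn by (intro mult_right_mono) auto
    ultimately show ?thesis by simp
  qed
qed

theorem theorem1p11:
  fixes \<sigma> :: "(real^'n::finite) \<times> (real^'n^'m::finite) \<Rightarrow> complex"
    and l \<rho> \<delta> C1 r :: real
    and \<phi> :: "real \<Rightarrow> real"
  assumes "0 \<le> \<rho>" "\<rho> \<le> 1" "0 \<le> \<delta>" "\<delta> \<le> 1"
    and "\<sigma> \<in> symbol_class l \<rho> \<delta>"
    and "l < real CARD('m) * real CARD('n) * (\<rho> - 1)"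
    and "N_function \<phi>" "submultiplicative \<phi>"
    and "\<And>s t. s \<ge> 2 \<Longrightarrow> t > 0 \<Longrightarrow> \<phi> (s * t) \<le> 2 powr C1 * s powr C1 * \<phi> t"
    and "1 \<le> r" "ereal r < lower_index \<phi>" "lower_index \<phi> < \<infinity>"
  shows "\<exists>C :: (real^'n \<Rightarrow> real) \<Rightarrow> real.
    \<forall>b :: 'm \<Rightarrow> real^'n \<Rightarrow> complex. (\<forall>j. b j \<in> bmo) \<longrightarrow>
      (\<exists>\<alpha> :: real. \<forall>(q :: real) (w :: real^'n \<Rightarrow> real) (f :: 'm \<Rightarrow> real^'n \<Rightarrow> complex).
        1 < q \<longrightarrow> ereal q < lower_index \<phi> / ereal r \<longrightarrow> w \<in> Aq q \<longrightarrow>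
        pdo_commutator_defined \<sigma> b f \<longrightarrow>
        (\<integral>\<^sup>+x. ennreal (\<phi> (cmod (pdo_commutator \<sigma> b f x))) * ennreal (w x) \<partial>lebesgue)
          \<le> ennreal (C w) * ennreal (bmo_vec_norm b powr (1 + \<alpha> * C1)) *
            ennpowr (\<Prod>i\<in>UNIV. \<integral>\<^sup>+x. ennreal (\<phi> (cmod (f i x)) ^ CARD('m)) * ennreal (w x) \<partial>lebesgue)
              (1 / real CARD('m)))"
proof -
  note N = assms(7) and sub = assms(8) and C1 = assms(9)
  define X where "X w f = ennpowr (\<Prod>i\<in>UNIV. \<integral>\<^sup>+x. ennreal (\<phi> (cmod (f i x)) ^ CARD('m)) * ennreal (w x) \<partial>lebesgue)
              (1 / real CARD('m))" for w and f :: "'m \<Rightarrow> real^'n \<Rightarrow> complex"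
  obtain wt t :: "nat \<Rightarrow> real" and M where kern: "\<And>k. wt k \<ge> 0" "\<And>k. t k > 0" "summable wt"
    "\<And>x R z. R \<ge> 1 \<Longrightarrow> ennreal (cmod (trunc_kernel \<sigma> M R x z))
        \<le> (\<Sum>k. ennreal (wt k / t k ^ (CARD('m) * CARD('n))) * of_bool (\<forall>j i. \<bar>z $ j $ i\<bar> \<le> t k))"
    "\<And>x R. R \<ge> 1 \<Longrightarrow> integrable lebesgue (\<lambda>\<xi>. \<sigma> (x, \<xi>) * cutoff M R \<xi>)"
    using kernel_majorant[OF assms(1,2,5,6)] by blast
  \<comment> \<open>A constant for \<open>w\<close> is fixed once, for one exponent \<open>q < i\<^sub>\<phi>\<close> with \<open>w \<in> A\<^sub>q\<close>; it then serves all \<open>q\<close> of the claim.\<close>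
  define good where "good w \<longleftrightarrow> (\<exists>q. 1 < q \<and> ereal q < lower_index \<phi> \<and> w \<in> Aq q)" for w :: "real^'n \<Rightarrow> real"
  have "\<exists>C. C \<ge> 0 \<and> (good w \<longrightarrow> (\<forall>b f. (\<forall>j. unit_bmo (b j)) \<longrightarrow> pdo_commutator_defined \<sigma> b f \<longrightarrow>
     (\<integral>\<^sup>+x. ennreal (\<phi> (cmod (pdo_commutator \<sigma> b f x))) * ennreal (w x) \<partial>lebesgue) \<le> ennreal C * X w f))" for w
  proof (cases "good w")
    case True
    then obtain q where q: "1 < q" "ereal q < lower_index \<phi>" "w \<in> Aq q" by (auto simp: good_def)
    show ?thesis
    proof (rule Aq_cases[OF q(1,3)])
      assume z: "AE x in lebesgue. w x = 0"
      have "(\<integral>\<^sup>+x. ennreal (\<phi> (cmod (pdo_commutator \<sigma> b f x))) * ennreal (w x) \<partial>lebesgue) = 0" for b f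
      proof -
        have "(\<integral>\<^sup>+x. ennreal (\<phi> (cmod (pdo_commutator \<sigma> b f x))) * ennreal (w x) \<partial>lebesgue) = (\<integral>\<^sup>+(x::real^'n). 0 \<partial>lebesgue)"
          by (rule nn_integral_cong_AE, rule eventually_mono[OF z]) simp
        then show ?thesis by simp
      qed
      then show ?thesis by (intro exI[of _ 0]) simp
    next
      fix A W S assume Aq: "Aq_weight w (\<lambda>x. w x powr (- 1 / (q - 1))) q A W S"
      obtain c where adm: "admissible_growth (\<lambda>t. \<phi> t ^ CARD('m)) q c ((\<phi> 2 + 2 powr C1 * \<phi> 1) ^ CARD('m)) (nat \<lceil>C1\<rceil> * CARD('m))"
        using admissible_growth_power[OF N sub q(2) _ _ N_function_poly_growth[OF N C1], where m = "CARD('m)"] q(1) by auto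
      have "Aq_growth w (\<lambda>x. w x powr (- 1 / (q - 1))) q A W S (\<lambda>t. \<phi> t ^ CARD('m)) c ((\<phi> 2 + 2 powr C1 * \<phi> 1) ^ CARD('m)) (nat \<lceil>C1\<rceil> * CARD('m))"
        using Aq adm by (simp add: Aq_growth_def)
      from commutator_modular[OF N sub kern this] obtain C where C: "C \<ge> 0"
        "\<And>b f. (\<And>j. unit_bmo (b j)) \<Longrightarrow> pdo_commutator_defined \<sigma> b f \<Longrightarrow>
          (\<integral>\<^sup>+x. ennreal (\<phi> (cmod (pdo_commutator \<sigma> b f x))) * ennreal (w x) \<partial>lebesgue) \<le> ennreal C * X w f"
        unfolding X_def by blast
      show ?thesis by (intro exI[of _ C] conjI impI allI C) simp_all
    qed
  qed (intro exI[of _ 0], simp)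
  then have "\<forall>w. \<exists>C. C \<ge> 0 \<and> (good w \<longrightarrow> (\<forall>b f. (\<forall>j. unit_bmo (b j)) \<longrightarrow> pdo_commutator_defined \<sigma> b f \<longrightarrow>
     (\<integral>\<^sup>+x. ennreal (\<phi> (cmod (pdo_commutator \<sigma> b f x))) * ennreal (w x) \<partial>lebesgue) \<le> ennreal C * X w f))" by blast
  from choice[OF this] obtain C0 where C0: "\<And>w. C0 w \<ge> 0" "\<And>w b f. good w \<Longrightarrow> (\<And>j. unit_bmo (b j)) \<Longrightarrow> pdo_commutator_defined \<sigma> b f \<Longrightarrow>
     (\<integral>\<^sup>+x. ennreal (\<phi> (cmod (pdo_commutator \<sigma> b f x))) * ennreal (w x) \<partial>lebesgue) \<le> ennreal (C0 w) * X w f" by blast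
  define K where "K = \<phi> 2 + 2 powr C1 * \<phi> 1"
  have Kp: "K > 0" using N_function_nonneg[OF N, of 1] N_function_pos[OF N sub, of 2] by (simp add: K_def add_pos_nonneg)
  then have K: "K \<ge> 0" by simp
  have good: "good w" if "1 < q" "ereal q < lower_index \<phi> / ereal r" "w \<in> Aq q" for q w
  proof -
    obtain L where L: "lower_index \<phi> = ereal L" using assms(11,12) by (cases "lower_index \<phi>") auto
    then have "q < L / r" "r < L" using that(2) assms(10,11) by auto
    moreover have "L / r \<le> L / 1" using assms(10) \<open>r < L\<close> by (intro divide_left_mono) auto
    ultimately show ?thesis using that L by (auto simp: good_def)
  qed
  show ?thesis
  proof (intro exI[of _ "\<lambda>w. K * C0 w"] allI impI)
    fix b :: "'m \<Rightarrow> real^'n \<Rightarrow> complex" assume b: "\<forall>j. b j \<in> bmo"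
    define \<beta> where "\<beta> = bmo_vec_norm b"
    have \<beta>0: "\<beta> \<ge> 0" using bmo_norm_le_vec[of b undefined] bmo_norm_nonneg b unfolding \<beta>_def by (meson order_trans)
    define \<alpha> where "\<alpha> = (if \<beta> \<le> 2 then 0 else (C1 - 1) / C1)"
    show "\<exists>\<alpha> :: real. \<forall>(q :: real) (w :: real^'n \<Rightarrow> real) (f :: 'm \<Rightarrow> real^'n \<Rightarrow> complex).
        1 < q \<longrightarrow> ereal q < lower_index \<phi> / ereal r \<longrightarrow> w \<in> Aq q \<longrightarrow>
        pdo_commutator_defined \<sigma> b f \<longrightarrow>
        (\<integral>\<^sup>+x. ennreal (\<phi> (cmod (pdo_commutator \<sigma> b f x))) * ennreal (w x) \<partial>lebesgue)
          \<le> ennreal (K * C0 w) * ennreal (bmo_vec_norm b powr (1 + \<alpha> * C1)) *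
            ennpowr (\<Prod>i\<in>UNIV. \<integral>\<^sup>+x. ennreal (\<phi> (cmod (f i x)) ^ CARD('m)) * ennreal (w x) \<partial>lebesgue)
              (1 / real CARD('m))"
    proof (intro exI[of _ \<alpha>] allI impI, unfold X_def[symmetric] \<beta>_def[symmetric])
      fix q :: real and w :: "real^'n \<Rightarrow> real" and f :: "'m \<Rightarrow> real^'n \<Rightarrow> complex"
      assume q: "1 < q" "ereal q < lower_index \<phi> / ereal r" "w \<in> Aq q" and def: "pdo_commutator_defined \<sigma> b f"
      show "(\<integral>\<^sup>+x. ennreal (\<phi> (cmod (pdo_commutator \<sigma> b f x))) * ennreal (w x) \<partial>lebesgue)
          \<le> ennreal (K * C0 w) * ennreal (\<beta> powr (1 + \<alpha> * C1)) * X w f"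
      proof (cases "\<beta> = 0")
        case True
        have "\<exists>c. AE x in lebesgue. b j x = c" for j
          using bmo_norm_zero_imp_constant[of "b j"] b bmo_norm_le_vec[of b j] True unfolding \<beta>_def by metis
        then obtain c where c: "\<And>j. AE x in lebesgue. b j x = c j" by metis
        have "b j \<in> borel_measurable lebesgue" for j using b by (auto simp: bmo_def intro: locally_integrable_measurable)
        moreover have "f i \<in> borel_measurable lebesgue" for i
          using def by (auto simp: pdo_commutator_defined_def pdo_defined_def intro: borel_measurable_integrable)
        ultimately have ae: "AE x in lebesgue. pdo_commutator \<sigma> b f x = 0" by (rule commutator_vanishes[OF c])
        have "(\<integral>\<^sup>+x. ennreal (\<phi> (cmod (pdo_commutator \<sigma> b f x))) * ennreal (w x) \<partial>lebesgue) = (\<integral>\<^sup>+(x::real^'n). 0 \<partial>lebesgue)"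
          by (rule nn_integral_cong_AE, rule eventually_mono[OF ae]) (simp add: N_function_zero[OF N])
        then show ?thesis by simp
      next
        case False
        then have \<beta>: "\<beta> > 0" using \<beta>0 by simp
        define b' where "b' = (\<lambda>j x. of_real (1 / \<beta>) * b j x)"
        have u: "unit_bmo (b' j)" for j
          unfolding b'_def using b bmo_norm_le_vec[of b j] \<beta> by (intro unit_bmo_scaled) (auto simp: \<beta>_def)
        have def': "pdo_commutator_defined \<sigma> b' f" unfolding b'_def by (rule pdo_commutator_defined_scale[OF def])
        have pt: "\<phi> (cmod (pdo_commutator \<sigma> b f x)) \<le> K * \<beta> powr (1 + \<alpha> * C1) * \<phi> (cmod (pdo_commutator \<sigma> b' f x))" for x
        proof -
          have "pdo_commutator \<sigma> b' f x = of_real (1 / \<beta>) * pdo_commutator \<sigma> b f x"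
            unfolding b'_def by (rule pdo_commutator_scale)
          then have "cmod (pdo_commutator \<sigma> b f x) = \<beta> * cmod (pdo_commutator \<sigma> b' f x)"
            using \<beta> by (simp add: norm_mult norm_divide)
          then have "\<phi> (cmod (pdo_commutator \<sigma> b f x)) \<le> \<phi> \<beta> * \<phi> (cmod (pdo_commutator \<sigma> b' f x))"
            using sub \<beta> by (simp add: submultiplicative_def)
          also have "\<dots> \<le> K * \<beta> powr (1 + \<alpha> * C1) * \<phi> (cmod (pdo_commutator \<sigma> b' f x))"
            unfolding K_def \<alpha>_def by (intro mult_right_mono N_function_le_power[OF N C1 \<beta>] N_function_nonneg[OF N]) auto
          finally show ?thesis .
        qed
        have "(\<integral>\<^sup>+x. ennreal (\<phi> (cmod (pdo_commutator \<sigma> b f x))) * ennreal (w x) \<partial>lebesgue)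
          \<le> (\<integral>\<^sup>+x. ennreal (K * \<beta> powr (1 + \<alpha> * C1)) * (ennreal (\<phi> (cmod (pdo_commutator \<sigma> b' f x))) * ennreal (w x)) \<partial>lebesgue)"
        proof (rule nn_integral_mono)
          fix x
          have "ennreal (\<phi> (cmod (pdo_commutator \<sigma> b f x))) \<le> ennreal (K * \<beta> powr (1 + \<alpha> * C1)) * ennreal (\<phi> (cmod (pdo_commutator \<sigma> b' f x)))"
            using ennreal_leI[OF pt[of x]] K by (simp add: ennreal_mult')
          then show "ennreal (\<phi> (cmod (pdo_commutator \<sigma> b f x))) * ennreal (w x)
            \<le> ennreal (K * \<beta> powr (1 + \<alpha> * C1)) * (ennreal (\<phi> (cmod (pdo_commutator \<sigma> b' f x))) * ennreal (w x))"
            unfolding mult.assoc[symmetric] by (rule mult_right_mono) simp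
        qed
        also have "\<dots> \<le> ennreal (K * \<beta> powr (1 + \<alpha> * C1)) * (\<integral>\<^sup>+x. ennreal (\<phi> (cmod (pdo_commutator \<sigma> b' f x))) * ennreal (w x) \<partial>lebesgue)"
          using Kp \<beta> by (intro nn_integral_cmult_le) simp
        also have "\<dots> \<le> ennreal (K * \<beta> powr (1 + \<alpha> * C1)) * (ennreal (C0 w) * X w f)"
          by (intro mult_left_mono C0(2) good[OF q] u def') simp
        also have "\<dots> = ennreal (K * C0 w) * ennreal (\<beta> powr (1 + \<alpha> * C1)) * X w f"
          using K C0(1)[of w] by (simp add: ennreal_mult' mult_ac)
        finally show ?thesis .
      qed
    qed
  qed
qed

end
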